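(* Let $k$ be an algebraically closed field, $n\ge2$, and $\Pi$ the complete preprojective algebra of type $\widetilde{\mathbb{A}}_{n-1}$ with vertices $1,\ldots,n$. Let $H=\{\theta\in K_0(\operatorname{proj}\Pi)_\mathbb{R}\mid\theta(h)=0\}$ where $h=\sum_{i=1}^n[S(i)]$. Then $$H=\bigsqcup_{J\subseteq\{1,\ldots,n-1\},\ w\in W'/W'_J}w\bigl(\operatorname{cone}^\circ\{[P(j)]-[P(n)]\mid j\in J\}\bigr)=\bigsqcup_{U\in\operatorname{2\text{-}presilt}\Pi'}\iota(C^\circ(U)),$$ and this is the decomposition of $H$ into TF equivalence classes (each displayed piece is a TF equivalence class, depending only on the coset $wW'_J$, and distinct pieces are disjoint).
   Context: $\Pi$ is the completion of the path algebra of the double of the cyclic quiver with $n$ vertices modulo the preprojective relations; $P(i)=e_i\Pi$, $S(i)$ its simple top. $\operatorname{fl}\Pi$ is the category of finite dimensional $\Pi$-modules. $K_0(\operatorname{proj}\Pi)_\mathbb{R}$ has basis $[P(i)]$ and $\theta(X)=\langle\theta,[X]\rangle$ with $\langle[P(i)],[S(j)]\rangle=\delta_{ij}$ for $X\in\operatorname{fl}\Pi$. For $\theta\in K_0(\operatorname{proj}\Pi)_\mathbb{R}$: $\overline{\mathcal{T}}_\theta=\{X\in\operatorname{fl}\Pi\mid\theta(X')\ge0$ for all factor modules $X'\}$, $\overline{\mathcal{F}}_\theta=\{X\in\operatorname{fl}\Pi\mid\theta(X')\le0$ for all submodules $X'\}$; $\theta,\eta$ are TF equivalent if $\overline{\mathcal{T}}_\theta=\overline{\mathcal{T}}_\eta$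 and $\overline{\mathcal{F}}_\theta=\overline{\mathcal{F}}_\eta$. $W$ is the affine Coxeter group of type $\widetilde{\mathbb{A}}_{n-1}$ with generators $s_1,\dots,s_n$, acting on $K_0(\operatorname{proj}\Pi)_\mathbb{R}$ by $s_j[P(j)]=-[P(j)]+[P(j-1)]+[P(j+1)]$ (indices mod $n$) and $s_j[P(i)]=[P(i)]$ for $i\ne j$. $W'=\langle s_1,\ldots,s_{n-1}\rangle$ and, for $J\subseteq\{1,\ldots,n-1\}$, $W'_J=\langle s_j\mid j\in\{1,\dots,n-1\}\setminus J\rangle$. $\operatorname{cone}^\circ\emptyset=\{0\}$, $\operatorname{cone}^\circ X=\sum_{x\in X}\mathbb{R}_{>0}x$. $\Pi'=\Pi/\langle e_n\rangle$ (preprojective algebra of type $\mathbb{A}_{n-1}$) with indecomposable projectives $P'(1),\dots,P'(n-1)$; $\operatorname{2\text{-}presilt}\Pi'$ is the set of basic 2-term presilting complexes $U$ in $\mathsf{K}^b(\operatorname{proj}\Pi')$ (i.e. $\operatorname{Hom}(U,U[1])=0$); for $U=\bigoplus U_i$ with $U_i$ indecomposable, $C^\circ(U)=\operatorname{cone}^\circ\{[U_i]\}$; $\iota\colon K_0(\operatorname{proj}\Pi')_\mathbb{R}\to H$ is the linear isomorphism $[P'(i)]\mapsto[P(i)]-[P(n)]$. *)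

theory Defs
  imports "HOL-Computational_Algebra.Polynomial" "Jordan_Normal_Form.Matrix_Kernel"
begin

(* ---------- conventions ----------
  Vertices of the cyclic quiver are 0,...,n-1; the paper's vertex i (1<=i<=n-1) is i,
  the paper's vertex n is 0.  Elements of K_0(proj Pi)_R are functions nat => real
  (coefficients w.r.t. the basis [P(i)]) vanishing at indices >= n. *)

definition alg_closed :: "'k::field itself \<Rightarrow> bool" where
  "alg_closed _ = (\<forall>p :: 'k poly. degree p \<ge> 1 \<longrightarrow> (\<exists>x. poly p x = 0))"

definition sc :: "nat \<Rightarrow> nat \<Rightarrow> nat" where "sc n i = (i + 1) mod n"
definition pr :: "nat \<Rightarrow> nat \<Rightarrow> nat" where "pr n i = (i + n - 1) mod n"

definition K0 :: "nat \<Rightarrow> (nat \<Rightarrow> real) set" where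
  "K0 n = {\<theta>. \<forall>i\<ge>n. \<theta> i = 0}"

(* H = {theta | theta(h) = 0}, h = sum of [S(i)], <[P(i)],[S(j)]> = delta *)
definition Hsp :: "nat \<Rightarrow> (nat \<Rightarrow> real) set" where
  "Hsp n = {\<theta> \<in> K0 n. (\<Sum>i<n. \<theta> i) = 0}"

definition sref :: "nat \<Rightarrow> nat \<Rightarrow> (nat \<Rightarrow> real) \<Rightarrow> (nat \<Rightarrow> real)" where
  "sref n j \<theta> = (\<lambda>i. if i < n then
      (if i = j then - \<theta> j
       else \<theta> i + (if i = pr n j then \<theta> j else 0) + (if i = sc n j then \<theta> j else 0))
     else \<theta> i)"

inductive_set gen_grp :: "('a \<Rightarrow> 'a) set \<Rightarrow> ('a \<Rightarrow> 'a) set" for S where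
  gen_id: "id \<in> gen_grp S"
| gen_step: "s \<in> S \<Longrightarrow> w \<in> gen_grp S \<Longrightarrow> s \<circ> w \<in> gen_grp S"

definition Wp :: "nat \<Rightarrow> ((nat \<Rightarrow> real) \<Rightarrow> (nat \<Rightarrow> real)) set" where
  "Wp n = gen_grp {sref n j | j. 1 \<le> j \<and> j < n}"
definition WpJ :: "nat \<Rightarrow> nat set \<Rightarrow> ((nat \<Rightarrow> real) \<Rightarrow> (nat \<Rightarrow> real)) set" where
  "WpJ n J = gen_grp {sref n j | j. 1 \<le> j \<and> j < n \<and> j \<notin> J}"

(* open cone (X finite): cone_open {} = {0} *)
definition cone_open :: "(nat \<Rightarrow> real) set \<Rightarrow> (nat \<Rightarrow> real) set" where
  "cone_open X = {v. \<exists>l. (\<forall>x\<in>X. l x > 0) \<and> v = (\<lambda>i. \<Sum>x\<in>X. l x * x i)}"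

definition Pdiff :: "nat \<Rightarrow> nat \<Rightarrow> (nat \<Rightarrow> real)" where
  "Pdiff n j = (\<lambda>i. if i = j then 1 else if i = 0 then -1 else 0)"

definition piece :: "nat \<Rightarrow> nat set \<Rightarrow> ((nat \<Rightarrow> real) \<Rightarrow> (nat \<Rightarrow> real)) \<Rightarrow> (nat \<Rightarrow> real) set" where
  "piece n J w = w ` cone_open (Pdiff n ` J)"

(* ---------- finite dimensional Pi-modules as nilpotent representations ----------
  arra i : X_i -> X_{i+1},  arrb i : X_{i+1} -> X_i  (the double of the cyclic quiver) *)
record 'k qrep =
  dimv :: "nat \<Rightarrow> nat"
  arra :: "nat \<Rightarrow> 'k mat"
  arrb :: "nat \<Rightarrow> 'k mat"

definition is_rep :: "nat \<Rightarrow> 'k::field qrep \<Rightarrow> bool" where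
  "is_rep n X = ((\<forall>i<n. arra X i \<in> carrier_mat (dimv X (sc n i)) (dimv X i)
                     \<and> arrb X i \<in> carrier_mat (dimv X i) (dimv X (sc n i)))
                \<and> (\<forall>i\<ge>n. dimv X i = 0))"

definition preproj :: "nat \<Rightarrow> 'k::field qrep \<Rightarrow> bool" where
  "preproj n X = (\<forall>i<n. arra X (pr n i) * arrb X (pr n i) = arrb X i * arra X i)"

fun pathmat :: "nat \<Rightarrow> 'k::field qrep \<Rightarrow> nat \<Rightarrow> bool list \<Rightarrow> 'k mat" where
  "pathmat n X i [] = 1\<^sub>m (dimv X i)"
| "pathmat n X i (True # w) = pathmat n X (sc n i) w * arra X i"
| "pathmat n X i (False # w) = pathmat n X (pr n i) w * arrb X (pr n i)"

definition is_zero_mat :: "'k::field mat \<Rightarrow> bool" where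
  "is_zero_mat A = (\<forall>r<dim_row A. \<forall>c<dim_col A. A $$ (r, c) = 0)"

definition nilp :: "nat \<Rightarrow> 'k::field qrep \<Rightarrow> bool" where
  "nilp n X = (\<exists>N. \<forall>i<n. \<forall>w. length w = N \<longrightarrow> is_zero_mat (pathmat n X i w))"

(* objects of fl Pi (Pi the completed preprojective algebra) *)
definition flmod :: "nat \<Rightarrow> 'k::field qrep \<Rightarrow> bool" where
  "flmod n X = (is_rep n X \<and> preproj n X \<and> nilp n X)"

definition morphism :: "nat \<Rightarrow> 'k::field qrep \<Rightarrow> 'k qrep \<Rightarrow> (nat \<Rightarrow> 'k mat) \<Rightarrow> bool" where
  "morphism n X Y f = (\<forall>i<n. f i \<in> carrier_mat (dimv Y i) (dimv X i)
       \<and> f (sc n i) * arra X i = arra Y i * f i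
       \<and> f i * arrb X i = arrb Y i * f (sc n i))"

definition surj_mor :: "nat \<Rightarrow> 'k::field qrep \<Rightarrow> 'k qrep \<Rightarrow> (nat \<Rightarrow> 'k mat) \<Rightarrow> bool" where
  "surj_mor n X Y f = (morphism n X Y f \<and>
     (\<forall>i<n. \<forall>y\<in>carrier_vec (dimv Y i). \<exists>x\<in>carrier_vec (dimv X i). f i *\<^sub>v x = y))"

definition inj_mor :: "nat \<Rightarrow> 'k::field qrep \<Rightarrow> 'k qrep \<Rightarrow> (nat \<Rightarrow> 'k mat) \<Rightarrow> bool" where
  "inj_mor n X Y f = (morphism n X Y f \<and>
     (\<forall>i<n. \<forall>x\<in>carrier_vec (dimv X i). f i *\<^sub>v x = 0\<^sub>v (dimv Y i) \<longrightarrow> x = 0\<^sub>v (dimv X i)))"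

definition thval :: "nat \<Rightarrow> (nat \<Rightarrow> real) \<Rightarrow> 'k::field qrep \<Rightarrow> real" where
  "thval n \<theta> X = (\<Sum>i<n. \<theta> i * real (dimv X i))"

definition Tbar :: "nat \<Rightarrow> (nat \<Rightarrow> real) \<Rightarrow> 'k::field qrep set" where
  "Tbar n \<theta> = {X. flmod n X \<and> (\<forall>Y f. flmod n Y \<and> surj_mor n X Y f \<longrightarrow> thval n \<theta> Y \<ge> 0)}"

definition Fbar :: "nat \<Rightarrow> (nat \<Rightarrow> real) \<Rightarrow> 'k::field qrep set" where
  "Fbar n \<theta> = {X. flmod n X \<and> (\<forall>Y f. flmod n Y \<and> inj_mor n Y X f \<longrightarrow> thval n \<theta> Y \<le> 0)}"

definition TF_equiv :: "'k::field itself \<Rightarrow> nat \<Rightarrow> (nat \<Rightarrow> real) \<Rightarrow> (nat \<Rightarrow> real) \<Rightarrow> bool" where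
  "TF_equiv _ n \<theta> \<eta> = ((Tbar n \<theta> :: 'k qrep set) = Tbar n \<eta> \<and> (Fbar n \<theta> :: 'k qrep set) = Fbar n \<eta>)"

(* ---------- Pi' = Pi / <e_n>: modules are Pi-modules vanishing at vertex n (= 0) ---------- *)
definition pmod :: "nat \<Rightarrow> 'k::field qrep \<Rightarrow> bool" where
  "pmod n X = (flmod n X \<and> dimv X 0 = 0)"

definition projective :: "nat \<Rightarrow> 'k::field qrep \<Rightarrow> bool" where
  "projective n P = (pmod n P \<and>
     (\<forall>M N g h. pmod n M \<and> pmod n N \<and> surj_mor n M N g \<and> morphism n P N h \<longrightarrow>
        (\<exists>l. morphism n P M l \<and> (\<forall>i<n. g i * l i = h i))))"

(* dim Hom(P, S(i)): morphisms P -> S(i) are the vectors r in P_i^* killed by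
   all arrows ending in i, i.e. the kernel of the stacked transposed arrow matrices *)
definition homS_dim :: "nat \<Rightarrow> 'k::field qrep \<Rightarrow> nat \<Rightarrow> nat" where
  "homS_dim n P i = kernel_dim (four_block_mat
      (transpose_mat (arra P (pr n i))) (0\<^sub>m (dim_col (arra P (pr n i))) 0)
      (transpose_mat (arrb P i)) (0\<^sub>m (dim_col (arrb P i)) 0))"

(* 2-term complexes  c1 --dif--> c0  (degrees -1, 0) of projective Pi'-modules *)
record 'k cx =
  c1 :: "'k qrep"
  c0 :: "'k qrep"
  dif :: "nat \<Rightarrow> 'k mat"

definition is_cx :: "nat \<Rightarrow> 'k::field cx \<Rightarrow> bool" where
  "is_cx n U = (projective n (c1 U) \<and> projective n (c0 U) \<and> morphism n (c1 U) (c0 U) (dif U))"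

definition mcomp :: "(nat \<Rightarrow> 'k::field mat) \<Rightarrow> (nat \<Rightarrow> 'k mat) \<Rightarrow> (nat \<Rightarrow> 'k mat)" where
  "mcomp f g = (\<lambda>i. f i * g i)"

definition idm :: "'k::field qrep \<Rightarrow> (nat \<Rightarrow> 'k mat)" where
  "idm X = (\<lambda>i. 1\<^sub>m (dimv X i))"

definition zmor :: "'k::field qrep \<Rightarrow> 'k qrep \<Rightarrow> (nat \<Rightarrow> 'k mat)" where
  "zmor X Y = (\<lambda>i. 0\<^sub>m (dimv Y i) (dimv X i))"

definition chmap :: "nat \<Rightarrow> 'k::field cx \<Rightarrow> 'k cx \<Rightarrow> (nat \<Rightarrow> 'k mat) \<times> (nat \<Rightarrow> 'k mat) \<Rightarrow> bool" where
  "chmap n U V F = (morphism n (c1 U) (c1 V) (fst F) \<and> morphism n (c0 U) (c0 V) (snd F) \<and>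
     (\<forall>i<n. snd F i * dif U i = dif V i * fst F i))"

definition homot :: "nat \<Rightarrow> 'k::field cx \<Rightarrow> 'k cx \<Rightarrow> (nat \<Rightarrow> 'k mat) \<times> (nat \<Rightarrow> 'k mat)
     \<Rightarrow> (nat \<Rightarrow> 'k mat) \<times> (nat \<Rightarrow> 'k mat) \<Rightarrow> bool" where
  "homot n U V F G = (\<exists>h. morphism n (c0 U) (c1 V) h \<and>
     (\<forall>i<n. fst F i - fst G i = h i * dif U i \<and> snd F i - snd G i = dif V i * h i))"

definition chcomp where
  "chcomp G F = (mcomp (fst G) (fst F), mcomp (snd G) (snd F))"

definition chid :: "'k::field cx \<Rightarrow> (nat \<Rightarrow> 'k mat) \<times> (nat \<Rightarrow> 'k mat)" where
  "chid U = (idm (c1 U), idm (c0 U))"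

definition htpy_equiv :: "nat \<Rightarrow> 'k::field cx \<Rightarrow> 'k cx \<Rightarrow> bool" where
  "htpy_equiv n U V = (\<exists>F G. chmap n U V F \<and> chmap n V U G \<and>
      homot n U U (chcomp G F) (chid U) \<and> homot n V V (chcomp F G) (chid V))"

definition zeroK :: "nat \<Rightarrow> 'k::field cx \<Rightarrow> bool" where
  "zeroK n U = homot n U U (chid U) (zmor (c1 U) (c1 U), zmor (c0 U) (c0 U))"

definition bdiag :: "'k::field mat \<Rightarrow> 'k mat \<Rightarrow> 'k mat" where
  "bdiag A B = four_block_mat A (0\<^sub>m (dim_row A) (dim_col B)) (0\<^sub>m (dim_row B) (dim_col A)) B"

definition rsum :: "'k::field qrep \<Rightarrow> 'k qrep \<Rightarrow> 'k qrep" where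
  "rsum X Y = \<lparr>dimv = (\<lambda>i. dimv X i + dimv Y i),
               arra = (\<lambda>i. bdiag (arra X i) (arra Y i)),
               arrb = (\<lambda>i. bdiag (arrb X i) (arrb Y i))\<rparr>"

definition cxsum :: "'k::field cx \<Rightarrow> 'k cx \<Rightarrow> 'k cx" where
  "cxsum U V = \<lparr>c1 = rsum (c1 U) (c1 V), c0 = rsum (c0 U) (c0 V),
                dif = (\<lambda>i. bdiag (dif U i) (dif V i))\<rparr>"

definition indec :: "nat \<Rightarrow> 'k::field cx \<Rightarrow> bool" where
  "indec n U = (is_cx n U \<and> \<not> zeroK n U \<and>
     (\<forall>V1 V2. is_cx n V1 \<and> is_cx n V2 \<and> htpy_equiv n U (cxsum V1 V2) \<longrightarrow> zeroK n V1 \<or> zeroK n V2))"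

definition summand :: "nat \<Rightarrow> 'k::field cx \<Rightarrow> 'k cx \<Rightarrow> bool" where
  "summand n V U = (is_cx n V \<and> (\<exists>V'. is_cx n V' \<and> htpy_equiv n U (cxsum V V')))"

definition basic :: "nat \<Rightarrow> 'k::field cx \<Rightarrow> bool" where
  "basic n U = (\<forall>V. indec n V \<longrightarrow> \<not> summand n (cxsum V V) U)"

(* basic 2-term presilting: Hom_K(U, U[1]) = 0 *)
definition presilt :: "nat \<Rightarrow> 'k::field cx \<Rightarrow> bool" where
  "presilt n U = (is_cx n U \<and> basic n U \<and>
     (\<forall>f. morphism n (c1 U) (c0 U) f \<longrightarrow>
        (\<exists>h0 h1. morphism n (c0 U) (c0 U) h0 \<and> morphism n (c1 U) (c1 U) h1 \<and>
            (\<forall>i<n. f i = h0 i * dif U i + dif U i * h1 i))))"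

(* class [U] = [U^0] - [U^{-1}] in K_0(proj Pi')_R, coordinates w.r.t. [P'(1)],...,[P'(n-1)] *)
definition clsCx :: "nat \<Rightarrow> 'k::field cx \<Rightarrow> (nat \<Rightarrow> real)" where
  "clsCx n U = (\<lambda>i. if 1 \<le> i \<and> i < n
       then real (homS_dim n (c0 U) i) - real (homS_dim n (c1 U) i) else 0)"

definition Ccone :: "nat \<Rightarrow> 'k::field cx \<Rightarrow> (nat \<Rightarrow> real) set" where
  "Ccone n U = cone_open {clsCx n V | V. indec n V \<and> summand n V U}"

(* iota: [P'(i)] |-> [P(i)] - [P(n)] *)
definition iota :: "nat \<Rightarrow> (nat \<Rightarrow> real) \<Rightarrow> (nat \<Rightarrow> real)" where
  "iota n c = (\<lambda>i. if 1 \<le> i \<and> i < n then c i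
                   else if i = 0 then - (\<Sum>j\<in>{1..<n}. c j) else 0)"

end

theory Submission
  imports Defs "HOL-Library.Function_Algebras" "HOL-Combinatorics.Permutations" "Jordan_Normal_Form.Char_Poly"
begin

text \<open>Writing \<open>H\<close> in coordinates \<open>x\<^sub>1, ..., x\<^sub>n\<close> modulo constants turns \<open>W'\<close> into the symmetric group, and
  the pieces become the sets of vectors with a given weak ordering, that is, the cones spanned by
  chains of subsets of \<open>{1, ..., n}\<close>. TF equivalence: a minimal witness distinguishing two vectors is a
  brick; bricks have a dimension vector \<open>d\<close> with \<open>\<Sum> (d\<^sub>i - d\<^sub>i\<^sub>+\<^sub>1)\<^sup>2 \<le> 2\<close>, so the value of a vector on them is
  \<open>0\<close> or some \<open>x\<^sub>p - x\<^sub>q\<close>; conversely string modules detect the sign of every \<open>x\<^sub>p - x\<^sub>q\<close>. Silting: every subset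
  \<open>S\<close> gives an explicit two-term complex, two of them are compatible iff the subsets are comparable,
  and a rigid complex is determined by its class, so presilting complexes correspond to chains.\<close>

section \<open>Operators on sequences\<close>

text \<open>Matrices of varying sizes do not form a ring, so the linear algebra takes place in the
  ring of all linear endomorphisms of \<open>nat => 'k\<close>. A matrix is an operator fixed by
  projections onto initial coordinates; representations, morphisms and complexes become families of
  operators that add and multiply freely. On the silting side the obstacle is to control all direct
  summands of a complex. Krull-Schmidt is replaced by numerics: modulo constants every integral
  vector is a sum of indicators along exactly one chain of proper nonempty subsets, repetitions
  allowed; the sum of the corresponding complexes is rigid; over an infinite field the class then
  determines it up to homotopy. So each rigid complex is a sum of the explicit ones, and
  indecomposability and basicness become statements about multisets of subsets. The constant 2 on
  the TF side is twice the dimension of the endomorphism ring of a nonzero brick: since products of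
  opposite arrows vanish on a brick, so few equations cut out its endomorphisms that \<Sum> d_i^2 -
  \<Sum> d_i d_(i+1) \<le> 1.\<close>

typedef (overloaded) 'k lop =
  "{f :: (nat => 'k::field) => nat => 'k.
      (\<forall>u v. f (%i. u i + v i) = (%i. f u i + f v i)) & (\<forall>c u. f (%i. c * u i) = (%i. c * f u i))}"
  morphisms app Lop
  by (rule exI[of _ "%u. u"]) simp

setup_lifting type_definition_lop

instantiation lop :: (field) ring_1
begin
lift_definition zero_lop :: "'a lop" is "%u i. 0" by simp
lift_definition one_lop :: "'a lop" is "%u. u" by simp
lift_definition plus_lop :: "'a lop => 'a lop => 'a lop" is "%f g u i. f u i + g u i"
  by (simp add: algebra_simps)
lift_definition minus_lop :: "'a lop => 'a lop => 'a lop" is "%f g u i. f u i - g u i"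
  by (simp add: algebra_simps)
lift_definition uminus_lop :: "'a lop => 'a lop" is "%f u i. - f u i"
  by simp
lift_definition times_lop :: "'a lop => 'a lop => 'a lop" is "%f g u. f (g u)"
  by simp
instance
proof
  show "(0::'a lop) \<noteq> 1"
    by transfer (auto simp: fun_eq_iff intro!: exI[of _ "%_. 1"])
qed (transfer; simp add: algebra_simps fun_eq_iff)+
end

lift_definition scl :: "'k::field => 'k lop" is "%c u i. c * u i"
  by (simp add: algebra_simps)
lift_definition un :: "nat => nat => 'k::field lop" is "%i j u r. if r = i then u j else 0"
  by (simp add: fun_eq_iff)
text \<open>The projection onto the first \<open>d\<close> coordinates stands for the identity
  matrix of size \<open>d\<close>; sizes of matrices are expressed by multiplying with it.\<close>

lift_definition eye :: "nat => 'k::field lop" is "%d u r. if r < d then u r else 0"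
  by (simp add: fun_eq_iff)

text \<open>On infinite sequences the entries do not determine an operator; they do so once it is
  cut down by projections on both sides.\<close>

definition ent :: "'k::field lop => nat => nat => 'k" where
  "ent f i j = app f (%t. if t = j then 1 else 0) i"

lemma scl_comm: "f * scl c = scl c * f"
  by transfer simp
lemma scl_left_comm: "f * (scl c * g) = scl c * (f * g)"
  by (metis mult.assoc scl_comm)
lemma scl_add: "scl (a + b) = scl a + scl b"
  by transfer (simp add: algebra_simps)
lemma scl_diff: "scl (a - b) = scl a - scl b"
  by transfer (simp add: algebra_simps)
lemma scl_minus: "scl (- a) = - scl a"
  by transfer (simp add: algebra_simps)
lemma scl_mult: "scl (a * b) = scl a * scl b"
  by transfer (simp add: algebra_simps)
lemma scl_mult': "scl a * (scl b * x) = scl (a * b) * x"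
  by (simp add: scl_mult mult.assoc)
lemma scl_0 [simp]: "scl 0 = 0"
  by transfer simp
lemma scl_1 [simp]: "scl 1 = 1"
  by transfer simp
lemma scl_sum: "scl (sum g A) = (\<Sum>a\<in>A. scl (g a))"
  by (induct A rule: infinite_finite_induct) (auto simp: scl_add)

lemma eye_0 [simp]: "eye 0 = 0"
  by transfer simp
lemma eye_eye: "eye a * eye b = (eye (min a b) :: 'k::field lop)"
  by transfer (auto simp: fun_eq_iff)
lemma eye_idem [simp]: "eye a * eye a = eye a"
  by (simp add: eye_eye)
lemma eye_idem' [simp]: "eye a * (eye a * f) = eye a * f"
  by (simp flip: mult.assoc)
lemma un_un: "un i j * un k l = (if j = k then un i l else (0 :: 'k::field lop))"
  by transfer (auto simp: fun_eq_iff)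
lemma eye_un: "eye d * un i j = (if i < d then un i j else (0 :: 'k::field lop))"
  by transfer (auto simp: fun_eq_iff)
lemma un_eye: "un i j * eye d = (if j < d then un i j else (0 :: 'k::field lop))"
  by transfer (auto simp: fun_eq_iff)
lemma eye_Suc: "eye (Suc d) = eye d + un d d"
  by transfer (auto simp: fun_eq_iff)
lemma eye_sum: "eye d = (\<Sum>k<d. un k k)"
  by (induct d) (auto simp: eye_Suc)

lemma ent_add: "ent (f + g) i j = ent f i j + ent g i j"
  unfolding ent_def by transfer simp
lemma ent_diff: "ent (f - g) i j = ent f i j - ent g i j"
  unfolding ent_def by transfer simp
lemma ent_0 [simp]: "ent 0 i j = 0"
  unfolding ent_def by transfer simp
lemma ent_sum: "ent (sum f A) i j = (\<Sum>a\<in>A. ent (f a) i j)"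
  by (induct A rule: infinite_finite_induct) (auto simp: ent_add)
lemma ent_scl: "ent (scl c * f) i j = c * ent f i j"
  unfolding ent_def by transfer simp
lemma ent_un: "ent (un a b) i j = (if i = a & j = b then 1 else 0)"
  unfolding ent_def by transfer auto
lemma ent_eye: "ent (eye d) i j = (if i = j & i < d then 1 else 0)"
  unfolding ent_def by transfer auto

text \<open>The image of \<open>un s j\<close> consists of multiples of one unit sequence, so by
  homogeneity \<open>f\<close> enters only through a single number.\<close>

lemma un_sandwich: "un i r * f * un s j = scl (ent f r s) * un i j"
proof -
  have "app f (%t. if t = s then u j else 0) r = app f (%t. if t = s then 1 else 0) r * u j" for u
  proof -
    have "app f (%t. u j * (if t = s then 1 else 0)) = (%i. u j * app f (%t. if t = s then 1 else 0) i)"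
      using app[of f] by simp
    moreover have "(%t. u j * (if t = s then 1 else 0)) = (%t. if t = s then u j else 0)"
      by auto
    ultimately show ?thesis by (simp add: mult.commute)
  qed
  then show ?thesis
    unfolding ent_def by transfer (auto simp: fun_eq_iff)
qed

lemma ent_mult_un: "ent (f * un t t * g) i j = ent f i t * ent g t j"
proof -
  \<comment> \<open>Routing \<open>un t t\<close> through the index 0 splits the product into two
    sandwiches, each of which yields one entry.\<close>
  have eq: "(un t t :: 'a lop) = un t 0 * un 0 t" by (simp add: un_un)
  have "scl (ent (f * un t t * g) i j) * un 0 0 = un 0 i * (f * un t t * g) * un j 0"
    by (simp add: un_sandwich)
  also have "\<dots> = (un 0 i * f * un t 0) * (un 0 t * g * un j 0)"
    by (simp only: eq mult.assoc)
  also have "\<dots> = scl (ent f i t * ent g t j) * un 0 0"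
    unfolding un_sandwich
    by (metis (no_types, lifting) mult.assoc scl_comm scl_mult un_un)
  finally have "ent (scl (ent (f * un t t * g) i j) * un 0 0) 0 0 = ent (scl (ent f i t * ent g t j) * un 0 0 :: 'a lop) 0 0"
    by simp
  then show ?thesis by (simp add: ent_scl ent_un)
qed

text \<open>The \<open>m\<close> by \<open>n\<close> matrices inside the ring. Membership consists
  of two equations, so that size arguments become rewriting with \<open>eye\<close>.\<close>

definition ops :: "nat => nat => 'k::field lop set" where
  "ops m n = {f. eye m * f = f & f * eye n = f}"

lemma ops_l: "f \<in> ops m n ==> eye m * f = f" and ops_r: "f \<in> ops m n ==> f * eye n = f"
  by (auto simp: ops_def)
lemma ops_l': "f \<in> ops m n ==> eye m * (f * g) = f * g"
  by (auto simp: ops_def simp flip: mult.assoc)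
lemma ops_r': "f \<in> ops m n ==> f * (eye n * g) = f * g"
  by (auto simp: ops_def simp flip: mult.assoc)

lemma ops_mult: "f \<in> ops m n ==> g \<in> ops n p ==> f * g \<in> ops m p"
  unfolding ops_def by simp (metis mult.assoc)
lemma ops_add: "f \<in> ops m n ==> g \<in> ops m n ==> f + g \<in> ops m n"
  unfolding ops_def by (auto simp: algebra_simps)
lemma ops_diff: "f \<in> ops m n ==> g \<in> ops m n ==> f - g \<in> ops m n"
  unfolding ops_def by (auto simp: algebra_simps)
lemma ops_minus: "f \<in> ops m n ==> - f \<in> ops m n"
  unfolding ops_def by (auto simp: algebra_simps)
lemma ops_0 [simp]: "0 \<in> ops m n"
  unfolding ops_def by simp
lemma ops_eye [simp]: "eye n \<in> ops n n"
  unfolding ops_def by simp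
lemma ops_un: "i < m ==> j < n ==> un i j \<in> ops m n"
  unfolding ops_def by (simp add: eye_un un_eye)
lemma ops_scl: "f \<in> ops m n ==> scl c * f \<in> ops m n"
  unfolding ops_def by (auto simp: scl_left_comm mult.assoc)
lemma ops_sum: "(\<And>a. a \<in> A ==> f a \<in> ops m n) ==> sum f A \<in> ops m n"
  by (induct A rule: infinite_finite_induct) (auto simp: ops_add)
lemma ops_block: "eye m * f * eye n \<in> ops m n"
  unfolding ops_def by (simp add: mult.assoc)

lemma ops_zero_dim: "f \<in> ops 0 n ==> f = 0" "f \<in> ops m 0 ==> f = 0"
  unfolding ops_def by auto

lemma block_expand: "eye m * f * eye n = (\<Sum>i<m. \<Sum>j<n. scl (ent f i j) * un i j)"
  unfolding eye_sum
  by (simp add: sum_distrib_left sum_distrib_right un_sandwich) (rule sum.swap)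

lemma ops_expand: "f \<in> ops m n ==> f = (\<Sum>i<m. \<Sum>j<n. scl (ent f i j) * un i j)"
  using block_expand[of m f n] by (simp add: ops_l ops_r)

lemma ops_eqI:
  assumes "f \<in> ops m n" "g \<in> ops m n" "\<And>i j. i < m ==> j < n ==> ent f i j = ent g i j"
  shows "f = g"
proof -
  have "(\<Sum>i<m. \<Sum>j<n. scl (ent f i j) * un i j) = (\<Sum>i<m. \<Sum>j<n. scl (ent g i j) * un i j)"
    by (intro sum.cong refl) (simp add: assms(3))
  then show ?thesis using ops_expand[OF assms(1)] ops_expand[OF assms(2)] by simp
qed

lemma ent_mult:
  assumes "f * eye k = f"
  shows "ent (f * g) i j = (\<Sum>t<k. ent f i t * ent g t j)"
proof -
  have "f * g = (\<Sum>t<k. f * un t t * g)"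
    by (subst assms[symmetric]) (simp add: eye_sum sum_distrib_left sum_distrib_right)
  then show ?thesis by (simp add: ent_sum ent_mult_un)
qed

subsection \<open>Linear algebra with operators\<close>

lemma homogeneous_system:
  fixes L :: "'j => ('i => 'k::field) => 'k"
  assumes "finite J" "finite I" "card J < card I"
    and "\<And>j x c y. L j (%i. x i + c * y i) = L j x + c * L j y"
  shows "\<exists>x. (\<exists>i\<in>I. x i \<noteq> 0) & (\<forall>i. i \<notin> I --> x i = 0) & (\<forall>j\<in>J. L j x = 0)"
  using assms
proof (induct J arbitrary: I L rule: finite_induct)
  case empty
  then obtain i where "i \<in> I" by fastforce
  then show ?case by (intro exI[of _ "%t. if t = i then 1 else 0"]) auto
next
  case (insert j J)
  define d where "d i = (%t. if t = i then 1 else (0::'k))" for i :: 'i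
  note lin = insert.prems(3)
  show ?case
  proof (cases "\<forall>i\<in>I. L j (d i) = 0")
    case True
    have z: "L j (%_. 0) = 0"
      using insert.prems(3)[of j "%_. 0" "-1" "%_. 0"] by simp
    have w: "L j x = 0" if "\<forall>i. i \<notin> A --> x i = 0" "A \<subseteq> I" "finite A" for x A
      using that(3,1,2)
    proof (induct A arbitrary: x rule: finite_induct)
      case empty
      then have "x = (%_. 0)" by auto
      then show ?case using z by simp
    next
      case (insert a A)
      have "x = (%i. (x(a := 0)) i + x a * d a i)" by (auto simp: d_def)
      then have "L j x = L j (x(a := 0)) + x a * L j (d a)"
        using lin[of j "x(a := 0)" "x a" "d a"] by (rule trans[OF arg_cong[of _ _ "L j"]])
      moreover have "L j (x(a := 0)) = 0"
        using insert by (intro insert(3)) auto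
      ultimately show ?case using True insert by auto
    qed
    have v: "L j x = 0" if "\<forall>i. i \<notin> I --> x i = 0" for x
      using w[of I x] that insert.prems(1) by simp
    have "\<exists>x. (\<exists>i\<in>I. x i \<noteq> 0) & (\<forall>i. i \<notin> I --> x i = 0) & (\<forall>j\<in>J. L j x = 0)"
    proof (rule insert.hyps(3))
      show "finite I" "card J < card I" using insert.prems insert.hyps(1,2) by auto
      show "L j (%i. x i + c * y i) = L j x + c * L j y" for j x c y by (rule insert.prems(3))
    qed
    then show ?thesis using v by auto
  next
    case False
    then obtain i0 where i0: "i0 \<in> I" "L j (d i0) \<noteq> 0" by blast
    \<comment> \<open>The other equations after equation \<open>j\<close> has been solved for the
      unknown \<open>i0\<close>.\<close>
    define L' where "L' j' x = L j' (%i. x i + (- L j x / L j (d i0)) * d i0 i)" for j' x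
    have lin': "L' j' x = L j' x + (- L j x / L j (d i0)) * L j' (d i0)" for j' x
      unfolding L'_def by (rule insert.prems(3))
    have "\<exists>x. (\<exists>i\<in>I - {i0}. x i \<noteq> 0) & (\<forall>i. i \<notin> I - {i0} --> x i = 0) & (\<forall>j\<in>J. L' j x = 0)"
    proof (rule insert.hyps(3))
      show "finite (I - {i0})" using insert.prems by simp
      show "card J < card (I - {i0})"
        using insert.prems insert.hyps i0 by simp
      show "L' j' (%i. x i + c * y i) = L' j' x + c * L' j' y" for j' x c y
        unfolding lin' insert.prems(3) using i0 by (simp add: field_simps)
    qed
    then obtain x i1 where x: "i1 \<in> I - {i0}" "x i1 \<noteq> 0" "\<forall>i. i \<notin> I - {i0} --> x i = 0"
      "\<forall>j\<in>J. L' j x = 0" by blast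
    let ?x = "%i. x i + (- L j x / L j (d i0)) * d i0 i"
    have "L j ?x = 0" using lin'[of j x] i0 by (simp add: L'_def)
    moreover have "?x i1 \<noteq> 0" using x by (auto simp: d_def)
    moreover have "\<forall>i. i \<notin> I --> ?x i = 0" using x i0 by (auto simp: d_def)
    ultimately show ?thesis using x by (intro exI[of _ ?x]) (auto simp: L'_def)
  qed
qed

lemma app_lin: "app f (%i. x i + c * y i) = (%i. app f x i + c * app f y i)"
  using app[of f] by simp

text \<open>If \<open>s < r\<close>, the first \<open>s\<close> coordinates of \<open>g x\<close>
  vanish for some nonzero \<open>x\<close> in \<open>r\<close> unknowns. Since \<open>f\<close>
  reads only these coordinates, \<open>f * g\<close> would kill \<open>x\<close> instead of fixing
  it.\<close>

lemma dim_le: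
  assumes "f \<in> ops r s" "g * eye r = g" "f * g = eye r"
  shows "r \<le> s"
proof (rule ccontr)
  assume "\<not> r \<le> s"
  then obtain x where x: "\<exists>i\<in>{..<r}. x i \<noteq> 0" "\<forall>i. i \<notin> {..<r} --> x i = 0" "\<forall>j\<in>{..<s}. app g x j = 0"
    using homogeneous_system[of "{..<s}" "{..<r}" "%j x. app g x j"] by (auto simp: app_lin)
  have "app (eye s * g) x = app 0 x"
    using x(3) by transfer auto
  then have "app (f * (eye s * g)) x = app (f * 0) x"
    unfolding times_lop.rep_eq by simp
  then have "app (eye r) x = (%_. 0)"
    using assms by (simp add: ops_r' zero_lop.rep_eq)
  then have "x i = 0" if "i < r" for i
    using that by (auto simp: eye.rep_eq fun_eq_iff split: if_splits)
  then show False using x by auto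
qed

lemma dim_eq:
  assumes "f \<in> ops r s" "g \<in> ops s r" "f * g = eye r" "g * f = eye s"
  shows "r = s"
  using dim_le[of f r s g] dim_le[of g s r f] assms ops_r by (metis le_antisym)

text \<open>Induction on the number of columns: the last column either lies in the column space
  found so far, or it enlarges \<open>u\<close> by one column. The one-sided inverses
  \<open>u'\<close> and \<open>v'\<close> are carried along, since they are what later constructions
  use.\<close>

lemma rank_factorization:
  assumes "f \<in> ops m n"
  shows "\<exists>r u v u' v'. u \<in> ops m r & v \<in> ops r n & u' \<in> ops r m & v' \<in> ops n r &
    u * v = f & u' * u = eye r & v * v' = eye r"
  using assms
proof (induct n arbitrary: f)
  case 0
  then have "f = 0" by (auto dest: ops_zero_dim)
  then show ?case by (intro exI[of _ 0]) auto
next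
  case (Suc n)
  have "f * eye n \<in> ops m n"
    using Suc.prems by (simp add: ops_def mult.assoc) (metis mult.assoc)
  from Suc.hyps[OF this] obtain r u v u' v' where
    uv: "u \<in> ops m r" "v \<in> ops r n" "u' \<in> ops r m" "v' \<in> ops n r"
    and eq: "u * v = f * eye n" "u' * u = eye r" "v * v' = eye r"
    by blast
  define c where "c = f * un n n"
  have f: "f = u * v + c"
    using Suc.prems unfolding c_def eq by (metis distrib_left eye_Suc ops_r)
  have cn: "c * un n n = c" unfolding c_def by (simp add: mult.assoc un_un)
  have cl: "eye m * c = c" unfolding c_def using Suc.prems by (simp add: ops_l')
  have cops: "c \<in> ops m (Suc n)"
    using cl cn by (auto simp: ops_def eye_Suc distrib_left c_def mult.assoc un_eye)
  have ops_up: "x \<in> ops k (Suc n)" if "x \<in> ops k n" for x :: "'a lop" and k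
    using that unfolding ops_def by (auto simp: eye_Suc distrib_left) (metis add_0_right mult.assoc mult_zero_right eye_un less_irrefl un_eye)
  have ops_up': "x \<in> ops (Suc n) k" if "x \<in> ops n k" for x :: "'a lop" and k
    using that unfolding ops_def by (auto simp: eye_Suc distrib_right) (metis add_0_right mult.assoc mult_zero_left eye_un less_irrefl un_eye)
  have cv: "c * x = 0" if "x \<in> ops n k" for x :: "'a lop" and k
  proof -
    have "c * x = c * (un n n * eye n) * x"
      using that by (metis cn mult.assoc ops_l)
    then show ?thesis by (simp add: un_eye)
  qed
  \<comment> \<open>The part of the last column that is new to the current column space;
    \<open>u'\<close> annihilates it.\<close>
  define y where "y = c - u * (u' * c)"
  show ?case
  proof (cases "y = 0")
    case True
    have "u * (v + u' * c) = f"
      using f True by (simp add: y_def distrib_left)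
    moreover have "(v + u' * c) * v' = eye r"
      using eq cv[OF uv(4)] by (simp add: distrib_right mult.assoc)
    moreover have "v + u' * c \<in> ops r (Suc n)"
      using uv cops ops_up by (intro ops_add ops_mult[of u' r m]) auto
    ultimately show ?thesis
      using uv eq ops_up' by blast
  next
    case False
    have yops: "y \<in> ops m (Suc n)"
      unfolding y_def using uv cops by (intro ops_diff) (auto intro: ops_mult)
    have yn: "y * un n n = y" unfolding y_def by (simp add: algebra_simps cn mult.assoc)
    have u'y: "u' * y = 0"
      using eq uv(3) unfolding y_def by (simp add: right_diff_distrib ops_l' flip: mult.assoc) (simp add: ops_l)
    have uu'y: "u * (u' * y) = 0" using u'y by simp
    obtain s where s: "s < m" "ent y s n \<noteq> 0"
    proof -
      have "\<exists>i j. i < m & j < Suc n & ent y i j \<noteq> 0"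
        using ops_eqI[OF yops ops_0] False by auto
      then obtain i j where ij: "i < m" "j < Suc n" "ent y i j \<noteq> 0" by blast
      have "ent y i j = ent (y * un n n * 1) i j" using yn by simp
      also have "\<dots> = ent y i n * ent 1 n j" by (rule ent_mult_un)
      finally show ?thesis using that ij by auto
    qed
    \<comment> \<open>The pivot row, normalised so that \<open>ps * y\<close> becomes the matrix
      unit in position \<open>(r, n)\<close>.\<close>
    define ps where "ps = scl (1 / ent y s n) * un r s"
    have psy: "ps * y = un r n"
    proof -
      have "un r s * y * un n n = scl (ent y s n) * un r n"
        by (rule un_sandwich)
      then have "un r s * y = scl (ent y s n) * un r n"
        using yn by (simp add: mult.assoc)
      then show ?thesis
        using s by (simp add: ps_def mult.assoc scl_mult')
    qed
    define u1 where "u1 = u + y * un n r"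
    \<comment> \<open>The correction term makes the new row vanish on the old columns.\<close>
    define u1' where "u1' = u' + ps - ps * u * u'"
    define v1 where "v1 = v + u' * c + un r n"
    define v1' where "v1' = v' + un n r - v' * u' * c * un n r"
    have psu: "ps \<in> ops (Suc r) m" unfolding ps_def using s by (intro ops_scl ops_un) auto
    have up: "x \<in> ops (Suc r) k" if "x \<in> ops r k" for x :: "'a lop" and k
      using that unfolding ops_def by (auto simp: eye_Suc distrib_right) (metis add_0_right mult.assoc mult_zero_left eye_un less_irrefl un_eye)
    have up': "x \<in> ops k (Suc r)" if "x \<in> ops k r" for x :: "'a lop" and k
      using that unfolding ops_def by (auto simp: eye_Suc distrib_left) (metis add_0_right mult.assoc mult_zero_right eye_un less_irrefl un_eye)
    have ur: "u * (un r t * x) = 0" "u * un r t = 0" for t x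
    proof -
      have "u * un r t = u * (eye r * un r t)" using uv by (simp add: ops_r')
      then show "u * un r t = 0" by (simp add: eye_un)
      then show "u * (un r t * x) = 0" by (simp flip: mult.assoc)
    qed
    have vn: "v * (un n t * x) = 0" "v * un n t = 0" for t x
    proof -
      have "v * un n t = v * (eye n * un n t)" using uv by (simp add: ops_r')
      then show "v * un n t = 0" by (simp add: eye_un)
      then show "v * (un n t * x) = 0" by (simp flip: mult.assoc)
    qed
    have rv: "un t r * (x * z) = 0" "un t r * x = 0" if "x \<in> ops r k" for t x k z
    proof -
      have "un t r * x = un t r * eye r * x" using that by (simp add: ops_l mult.assoc)
      then show "un t r * x = 0" by (simp add: un_eye)
      then show "un t r * (x * z) = 0" by (simp flip: mult.assoc)
    qed
    have nv': "un t n * (v' * z) = 0" "un t n * v' = 0" for t z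
    proof -
      have "un t n * v' = un t n * eye n * v'" using uv(4) by (simp add: ops_l mult.assoc)
      then show "un t n * v' = 0" by (simp add: un_eye)
      then show "un t n * (v' * z) = 0" by (simp flip: mult.assoc)
    qed
    have cv': "c * (v' * z) = 0" for z using cv[OF uv(4)] by (simp flip: mult.assoc)
    have u'u: "u' * (u * z) = eye r * z" for z using eq by (simp flip: mult.assoc)
    have vv': "v * (v' * z) = eye r * z" for z using eq by (simp flip: mult.assoc)
    have "u1' * u1 = eye r + un r n * un n r"
      unfolding u1_def u1'_def
      using uv by (simp add: algebra_simps u'u eq u'y psy mult.assoc ops_r)
        (simp add: u'y psy ops_r flip: mult.assoc)
    then have a: "u1' * u1 = eye (Suc r)" by (simp add: un_un eye_Suc)
    have "u1 * v1 = u * v + u * (u' * c) + y"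
      unfolding u1_def v1_def
      using yn by (simp add: algebra_simps ur rv[OF uv(2)] rv[OF uv(3)] mult.assoc un_un)
    then have b: "u1 * v1 = f" by (simp add: y_def f)
    have cz: "c * (un n r) = c * un n r" ..
    have "v1 * v1' = eye r + un r r"
      unfolding v1_def v1'_def
      using uv by (simp add: algebra_simps mult.assoc vv' eq vn cv' nv' cv[OF uv(4)] un_un ops_l')
    then have d: "v1 * v1' = eye (Suc r)" by (simp add: eye_Suc)
    have "u1 \<in> ops m (Suc r)"
      unfolding u1_def by (rule ops_add[OF up'[OF uv(1)] ops_mult[OF yops ops_un[OF lessI lessI]]])
    moreover have "u1' \<in> ops (Suc r) m"
      unfolding u1'_def by (rule ops_diff[OF ops_add[OF up[OF uv(3)] psu] ops_mult[OF ops_mult[OF psu uv(1)] uv(3)]])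
    moreover have "v1 \<in> ops (Suc r) (Suc n)"
      unfolding v1_def
      by (rule ops_add[OF ops_add[OF ops_up[OF up[OF uv(2)]] up[OF ops_mult[OF uv(3) cops]]] ops_un[OF lessI lessI]])
    moreover have "v1' \<in> ops (Suc n) (Suc r)"
      unfolding v1'_def
      by (rule ops_diff[OF ops_add[OF ops_up'[OF up'[OF uv(4)]] ops_un[OF lessI lessI]]
          ops_up'[OF ops_mult[OF ops_mult[OF ops_mult[OF uv(4) uv(3)] cops] ops_un[OF lessI lessI]]]])
    ultimately show ?thesis using a b d by blast
  qed
qed

text \<open>The image of the idempotent \<open>e\<close> as a coordinate space of dimension
  \<open>r\<close>: \<open>u\<close> includes it and \<open>v\<close> projects onto it.\<close>

definition splits :: "'k::field lop => nat => nat => 'k lop => 'k lop => bool" where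
  "splits e d r u v \<longleftrightarrow> u \<in> ops d r & v \<in> ops r d & u * v = e & v * u = eye r"

lemma splitsD:
  assumes "splits e d r u v"
  shows "u \<in> ops d r" "v \<in> ops r d" "e \<in> ops d d"
    "u * v = e" "u * (v * x) = e * x" "v * u = eye r" "v * (u * x) = eye r * x"
    "eye d * u = u" "eye d * (u * x) = u * x" "u * eye r = u" "u * (eye r * x) = u * x"
    "eye r * v = v" "eye r * (v * x) = v * x" "v * eye d = v" "v * (eye d * x) = v * x"
    "eye d * e = e" "eye d * (e * x) = e * x" "e * eye d = e" "e * (eye d * x) = e * x"
    "e * e = e" "e * (e * x) = e * x" "e * u = u" "e * (u * x) = u * x" "v * e = v" "v * (e * x) = v * x"
proof -
  have a: "u \<in> ops d r" "v \<in> ops r d" "u * v = e" "v * u = eye r"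
    using assms by (auto simp: splits_def)
  show "u \<in> ops d r" "v \<in> ops r d" "u * v = e" "v * u = eye r" by fact+
  show b: "e \<in> ops d d" using a ops_mult by blast
  show "u * (v * x) = e * x" and vu: "v * (u * x) = eye r * x" for x
    using a by (simp_all flip: mult.assoc)
  show "eye d * u = u" "eye d * (u * x) = u * x" "u * eye r = u" "u * (eye r * x) = u * x"
    "eye r * v = v" "eye r * (v * x) = v * x" "v * eye d = v" "v * (eye d * x) = v * x"
    "eye d * e = e" "eye d * (e * x) = e * x" "e * eye d = e" "e * (eye d * x) = e * x"
    using a b by (simp_all add: ops_l ops_r ops_l' ops_r')
  show eu: "e * u = u" using a by (metis mult.assoc ops_r)
  show ve: "v * e = v" using a by (metis mult.assoc ops_l)
  show "e * (u * x) = u * x" "v * (e * x) = v * x"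
    using eu ve by (simp_all flip: mult.assoc)
  show ee: "e * e = e" using a eu by (metis mult.assoc)
  show "e * (e * x) = e * x" using ee by (simp flip: mult.assoc)
qed

text \<open>In a rank factorisation \<open>e = u * v\<close> of an idempotent, cancelling the
  one-sided inverses in \<open>e * e = e\<close> leaves \<open>v * u = eye r\<close>.\<close>

lemma idempotent_splits:
  assumes "e \<in> ops d d" "e * e = e"
  shows "\<exists>r u v. splits e d r u v"
proof -
  obtain r u v u' v' where uv: "u \<in> ops d r" "v \<in> ops r d" "u' \<in> ops r d" "v' \<in> ops d r"
    and eq: "u * v = e" "u' * u = eye r" "v * v' = eye r"
    using rank_factorization[OF assms(1)] by blast
  have "u' * (u * v * (u * v)) * v' = u' * (u * v) * v'"
    using assms(2) eq by simp
  then have "(u' * u) * (v * u) * (v * v') = (u' * u) * (v * v')"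
    by (simp add: mult.assoc)
  then have "v * u = eye r"
    using uv by (simp add: eq ops_l' ops_r mult.assoc)
  then show ?thesis using uv eq unfolding splits_def by blast
qed

text \<open>The product \<open>v' * u'\<close> of the one-sided inverses of a rank factorisation.
  With it \<open>f * g\<close> projects onto the image of \<open>f\<close>, and \<open>g * f\<close>
  projects along its kernel.\<close>

lemma generalized_inverse:
  assumes "f \<in> ops m n"
  shows "\<exists>g\<in>ops n m. f * g * f = f & g * f * g = g"
proof -
  obtain r u v u' v' where uv: "u \<in> ops m r" "v \<in> ops r n" "u' \<in> ops r m" "v' \<in> ops n r"
    and eq: "u * v = f" "u' * u = eye r" "v * v' = eye r"
    using rank_factorization[OF assms] by blast
  have "u * v * (v' * u') * (u * v) = u * (v * v') * (u' * u) * v"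
    by (simp add: mult.assoc)
  also have "\<dots> = f" using uv eq by (simp add: ops_r ops_r')
  finally have a: "f * (v' * u') * f = f" using eq by simp
  have "v' * u' * (u * v) * (v' * u') = v' * (u' * u) * (v * v') * u'"
    by (simp add: mult.assoc)
  also have "\<dots> = v' * u'" using uv eq by (simp add: ops_r ops_r')
  finally have b: "(v' * u') * f * (v' * u') = v' * u'" using eq by simp
  show ?thesis using a b uv by (intro bexI[of _ "v' * u'"]) (auto intro: ops_mult)
qed

text \<open>\<open>sh k\<close> and its left inverse \<open>shb k\<close> move a block behind the
  first \<open>k\<close> coordinates and back; they serve for direct sums and stacked
  matrices.\<close>

lift_definition sh :: "nat => 'k::field lop" is "%k u r. if k \<le> r then u (r - k) else 0"
  by (simp add: fun_eq_iff)
lift_definition shb :: "nat => 'k::field lop" is "%k u r. u (r + k)"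
  by (simp add: fun_eq_iff)

lemma shb_sh [simp]: "shb k * sh k = 1"
  by transfer (auto simp: fun_eq_iff)
lemma shb_sh' [simp]: "shb k * (sh k * x) = x"
  by (simp flip: mult.assoc)
lemma sh_shb: "sh k * shb k = 1 - eye k"
  by transfer (auto simp: fun_eq_iff)
lemma eye_sh: "eye k * sh k = 0" and shb_eye: "shb k * eye k = 0"
  by (transfer; auto simp: fun_eq_iff)+
lemma sh_eye: "sh k * eye d = eye (k + d) * sh k"
  by transfer (auto simp: fun_eq_iff)
lemma eye_shb: "eye d * shb k = shb k * eye (k + d)"
  by transfer (auto simp: fun_eq_iff add.commute)
lemma sh_eye_ops: "sh k * eye d \<in> ops (k + d) d"
  by (simp add: ops_def mult.assoc) (simp add: sh_eye flip: mult.assoc)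
lemma eye_shb_ops: "eye d * shb k \<in> ops d (k + d)"
  by (simp add: ops_def mult.assoc flip: eye_shb)
lemma sh_eye_shb: "sh k * eye d * shb k = eye (k + d) - eye k"
  by transfer (auto simp: fun_eq_iff)
lemma sh_eye_shb': "sh k * (eye d * shb k) = eye (k + d) - eye k"
  by (simp add: sh_eye_shb flip: mult.assoc)
lemma shb_eye': "shb k * (eye k * x) = 0" and eye_sh': "eye k * (sh k * x) = 0"
  by (simp_all add: shb_eye eye_sh flip: mult.assoc)
lemma sh_sh: "sh a * sh b = sh (a + b)" and sh_0 [simp]: "sh 0 = 1"
  by (transfer; auto simp: fun_eq_iff)+
lemma eye_ops_le: "a \<le> b ==> eye a \<in> ops a b" "a \<le> b ==> eye a \<in> ops b a"
  by (auto simp: ops_def eye_eye min_def)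

text \<open>Coordinates on the image of \<open>e\<close> followed by coordinates on the
  complementary image form a base change of the whole space, whose first \<open>r\<close> rows are
  \<open>v\<close>.\<close>

lemma splits_combine:
  assumes "splits e d r u v" "splits (eye d - e) d s p q"
  shows "\<exists>f\<in>ops (r + s) d. \<exists>g\<in>ops d (r + s). f * g = eye (r + s) & g * f = eye d & eye r * f = v"
proof -
  note d = splitsD[OF assms(1)] splitsD[OF assms(2)]
  have qe: "q * e = 0" using splitsD(24)[OF assms(2)] splitsD(14)[OF assms(2)] by (simp add: right_diff_distrib)
  have ep: "e * p = 0"
    using splitsD(22)[OF assms(2)] splitsD(8)[OF assms(2)] by (simp add: left_diff_distrib)
  have qu: "q * u = 0" by (metis qe d(22) mult.assoc mult_zero_left)
  have vp: "v * p = 0" by (metis ep d(24) mult.assoc mult_zero_right)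
  define f where "f = v + sh r * q"
  define g where "g = u + p * shb r"
  have shq: "shb r * v = 0"
    by (metis assms(1) mult.assoc mult_zero_left ops_l shb_eye splits_def)
  have ush: "u * sh r = 0"
    by (metis assms(1) mult.assoc mult_zero_right ops_r eye_sh splits_def)
  have ush': "u * (sh r * x) = 0" for x using ush by (simp flip: mult.assoc)
  have gf: "g * f = eye d"
    using assms unfolding f_def g_def splits_def
    by (simp add: algebra_simps mult.assoc shq ush')
  have fg: "f * g = eye (r + s)"
  proof -
    have vp': "v * (p * x) = 0" and qp: "q * (p * x) = eye s * x" for x
      using vp assms by (auto simp: splits_def simp flip: mult.assoc)
    show ?thesis
      using assms unfolding f_def g_def splits_def
      by (simp add: algebra_simps mult.assoc vp' qu qp sh_eye_shb')
  qed
  note o = splitsD(1,2)[OF assms(1)] splitsD(1,2)[OF assms(2)]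
  have "eye r * v \<in> ops (r + s) d" "u * eye r \<in> ops d (r + s)"
    by (rule ops_mult[OF eye_ops_le(2) o(2)] ops_mult[OF o(1) eye_ops_le(1)]; simp)+
  moreover have "sh r * eye s * q \<in> ops (r + s) d" "p * (eye s * shb r) \<in> ops d (r + s)"
    by (rule ops_mult[OF sh_eye_ops o(4)] ops_mult[OF o(3) eye_shb_ops])+
  ultimately have f: "f \<in> ops (r + s) d" and g: "g \<in> ops d (r + s)"
    unfolding f_def g_def by (auto intro!: ops_add simp: d mult.assoc)
  have rf: "eye r * f = v"
    unfolding f_def by (simp add: distrib_left d eye_sh flip: mult.assoc)
  show ?thesis using f g fg gf rf by blast
qed

lemma splits_dim_add:
  assumes "splits e d r u v" "splits (eye d - e) d s p q"
  shows "r + s = d"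
  using splits_combine[OF assms] dim_eq by metis

subsection \<open>Matrices as operators\<close>

definition opm :: "'k::field mat => 'k lop" where
  "opm A = (\<Sum>i<dim_row A. \<Sum>j<dim_col A. scl (A $$ (i, j)) * un i j)"

definition matop :: "nat => nat => 'k::field lop => 'k mat" where
  "matop m n f = mat m n (%(i, j). ent f i j)"

lemma matop_carrier [simp]: "matop m n f \<in> carrier_mat m n"
  by (simp add: matop_def)
lemma matop_dim [simp]: "dim_row (matop m n f) = m" "dim_col (matop m n f) = n"
  by (simp_all add: matop_def)
lemma matop_index [simp]: "i < m ==> j < n ==> matop m n f $$ (i, j) = ent f i j"
  by (simp add: matop_def)

lemma opm_ops: "opm A \<in> ops (dim_row A) (dim_col A)"
  unfolding opm_def by (intro ops_sum ops_scl ops_un) auto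
lemma opm_ops' [intro]: "A \<in> carrier_mat m n ==> opm A \<in> ops m n"
  using opm_ops by auto

lemma ent_opm: "ent (opm A) i j = (if i < dim_row A & j < dim_col A then A $$ (i, j) else 0)"
proof -
  have "ent (opm A) i j =
    (\<Sum>i'<dim_row A. \<Sum>j'<dim_col A. if i = i' then if j = j' then A $$ (i', j') else 0 else 0)"
    unfolding opm_def ent_sum ent_scl ent_un by (intro sum.cong refl) auto
  also have "\<dots> = (\<Sum>i'<dim_row A. if i = i' then (\<Sum>j'<dim_col A. if j = j' then A $$ (i', j') else 0) else 0)"
    by (intro sum.cong refl) auto
  finally show ?thesis by auto
qed

lemma opm_inj: "A \<in> carrier_mat m n ==> B \<in> carrier_mat m n ==> opm A = opm B \<longleftrightarrow> A = B"
proof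
  assume "A \<in> carrier_mat m n" "B \<in> carrier_mat m n" "opm A = opm B"
  then have "A $$ (i, j) = B $$ (i, j)" if "i < m" "j < n" for i j
    using ent_opm[of A i j] ent_opm[of B i j] that by auto
  then show "A = B" using \<open>A \<in> _\<close> \<open>B \<in> _\<close> by auto
qed simp

lemma opm_matop: "f \<in> ops m n ==> opm (matop m n f) = f"
  by (rule ops_eqI[of _ m n]) (auto simp: ent_opm)

lemma matop_opm: "A \<in> carrier_mat m n ==> matop m n (opm A) = A"
  by (rule eq_matI) (auto simp: ent_opm)

lemma opm_mult: "dim_col A = dim_row B ==> opm (A * B) = opm A * opm B"
  by (rule ops_eqI[of _ "dim_row A" "dim_col B"])
    (use opm_ops[of "A * B"] in \<open>auto simp: ent_opm ent_mult[OF ops_r[OF opm_ops]] scalar_prod_def atLeast0LessThan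
      intro!: ops_mult[OF opm_ops] sum.cong, (metis opm_ops)?\<close>)

lemma opm_add: "A \<in> carrier_mat m n ==> B \<in> carrier_mat m n ==> opm (A + B) = opm A + opm B"
  by (rule ops_eqI[of _ m n]) (auto simp: ent_opm ent_add intro!: ops_add)

lemma opm_diff: "A \<in> carrier_mat m n ==> B \<in> carrier_mat m n ==> opm (A - B) = opm A - opm B"
  by (rule ops_eqI[of _ m n]) (auto simp: ent_opm ent_diff intro!: ops_diff opm_ops'[OF minus_carrier_mat])

lemma opm_one [simp]: "opm (1\<^sub>m d) = eye d"
  by (rule ops_eqI[of _ d d]) (auto simp: ent_opm ent_eye)

lemma opm_zero [simp]: "opm (0\<^sub>m m n) = 0"
  by (rule ops_eqI[of _ m n]) (auto simp: ent_opm)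

lemma matop_mult: "f \<in> ops m k ==> g \<in> ops k n ==> matop m n (f * g) = matop m k f * matop k n g"
  by (subst opm_inj[of _ m n, symmetric]) (auto simp: opm_matop opm_mult ops_mult)

lemma matop_eye: "matop d d (eye d) = 1\<^sub>m d"
  by (subst opm_inj[of _ d d, symmetric]) (auto simp: opm_matop)

section \<open>Transposition and kernel dimensions\<close>

text \<open>Operators on all sequences have no transpose in general, so it is formed from the
  leading \<open>m\<close> by \<open>n\<close> block.\<close>

definition trp :: "nat => nat => 'k::field lop => 'k lop" where
  "trp m n f = opm (transpose_mat (matop m n f))"

lemma trp_ops [simp]: "trp m n f \<in> ops n m"
  unfolding trp_def by (intro opm_ops') auto
lemma trp_mult: "f \<in> ops m k ==> g \<in> ops k n ==> trp m n (f * g) = trp k n g * trp m k f"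
  unfolding trp_def by (simp add: matop_mult opm_mult transpose_mult[OF matop_carrier matop_carrier])
lemma trp_eye [simp]: "trp d d (eye d) = eye d"
  by (simp add: trp_def matop_eye)
lemma trp_0 [simp]: "trp m n 0 = 0"
  by (rule ops_eqI[OF trp_ops ops_0]) (simp add: trp_def ent_opm)
lemma trp_add: "trp m n (f + g) = trp m n f + trp m n g"
  by (rule ops_eqI[OF trp_ops ops_add[OF trp_ops trp_ops]]) (simp add: trp_def ent_opm ent_add)
lemma trp_opm: "A \<in> carrier_mat m n ==> trp m n (opm A) = opm (transpose_mat A)"
  by (simp add: trp_def matop_opm)

text \<open>In coordinates adapted to \<open>eye d - e\<close> and \<open>e\<close>, the kernel of
  \<open>A\<close> becomes the kernel of a matrix in row echelon form with \<open>d - m\<close>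
  pivots. The operator \<open>B\<close> certifies that \<open>A\<close> kills nothing outside the
  image of \<open>e\<close>.\<close>

lemma kernel_dim_idempotent:
  fixes A :: "'k::field mat"
  assumes A: "A \<in> carrier_mat nr d" and sp: "splits e d m u v" and Ae: "opm A * e = 0"
    and B: "B \<in> ops d nr" "eye d - e = B * opm A"
  shows "kernel_dim A = m"
proof -
  note d = splitsD[OF sp]
  have id: "eye d - e \<in> ops d d" "(eye d - e) * (eye d - e) = eye d - e"
    using d by (auto intro!: ops_diff simp: algebra_simps)
  obtain s p q where sp': "splits (eye d - e) d s p q"
    using idempotent_splits[OF id] by blast
  note d' = splitsD[OF sp']
  have sp'': "splits (eye d - (eye d - e)) d m u v" using sp by simp
  obtain f g where fg: "f \<in> ops (s + m) d" "g \<in> ops d (s + m)" "f * g = eye (s + m)" "g * f = eye d"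
    "eye s * f = q"
    using splits_combine[OF sp' sp''] by blast
  have smd: "s + m = d" using splits_dim_add[OF sp' sp''] .
  define Q D F G where "Q = matop s d q" and "D = (matop s d (eye s) :: 'k mat)" and "F = matop d d f" and "G = matop d d g"
  have FG: "F * G = 1\<^sub>m d" "G * F = 1\<^sub>m d"
    using fg smd unfolding F_def G_def by (simp_all add: matop_eye flip: matop_mult)
  have esd: "(eye s :: 'k lop) \<in> ops s d" using smd by (intro eye_ops_le) simp
  \<comment> \<open>The rows of \<open>Q\<close> are the first \<open>s\<close> rows of the
    invertible \<open>F\<close>, so \<open>D\<close> is a truncated identity matrix and already in
    echelon form.\<close>
  have Q: "Q = D * F" unfolding Q_def D_def F_def using fg smd esd by (simp flip: matop_mult)
  have "opm A \<in> ops nr d" using A by auto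
  then have "opm A = (opm A * p) * q" using Ae d'(4)
    by (metis (no_types, lifting) diff_zero mult.assoc ops_r right_diff_distrib)
  then have "matop nr d (opm A) = matop nr s (opm A * p) * matop s d q"
    using matop_mult[OF ops_mult[OF \<open>opm A \<in> ops nr d\<close> d'(1)] d'(2)] by simp
  then have AQ: "A = matop nr s (opm A * p) * Q"
    using matop_opm[OF A] by (simp add: Q_def)
  have "q = q * B * opm A" using d'(24) B(2) by (simp add: mult.assoc)
  then have QA: "Q = matop s nr (q * B) * A"
    using A d' B(1) unfolding Q_def by (metis matop_mult matop_opm opm_ops' ops_mult)
  \<comment> \<open>Each of \<open>A\<close> and \<open>Q\<close> is a left multiple of the
    other.\<close>
  have ker: "mat_kernel A = mat_kernel Q"
  proof
    show "mat_kernel A \<subseteq> mat_kernel Q" by (subst QA, rule mat_kernel_mult_subset[OF A matop_carrier])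
    show "mat_kernel Q \<subseteq> mat_kernel A" 
      by (subst AQ, rule mat_kernel_mult_subset[of _ s d]) (auto simp: Q_def)
  qed
  have D: "D \<in> carrier_mat s d" by (simp add: D_def)
  have Dij: "D $$ (i, j) = (if i = j then 1 else 0)" if "i < s" "j < d" for i j
    using that by (simp add: D_def ent_eye)
  have "pivot_fun D id d"
    by (rule pivot_funI[OF carrier_matD(1)[OF D]]) (use Dij smd in auto)
  then have row: "row_echelon_form D" unfolding row_echelon_form_def using D by auto
  have "row D i \<noteq> 0\<^sub>v d" if "i < s" for i
  proof
    assume "row D i = 0\<^sub>v d"
    then have "row D i $ i = 0" using that smd by simp
    then show False using Dij[of i i] that smd D by simp
  qed
  then have "{i. i < s & row D i \<noteq> 0\<^sub>v d} = {0..<s}" by auto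
  then have c: "card {i. i < s & row D i \<noteq> 0\<^sub>v d} = s" by simp
  interpret D: kernel s d D by (unfold_locales, rule D)
  have "kernel.dim d D = m" using find_base_vectors[OF row D] c smd by simp
  moreover have "kernel.dim d (D * F) = kernel.dim d D"
    by (rule mat_kernel_dim_mult_eq_right[OF D _ _ FG(1)]) (auto simp: F_def G_def)
  moreover have "kernel_dim A = kernel.dim d A" using A by (simp add: kernel_dim_def)
  ultimately show ?thesis using ker Q by simp
qed

section \<open>Representations and morphisms as operators\<close>

lemma app_zero_fun: "app f (%_. 0) i = 0"
  using app_lin[of f "%_. 0" "-1" "%_. 0"] by simp

text \<open>Chosen preimages of the unit vectors are the columns of a right inverse.\<close>

lemma surj_mat_iff:
  assumes "A \<in> carrier_mat m n"
  shows "(\<forall>y\<in>carrier_vec m. \<exists>x\<in>carrier_vec n. A *\<^sub>v x = y) \<longleftrightarrow> (\<exists>s\<in>ops n m. opm A * s = eye m)"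
proof
  assume "\<forall>y\<in>carrier_vec m. \<exists>x\<in>carrier_vec n. A *\<^sub>v x = y"
  then obtain x where x: "\<And>y. y \<in> carrier_vec m ==> x y \<in> carrier_vec n & A *\<^sub>v x y = y"
    by metis
  define S where "S = mat n m (%(i, j). x (unit_vec m j) $ i)"
  have S: "S \<in> carrier_mat n m" by (simp add: S_def)
  have colS: "col S j = x (unit_vec m j)" if "j < m" for j
    using x[of "unit_vec m j"] that by (auto simp: S_def)
  have "A * S = 1\<^sub>m m"
  proof (rule mat_col_eqI)
    fix j assume "j < dim_col (1\<^sub>m m :: 'a mat)"
    then have j: "j < m" by simp
    have "A *\<^sub>v x (unit_vec m j) = unit_vec m j" using x[OF unit_vec_carrier] by (rule conjunct2)
    then have e: "col (A * S) j = unit_vec m j" by (simp only: col_mult2[OF assms S j] colS[OF j])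
    show "col (A * S) j = col (1\<^sub>m m) j" unfolding e by (simp add: j)
  qed (use assms S in auto)
  then show "\<exists>s\<in>ops n m. opm A * s = eye m"
    using S assms by (intro bexI[of _ "opm S"]) (auto simp flip: opm_mult)
next
  assume "\<exists>s\<in>ops n m. opm A * s = eye m"
  then obtain s where s: "s \<in> ops n m" "opm A * s = eye m" by blast
  have "A * matop n m s = 1\<^sub>m m"
    using s assms by (subst opm_inj[of _ m m, symmetric]) (auto simp: opm_mult opm_matop)
  then have "A *\<^sub>v (matop n m s *\<^sub>v y) = y" if "y \<in> carrier_vec m" for y
    using that assms by (subst assoc_mult_mat_vec[symmetric]) auto
  then show "\<forall>y\<in>carrier_vec m. \<exists>x\<in>carrier_vec n. A *\<^sub>v x = y"
    by (metis matop_carrier mult_mat_vec_carrier)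
qed

text \<open>For a rank factorisation \<open>u * v\<close> the columns of
  \<open>eye n - v' * v\<close> lie in the kernel; if the kernel is zero this operator vanishes, and
  \<open>v' * u'\<close> is a left inverse.\<close>

lemma inj_mat_iff:
  assumes "A \<in> carrier_mat m n"
  shows "(\<forall>x\<in>carrier_vec n. A *\<^sub>v x = 0\<^sub>v m --> x = 0\<^sub>v n) \<longleftrightarrow> (\<exists>s\<in>ops n m. s * opm A = eye n)"
proof
  assume inj: "\<forall>x\<in>carrier_vec n. A *\<^sub>v x = 0\<^sub>v m --> x = 0\<^sub>v n"
  have opA: "opm A \<in> ops m n" using assms by auto
  obtain r u v u' v' where uv: "u \<in> ops m r" "v \<in> ops r n" "u' \<in> ops r m" "v' \<in> ops n r"
    and eq: "u * v = opm A" "u' * u = eye r" "v * v' = eye r"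
    using rank_factorization[OF opA] by blast
  define e where "e = eye n - v' * v"
  have e: "e \<in> ops n n" unfolding e_def using uv by (intro ops_diff ops_mult) auto
  have "v * e = 0"
    unfolding e_def using uv eq by (simp add: right_diff_distrib ops_r ops_l flip: mult.assoc)
  then have "opm A * e = 0" by (simp add: mult.assoc flip: eq(1))
  then have Ae: "A * matop n n e = 0\<^sub>m m n"
    using e assms by (subst opm_inj[of _ m n, symmetric]) (auto simp: opm_mult opm_matop)
  have "col (matop n n e) j = 0\<^sub>v n" if "j < n" for j
  proof -
    have "A *\<^sub>v col (matop n n e) j = 0\<^sub>v m"
      using that col_mult2[OF assms matop_carrier that, of e] Ae by simp
    then show ?thesis using inj by (metis col_dim matop_dim(1) carrier_vec_dim_vec dim_col)
  qed
  then have "matop n n e = 0\<^sub>m n n" by (intro mat_col_eqI) auto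
  then have "e = 0" using e by (metis opm_matop opm_zero)
  then have "v' * (u' * opm A) = eye n"
    using uv eq by (simp add: e_def ops_l flip: eq(1)) (metis mult.assoc ops_l)
  then show "\<exists>s\<in>ops n m. s * opm A = eye n"
    using uv by (intro bexI[of _ "v' * u'"]) (auto simp: mult.assoc intro: ops_mult)
next
  assume "\<exists>s\<in>ops n m. s * opm A = eye n"
  then obtain s where s: "s \<in> ops n m" "s * opm A = eye n" by blast
  have SA: "matop n m s * A = 1\<^sub>m n"
    using s assms by (subst opm_inj[of _ n n, symmetric]) (auto simp: opm_mult opm_matop)
  show "\<forall>x\<in>carrier_vec n. A *\<^sub>v x = 0\<^sub>v m --> x = 0\<^sub>v n"
  proof (intro ballI impI)
    fix x :: "'a vec" assume x: "x \<in> carrier_vec n" "A *\<^sub>v x = 0\<^sub>v m"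
    have "x = (matop n m s * A) *\<^sub>v x" using SA x by simp
    also have "\<dots> = matop n m s *\<^sub>v (A *\<^sub>v x)" using x assms by (intro assoc_mult_mat_vec) auto
    finally show "x = 0\<^sub>v n" using x by (auto intro!: eq_vecI)
  qed
qed

definition aa :: "'k::field qrep => nat => 'k lop" where "aa X i = opm (arra X i)"
definition bb :: "'k::field qrep => nat => 'k lop" where "bb X i = opm (arrb X i)"

locale cyclic =
  fixes n :: nat
  assumes n_ge2: "2 \<le> n"
begin

lemma sc_if: "i < n ==> sc n i = (if Suc i = n then 0 else Suc i)"
  by (auto simp: sc_def)
lemma pr_if: "i < n ==> pr n i = (if i = 0 then n - 1 else i - 1)"
  using n_ge2 by (auto simp: pr_def) (metis One_nat_def Suc_pred add.commute add_diff_inverse_nat diff_Suc_1 less_Suc_eq less_imp_diff_less mod_add_self2 mod_less nat_neq_iff not_less0 Nat.add_diff_assoc2 Suc_leI neq0_conv)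
lemma sc_lt [simp]: "i < n ==> sc n i < n"
  using n_ge2 by (auto simp: sc_def)
lemma pr_lt [simp]: "i < n ==> pr n i < n"
  using n_ge2 by (auto simp: pr_def)
lemma sc_pr [simp]: "i < n ==> sc n (pr n i) = i"
  by (auto simp: pr_if sc_if)
lemma pr_sc [simp]: "i < n ==> pr n (sc n i) = i"
  by (auto simp: pr_if sc_if)

lemma aa_ops [simp, intro]: "is_rep n X ==> i < n ==> aa X i \<in> ops (dimv X (sc n i)) (dimv X i)"
  by (auto simp: is_rep_def aa_def)
lemma bb_ops [simp, intro]: "is_rep n X ==> i < n ==> bb X i \<in> ops (dimv X i) (dimv X (sc n i))"
  by (auto simp: is_rep_def bb_def)

lemma arra_carrier: "is_rep n X ==> i < n ==> arra X i \<in> carrier_mat (dimv X (sc n i)) (dimv X i)"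
  and arrb_carrier: "is_rep n X ==> i < n ==> arrb X i \<in> carrier_mat (dimv X i) (dimv X (sc n i))"
  by (auto simp: is_rep_def)

lemma preproj_iff:
  assumes "is_rep n X"
  shows "preproj n X \<longleftrightarrow> (\<forall>i<n. aa X (pr n i) * bb X (pr n i) = bb X i * aa X i)"
proof -
  have "arra X (pr n i) * arrb X (pr n i) = arrb X i * arra X i \<longleftrightarrow>
    aa X (pr n i) * bb X (pr n i) = bb X i * aa X i" if "i < n" for i
  proof -
    note c = arra_carrier[OF assms that] arrb_carrier[OF assms that]
      arra_carrier[OF assms pr_lt[OF that]] arrb_carrier[OF assms pr_lt[OF that]]
    have "arra X (pr n i) * arrb X (pr n i) \<in> carrier_mat (dimv X i) (dimv X i)"
      "arrb X i * arra X i \<in> carrier_mat (dimv X i) (dimv X i)"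
      using c that by auto
    then show ?thesis
      unfolding aa_def bb_def using c that
      by (subst opm_inj[symmetric]) (auto simp: opm_mult)
  qed
  then show ?thesis by (simp add: preproj_def)
qed

section \<open>Paths and nilpotency\<close>

fun pend :: "nat => bool list => nat" where
  "pend i [] = i"
| "pend i (True # w) = pend (sc n i) w"
| "pend i (False # w) = pend (pr n i) w"

fun pth :: "'k::field qrep => nat => bool list => 'k lop" where
  "pth X i [] = eye (dimv X i)"
| "pth X i (True # w) = pth X (sc n i) w * aa X i"
| "pth X i (False # w) = pth X (pr n i) w * bb X (pr n i)"

lemma pend_lt [simp]: "i < n ==> pend i w < n"
  by (induct i w rule: pend.induct) auto

lemma pathmat_pth:
  assumes "is_rep n X" "i < n"
  shows "pathmat n X i w \<in> carrier_mat (dimv X (pend i w)) (dimv X i) & opm (pathmat n X i w) = pth X i w"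
  using assms(2)
proof (induct i w rule: pend.induct)
  case (2 i w)
  then show ?case using arra_carrier[OF assms(1), of i] by (auto simp: opm_mult aa_def)
next
  case (3 i w)
  then show ?case using arrb_carrier[OF assms(1), of "pr n i"] by (auto simp: opm_mult bb_def)
qed auto

lemma is_zero_mat_iff: "is_zero_mat A \<longleftrightarrow> opm A = 0"
proof
  show "is_zero_mat A ==> opm A = 0"
    by (rule ops_eqI[OF opm_ops ops_0]) (auto simp: is_zero_mat_def ent_opm)
  show "opm A = 0 ==> is_zero_mat A"
    unfolding is_zero_mat_def by (metis ent_0 ent_opm)
qed

lemma nilp_iff:
  assumes "is_rep n X"
  shows "nilp n X \<longleftrightarrow> (\<exists>N. \<forall>i<n. \<forall>w. length w = N --> pth X i w = 0)"
  unfolding nilp_def is_zero_mat_iff using pathmat_pth[OF assms] by simp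

lemma pth_ops: "is_rep n X ==> i < n ==> pth X i w \<in> ops (dimv X (pend i w)) (dimv X i)"
  using pathmat_pth[of X i w] opm_ops'[of "pathmat n X i w"] by metis

lemma pth_append: "is_rep n X ==> i < n ==> pth X i (w @ w') = pth X (pend i w) w' * pth X i w"
proof (induct X i w rule: pth.induct)
  case (1 X i)
  then show ?case using ops_r[OF pth_ops[of X i w']] by simp
qed (auto simp: mult.assoc)

lemma pth_zero_mono:
  assumes "is_rep n X" "\<forall>i<n. \<forall>w. length w = N --> pth X i w = 0" "N \<le> length w" "i < n"
  shows "pth X i w = 0"
proof -
  have "pth X i (take N w @ drop N w) = 0"
    unfolding pth_append[OF assms(1,4)] using assms by simp
  then show ?thesis by simp
qed

text \<open>The weights grade the basis vectors, and every nonzero matrix entry of an arrow raises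
  the weight strictly; a path of length \<open>N\<close> would therefore leave the range below
  \<open>N\<close>.\<close>

lemma nilp_weight:
  assumes rep: "is_rep n X"
    and a: "\<And>i r c. i < n ==> ent (aa X i) r c \<noteq> 0 ==> wt (sc n i) r > (wt i c :: nat)"
    and b: "\<And>i r c. i < n ==> ent (bb X i) r c \<noteq> 0 ==> wt i r > wt (sc n i) c"
    and bd: "\<And>i r. i < n ==> r < dimv X i ==> wt i r < N"
  shows "nilp n X"
proof -
  have "i < n ==> ent (pth X i w) r c \<noteq> 0 ==> wt (pend i w) r \<ge> wt i c + length w" for i w r c
  proof (induct i w arbitrary: r c rule: pend.induct)
    case (1 i)
    then show ?case by (auto simp: ent_eye split: if_splits)
  next
    case (2 i w)
    have "ent (pth X i (True # w)) r c = (\<Sum>t<dimv X (sc n i). ent (pth X (sc n i) w) r t * ent (aa X i) t c)"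
      using ops_r[OF pth_ops[OF rep sc_lt[OF 2(2)]]] by (simp add: ent_mult)
    then obtain t where "ent (pth X (sc n i) w) r t \<noteq> 0" "ent (aa X i) t c \<noteq> 0"
      using 2(3) by (metis (no_types, lifting) mult_eq_0_iff sum.neutral)
    then show ?case using 2(1)[of r t] a[OF 2(2), of t c] 2(2) by simp
  next
    case (3 i w)
    have "ent (pth X i (False # w)) r c = (\<Sum>t<dimv X (pr n i). ent (pth X (pr n i) w) r t * ent (bb X (pr n i)) t c)"
      using ops_r[OF pth_ops[OF rep pr_lt[OF 3(2)]]] by (simp add: ent_mult)
    then obtain t where "ent (pth X (pr n i) w) r t \<noteq> 0" "ent (bb X (pr n i)) t c \<noteq> 0"
      using 3(3) by (metis (no_types, lifting) mult_eq_0_iff sum.neutral)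
    then show ?case using 3(1)[of r t] b[OF pr_lt[OF 3(2)], of t c] 3(2) by simp
  qed
  note w = this
  have "pth X i w = 0" if "i < n" "length w = N" for i w
  proof (rule ops_eqI[OF pth_ops[OF rep that(1)] ops_0])
    fix r c assume "r < dimv X (pend i w)" "c < dimv X i"
    then show "ent (pth X i w) r c = ent 0 r c"
      using w[OF that(1), of w r c] bd[of "pend i w" r] that by fastforce
  qed
  then show ?thesis unfolding nilp_iff[OF rep] by blast
qed

lemma flmodD:
  assumes "flmod n X"
  shows "is_rep n X" "i < n ==> aa X (pr n i) * bb X (pr n i) = bb X i * aa X i"
    "i < n ==> aa X i * bb X i = bb X (sc n i) * aa X (sc n i)"
    "\<exists>N. \<forall>i<n. \<forall>w. length w = N --> pth X i w = 0"
proof -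
  show r: "is_rep n X" using assms by (simp add: flmod_def)
  have p: "aa X (pr n i) * bb X (pr n i) = bb X i * aa X i" if "i < n" for i
    using assms that preproj_iff[OF r] by (simp add: flmod_def)
  show "i < n ==> aa X (pr n i) * bb X (pr n i) = bb X i * aa X i" by (rule p)
  show "i < n ==> aa X i * bb X i = bb X (sc n i) * aa X (sc n i)"
    using p[of "sc n i"] by simp
  show "\<exists>N. \<forall>i<n. \<forall>w. length w = N --> pth X i w = 0"
    using assms nilp_iff[OF r] by (simp add: flmod_def)
qed

subsection \<open>Morphisms\<close>

text \<open>Families vanish beyond the vertices, so that equality of morphisms is equality of
  functions and the pointwise sums and products of functions are available.\<close>

definition hom :: "'k::field qrep => 'k qrep => (nat => 'k lop) set" where
  "hom X Y = {f. (\<forall>i\<ge>n. f i = 0) & (\<forall>i<n. f i \<in> ops (dimv Y i) (dimv X i) &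
     f (sc n i) * aa X i = aa Y i * f i & f i * bb X i = bb Y i * f (sc n i))}"

definition fam :: "(nat => 'k::field mat) => nat => 'k lop" where
  "fam F i = (if i < n then opm (F i) else 0)"
definition unfam :: "'k::field qrep => 'k qrep => (nat => 'k lop) => nat => 'k mat" where
  "unfam X Y f i = matop (dimv Y i) (dimv X i) (f i)"
definition idn :: "'k::field qrep => nat => 'k lop" where
  "idn X i = (if i < n then eye (dimv X i) else 0)"

lemma homI:
  assumes "\<And>i. n \<le> i ==> f i = 0" "\<And>i. i < n ==> f i \<in> ops (dimv Y i) (dimv X i)"
    "\<And>i. i < n ==> f (sc n i) * aa X i = aa Y i * f i"
    "\<And>i. i < n ==> f i * bb X i = bb Y i * f (sc n i)"
  shows "f \<in> hom X Y"
  using assms by (simp add: hom_def)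

lemma homD:
  assumes "f \<in> hom X Y"
  shows "n \<le> i ==> f i = 0" "i < n ==> f i \<in> ops (dimv Y i) (dimv X i)"
    "i < n ==> f (sc n i) * aa X i = aa Y i * f i"
    "i < n ==> f i * bb X i = bb Y i * f (sc n i)"
  using assms by (simp_all add: hom_def)

lemma morphism_hom:
  assumes "is_rep n X" "is_rep n Y" "morphism n X Y F"
  shows "fam F \<in> hom X Y"
proof (rule homI)
  fix i assume i: "i < n"
  note c = arra_carrier[OF assms(1) i] arrb_carrier[OF assms(1) i]
    arra_carrier[OF assms(2) i] arrb_carrier[OF assms(2) i]
  have F: "F i \<in> carrier_mat (dimv Y i) (dimv X i)"
    "F (sc n i) \<in> carrier_mat (dimv Y (sc n i)) (dimv X (sc n i))"
    "F (sc n i) * arra X i = arra Y i * F i" "F i * arrb X i = arrb Y i * F (sc n i)"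
    using assms(3) i by (auto simp: morphism_def)
  show "fam F i \<in> ops (dimv Y i) (dimv X i)" using F i by (auto simp: fam_def)
  show "fam F (sc n i) * aa X i = aa Y i * fam F i"
    using F(1,2) c i arg_cong[OF F(3), of opm] by (simp add: fam_def aa_def opm_mult[of "F _"] opm_mult[of _ "F _"])
  show "fam F i * bb X i = bb Y i * fam F (sc n i)"
    using F(1,2) c i arg_cong[OF F(4), of opm] by (simp add: fam_def bb_def opm_mult[of "F _"] opm_mult[of _ "F _"])
qed (simp add: fam_def)

lemma fam_unfam: "f \<in> hom X Y ==> fam (unfam X Y f) = f"
  by (rule ext) (simp add: fam_def unfam_def homD opm_matop)

lemma unfam_morphism:
  assumes "is_rep n X" "is_rep n Y" "f \<in> hom X Y"
  shows "morphism n X Y (unfam X Y f)"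
  unfolding morphism_def
proof (intro allI impI conjI)
  fix i assume i: "i < n"
  note c = arra_carrier[OF assms(1) i] arrb_carrier[OF assms(1) i]
    arra_carrier[OF assms(2) i] arrb_carrier[OF assms(2) i]
  note h = homD[OF assms(3)]
  show "unfam X Y f i \<in> carrier_mat (dimv Y i) (dimv X i)" by (simp add: unfam_def)
  show "unfam X Y f (sc n i) * arra X i = arra Y i * unfam X Y f i"
    using c h(2)[OF i] h(2)[OF sc_lt[OF i]] h(3)[OF i]
    by (subst opm_inj[of _ "dimv Y (sc n i)" "dimv X i", symmetric])
      (auto simp: unfam_def opm_mult opm_matop aa_def)
  show "unfam X Y f i * arrb X i = arrb Y i * unfam X Y f (sc n i)"
    using c h(2)[OF i] h(2)[OF sc_lt[OF i]] h(4)[OF i]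
    by (subst opm_inj[of _ "dimv Y i" "dimv X (sc n i)", symmetric])
      (auto simp: unfam_def opm_mult opm_matop bb_def)
qed

lemma ex_morphism_iff:
  assumes "is_rep n X" "is_rep n Y"
  shows "(\<exists>F. morphism n X Y F & P (fam F)) \<longleftrightarrow> (\<exists>f\<in>hom X Y. P f)"
  using morphism_hom[OF assms] unfam_morphism[OF assms] fam_unfam by metis

lemma fam_eq_iff:
  assumes "\<And>i. i < n ==> F i \<in> carrier_mat (p i) (q i)" "\<And>i. i < n ==> G i \<in> carrier_mat (p i) (q i)"
  shows "(\<forall>i<n. F i = G i) \<longleftrightarrow> fam F = fam G"
  unfolding fun_eq_iff fam_def using opm_inj[OF assms] by auto

lemma fam_mult:
  assumes "\<And>i. i < n ==> F i \<in> carrier_mat (p i) (q i)" "\<And>i. i < n ==> G i \<in> carrier_mat (q i) (r i)"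
  shows "fam (%i. F i * G i) = fam F * fam G"
  using assms by (auto simp: fam_def fun_eq_iff) (metis carrier_matD opm_mult)

lemma fam_add:
  assumes "\<And>i. i < n ==> F i \<in> carrier_mat (p i) (q i)" "\<And>i. i < n ==> G i \<in> carrier_mat (p i) (q i)"
  shows "fam (%i. F i + G i) = fam F + fam G"
  using opm_add[OF assms] by (auto simp: fam_def fun_eq_iff)

lemma fam_diff:
  assumes "\<And>i. i < n ==> F i \<in> carrier_mat (p i) (q i)" "\<And>i. i < n ==> G i \<in> carrier_mat (p i) (q i)"
  shows "fam (%i. F i - G i) = fam F - fam G"
  using opm_diff[OF assms] by (auto simp: fam_def fun_eq_iff)

lemma fam_idm [simp]: "fam (idm X) = idn X"
  by (auto simp: fam_def idm_def idn_def)
lemma fam_zmor [simp]: "fam (zmor X Y) = 0"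
  by (auto simp: fam_def zmor_def)

lemma morphism_carrier: "morphism n X Y F ==> i < n ==> F i \<in> carrier_mat (dimv Y i) (dimv X i)"
  by (simp add: morphism_def)

lemma hom_0 [simp]: "0 \<in> hom X Y"
  by (rule homI) auto
lemma hom_add: "f \<in> hom X Y ==> g \<in> hom X Y ==> f + g \<in> hom X Y"
  by (rule homI) (simp_all add: homD[of f X Y] homD[of g X Y] ops_add algebra_simps)
lemma hom_diff: "f \<in> hom X Y ==> g \<in> hom X Y ==> f - g \<in> hom X Y"
  by (rule homI) (simp_all add: homD[of f X Y] homD[of g X Y] ops_diff algebra_simps)
lemma hom_minus: "f \<in> hom X Y ==> - f \<in> hom X Y"
  by (rule homI) (simp_all add: homD[of f X Y] ops_minus)
lemma hom_sum: "(\<And>a. a \<in> A ==> f a \<in> hom X Y) ==> sum f A \<in> hom X Y"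
  by (induct A rule: infinite_finite_induct) (auto intro: hom_add)
lemma hom_comp: 
  assumes "f \<in> hom Y Z" "g \<in> hom X Y" 
  shows "f * g \<in> hom X Z"
proof (rule homI)
  note f = homD[OF assms(1)] and g = homD[OF assms(2)]
  fix i assume i: "i < n"
  show "(f * g) i \<in> ops (dimv Z i) (dimv X i)" using f(2)[OF i] g(2)[OF i] by (auto intro: ops_mult)
  show "(f * g) (sc n i) * aa X i = aa Z i * (f * g) i"
    using f(3)[OF i] g(3)[OF i] by simp (metis mult.assoc)
  show "(f * g) i * bb X i = bb Z i * (f * g) (sc n i)"
    using f(4)[OF i] g(4)[OF i] by simp (metis mult.assoc)
qed (use homD[OF assms(1)] in auto)
lemma hom_idn [simp]: "is_rep n X ==> idn X \<in> hom X X"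
  by (rule homI) (auto simp: idn_def ops_l[OF aa_ops] ops_r[OF aa_ops] ops_l[OF bb_ops] ops_r[OF bb_ops])
lemma hom_id_l: "f \<in> hom X Y ==> idn Y * f = f"
  by (rule ext) (simp add: idn_def homD ops_l[OF homD(2)])
lemma hom_id_r: "f \<in> hom X Y ==> f * idn X = f"
  by (rule ext) (simp add: idn_def homD ops_r[OF homD(2)])
lemma hom_id_l': "f \<in> hom X Y ==> idn Y * (f * g) = f * g"
  by (simp add: hom_id_l flip: mult.assoc)
definition surjh :: "'k::field qrep => 'k qrep => (nat => 'k lop) => bool" where
  "surjh X Y f \<longleftrightarrow> f \<in> hom X Y & (\<forall>i<n. \<exists>s\<in>ops (dimv X i) (dimv Y i). f i * s = eye (dimv Y i))"
definition injh :: "'k::field qrep => 'k qrep => (nat => 'k lop) => bool" where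
  "injh X Y f \<longleftrightarrow> f \<in> hom X Y & (\<forall>i<n. \<exists>s\<in>ops (dimv X i) (dimv Y i). s * f i = eye (dimv X i))"

lemma surj_mor_surjh: "is_rep n X ==> is_rep n Y ==> surj_mor n X Y F ==> surjh X Y (fam F)"
  unfolding surj_mor_def surjh_def using morphism_hom surj_mat_iff[OF morphism_carrier]
  by (metis fam_def)
lemma inj_mor_injh: "is_rep n X ==> is_rep n Y ==> inj_mor n X Y F ==> injh X Y (fam F)"
  unfolding inj_mor_def injh_def using morphism_hom inj_mat_iff[OF morphism_carrier]
  by (metis fam_def)
lemma surjh_surj_mor:
  assumes "is_rep n X" "is_rep n Y" "surjh X Y f" shows "surj_mor n X Y (unfam X Y f)"
  unfolding surj_mor_def
proof (intro conjI allI impI)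
  have f: "f \<in> hom X Y" using assms by (simp add: surjh_def)
  show m: "morphism n X Y (unfam X Y f)" using unfam_morphism assms f by blast
  fix i assume i: "i < n"
  show "\<forall>y\<in>carrier_vec (dimv Y i). \<exists>x\<in>carrier_vec (dimv X i). unfam X Y f i *\<^sub>v x = y"
    using surj_mat_iff[OF morphism_carrier[OF m i]] assms(3) i homD(2)[OF f i]
    by (simp add: surjh_def unfam_def opm_matop)
qed
lemma injh_inj_mor:
  assumes "is_rep n X" "is_rep n Y" "injh X Y f" shows "inj_mor n X Y (unfam X Y f)"
  unfolding inj_mor_def
proof (intro conjI allI impI)
  have f: "f \<in> hom X Y" using assms by (simp add: injh_def)
  show m: "morphism n X Y (unfam X Y f)" using unfam_morphism assms f by blast
  fix i assume i: "i < n"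
  show "\<forall>x\<in>carrier_vec (dimv X i). unfam X Y f i *\<^sub>v x = 0\<^sub>v (dimv Y i) --> x = 0\<^sub>v (dimv X i)"
    using inj_mat_iff[OF morphism_carrier[OF m i]] assms(3) i homD(2)[OF f i]
    by (simp add: injh_def unfam_def opm_matop)
qed

lemma hom_pth:
  assumes "is_rep n X" "is_rep n Y" "f \<in> hom X Y" "i < n"
  shows "f (pend i w) * pth X i w = pth Y i w * f i"
  using assms(4)
proof (induct i w rule: pend.induct)
  case (1 i)
  then show ?case using ops_l[OF homD(2)[OF assms(3)]] ops_r[OF homD(2)[OF assms(3)]] by simp
next
  case (2 i w)
  then show ?case using homD(3)[OF assms(3), of i] by simp (metis mult.assoc)
next
  case (3 i w)
  then show ?case using homD(4)[OF assms(3), of "pr n i"] by simp (metis mult.assoc)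
qed

text \<open>A surjective morphism cancels on the right at each vertex, so the relations and the
  vanishing of long paths descend to its target.\<close>

lemma surjh_flmod:
  assumes "flmod n X" "is_rep n Y" "surjh X Y f"
  shows "flmod n Y"
proof -
  note X = flmodD[OF assms(1)]
  have f: "f \<in> hom X Y" using assms by (simp add: surjh_def)
  obtain s where s: "\<And>i. i < n ==> s i \<in> ops (dimv X i) (dimv Y i) & f i * s i = eye (dimv Y i)"
    using assms(3) unfolding surjh_def by metis
  have cancel: "g = h" if "i < n" "g * f i = h * f i" "g * eye (dimv Y i) = g" "h * eye (dimv Y i) = h" for i g h
    using s[OF that(1)] that by (metis mult.assoc)
  note r = ops_r[OF aa_ops[OF assms(2)]] ops_r[OF bb_ops[OF assms(2)]]
  have "aa Y (pr n i) * bb Y (pr n i) = bb Y i * aa Y i" if i: "i < n" for i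
  proof (rule cancel[OF i])
    have "aa Y (pr n i) * bb Y (pr n i) * f i = f i * (aa X (pr n i) * bb X (pr n i))"
      using homD(3)[OF f, of "pr n i"] homD(4)[OF f, of "pr n i"] i by (simp add: mult.assoc) (metis mult.assoc)
    also have "\<dots> = f i * (bb X i * aa X i)" using X(2)[OF i] by simp
    also have "\<dots> = bb Y i * aa Y i * f i"
      using homD(3)[OF f, of i] homD(4)[OF f, of i] i by (simp add: mult.assoc) (metis mult.assoc)
    finally show "aa Y (pr n i) * bb Y (pr n i) * f i = bb Y i * aa Y i * f i" .
    show "aa Y (pr n i) * bb Y (pr n i) * eye (dimv Y i) = aa Y (pr n i) * bb Y (pr n i)"
      using r(2)[OF pr_lt[OF i]] i by (simp add: mult.assoc)
    show "bb Y i * aa Y i * eye (dimv Y i) = bb Y i * aa Y i"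
      using r(1)[OF i] by (simp add: mult.assoc)
  qed
  moreover have "nilp n Y"
  proof -
    obtain N where N: "\<forall>i<n. \<forall>w. length w = N --> pth X i w = 0" using X(4) by blast
    have "pth Y i w = 0" if "i < n" "length w = N" for i w
    proof (rule cancel[OF that(1)])
      show "pth Y i w * f i = 0 * f i"
        using hom_pth[OF X(1) assms(2) f that(1), of w] N that by simp
      show "pth Y i w * eye (dimv Y i) = pth Y i w"
        using ops_r[OF pth_ops[OF assms(2) that(1)]] by simp
    qed simp
    then show ?thesis unfolding nilp_iff[OF assms(2)] by blast
  qed
  ultimately show ?thesis using assms(2) preproj_iff[OF assms(2)] by (simp add: flmod_def)
qed

text \<open>An injective morphism cancels on the left, so the relations are inherited by its
  source.\<close>

lemma injh_flmod:
  assumes "flmod n Y" "is_rep n X" "injh X Y f"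
  shows "flmod n X"
proof -
  note Y = flmodD[OF assms(1)]
  have f: "f \<in> hom X Y" using assms by (simp add: injh_def)
  obtain s where s: "\<And>i. i < n ==> s i \<in> ops (dimv X i) (dimv Y i) & s i * f i = eye (dimv X i)"
    using assms(3) unfolding injh_def by metis
  have cancel: "g = h" if "i < n" "f i * g = f i * h" "eye (dimv X i) * g = g" "eye (dimv X i) * h = h" for i g h
    using s[OF that(1)] that by (metis mult.assoc)
  note r = ops_l[OF aa_ops[OF assms(2)]] ops_l[OF bb_ops[OF assms(2)]]
  have "aa X (pr n i) * bb X (pr n i) = bb X i * aa X i" if i: "i < n" for i
  proof (rule cancel[OF i])
    have "f i * (aa X (pr n i) * bb X (pr n i)) = aa Y (pr n i) * bb Y (pr n i) * f i"
      using homD(3)[OF f, of "pr n i"] homD(4)[OF f, of "pr n i"] i by (simp add: mult.assoc) (metis mult.assoc)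
    also have "\<dots> = bb Y i * aa Y i * f i" using Y(2)[OF i] by simp
    also have "\<dots> = f i * (bb X i * aa X i)"
      using homD(3)[OF f, of i] homD(4)[OF f, of i] i by (simp add: mult.assoc) (metis mult.assoc)
    finally show "f i * (aa X (pr n i) * bb X (pr n i)) = f i * (bb X i * aa X i)" .
    show "eye (dimv X i) * (aa X (pr n i) * bb X (pr n i)) = aa X (pr n i) * bb X (pr n i)"
      using r(1)[OF pr_lt[OF i]] i by (simp flip: mult.assoc)
    show "eye (dimv X i) * (bb X i * aa X i) = bb X i * aa X i"
      using r(2)[OF i] by (simp flip: mult.assoc)
  qed
  moreover have "nilp n X"
  proof -
    obtain N where N: "\<forall>i<n. \<forall>w. length w = N --> pth Y i w = 0" using Y(4) by blast
    have "pth X i w = 0" if "i < n" "length w = N" for i w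
    proof (rule cancel[of "pend i w"])
      show "f (pend i w) * pth X i w = f (pend i w) * 0"
        using hom_pth[OF assms(2) Y(1) f that(1), of w] N that by simp
      show "eye (dimv X (pend i w)) * pth X i w = pth X i w"
        using ops_l[OF pth_ops[OF assms(2) that(1)]] by simp
    qed (use that in auto)
    then show ?thesis unfolding nilp_iff[OF assms(2)] by blast
  qed
  ultimately show ?thesis using assms(2) preproj_iff[OF assms(2)] by (simp add: flmod_def)
qed

section \<open>Quotients and subrepresentations cut out by idempotents\<close>

definition mkrep :: "(nat => nat) => (nat => 'k::field lop) => (nat => 'k lop) => 'k qrep" where
  "mkrep d a b = \<lparr>dimv = (%i. if i < n then d i else 0),
    arra = (%i. matop (d (sc n i)) (d i) (a i)), arrb = (%i. matop (d i) (d (sc n i)) (b i))\<rparr>"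

lemma mkrep_rep [simp]: "is_rep n (mkrep d a b)"
  by (simp add: is_rep_def mkrep_def)
lemma mkrep_dimv [simp]: "dimv (mkrep d a b) i = (if i < n then d i else 0)"
  by (simp add: mkrep_def)
lemma mkrep_aa: "a i \<in> ops (d (sc n i)) (d i) ==> aa (mkrep d a b) i = a i"
  by (simp add: mkrep_def aa_def opm_matop)
lemma mkrep_bb: "b i \<in> ops (d i) (d (sc n i)) ==> bb (mkrep d a b) i = b i"
  by (simp add: mkrep_def bb_def opm_matop)

text \<open>The two identities say that the kernels of the idempotents \<open>e i\<close> are stable
  under the arrows; the quotient by them is realised on the images.\<close>

lemma quotient_rep:
  assumes X: "flmod n X" and sp: "\<And>i. i < n ==> splits (e i) (dimv X i) (r i) (u i) (v i)"
    and a: "\<And>i. i < n ==> e (sc n i) * aa X i * e i = e (sc n i) * aa X i"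
    and b: "\<And>i. i < n ==> e i * bb X i * e (sc n i) = e i * bb X i"
  shows "\<exists>Y f. flmod n Y & surjh X Y f & (\<forall>i<n. dimv Y i = r i & f i = v i)"
proof -
  note rep = flmodD(1)[OF X]
  define Y where "Y = mkrep r (%i. v (sc n i) * aa X i * u i) (%i. v i * bb X i * u (sc n i))"
  have rY: "is_rep n Y" by (simp add: Y_def)
  have aY: "aa Y i = v (sc n i) * aa X i * u i" if "i < n" for i
    unfolding Y_def by (rule mkrep_aa) (use splitsD(1,2)[OF sp[OF that]] splitsD(1,2)[OF sp[OF sc_lt[OF that]]] aa_ops[OF rep that] in \<open>blast intro: ops_mult\<close>)
  have bY: "bb Y i = v i * bb X i * u (sc n i)" if "i < n" for i
    unfolding Y_def by (rule mkrep_bb) (use splitsD(1,2)[OF sp[OF that]] splitsD(1,2)[OF sp[OF sc_lt[OF that]]] bb_ops[OF rep that] in \<open>blast intro: ops_mult\<close>)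
  define f where "f i = (if i < n then v i else 0)" for i
  have "f \<in> hom X Y"
  proof (rule homI)
    fix i assume i: "i < n"
    note d = splitsD[OF sp[OF i]] splitsD[OF sp[OF sc_lt[OF i]]]
    show "f i \<in> ops (dimv Y i) (dimv X i)" using d(2) i by (simp add: f_def Y_def)
    show "f (sc n i) * aa X i = aa Y i * f i"
      using arg_cong[OF a[OF i], of "%t. v (sc n i) * t"] i by (simp add: f_def aY mult.assoc d)
    show "f i * bb X i = bb Y i * f (sc n i)"
      using arg_cong[OF b[OF i], of "%t. v i * t"] i by (simp add: f_def bY mult.assoc d)
  qed (simp add: f_def)
  then have "surjh X Y f"
    using splitsD(1,6)[OF sp] by (auto simp: surjh_def f_def Y_def intro!: bexI[of _ "u _"])
  then show ?thesis using surjh_flmod[OF X rY] by (auto simp: f_def Y_def intro!: exI[of _ Y] exI[of _ f])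
qed

text \<open>Here the two identities say that the images of the idempotents are stable under the
  arrows.\<close>

lemma sub_rep:
  assumes X: "flmod n X" and sp: "\<And>i. i < n ==> splits (e i) (dimv X i) (r i) (u i) (v i)"
    and a: "\<And>i. i < n ==> e (sc n i) * aa X i * e i = aa X i * e i"
    and b: "\<And>i. i < n ==> e i * bb X i * e (sc n i) = bb X i * e (sc n i)"
  shows "\<exists>Y f. flmod n Y & injh Y X f & (\<forall>i<n. dimv Y i = r i & f i = u i)"
proof -
  note rep = flmodD(1)[OF X]
  define Y where "Y = mkrep r (%i. v (sc n i) * aa X i * u i) (%i. v i * bb X i * u (sc n i))"
  have rY: "is_rep n Y" by (simp add: Y_def)
  have aY: "aa Y i = v (sc n i) * aa X i * u i" if "i < n" for i
    unfolding Y_def by (rule mkrep_aa) (use splitsD(1,2)[OF sp[OF that]] splitsD(1,2)[OF sp[OF sc_lt[OF that]]] aa_ops[OF rep that] in \<open>blast intro: ops_mult\<close>)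
  have bY: "bb Y i = v i * bb X i * u (sc n i)" if "i < n" for i
    unfolding Y_def by (rule mkrep_bb) (use splitsD(1,2)[OF sp[OF that]] splitsD(1,2)[OF sp[OF sc_lt[OF that]]] bb_ops[OF rep that] in \<open>blast intro: ops_mult\<close>)
  define f where "f i = (if i < n then u i else 0)" for i
  have "f \<in> hom Y X"
  proof (rule homI)
    fix i assume i: "i < n"
    note d = splitsD[OF sp[OF i]] splitsD[OF sp[OF sc_lt[OF i]]]
    show "f i \<in> ops (dimv X i) (dimv Y i)" using d(1) i by (simp add: f_def Y_def)
    show "f (sc n i) * aa Y i = aa X i * f i"
      using arg_cong[OF a[OF i], of "%t. t * u i"] i by (simp add: f_def aY mult.assoc d)
    show "f i * bb Y i = bb X i * f (sc n i)"
      using arg_cong[OF b[OF i], of "%t. t * u (sc n i)"] i by (simp add: f_def bY mult.assoc d)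
  qed (simp add: f_def)
  then have "injh Y X f"
    using splitsD(2,6)[OF sp] by (auto simp: injh_def f_def Y_def intro!: bexI[of _ "v _"])
  then show ?thesis using injh_flmod[OF X rY] by (auto simp: f_def Y_def intro!: exI[of _ Y] exI[of _ f])
qed

subsection \<open>Direct sums\<close>

definition in1 :: "'k::field qrep => 'k qrep => nat => 'k lop" where
  "in1 X Y i = (if i < n then eye (dimv X i) else 0)"
definition in2 :: "'k::field qrep => 'k qrep => nat => 'k lop" where
  "in2 X Y i = (if i < n then sh (dimv X i) * eye (dimv Y i) else 0)"
definition pj1 :: "'k::field qrep => 'k qrep => nat => 'k lop" where
  "pj1 X Y i = (if i < n then eye (dimv X i) else 0)"
definition pj2 :: "'k::field qrep => 'k qrep => nat => 'k lop" where
  "pj2 X Y i = (if i < n then eye (dimv Y i) * shb (dimv X i) else 0)"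

lemma opm_bdiag:
  "opm (bdiag A B) = opm A + sh (dim_row A) * opm B * shb (dim_col A)"
proof (rule ops_eqI)
  let ?B = "sh (dim_row A) * opm B * shb (dim_col A)"
  show "opm (bdiag A B) \<in> ops (dim_row A + dim_row B) (dim_col A + dim_col B)"
    by (rule opm_ops') (auto simp: bdiag_def)
  have entB: "ent ?B i j = (if dim_row A \<le> i & dim_col A \<le> j then ent (opm B) (i - dim_row A) (j - dim_col A) else 0)" for i j
  proof -
    have "(%t. if t + q = j then 1 else 0) = (%t. if q \<le> j & t = j - q then 1 else (0::'a))" for q
      by (auto simp: fun_eq_iff)
    then show ?thesis
      unfolding ent_def by (cases "dim_col A \<le> j")
        (simp_all add: times_lop.rep_eq sh.rep_eq shb.rep_eq app_zero_fun)
  qed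
  have "sh (dim_row A) * eye (dim_row B) * opm B * (eye (dim_col B) * shb (dim_col A)) \<in> ops (dim_row A + dim_row B) (dim_col A + dim_col B)"
    by (rule ops_mult[OF ops_mult[OF sh_eye_ops opm_ops] eye_shb_ops])
  then have "?B \<in> ops (dim_row A + dim_row B) (dim_col A + dim_col B)"
    using opm_ops[of B] by (simp add: mult.assoc ops_l' ops_r')
  moreover have "opm A \<in> ops (dim_row A + dim_row B) (dim_col A + dim_col B)"
  proof -
    have "eye (dim_row A) * opm A * eye (dim_col A) \<in> ops (dim_row A + dim_row B) (dim_col A + dim_col B)"
      by (rule ops_mult[OF ops_mult[OF eye_ops_le(2) opm_ops] eye_ops_le(1)]) auto
    then show ?thesis using opm_ops[of A] by (simp add: ops_l ops_r)
  qed
  ultimately show "opm A + ?B \<in> ops (dim_row A + dim_row B) (dim_col A + dim_col B)"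
    by (rule ops_add[rotated])
  show "ent (opm (bdiag A B)) i j = ent (opm A + ?B) i j"
    if "i < dim_row A + dim_row B" "j < dim_col A + dim_col B" for i j
    unfolding ent_add entB using that by (auto simp: ent_opm bdiag_def)
qed

end

declare One_nat_def [simp del]

lemma opm_stack:
  fixes A C :: "'k::field mat"
  assumes "dim_col C = dim_col A"
  shows "opm (four_block_mat A (0\<^sub>m (dim_row A) 0) C (0\<^sub>m (dim_row C) 0)) = opm A + sh (dim_row A) * opm C"
proof (rule ops_eqI)
  show "opm (four_block_mat A (0\<^sub>m (dim_row A) 0) C (0\<^sub>m (dim_row C) 0)) \<in> ops (dim_row A + dim_row C) (dim_col A)"
    using opm_ops[of "four_block_mat A (0\<^sub>m (dim_row A) 0) C (0\<^sub>m (dim_row C) 0)"] by simp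
  have e: "ent (sh (dim_row A) * opm C) i j = (if dim_row A \<le> i then ent (opm C) (i - dim_row A) j else 0)" for i j
    unfolding ent_def by (simp add: times_lop.rep_eq sh.rep_eq)
  have "sh (dim_row A) * eye (dim_row C) * opm C \<in> ops (dim_row A + dim_row C) (dim_col A)"
    using ops_mult[OF sh_eye_ops opm_ops, of "dim_row A" C] assms by simp
  then have 1: "sh (dim_row A) * opm C \<in> ops (dim_row A + dim_row C) (dim_col A)"
    using opm_ops[of C] by (simp add: mult.assoc ops_l)
  have "eye (dim_row A) * opm A \<in> ops (dim_row A + dim_row C) (dim_col A)"
    by (rule ops_mult[OF eye_ops_le(2) opm_ops]) simp
  then have 2: "opm A \<in> ops (dim_row A + dim_row C) (dim_col A)"
    using opm_ops[of A] by (simp add: ops_l)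
  show "opm A + sh (dim_row A) * opm C \<in> ops (dim_row A + dim_row C) (dim_col A)"
    using 1 2 by (rule ops_add[rotated])
  show "ent (opm (four_block_mat A (0\<^sub>m (dim_row A) 0) C (0\<^sub>m (dim_row C) 0))) i j
      = ent (opm A + sh (dim_row A) * opm C) i j" if "i < dim_row A + dim_row C" "j < dim_col A" for i j
    unfolding ent_add e using that assms by (auto simp: ent_opm)
qed

lemma ops_cols_eqI:
  assumes "f \<in> ops m k" "g \<in> ops m k" "\<And>c. c < k ==> f * un c 0 = g * un c 0"
  shows "f = g"
proof -
  have "h = (\<Sum>c<k. h * un c 0 * un 0 c)" if "h \<in> ops m k" for h :: "'a lop"
  proof -
    have "h = h * eye k" using that by (simp add: ops_r)
    also have "\<dots> = (\<Sum>c<k. h * un c 0 * un 0 c)"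
      by (simp add: eye_sum sum_distrib_left mult.assoc un_un)
    finally show ?thesis .
  qed
  then show ?thesis using assms by (metis (no_types, lifting) lessThan_iff sum.cong)
qed

lemma ops_col_expand: "x \<in> ops m 1 ==> x = (\<Sum>k<m. scl (ent x k 0) * un k 0)"
  using ops_expand[of x m 1] by (simp add: One_nat_def)

text \<open>Vectors are operators with a single column; preimages of the unit columns are placed
  side by side.\<close>

lemma right_inverse_of_elements:
  assumes "\<And>k. k < m ==> \<exists>y\<in>ops d 1. f * y = un k 0"
  shows "\<exists>s\<in>ops d m. f * s = eye m"
proof -
  obtain y where y: "\<And>k. k < m ==> y k \<in> ops d 1 & f * y k = un k 0"
    using assms by metis
  define s where "s = (\<Sum>k<m. y k * un 0 k)"
  have "s \<in> ops d m" unfolding s_def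
    using y by (intro ops_sum) (auto intro!: ops_mult[of _ d 1] ops_un)
  moreover have "f * s = eye m"
    unfolding s_def sum_distrib_left eye_sum
    by (intro sum.cong refl) (use y in \<open>simp add: un_un flip: mult.assoc\<close>)
  ultimately show ?thesis by blast
qed

context cyclic
begin

lemma rsum_dimv [simp]: "dimv (rsum X Y) i = dimv X i + dimv Y i"
  by (simp add: rsum_def)
lemma rsum_rep [simp]: "is_rep n X ==> is_rep n Y ==> is_rep n (rsum X Y)"
  by (auto simp: is_rep_def rsum_def bdiag_def)
lemma rsum_aa: "is_rep n X ==> i < n ==>
    aa (rsum X Y) i = aa X i + sh (dimv X (sc n i)) * aa Y i * shb (dimv X i)"
  using arra_carrier[of X i] by (simp add: aa_def rsum_def opm_bdiag)
lemma rsum_bb: "is_rep n X ==> i < n ==>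
    bb (rsum X Y) i = bb X i + sh (dimv X i) * bb Y i * shb (dimv X (sc n i))"
  using arrb_carrier[of X i] by (simp add: bb_def rsum_def opm_bdiag)

lemma sum_maps_hom:
  assumes X: "is_rep n X" and Y: "is_rep n Y"
  shows "in1 X Y \<in> hom X (rsum X Y)" "in2 X Y \<in> hom Y (rsum X Y)"
    "pj1 X Y \<in> hom (rsum X Y) X" "pj2 X Y \<in> hom (rsum X Y) Y"
proof -
  have o: "aa X i = eye (dimv X (sc n i)) * aa X i" "aa X i * eye (dimv X i) = aa X i"
    "bb X i = eye (dimv X i) * bb X i" "bb X i * eye (dimv X (sc n i)) = bb X i"
    "eye (dimv Y (sc n i)) * aa Y i = aa Y i" "aa Y i * eye (dimv Y i) = aa Y i"
    "eye (dimv Y i) * bb Y i = bb Y i" "bb Y i * eye (dimv Y (sc n i)) = bb Y i"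
    "eye (dimv Y (sc n i)) * (aa Y i * z) = aa Y i * z" "aa Y i * (eye (dimv Y i) * z) = aa Y i * z"
    "eye (dimv Y i) * (bb Y i * z) = bb Y i * z" "bb Y i * (eye (dimv Y (sc n i)) * z) = bb Y i * z"
    if "i < n" for i z
    using aa_ops[OF X that] bb_ops[OF X that] aa_ops[OF Y that] bb_ops[OF Y that]
    by (simp_all add: ops_l ops_r ops_l' ops_r')
  have s: "aa X i * sh (dimv X i) = 0" "bb X i * sh (dimv X (sc n i)) = 0"
    "shb (dimv X (sc n i)) * aa X i = 0" "shb (dimv X i) * bb X i = 0" if "i < n" for i
    by (metis o(2)[OF that] mult.assoc eye_sh mult_zero_right, metis o(4)[OF that] mult.assoc eye_sh mult_zero_right,
      metis o(1)[OF that] shb_eye' , metis o(3)[OF that] shb_eye')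
  have s': "aa X i * (sh (dimv X i) * z) = 0" "bb X i * (sh (dimv X (sc n i)) * z) = 0" if "i < n" for i z
    using s[OF that] by (simp_all flip: mult.assoc)
  have s'': "shb (dimv X (sc n i)) * (aa X i * z) = 0" "shb (dimv X i) * (bb X i * z) = 0" if "i < n" for i z
    using s[OF that] by (simp_all flip: mult.assoc)
  show "in1 X Y \<in> hom X (rsum X Y)"
  proof (rule homI)
    fix i assume i: "i < n"
    show "in1 X Y i \<in> ops (dimv (rsum X Y) i) (dimv X i)"
      using i by (simp add: in1_def eye_ops_le)
    show "in1 X Y (sc n i) * aa X i = aa (rsum X Y) i * in1 X Y i"
      using i o(1,2)[OF i] by (simp add: in1_def rsum_aa X distrib_right mult.assoc shb_eye)
    show "in1 X Y i * bb X i = bb (rsum X Y) i * in1 X Y (sc n i)"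
      using i o(3,4)[OF i] by (simp add: in1_def rsum_bb X distrib_right mult.assoc shb_eye)
  qed (simp add: in1_def)
  show "in2 X Y \<in> hom Y (rsum X Y)"
  proof (rule homI)
    fix i assume i: "i < n"
    show "in2 X Y i \<in> ops (dimv (rsum X Y) i) (dimv Y i)"
      using i by (simp add: in2_def sh_eye_ops)
    show "in2 X Y (sc n i) * aa Y i = aa (rsum X Y) i * in2 X Y i"
      using i by (simp add: in2_def rsum_aa X distrib_right mult.assoc o(5-)[OF i] s'[OF i])
    show "in2 X Y i * bb Y i = bb (rsum X Y) i * in2 X Y (sc n i)"
      using i by (simp add: in2_def rsum_bb X distrib_right mult.assoc o(5-)[OF i] s'[OF i])
  qed (simp add: in2_def)
  show "pj1 X Y \<in> hom (rsum X Y) X"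
  proof (rule homI)
    fix i assume i: "i < n"
    show "pj1 X Y i \<in> ops (dimv X i) (dimv (rsum X Y) i)"
      using i by (simp add: pj1_def eye_ops_le)
    show "pj1 X Y (sc n i) * aa (rsum X Y) i = aa X i * pj1 X Y i"
      using i o(1,2)[OF i] by (simp add: pj1_def rsum_aa X distrib_left mult.assoc eye_sh')
    show "pj1 X Y i * bb (rsum X Y) i = bb X i * pj1 X Y (sc n i)"
      using i o(3,4)[OF i] by (simp add: pj1_def rsum_bb X distrib_left mult.assoc eye_sh')
  qed (simp add: pj1_def)
  show "pj2 X Y \<in> hom (rsum X Y) Y"
  proof (rule homI)
    fix i assume i: "i < n"
    show "pj2 X Y i \<in> ops (dimv Y i) (dimv (rsum X Y) i)"
      using i by (simp add: pj2_def eye_shb_ops)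
    show "pj2 X Y (sc n i) * aa (rsum X Y) i = aa Y i * pj2 X Y i"
      using i by (simp add: pj2_def rsum_aa X distrib_left mult.assoc o(5-)[OF i] s[OF i])
    show "pj2 X Y i * bb (rsum X Y) i = bb Y i * pj2 X Y (sc n i)"
      using i by (simp add: pj2_def rsum_bb X distrib_left mult.assoc o(5-)[OF i] s[OF i])
  qed (simp add: pj2_def)
qed

lemma sum_maps:
  "pj1 X Y * in1 X Y = idn X" "pj2 X Y * in2 X Y = idn Y" "pj1 X Y * in2 X Y = 0" "pj2 X Y * in1 X Y = 0"
  "in1 X Y * pj1 X Y + in2 X Y * pj2 X Y = idn (rsum X Y)"
  unfolding fun_eq_iff
  by (auto simp: pj1_def in1_def pj2_def in2_def idn_def mult.assoc shb_eye eye_sh' sh_eye_shb')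

lemma sum_maps':
  "pj1 X Y * (in1 X Y * f) = idn X * f" "pj2 X Y * (in2 X Y * f) = idn Y * f"
  "pj1 X Y * (in2 X Y * f) = 0" "pj2 X Y * (in1 X Y * f) = 0"
  by (simp_all add: sum_maps flip: mult.assoc)

lemma idn_apply: "i < n ==> idn X i = eye (dimv X i)"
  by (simp add: idn_def)

lemma sum_maps_at:
  assumes "i < n"
  shows "pj1 X Y i * in1 X Y i = eye (dimv X i)" "pj2 X Y i * in2 X Y i = eye (dimv Y i)"
    "pj1 X Y i * in2 X Y i = 0" "pj2 X Y i * in1 X Y i = 0"
    "in1 X Y i * pj1 X Y i + in2 X Y i * pj2 X Y i = eye (dimv X i + dimv Y i)"
  using fun_cong[OF sum_maps(1)[of X Y], of i] fun_cong[OF sum_maps(2)[of X Y], of i]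
    fun_cong[OF sum_maps(3)[of X Y], of i] fun_cong[OF sum_maps(4)[of X Y], of i]
    fun_cong[OF sum_maps(5)[of X Y], of i] assms by (simp_all add: idn_apply)

lemma pmod_rep: "pmod n X ==> is_rep n X" and pmod_flmod: "pmod n X ==> flmod n X"
  and pmod_0: "pmod n X ==> dimv X 0 = 0"
  by (auto simp: pmod_def flmod_def)

text \<open>Relations and nilpotency are tested after composition with the two inclusions, which are
  jointly surjective and intertwine the paths.\<close>

lemma rsum_flmod:
  assumes "flmod n X" "flmod n Y"
  shows "flmod n (rsum X Y)"
proof -
  note X = flmodD[OF assms(1)] and Y = flmodD[OF assms(2)]
  note r = rsum_rep[OF X(1) Y(1)] and h = sum_maps_hom[OF X(1) Y(1)]
  let ?S = "rsum X Y"
  have dec: "z = w" if "z * in1 X Y i = w * in1 X Y i" "z * in2 X Y i = w * in2 X Y i"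
    "z * eye (dimv ?S i) = z" "w * eye (dimv ?S i) = w" "i < n" for z w i
    using that sum_maps_at(5)[OF that(5), of X Y] 
    by (metis (no_types, lifting) distrib_left mult.assoc rsum_dimv)
  have "aa ?S (pr n i) * bb ?S (pr n i) = bb ?S i * aa ?S i" if i: "i < n" for i
  proof (rule dec[OF _ _ _ _ i])
    note p = pr_lt[OF i]
    have "aa ?S (pr n i) * bb ?S (pr n i) * f i = f i * (aa Z (pr n i) * bb Z (pr n i))
      & bb ?S i * aa ?S i * f i = f i * (bb Z i * aa Z i)" if f: "f \<in> hom Z ?S" for f Z
      using homD(3)[OF f p] homD(4)[OF f p] homD(3)[OF f i] homD(4)[OF f i] i
      by (simp add: mult.assoc) (metis mult.assoc)
    from this[OF h(1)] this[OF h(2)] X(2)[OF i] Y(2)[OF i]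
    show "aa ?S (pr n i) * bb ?S (pr n i) * in1 X Y i = bb ?S i * aa ?S i * in1 X Y i"
      "aa ?S (pr n i) * bb ?S (pr n i) * in2 X Y i = bb ?S i * aa ?S i * in2 X Y i" by simp_all
    show "aa ?S (pr n i) * bb ?S (pr n i) * eye (dimv ?S i) = aa ?S (pr n i) * bb ?S (pr n i)"
      using ops_r[OF bb_ops[OF r p]] i by (simp add: mult.assoc)
    show "bb ?S i * aa ?S i * eye (dimv ?S i) = bb ?S i * aa ?S i"
      using ops_r[OF aa_ops[OF r i]] by (simp add: mult.assoc)
  qed
  moreover have "nilp n ?S"
  proof -
    obtain N1 where N1: "\<forall>i<n. \<forall>w. length w = N1 --> pth X i w = 0" using X(4) by blast
    obtain N2 where N2: "\<forall>i<n. \<forall>w. length w = N2 --> pth Y i w = 0" using Y(4) by blast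
    have "pth ?S i w = 0" if "i < n" "length w = N1 + N2" for i w
    proof (rule dec[OF _ _ _ _ that(1)])
      show "pth ?S i w * in1 X Y i = 0 * in1 X Y i" "pth ?S i w * in2 X Y i = 0 * in2 X Y i"
        using hom_pth[OF X(1) r h(1) that(1), of w] hom_pth[OF Y(1) r h(2) that(1), of w]
          pth_zero_mono[OF X(1) N1, of w i] pth_zero_mono[OF Y(1) N2, of w i] that by simp_all
      show "pth ?S i w * eye (dimv ?S i) = pth ?S i w"
        using ops_r[OF pth_ops[OF r that(1)]] by simp
    qed simp
    then show ?thesis unfolding nilp_iff[OF r] by blast
  qed
  ultimately show ?thesis using r preproj_iff[OF r] by (simp add: flmod_def)
qed

lemma rsum_pmod: "pmod n X ==> pmod n Y ==> pmod n (rsum X Y)"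
  by (simp add: pmod_def rsum_flmod)

section \<open>Free modules over the preprojective algebra\<close>

text \<open>A subrepresentation as a family of sets of vectors, without choice of bases. It is the
  form of invariant needed for inductions over the elements reached from given generators.\<close>

definition closed_family :: "'k::field qrep => (nat => 'k lop set) => bool" where
  "closed_family P N \<longleftrightarrow> (\<forall>i<n. 0 \<in> N i & (\<forall>x\<in>N i. \<forall>y\<in>N i. x + y \<in> N i) & (\<forall>x\<in>N i. \<forall>s. scl s * x \<in> N i)
     & (\<forall>x\<in>N i. aa P i * x \<in> N (sc n i)) & (\<forall>x\<in>N (sc n i). bb P i * x \<in> N i))"

lemma closed_familyI:
  assumes "\<And>i. i < n ==> 0 \<in> N i" "\<And>i x y. i < n ==> x \<in> N i ==> y \<in> N i ==> x + y \<in> N i"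
    "\<And>i x s. i < n ==> x \<in> N i ==> scl s * x \<in> N i"
    "\<And>i x. i < n ==> x \<in> N i ==> aa P i * x \<in> N (sc n i)"
    "\<And>i x. i < n ==> x \<in> N (sc n i) ==> bb P i * x \<in> N i"
  shows "closed_family P N"
  using assms by (simp add: closed_family_def)

lemma closed_familyD:
  assumes "closed_family P N" "i < n"
  shows "0 \<in> N i" "x \<in> N i ==> y \<in> N i ==> x + y \<in> N i" "x \<in> N i ==> scl s * x \<in> N i"
    "x \<in> N i ==> aa P i * x \<in> N (sc n i)" "x \<in> N (sc n i) ==> bb P i * x \<in> N i"
  using assms by (simp_all add: closed_family_def)

lemma closed_family_sum:
  "closed_family P N ==> i < n ==> (\<And>a. a \<in> A ==> f a \<in> N i) ==> sum f A \<in> N i"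
  by (induct A rule: infinite_finite_induct) (auto dest: closed_familyD)

lemma closed_family_pth:
  assumes "closed_family P N"
  shows "i < n ==> x \<in> ops (dimv P i) 1 ==> x \<in> N i ==> is_rep n P ==> pth P i w * x \<in> N (pend i w)"
proof (induct i w arbitrary: x rule: pend.induct)
  case (1 i)
  then show ?case by (simp add: ops_l)
next
  case (2 i w)
  then show ?case using closed_familyD(4)[OF assms, of i x] ops_mult[OF aa_ops[of P i]]
    by (simp add: mult.assoc)
next
  case (3 i w)
  then show ?case using closed_familyD(5)[OF assms, of "pr n i" x] ops_mult[OF bb_ops[of P "pr n i"]]
    by (simp add: mult.assoc)
qed

definition generated :: "'k::field qrep => 'i set => ('i => nat) => ('i => 'k lop) => bool" where
  "generated P I c g \<longleftrightarrow>
    (\<forall>N. closed_family P N & (\<forall>t\<in>I. g t \<in> N (c t)) --> (\<forall>i<n. ops (dimv P i) 1 \<subseteq> N i))"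

text \<open>The universal property of a direct sum of the modules P'(c t) with generators
  \<open>g t\<close>, tested on modules that vanish at vertex 0. A generator at vertex 0 is allowed
  and is then zero, which keeps later formulas uniform.\<close>

definition free :: "'k::field qrep => 'i set => ('i => nat) => ('i => 'k lop) => bool" where
  "free P I c g \<longleftrightarrow> pmod n P & (\<forall>t\<in>I. c t < n & g t \<in> ops (dimv P (c t)) 1) & generated P I c g &
    (\<forall>X x. pmod n X & (\<forall>t\<in>I. x t \<in> ops (dimv X (c t)) 1) --> (\<exists>f\<in>hom P X. \<forall>t\<in>I. f (c t) * g t = x t))"

lemma generatedD:
  assumes "generated P I c g" "closed_family P N" "\<And>t. t \<in> I ==> g t \<in> N (c t)" "i < n" "x \<in> ops (dimv P i) 1"
  shows "x \<in> N i"
  using assms unfolding generated_def by blast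

lemma freeD:
  assumes "free P I c g"
  shows "pmod n P" "is_rep n P" "t \<in> I ==> c t < n" "t \<in> I ==> g t \<in> ops (dimv P (c t)) 1"
    "generated P I c g"
    "pmod n X ==> (\<And>t. t \<in> I ==> x t \<in> ops (dimv X (c t)) 1) ==> \<exists>f\<in>hom P X. \<forall>t\<in>I. f (c t) * g t = x t"
  using assms by (auto simp: free_def pmod_rep)

text \<open>The vectors on which two morphisms agree form a subrepresentation.\<close>

lemma generated_hom_eq:
  assumes "is_rep n P" "generated P I c g" "is_rep n X" "f \<in> hom P X" "h \<in> hom P X"
    "\<And>t. t \<in> I ==> c t < n & g t \<in> ops (dimv P (c t)) 1"
    "\<And>t. t \<in> I ==> f (c t) * g t = h (c t) * g t"
  shows "f = h"
proof (rule ext)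
  fix i
  let ?N = "%i. {x \<in> ops (dimv P i) 1. f i * x = h i * x}"
  have cl: "closed_family P ?N"
  proof (rule closed_familyI)
    fix i x assume i: "i < n"
    show "x \<in> ?N i ==> aa P i * x \<in> ?N (sc n i)"
      using ops_mult[OF aa_ops[OF assms(1) i], of x 1] homD(3)[OF assms(4) i] homD(3)[OF assms(5) i]
      by (auto simp flip: mult.assoc) (auto simp: mult.assoc)
    show "x \<in> ?N (sc n i) ==> bb P i * x \<in> ?N i"
      using ops_mult[OF bb_ops[OF assms(1) i], of x 1] homD(4)[OF assms(4) i] homD(4)[OF assms(5) i]
      by (auto simp flip: mult.assoc) (auto simp: mult.assoc)
  qed (auto simp: ops_add ops_scl distrib_left scl_left_comm)
  show "f i = h i"
  proof (cases "i < n")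
    case True
    show ?thesis
    proof (rule ops_cols_eqI[OF homD(2)[OF assms(4) True] homD(2)[OF assms(5) True]])
      fix k assume "k < dimv P i"
      then have "un k 0 \<in> ?N i"
        by (intro generatedD[OF assms(2) cl _ True]) (auto simp: assms(6,7) intro: ops_un)
      then show "f i * un k 0 = h i * un k 0" by simp
    qed
  next
    case False
    then show ?thesis using homD(1)[OF assms(4)] homD(1)[OF assms(5)] by simp
  qed
qed

lemma free_hom_eq:
  assumes "free P I c g" "is_rep n X" "f \<in> hom P X" "h \<in> hom P X"
    "\<And>t. t \<in> I ==> f (c t) * g t = h (c t) * g t"
  shows "f = h"
  using generated_hom_eq[OF freeD(2,5)[OF assms(1)] assms(2-4)] freeD(3,4)[OF assms(1)] assms(5) by blast

text \<open>It suffices to lift the images of the generators, one vertex at a time.\<close>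

lemma free_lift:
  assumes F: "free P I c g" and M: "pmod n M" and N: "pmod n N" and s: "surjh M N p" and h: "h \<in> hom P N"
  shows "\<exists>l\<in>hom P M. p * l = h"
proof -
  have p: "p \<in> hom M N" using s by (simp add: surjh_def)
  have "\<exists>x\<in>ops (dimv M (c t)) 1. p (c t) * x = h (c t) * g t" if t: "t \<in> I" for t
  proof -
    note ct = freeD(3,4)[OF F t]
    obtain r where r: "r \<in> ops (dimv M (c t)) (dimv N (c t))" "p (c t) * r = eye (dimv N (c t))"
      using s ct by (auto simp: surjh_def)
    have "h (c t) * g t \<in> ops (dimv N (c t)) 1"
      using ops_mult[OF homD(2)[OF h ct(1)] ct(2)] .
    then show ?thesis using r by (intro bexI[of _ "r * (h (c t) * g t)"])
        (auto intro: ops_mult simp: ops_l simp flip: mult.assoc[of "p (c t)"])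
  qed
  then obtain x where x: "\<And>t. t \<in> I ==> x t \<in> ops (dimv M (c t)) 1 & p (c t) * x t = h (c t) * g t"
    by metis
  then obtain l where l: "l \<in> hom P M" "\<And>t. t \<in> I ==> l (c t) * g t = x t"
    using freeD(6)[OF F M, of x] by blast
  have "p * l = h"
    using x l by (intro free_hom_eq[OF F pmod_rep[OF N] hom_comp[OF p l(1)] h]) (simp add: mult.assoc)
  then show ?thesis using l by blast
qed

lemma projective_lift:
  assumes P: "projective n P" and M: "pmod n M" and N: "pmod n N" and s: "surjh M N p" and h: "h \<in> hom P N"
  shows "\<exists>l\<in>hom P M. p * l = h"
proof -
  note reps = pmod_rep[OF M] pmod_rep[OF N]
  have rP: "is_rep n P" using P by (simp add: projective_def pmod_rep)
  have p: "p \<in> hom M N" using s by (simp add: surjh_def)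
  obtain l where l: "morphism n P M l" "\<forall>i<n. unfam M N p i * l i = unfam P N h i"
    using P M N surjh_surj_mor[OF reps s] unfam_morphism[OF rP reps(2) h] unfolding projective_def by blast
  have "fam (%i. unfam M N p i * l i) = fam (unfam P N h)"
    using l(2) by (auto simp: fam_def fun_eq_iff)
  moreover have "fam (%i. unfam M N p i * l i) = fam (unfam M N p) * fam l"
    using morphism_carrier[OF l(1)] morphism_carrier[OF unfam_morphism[OF reps p]] by (rule fam_mult[rotated])
  ultimately have "p * fam l = h" using p h by (simp add: fam_unfam)
  then show ?thesis using morphism_hom[OF rP reps(1) l(1)] by blast
qed

lemma projectiveI:
  assumes P: "pmod n P"
    and lift: "\<And>M N p h. pmod n M ==> pmod n N ==> surjh M N p ==> h \<in> hom P N ==> \<exists>l\<in>hom P M. p * l = h"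
  shows "projective n P"
  unfolding projective_def
proof (intro conjI allI impI P)
  fix M N p h assume a: "pmod n M & pmod n N & surj_mor n M N p & morphism n P N h"
  then have M: "pmod n M" and N: "pmod n N" and s: "surj_mor n M N p" and h: "morphism n P N h" by auto
  note reps = pmod_rep[OF M] pmod_rep[OF N] pmod_rep[OF P]
  obtain l where l: "l \<in> hom P M" "fam p * l = fam h"
    using lift[OF M N surj_mor_surjh[OF reps(1,2) s] morphism_hom[OF reps(3,2) h]] by blast
  have m: "morphism n P M (unfam P M l)" by (rule unfam_morphism[OF reps(3,1) l(1)])
  have p: "morphism n M N p" using s by (simp add: surj_mor_def)
  note c = morphism_carrier[OF p] morphism_carrier[OF m]
  have "fam (%i. p i * unfam P M l i) = fam h"
    using l fam_mult[OF c] by (simp add: fam_unfam)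
  then have "\<forall>i<n. p i * unfam P M l i = h i"
    by (subst fam_eq_iff[OF mult_carrier_mat[OF c] morphism_carrier[OF h]])
  then show "\<exists>l. morphism n P M l & (\<forall>i<n. p i * l i = h i)" using m by blast
qed

lemma free_projective: "free P I c g ==> projective n P"
  using projectiveI free_lift freeD(1) by metis

lemma projective_pmod: "projective n P ==> pmod n P"
  by (simp add: projective_def)
lemma projective_rep: "projective n P ==> is_rep n P"
  by (simp add: projective_def pmod_rep)

lemma free_sum:
  fixes P Q :: "'k::field qrep"
  assumes P: "free P I c g" and Q: "free Q J c' g'"
  shows "free (rsum P Q) (I <+> J) (case_sum c c')
    (case_sum (%t. in1 P Q (c t) * g t) (%t. in2 P Q (c' t) * g' t))"
    (is "free _ _ ?c ?g")
  unfolding free_def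
proof (intro conjI allI impI ballI)
  note P' = freeD[OF P] and Q' = freeD[OF Q]
  note h = sum_maps_hom[OF P'(2) Q'(2)]
  show "pmod n (rsum P Q)" using P' Q' by (simp add: rsum_pmod)
  show "?c t < n" if "t \<in> I <+> J" for t using that P'(3) Q'(3) by auto
  show "?g t \<in> ops (dimv (rsum P Q) (?c t)) 1" if "t \<in> I <+> J" for t
    using that P'(3,4) Q'(3,4) ops_mult[OF homD(2)[OF h(1)]] ops_mult[OF homD(2)[OF h(2)]] by fastforce
  show "generated (rsum P Q) (I <+> J) ?c ?g"
    unfolding generated_def
  proof (intro allI impI subsetI)
    fix N :: "nat => 'k lop set" and i and x :: "'k lop" assume N: "closed_family (rsum P Q) N & (\<forall>t\<in>I <+> J. ?g t \<in> N (?c t))"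
      and i: "i < n" and x: "x \<in> ops (dimv (rsum P Q) i) 1"
    have *: "f i * y \<in> N i" if f: "f \<in> hom Z (rsum P Q)" and Z: "generated Z K cc gg"
      and gg: "\<And>t. t \<in> K ==> f (cc t) * gg t \<in> N (cc t)" and y: "y \<in> ops (dimv Z i) 1" for f Z K cc gg y
    proof -
      have "closed_family Z (%i. {y. f i * y \<in> N i})"
      proof (rule closed_familyI)
        fix i x assume i: "i < n"
        show "x \<in> {y. f i * y \<in> N i} ==> aa Z i * x \<in> {y. f (sc n i) * y \<in> N (sc n i)}"
          using closed_familyD(4)[OF conjunct1[OF N] i] homD(3)[OF f i] by (simp flip: mult.assoc) (simp add: mult.assoc)
        show "x \<in> {y. f (sc n i) * y \<in> N (sc n i)} ==> bb Z i * x \<in> {y. f i * y \<in> N i}"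
          using closed_familyD(5)[OF conjunct1[OF N] i] homD(4)[OF f i] by (simp flip: mult.assoc) (simp add: mult.assoc)
      qed (use closed_familyD[OF conjunct1[OF N]] in \<open>auto simp: distrib_left scl_left_comm\<close>)
      then show ?thesis using generatedD[OF Z _ _ i y, of "%i. {y. f i * y \<in> N i}"] gg by simp
    qed
    have "in1 P Q i * (pj1 P Q i * x) \<in> N i"
      using N ops_mult[OF homD(2)[OF h(3) i] x] by (intro *[OF h(1) P'(5)]) (auto dest!: bspec[of _ _ "Inl _"])
    moreover have "in2 P Q i * (pj2 P Q i * x) \<in> N i"
      using N ops_mult[OF homD(2)[OF h(4) i] x] by (intro *[OF h(2) Q'(5)]) (auto dest!: bspec[of _ _ "Inr _"])
    ultimately have "(in1 P Q i * pj1 P Q i + in2 P Q i * pj2 P Q i) * x \<in> N i"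
      using closed_familyD(2)[OF conjunct1[OF N] i] by (simp add: distrib_right mult.assoc)
    then show "x \<in> N i" using x i by (simp add: sum_maps_at ops_l)
  qed
  fix X :: "'k qrep" and x :: "_ => 'k lop" assume X: "pmod n X & (\<forall>t\<in>I <+> J. x t \<in> ops (dimv X (?c t)) 1)"
  obtain f1 where f1: "f1 \<in> hom P X" "\<And>t. t \<in> I ==> f1 (c t) * g t = x (Inl t)"
  proof -
    have "x (Inl t) \<in> ops (dimv X (c t)) 1" if "t \<in> I" for t
      using bspec[OF conjunct2[OF X], of "Inl t"] that by auto
    then show ?thesis using P'(6)[of X "%t. x (Inl t)"] X that by blast
  qed
  obtain f2 where f2: "f2 \<in> hom Q X" "\<And>t. t \<in> J ==> f2 (c' t) * g' t = x (Inr t)"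
  proof -
    have "x (Inr t) \<in> ops (dimv X (c' t)) 1" if "t \<in> J" for t
      using bspec[OF conjunct2[OF X], of "Inr t"] that by auto
    then show ?thesis using Q'(6)[of X "%t. x (Inr t)"] X that by blast
  qed
  have "(f1 * pj1 P Q + f2 * pj2 P Q) (?c t) * ?g t = x t" if "t \<in> I <+> J" for t
  proof -
    have z: "pj1 P Q i * (in2 P Q i * y) = 0" "pj2 P Q i * (in1 P Q i * y) = 0"
      "pj1 P Q i * (in1 P Q i * y) = eye (dimv P i) * y" "pj2 P Q i * (in2 P Q i * y) = eye (dimv Q i) * y"
      if "i < n" for i y
      using sum_maps_at[OF that, of P Q] by (simp_all flip: mult.assoc)
    show ?thesis using that P'(3,4) Q'(3,4) f1(2) f2(2)
      by (auto simp: distrib_right mult.assoc z ops_l[OF P'(4)] ops_l[OF Q'(4)])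
  qed
  then show "\<exists>f\<in>hom (rsum P Q) X. \<forall>t\<in>I <+> J. f (?c t) * ?g t = x t"
    using hom_add[OF hom_comp[OF f1(1) h(3)] hom_comp[OF f2(1) h(4)]] by blast
qed

lemma free_reindex:
  assumes P: "free P I c g" and h: "bij_betw h J I"
  shows "free P J (%t. c (h t)) (%t. g (h t))"
proof -
  have im: "h ` J = I" and inj: "inj_on h J" using h by (auto simp: bij_betw_def)
  have "\<exists>f\<in>hom P X. \<forall>t\<in>J. f (c (h t)) * g (h t) = x t"
    if "pmod n X" "\<forall>t\<in>J. x t \<in> ops (dimv X (c (h t))) 1" for X x
  proof -
    have "\<exists>f\<in>hom P X. \<forall>t\<in>I. f (c t) * g t = x (the_inv_into J h t)"
      using that im by (intro freeD(6)[OF P]) (auto simp: the_inv_into_f_f[OF inj])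
    then obtain f where f: "f \<in> hom P X" "\<forall>t\<in>I. f (c t) * g t = x (the_inv_into J h t)" by blast
    have "f (c (h t)) * g (h t) = x t" if "t \<in> J" for t
      using f(2) im that by (metis imageI inj the_inv_into_f_f)
    then show ?thesis using f(1) by blast
  qed
  moreover have "generated P J (%t. c (h t)) (%t. g (h t))"
    using freeD(5)[OF P] im unfolding generated_def by blast
  ultimately show ?thesis using freeD(1,3,4)[OF P] im unfolding free_def by blast
qed

lemma free_transport:
  fixes P Q :: "'k::field qrep"
  assumes P: "free P I c g" and f: "f \<in> hom P Q" and h: "h \<in> hom Q P"
    and inv: "h * f = idn P" "f * h = idn Q" and Q: "pmod n Q"
  shows "free Q I c (%t. f (c t) * g t)"
  unfolding free_def
proof (intro conjI allI impI ballI)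
  note P' = freeD[OF P] and rQ = pmod_rep[OF Q]
  have at: "h i * (f i * x) = eye (dimv P i) * x" "f i * (h i * x) = eye (dimv Q i) * x" if "i < n" for i x
    using fun_cong[OF inv(1), of i] fun_cong[OF inv(2), of i] that by (simp_all add: idn_apply flip: mult.assoc)
  show "pmod n Q" by fact
  show "c t < n" "f (c t) * g t \<in> ops (dimv Q (c t)) 1" if "t \<in> I" for t
    using that P' ops_mult[OF homD(2)[OF f]] by auto
  show "generated Q I c (%t. f (c t) * g t)"
    unfolding generated_def
  proof (intro allI impI subsetI)
    fix N :: "nat => 'k lop set" and i and x :: "'k lop" assume N: "closed_family Q N & (\<forall>t\<in>I. f (c t) * g t \<in> N (c t))"
      and i: "i < n" and x: "x \<in> ops (dimv Q i) 1"
    have "closed_family P (%i. {y. f i * y \<in> N i})"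
    proof (rule closed_familyI)
      fix i x assume i: "i < n"
      show "x \<in> {y. f i * y \<in> N i} ==> aa P i * x \<in> {y. f (sc n i) * y \<in> N (sc n i)}"
        using closed_familyD(4)[OF conjunct1[OF N] i] homD(3)[OF f i] by (simp flip: mult.assoc) (simp add: mult.assoc)
      show "x \<in> {y. f (sc n i) * y \<in> N (sc n i)} ==> bb P i * x \<in> {y. f i * y \<in> N i}"
        using closed_familyD(5)[OF conjunct1[OF N] i] homD(4)[OF f i] by (simp flip: mult.assoc) (simp add: mult.assoc)
    qed (use closed_familyD[OF conjunct1[OF N]] in \<open>auto simp: distrib_left scl_left_comm\<close>)
    then have "h i * x \<in> {y. f i * y \<in> N i}"
      using N by (intro generatedD[OF P'(5) _ _ i ops_mult[OF homD(2)[OF h i] x]]) auto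
    then show "x \<in> N i" using at[OF i] x by (simp add: ops_l)
  qed
  fix X :: "'k qrep" and x :: "_ => 'k lop" assume X: "pmod n X & (\<forall>t\<in>I. x t \<in> ops (dimv X (c t)) 1)"
  obtain l where l: "l \<in> hom P X" "\<And>t. t \<in> I ==> l (c t) * g t = x t"
    using P'(6)[of X x] X by blast
  have "(l * h) (c t) * (f (c t) * g t) = x t" if "t \<in> I" for t
    using that P'(3) l(2) by (simp add: mult.assoc at ops_l[OF P'(4)])
  then show "\<exists>l\<in>hom Q X. \<forall>t\<in>I. l (c t) * (f (c t) * g t) = x t"
    using hom_comp[OF l(1) h] by blast
qed

lemma free_iso:
  assumes P: "free P I c g" and Q: "free Q I c g'"
  shows "\<exists>f\<in>hom P Q. \<exists>h\<in>hom Q P. h * f = idn P & f * h = idn Q"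
proof -
  note P' = freeD[OF P] and Q' = freeD[OF Q]
  obtain f where f: "f \<in> hom P Q" "\<And>t. t \<in> I ==> f (c t) * g t = g' t"
    using P'(6)[OF Q'(1), of g'] Q'(4) by blast
  obtain h where h: "h \<in> hom Q P" "\<And>t. t \<in> I ==> h (c t) * g' t = g t"
    using Q'(6)[OF P'(1), of g] P'(4) by blast
  have "h * f = idn P"
    using f h P'(3,4) by (intro free_hom_eq[OF P P'(2) hom_comp[OF h(1) f(1)] hom_idn[OF P'(2)]])
      (simp add: mult.assoc idn_apply ops_l[OF P'(4)])
  moreover have "f * h = idn Q"
    using f h Q'(3,4) by (intro free_hom_eq[OF Q Q'(2) hom_comp[OF f(1) h(1)] hom_idn[OF Q'(2)]])
      (simp add: mult.assoc idn_apply ops_l[OF Q'(4)])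
  ultimately show ?thesis using f h by blast
qed

end

lemma sum_delta_mult: "finite A ==> a \<in> A ==> (\<Sum>t\<in>A. scl (if t = a then 1 else 0) * g t) = (g a :: 'k::field lop)"
proof -
  assume "finite A" "a \<in> A"
  then have "(\<Sum>t\<in>A. if a = t then g t else 0) = g a" by simp
  moreover have "(\<Sum>t\<in>A. scl (if t = a then 1 else 0) * g t) = (\<Sum>t\<in>A. if a = t then g t else 0)"
    by (intro sum.cong) auto
  ultimately show ?thesis by simp
qed

lemma gen_mult_zero: "x \<in> ops d 1 ==> d = 0 ==> x = 0"
  using ops_zero_dim by blast

context cyclic
begin

section \<open>Tops of modules and multiplicities of projectives\<close>

text \<open>\<open>u\<close> and \<open>v\<close> identify an \<open>m\<close>-dimensional
  complement of the radical at vertex \<open>i\<close>: \<open>v\<close> kills the images of the two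
  arrows ending there, and \<open>x\<close>, \<open>y\<close> certify that the rest of the space
  lies in the sum of these images.\<close>

definition is_top :: "'k::field qrep => nat => nat => 'k lop => 'k lop => 'k lop => 'k lop => bool" where
  "is_top P i m u v x y \<longleftrightarrow> u \<in> ops (dimv P i) m & v \<in> ops m (dimv P i) & v * u = eye m &
    x \<in> ops (dimv P (pr n i)) (dimv P i) & y \<in> ops (dimv P (sc n i)) (dimv P i) &
    u * v + (aa P (pr n i) * x + bb P i * y) = eye (dimv P i) &
    v * aa P (pr n i) = 0 & v * bb P i = 0"

lemma pr_ops:
  assumes "is_rep n P" "i < n"
  shows "aa P (pr n i) \<in> ops (dimv P i) (dimv P (pr n i))" "bb P (pr n i) \<in> ops (dimv P (pr n i)) (dimv P i)"
  using aa_ops[OF assms(1), of "pr n i"] bb_ops[OF assms(1), of "pr n i"] assms(2) by auto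

text \<open>With a generalized inverse \<open>g\<close> of the joint map of the incoming arrows,
  \<open>rho * g\<close> projects onto the radical at \<open>i\<close>; splitting the complementary
  idempotent gives the top.\<close>

lemma top_exists:
  assumes P: "is_rep n P" and i: "i < n"
  shows "\<exists>m u v x y. is_top P i m u v x y"
proof -
  let ?d = "dimv P i" and ?p = "dimv P (pr n i)" and ?s = "dimv P (sc n i)"
  let ?a = "aa P (pr n i)" and ?b = "bb P i"
  have a: "?a \<in> ops ?d ?p" and b: "?b \<in> ops ?d ?s" using pr_ops[OF P i] bb_ops[OF P i] by auto
  \<comment> \<open>The two incoming arrows placed side by side: the first block of columns is
    \<open>?a\<close>, the second, shifted by \<open>?p\<close>, is \<open>?b\<close>.\<close>
  define rho where "rho = ?a + ?b * shb ?p"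
  have "?b * (eye ?s * shb ?p) \<in> ops ?d (?p + ?s)" by (rule ops_mult[OF b eye_shb_ops])
  moreover have "?a * eye ?p \<in> ops ?d (?p + ?s)" by (rule ops_mult[OF a eye_ops_le(1)]) simp
  ultimately have rho: "rho \<in> ops ?d (?p + ?s)"
    unfolding rho_def using a b by (intro ops_add) (simp_all add: ops_r[OF a] ops_r'[OF b])
  obtain g where g: "g \<in> ops (?p + ?s) ?d" "rho * g * rho = rho"
    using generalized_inverse[OF rho] by blast
  have e: "eye ?d - rho * g \<in> ops ?d ?d" using rho g by (intro ops_diff ops_mult) auto
  have idem: "(eye ?d - rho * g) * (eye ?d - rho * g) = eye ?d - rho * g"
    using g rho by (simp add: algebra_simps ops_l'[OF rho] ops_r[OF g(1)]) (simp flip: mult.assoc)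
  obtain m u v where sp: "splits (eye ?d - rho * g) ?d m u v"
    using idempotent_splits[OF e idem] by blast
  note d = splitsD[OF sp]
  have er: "(eye ?d - rho * g) * rho = 0"
    using g rho by (simp add: left_diff_distrib ops_l[OF rho])
  have vr: "v * rho = 0" using er d(24) by (metis mult.assoc mult_zero_right)
  have ra: "rho * eye ?p = ?a"
    by (simp add: rho_def distrib_right ops_r[OF a] mult.assoc shb_eye)
  have "?a * sh ?p = ?a * (eye ?p * sh ?p)" using ops_r'[OF a] by simp
  then have as: "?a * sh ?p = 0" by (simp add: eye_sh)
  have rb: "rho * sh ?p = ?b"
    by (simp add: rho_def distrib_right mult.assoc as)
  have va: "v * ?a = 0" using vr ra by (metis mult.assoc mult_zero_left)
  have vb: "v * ?b = 0" using vr rb by (metis mult.assoc mult_zero_left)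
  have rg: "rho * g = ?a * (eye ?p * g) + ?b * (eye ?s * shb ?p * g)"
    by (simp add: rho_def distrib_right mult.assoc ops_r'[OF a] ops_r'[OF b])
  have x: "eye ?p * g \<in> ops ?p ?d"
    by (rule ops_mult[OF eye_ops_le(1) g(1)]) simp
  have y: "eye ?s * shb ?p * g \<in> ops ?s ?d"
    by (rule ops_mult[OF eye_shb_ops g(1)])
  have "is_top P i m u v (eye ?p * g) (eye ?s * shb ?p * g)"
    unfolding is_top_def using d(1,2,4,6) x y va vb rg by (simp add: algebra_simps)
  then show ?thesis by blast
qed

text \<open>\<open>homS_dim\<close> is the dimension of the kernel of the stacked transposed arrows.
  Transposing the decomposition of the identity exhibits the transpose of \<open>u * v\<close> as a
  projection onto that kernel.\<close>

lemma homS_dim_top: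
  assumes P: "is_rep n P" and i: "i < n" and top: "is_top P i m u v x y"
  shows "homS_dim n P i = m"
proof -
  let ?d = "dimv P i" and ?p = "dimv P (pr n i)" and ?s = "dimv P (sc n i)"
  let ?A = "arra P (pr n i)" and ?B = "arrb P i"
  have uv: "u \<in> ops ?d m" "v \<in> ops m ?d" "v * u = eye m" "x \<in> ops ?p ?d" "y \<in> ops ?s ?d"
    and eq: "u * v + (aa P (pr n i) * x + bb P i * y) = eye ?d" and z: "v * aa P (pr n i) = 0" "v * bb P i = 0"
    using top by (auto simp: is_top_def)
  have a: "aa P (pr n i) \<in> ops ?d ?p" and b: "bb P i \<in> ops ?d ?s" using pr_ops[OF P i] bb_ops[OF P i] by auto
  have cA: "?A \<in> carrier_mat ?d ?p" using arra_carrier[OF P pr_lt[OF i]] i by simp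
  have cB: "?B \<in> carrier_mat ?d ?s" using arrb_carrier[OF P i] .
  define S where "S = four_block_mat (transpose_mat ?A) (0\<^sub>m (dim_col ?A) 0) (transpose_mat ?B) (0\<^sub>m (dim_col ?B) 0)"
  define ta tb where "ta = trp ?d ?p (aa P (pr n i))" and "tb = trp ?d ?s (bb P i)"
  have t: "ta \<in> ops ?p ?d" "tb \<in> ops ?s ?d" by (simp_all add: ta_def tb_def)
  have opS: "opm S = ta + sh ?p * tb"
    using opm_stack[of "transpose_mat ?B" "transpose_mat ?A"] cA cB
    by (simp add: S_def ta_def tb_def aa_def bb_def trp_opm)
  have cS: "S \<in> carrier_mat (?p + ?s) ?d"
    unfolding S_def using cA cB by (auto intro!: carrier_matI)
  have sp: "splits (trp ?d ?d (u * v)) ?d m (trp m ?d v) (trp ?d m u)"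
    unfolding splits_def using uv by (simp flip: trp_mult)
  have tv: "ta * trp m ?d v = 0" "tb * trp m ?d v = 0"
    using uv a b z by (simp_all add: ta_def tb_def flip: trp_mult)
  have tv': "ta * (trp m ?d v * q) = 0" "tb * (trp m ?d v * q) = 0" for q
    by (simp_all add: tv flip: mult.assoc)
  have "opm S * trp ?d ?d (u * v) = 0"
    by (simp add: opS trp_mult[OF uv(1,2)] distrib_right mult.assoc tv')
  moreover have "eye ?d - trp ?d ?d (u * v) = (trp ?p ?d x * eye ?p + trp ?s ?d y * (eye ?s * shb ?p)) * opm S"
  proof -
    have "trp ?d ?d (u * v) + (trp ?p ?d x * ta + trp ?s ?d y * tb) = eye ?d"
      using arg_cong[OF eq, of "trp ?d ?d"] uv a b
      by (simp add: trp_add trp_mult[OF a] trp_mult[OF b] ta_def tb_def)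
    moreover have "shb ?p * ta = 0" using shb_eye'[of ?p ta] by (simp add: ops_l[OF t(1)])
    ultimately show ?thesis
      by (simp add: opS algebra_simps ops_l[OF t(1)] ops_l[OF t(2)] eye_sh' shb_eye')
  qed
  moreover have "trp ?p ?d x * eye ?p + trp ?s ?d y * (eye ?s * shb ?p) \<in> ops ?d (?p + ?s)"
    by (intro ops_add ops_mult[OF trp_ops eye_ops_le(1)] ops_mult[OF trp_ops eye_shb_ops]) simp
  ultimately have "kernel_dim S = m"
    by (intro kernel_dim_idempotent[OF cS sp])
  then show ?thesis by (simp add: homS_dim_def S_def)
qed

text \<open>Generators span modulo the radical: the vectors of the stated form are stable under the
  arrows, because anything in the image of an arrow has this form with zero coefficients.\<close>

lemma generated_span:
  assumes P: "is_rep n P" and gen: "generated P I c g" and fin: "finite I"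
    and g: "\<And>t. t \<in> I ==> c t < n & g t \<in> ops (dimv P (c t)) 1" and i: "i < n" and y: "y \<in> ops (dimv P i) 1"
  shows "\<exists>l x z. y = (\<Sum>t\<in>{t\<in>I. c t = i}. scl (l t) * g t) + (aa P (pr n i) * x + bb P i * z) &
    x \<in> ops (dimv P (pr n i)) 1 & z \<in> ops (dimv P (sc n i)) 1"
proof -
  define R where "R i y \<longleftrightarrow> (\<exists>l x z. y = (\<Sum>t\<in>{t\<in>I. c t = i}. scl (l t) * g t) + (aa P (pr n i) * x + bb P i * z) &
    x \<in> ops (dimv P (pr n i)) 1 & z \<in> ops (dimv P (sc n i)) 1)" for i y
  have RI: "R k w" if "w = (\<Sum>t\<in>{t\<in>I. c t = k}. scl (l t) * g t) + (aa P (pr n k) * p + bb P k * q)"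
    "p \<in> ops (dimv P (pr n k)) 1" "q \<in> ops (dimv P (sc n k)) 1" for k w l p q
    using that unfolding R_def by blast
  let ?N = "%i. {y\<in>ops (dimv P i) 1. R i y}"
  have "y \<in> ?N i"
  proof (rule generatedD[OF gen _ _ i y])
    show "closed_family P ?N"
    proof (rule closed_familyI)
      fix i assume i: "i < n"
      have "0 = (\<Sum>t\<in>{t\<in>I. c t = i}. scl 0 * g t) + (aa P (pr n i) * 0 + bb P i * 0)" by simp
      from RI[OF this] show "0 \<in> ?N i" by simp
      show "y + y' \<in> ?N i" if y: "y \<in> ?N i" and y': "y' \<in> ?N i" for y y'
      proof -
        obtain l x z where 1: "y = (\<Sum>t\<in>{t\<in>I. c t = i}. scl (l t) * g t) + (aa P (pr n i) * x + bb P i * z)"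
          "x \<in> ops (dimv P (pr n i)) 1" "z \<in> ops (dimv P (sc n i)) 1" using y unfolding R_def by blast
        obtain l' x' z' where 2: "y' = (\<Sum>t\<in>{t\<in>I. c t = i}. scl (l' t) * g t) + (aa P (pr n i) * x' + bb P i * z')"
          "x' \<in> ops (dimv P (pr n i)) 1" "z' \<in> ops (dimv P (sc n i)) 1" using y' unfolding R_def by blast
        have "y + y' = (\<Sum>t\<in>{t\<in>I. c t = i}. scl (l t + l' t) * g t) + (aa P (pr n i) * (x + x') + bb P i * (z + z'))"
          unfolding 1 2 by (simp add: scl_add distrib_right sum.distrib distrib_left)
        from RI[OF this ops_add[OF 1(2) 2(2)] ops_add[OF 1(3) 2(3)]] show ?thesis
          using y y' by (simp add: ops_add)
      qed
      show "scl s * y \<in> ?N i" if y: "y \<in> ?N i" for s y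
      proof -
        obtain l x z where 1: "y = (\<Sum>t\<in>{t\<in>I. c t = i}. scl (l t) * g t) + (aa P (pr n i) * x + bb P i * z)"
          "x \<in> ops (dimv P (pr n i)) 1" "z \<in> ops (dimv P (sc n i)) 1" using y unfolding R_def by blast
        have "scl s * y = (\<Sum>t\<in>{t\<in>I. c t = i}. scl (s * l t) * g t) + (aa P (pr n i) * (scl s * x) + bb P i * (scl s * z))"
          unfolding 1 scl_left_comm[of "aa P _"] scl_left_comm[of "bb P _"]
          by (simp add: scl_mult' sum_distrib_left distrib_left)
        from RI[OF this ops_scl[OF 1(2)] ops_scl[OF 1(3)]] show ?thesis
          using y by (simp add: ops_scl)
      qed
      show "aa P i * y \<in> ?N (sc n i)" if y: "y \<in> ?N i" for y
      proof -
        have "aa P i * y = (\<Sum>t\<in>{t\<in>I. c t = sc n i}. scl 0 * g t) + (aa P (pr n (sc n i)) * y + bb P (sc n i) * 0)"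
          using i by simp
        from RI[OF this] show ?thesis using y i ops_mult[OF aa_ops[OF P i], of y 1] by simp
      qed
      show "bb P i * y \<in> ?N i" if y: "y \<in> ?N (sc n i)" for y
      proof -
        have "bb P i * y = (\<Sum>t\<in>{t\<in>I. c t = i}. scl 0 * g t) + (aa P (pr n i) * 0 + bb P i * y)"
          by simp
        from RI[OF this] show ?thesis using y i ops_mult[OF bb_ops[OF P i], of y 1] by simp
      qed
    qed
    fix t assume t: "t \<in> I"
    have "g t = (\<Sum>s\<in>{s\<in>I. c s = c t}. scl (if s = t then 1 else 0) * g s)"
      using sum_delta_mult[of "{s\<in>I. c s = c t}" t g] t fin by simp
    then have "g t = (\<Sum>s\<in>{s\<in>I. c s = c t}. scl (if s = t then 1 else 0) * g s) + (aa P (pr n (c t)) * 0 + bb P (c t) * 0)"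
      by simp
    from RI[OF this] show "g t \<in> ?N (c t)" using g[OF t] by simp
  qed
  then show ?thesis unfolding R_def by blast
qed

lemma aa_mkrep0 [simp]: "aa (mkrep d (%_. 0) b) i = 0" and bb_mkrep0 [simp]: "bb (mkrep d a (%_. 0)) i = 0"
  by (simp_all add: mkrep_aa mkrep_bb)

lemma semisimple_flmod: "flmod n (mkrep d (%_. 0) (%_. 0) :: 'k::field qrep)"
proof -
  let ?X = "mkrep d (%_. 0) (%_. 0) :: 'k qrep"
  have "nilp n ?X" by (rule nilp_weight[of ?X "%_ _. 0" 1]) auto
  then show ?thesis using preproj_iff[of ?X] by (simp add: flmod_def)
qed

text \<open>The generators at \<open>i\<close> form a basis of the top at \<open>i\<close>: they
  span it because they generate \<open>P\<close>, and they are independent because the universal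
  property maps them to a basis of a semisimple module.\<close>

lemma homS_dim_free:
  fixes P :: "'k::field qrep"
  assumes F: "free P I c g" and fin: "finite I" and i: "1 \<le> i" "i < n"
  shows "homS_dim n P i = card {t\<in>I. c t = i}"
proof -
  note P = freeD[OF F]
  obtain m u v x y where top: "is_top P i m u v x y" using top_exists[OF P(2) i(2)] by blast
  have uv: "u \<in> ops (dimv P i) m" "v \<in> ops m (dimv P i)" "v * u = eye m"
    and eq: "u * v + (aa P (pr n i) * x + bb P i * y) = eye (dimv P i)"
    and z: "v * aa P (pr n i) = 0" "v * bb P i = 0"
    using top by (auto simp: is_top_def)
  define T where "T = {t\<in>I. c t = i}"
  define r where "r = card T"
  have finT: "finite T" using fin by (simp add: T_def)
  then obtain h where h: "bij_betw h {..<r} T"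
    unfolding r_def using ex_bij_betw_nat_finite[of T] by (auto simp: atLeast0LessThan)
  have hT: "h k \<in> T" if "k < r" for k using h that by (auto simp: bij_betw_def)
  define G where "G = (\<Sum>k<r. v * g (h k) * un 0 k)"
  have vg: "v * g t \<in> ops m 1" if "t \<in> T" for t
    using that P(4)[of t] uv by (auto simp: T_def intro: ops_mult)
  have G: "G \<in> ops m r"
    unfolding G_def by (intro ops_sum ops_mult[OF vg[OF hT] ops_un]) auto
  have Gk: "G * un k 0 = v * g (h k)" if "k < r" for k
  proof -
    have "G * un k 0 = (\<Sum>j<r. if k = j then v * g (h j) * un 0 0 else 0)"
      unfolding G_def sum_distrib_right by (intro sum.cong refl) (simp add: mult.assoc un_un)
    also have "\<dots> = v * g (h k) * un 0 0" using that by simp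
    also have "\<dots> = v * g (h k)"
      using ops_r[OF vg[OF hT[OF that]]] by (simp add: eye_sum One_nat_def)
    finally show ?thesis .
  qed
  have "m \<le> r"
  proof -
    \<comment> \<open>Vectors at \<open>i\<close> whose class in the top is a combination of the
      generators. Other vertices carry no condition, so only the arrows ending in \<open>i\<close>
      matter, and \<open>v\<close> kills their images.\<close>
    let ?N = "%j. if j = i then {w. \<exists>q\<in>ops r 1. v * w = G * q} else UNIV"
    have cl: "closed_family P ?N"
    proof (rule closed_familyI)
      fix j w w' :: _ and s :: 'k
      assume j: "j < n"
      show "0 \<in> ?N j" by (auto intro: bexI[of _ 0])
      show "w \<in> ?N j ==> w' \<in> ?N j ==> w + w' \<in> ?N j"
        by (auto simp: distrib_left split: if_splits) (metis distrib_left ops_add)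
      show "w \<in> ?N j ==> scl s * w \<in> ?N j"
        by (auto simp: scl_left_comm[of v] split: if_splits) (metis ops_scl scl_left_comm)
      show "aa P j * w \<in> ?N (sc n j)"
        using z(1) pr_sc[OF j] by (auto intro!: bexI[of _ 0] simp flip: mult.assoc)
      show "bb P j * w \<in> ?N j"
        using z(2) by (auto intro!: bexI[of _ 0] simp flip: mult.assoc)
    qed
    have "g t \<in> ?N (c t)" if t: "t \<in> I" for t
    proof (cases "c t = i")
      case True
      then obtain k where "k < r" "t = h k" using t h by (auto simp: bij_betw_def T_def)
      then show ?thesis using Gk[of k] True by (auto intro!: bexI[of _ "un k 0"] ops_un)
    qed simp
    then have N: "w \<in> ops (dimv P i) 1 ==> w \<in> ?N i" for w
      using generatedD[OF P(5) cl _ i(2)] by blast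
    have "\<exists>q\<in>ops r 1. G * q = un k 0" if "k < m" for k
    proof -
      have "u * un k 0 \<in> ?N i"
        using that uv by (intro N ops_mult[OF uv(1)] ops_un) auto
      then obtain q where "q \<in> ops r 1" "v * (u * un k 0) = G * q" by auto
      moreover have "v * (u * un k 0) = un k 0"
        using uv(3) that by (simp add: eye_un flip: mult.assoc)
      ultimately show ?thesis by metis
    qed
    then obtain s where "s \<in> ops r m" "G * s = eye m" using right_inverse_of_elements by blast
    then show ?thesis using dim_le[OF G] ops_r by blast
  qed
  moreover have "r \<le> m"
  proof -
    \<comment> \<open>The sum of \<open>r\<close> copies of the simple module at \<open>i\<close>;
      it vanishes at vertex 0 because of \<open>1 \<le> i\<close>.\<close>
    define X :: "'k qrep" where "X = mkrep (%j. if j = i then r else 0) (%_. 0) (%_. 0)"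
    have X: "pmod n X" using i by (simp add: pmod_def X_def semisimple_flmod)
    define xx :: "_ => 'k lop" where "xx t = (if t \<in> T then un (the_inv_into {..<r} h t) 0 else 0)" for t
    have "xx t \<in> ops (dimv X (c t)) 1" if "t \<in> I" for t
      using that h i P(3) by (auto simp: xx_def X_def T_def bij_betw_def intro!: ops_un)
        (metis (mono_tags, lifting) T_def lessThan_iff mem_Collect_eq subset_refl the_inv_into_into)
    then obtain f where f: "f \<in> hom P X" "\<And>t. t \<in> I ==> f (c t) * g t = xx t"
      using P(6)[OF X, of xx] by blast
    have fh: "f i * g (h k) = un k 0" if "k < r" for k
      using f(2)[of "h k"] hT[OF that] h that
      by (auto simp: T_def xx_def bij_betw_def the_inv_into_f_f)
    have fa: "f i * aa P (pr n i) = 0" "f i * bb P i = 0"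
      using homD(3)[OF f(1), of "pr n i"] homD(4)[OF f(1), of i] i by (simp_all add: X_def)
    have fi: "f i \<in> ops r (dimv P i)" using homD(2)[OF f(1) i(2)] i by (simp add: X_def)
    have "f i = f i * (u * v + (aa P (pr n i) * x + bb P i * y))"
      using ops_r[OF fi] eq by simp
    also have "\<dots> = f i * u * v"
      using fa by (simp add: distrib_left flip: mult.assoc)
    finally have fuv: "f i * u * v = f i" by simp
    have "(f i * u) * G = eye r"
      unfolding G_def sum_distrib_left eye_sum
      by (intro sum.cong refl) (use fuv fh in \<open>simp add: un_un flip: mult.assoc\<close>)
    then show ?thesis
      using dim_le[of "f i * u" r m G] ops_mult[OF fi uv(1)] ops_r[OF G] by blast
  qed
  ultimately show ?thesis using homS_dim_top[OF P(2) i(2) top] by (simp add: r_def T_def)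
qed

text \<open>The indecomposable projective at the vertex \<open>j\<close>: the \<open>m\<^sub>i\<close>-dimensional space at the vertex \<open>i\<close>
  has as its basis the shortest path from \<open>j\<close> to \<open>i\<close> followed by powers of the central element.\<close>

definition pdim :: "nat => nat => nat" where "pdim j i = min (min i j) (n - max i j)"
definition indproj :: "nat => 'k::field qrep" where
  "indproj j = mkrep (pdim j)
     (%i. eye (pdim j (sc n i)) * sh (if Suc i \<le> j then 1 else 0) * eye (pdim j i))
     (%i. eye (pdim j i) * sh (if Suc i \<le> j then 0 else 1) * eye (pdim j (sc n i)))"

lemma pdim_sc: "i < n ==> pdim j (sc n i) = pdim j (Suc i)"
  by (auto simp: sc_if pdim_def)
lemma pdim_0 [simp]: "pdim j 0 = 0" "pdim 0 j = 0"
  by (simp_all add: pdim_def)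
lemma pdim_Suc: "i < n ==> Suc i \<le> j ==> j < n ==> pdim j i \<le> pdim j (Suc i) & pdim j (Suc i) \<le> Suc (pdim j i)"
  "i < n ==> \<not> Suc i \<le> j ==> pdim j (Suc i) \<le> pdim j i & pdim j i \<le> Suc (pdim j (Suc i))"
  by (auto simp: pdim_def)

lemma indproj_dimv [simp]: "dimv (indproj j) i = (if i < n then pdim j i else 0)"
  by (simp add: indproj_def)
lemma indproj_rep [simp]: "is_rep n (indproj j)"
  by (simp add: indproj_def)
lemma indproj_aa: "i < n ==> aa (indproj j) i = eye (pdim j (Suc i)) * sh (if Suc i \<le> j then 1 else 0) * eye (pdim j i)"
  unfolding indproj_def by (subst mkrep_aa) (auto simp: ops_block pdim_sc)
lemma indproj_bb: "i < n ==> bb (indproj j) i = eye (pdim j i) * sh (if Suc i \<le> j then 0 else 1) * eye (pdim j (Suc i))"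
  unfolding indproj_def by (subst mkrep_bb) (auto simp: ops_block pdim_sc)

lemma ent_block_sh: "ent (eye a * sh s * eye b :: 'k::field lop) r c = (if r = c + s & r < a & c < b then 1 else 0)"
  unfolding ent_def by transfer auto

lemma shift_unshift: "a \<le> Suc b ==> eye a * sh 1 * eye b * (eye b * sh 0 * eye a) = (eye a * sh 1 * eye a :: 'k::field lop)"
  by transfer (auto simp: fun_eq_iff)
lemma unshift_shift: "a \<le> b ==> eye a * sh 0 * eye b * (eye b * sh 1 * eye a) = (eye a * sh 1 * eye a :: 'k::field lop)"
  by transfer (auto simp: fun_eq_iff)

lemma indproj_pmod:
  assumes "j < n"
  shows "pmod n (indproj j :: 'k::field qrep)"
proof -
  let ?P = "indproj j :: 'k qrep"
  have "aa ?P (pr n i) * bb ?P (pr n i) = bb ?P i * aa ?P i" if i: "i < n" for i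
  proof (cases "i = 0")
    case True
    have "bb ?P i * aa ?P i \<in> ops 0 0" "aa ?P (pr n i) * bb ?P (pr n i) \<in> ops 0 0"
      using ops_mult[OF bb_ops[OF indproj_rep i] aa_ops[OF indproj_rep i], of j]
        ops_mult[OF pr_ops[OF indproj_rep i], of j] i True by simp_all
    then show ?thesis using ops_zero_dim by metis
  next
    case False
    then obtain k where k: "i = Suc k" by (cases i) auto
    have p: "pr n i = k" using i k by (simp add: pr_if)
    have "aa ?P k * bb ?P k = eye (pdim j i) * sh 1 * eye (pdim j i)"
      using pdim_Suc[of k j] i k assms by (auto simp: indproj_aa indproj_bb shift_unshift unshift_shift simp del: sh_0)
    moreover have "bb ?P i * aa ?P i = eye (pdim j i) * sh 1 * eye (pdim j i)"
      using pdim_Suc[of i j] i assms by (auto simp: indproj_aa indproj_bb shift_unshift unshift_shift simp del: sh_0)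
    ultimately show ?thesis using p by simp
  qed
  moreover have "nilp n ?P"
  \<comment> \<open>The weight is the length of the path represented by a basis vector: the distance
    from \<open>j\<close> to \<open>i\<close> (one of the truncated differences is 0) plus 2 for
    each power of the central element.\<close>
  proof (rule nilp_weight[of ?P "%i r. 2 * r + (i - j) + (j - i)" "4 * n"])
    fix i r c assume i: "i < n"
    have e: "pdim j (Suc i) = 0" if "sc n i = 0" using pdim_sc[OF i, of j] that by simp
    have s: "sc n i = Suc i" if "sc n i \<noteq> 0" using i that by (auto simp: sc_if split: if_splits)
    show "2 * c + (i - j) + (j - i) < 2 * r + (sc n i - j) + (j - sc n i)" if "ent (aa ?P i) r c \<noteq> 0"
      using that i e s by (cases "sc n i = 0") (auto simp: indproj_aa ent_block_sh split: if_splits)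
    show "2 * c + (sc n i - j) + (j - sc n i) < 2 * r + (i - j) + (j - i)" if "ent (bb ?P i) r c \<noteq> 0"
      using that i e s by (cases "sc n i = 0") (auto simp: indproj_bb ent_block_sh split: if_splits)
  qed (use assms in \<open>auto simp: pdim_def\<close>)
  ultimately show ?thesis
    using preproj_iff[of ?P] n_ge2 by (simp add: pmod_def flmod_def)
qed

text \<open>The image of the basis vector \<open>k\<close> at the vertex \<open>i\<close> under the morphism from the
  projective at \<open>j\<close> given by \<open>x\<close>.\<close>

fun upath :: "'k::field qrep => nat => nat => 'k lop => 'k lop" where
  "upath X j 0 x = x"
| "upath X j (Suc k) x = aa X (j + k) * upath X j k x"
fun dpath :: "'k::field qrep => nat => nat => 'k lop => 'k lop" where
  "dpath X j 0 x = x"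
| "dpath X j (Suc k) x = bb X (j - Suc k) * dpath X j k x"
definition pbas :: "'k::field qrep => nat => 'k lop => nat => nat => 'k lop" where
  "pbas X j x i k = (bb X i * aa X i) ^ k * (if j \<le> i then upath X j (i - j) x else dpath X j (j - i) x)"

context
  fixes X :: "'k::field qrep" and j :: nat and x :: "'k lop"
  assumes X: "pmod n X" and j: "j < n" and x: "x \<in> ops (dimv X j) 1"
begin

text \<open>The preprojective relation says that the loops \<open>bb X i * aa X i\<close> together
  form a central element of the algebra.\<close>

lemma central: "Suc i < n ==> aa X i * bb X i = bb X (Suc i) * aa X (Suc i)"
  using flmodD(3)[OF pmod_flmod[OF X], of i] by (simp add: sc_if)

lemma central_aa: "Suc i < n ==> aa X i * (bb X i * aa X i) ^ k = (bb X (Suc i) * aa X (Suc i)) ^ k * aa X i"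
proof (induct k)
  case (Suc k)
  then show ?case using central[of i] by (simp add: mult.assoc flip: power_Suc2) (simp flip: mult.assoc)
qed simp
lemma central_bb: "Suc i < n ==> bb X i * (bb X (Suc i) * aa X (Suc i)) ^ k = (bb X i * aa X i) ^ k * bb X i"
proof (induct k)
  case (Suc k)
  have "bb X i * (bb X (Suc i) * aa X (Suc i)) ^ Suc k = bb X i * (aa X i * bb X i) * (bb X (Suc i) * aa X (Suc i)) ^ k"
    using central[OF Suc(2)] by (simp add: mult.assoc)
  also have "\<dots> = (bb X i * aa X i) * (bb X i * (bb X (Suc i) * aa X (Suc i)) ^ k)" by (simp add: mult.assoc)
  finally show ?case using Suc by (simp add: mult.assoc)
qed simp

text \<open>For \<open>Suc i \<le> j\<close> the arrow leads back towards \<open>j\<close> and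
  retraces the last step of the path, which contributes one power of the central element; otherwise
  it prolongs the shortest path.\<close>

lemma pbas_aa: "Suc i < n ==> aa X i * pbas X j x i k = pbas X j x (Suc i) (if Suc i \<le> j then Suc k else k)"
proof (cases "Suc i \<le> j")
  case True
  assume i: "Suc i < n"
  have e: "j - i = Suc (j - Suc i)" "j - Suc (j - Suc i) = i" using True by auto
  have d: "dpath X j (j - i) x = bb X i * dpath X j (j - Suc i) x"
    using e by (metis dpath.simps(2))
  have f: "(if j \<le> Suc i then upath X j (Suc i - j) x else dpath X j (j - Suc i) x) = dpath X j (j - Suc i) x"
    using True by (auto simp: Suc_le_eq le_less)
  have "aa X i * pbas X j x i k = (aa X i * (bb X i * aa X i) ^ k) * (bb X i * dpath X j (j - Suc i) x)"
    using True d by (simp add: pbas_def mult.assoc)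
  also have "\<dots> = (bb X (Suc i) * aa X (Suc i)) ^ k * ((aa X i * bb X i) * dpath X j (j - Suc i) x)"
    unfolding central_aa[OF i] by (simp add: mult.assoc)
  also have "\<dots> = (bb X (Suc i) * aa X (Suc i)) ^ Suc k * dpath X j (j - Suc i) x"
    unfolding central[OF i] power_Suc2 by (simp add: mult.assoc)
  finally show ?thesis using True f by (simp add: pbas_def)
next
  case False
  assume i: "Suc i < n"
  have "aa X i * pbas X j x i k = (bb X (Suc i) * aa X (Suc i)) ^ k * (aa X i * upath X j (i - j) x)"
    using False central_aa[OF i, of k] by (simp add: pbas_def flip: mult.assoc)
  moreover have "aa X i * upath X j (i - j) x = upath X j (Suc i - j) x"
    using False by (simp add: Suc_diff_le)
  ultimately show ?thesis using False by (simp add: pbas_def)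
qed

lemma pbas_bb: "Suc i < n ==> bb X i * pbas X j x (Suc i) k = pbas X j x i (if Suc i \<le> j then k else Suc k)"
proof (cases "Suc i \<le> j")
  case True
  assume i: "Suc i < n"
  have e: "j - i = Suc (j - Suc i)" "j - Suc (j - Suc i) = i" using True by auto
  have d: "dpath X j (j - i) x = bb X i * dpath X j (j - Suc i) x"
    using e by (metis dpath.simps(2))
  have f: "(if j \<le> Suc i then upath X j (Suc i - j) x else dpath X j (j - Suc i) x) = dpath X j (j - Suc i) x"
    using True by (auto simp: Suc_le_eq le_less)
  show ?thesis using True f d central_bb[OF i, of k] unfolding pbas_def f by (simp flip: mult.assoc)
next
  case False
  assume i: "Suc i < n"
  have "upath X j (Suc i - j) x = aa X i * upath X j (i - j) x"
    using False by (simp add: Suc_diff_le)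
  then have "bb X i * pbas X j x (Suc i) k = (bb X i * (bb X (Suc i) * aa X (Suc i)) ^ k) * (aa X i * upath X j (i - j) x)"
    using False by (simp add: pbas_def mult.assoc)
  also have "\<dots> = (bb X i * aa X i) ^ Suc k * upath X j (i - j) x"
    unfolding central_bb[OF i] power_Suc2 by (simp add: mult.assoc)
  finally show ?thesis using False by (simp add: pbas_def)
qed

lemma pbas_start: "pbas X j x j 0 = x"
  by (simp add: pbas_def)

lemma pbas_ops: "i < n ==> pbas X j x i k \<in> ops (dimv X i) 1"
proof -
  note r = pmod_rep[OF X]
  have up: "j + k < n ==> upath X j k x \<in> ops (dimv X (j + k)) 1" for k
  proof (induct k)
    case (Suc k)
    then show ?case using ops_mult[OF aa_ops[OF r, of "j + k"]] by (auto simp: sc_if)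
  qed (use x in simp)
  have down: "k \<le> j ==> dpath X j k x \<in> ops (dimv X (j - k)) 1" for k
  proof (induct k)
    case (Suc k)
    have "sc n (j - Suc k) = j - k" "j - Suc k < n" using Suc(2) j by (simp_all add: sc_if Suc_diff_Suc)
    then show ?case using ops_mult[OF bb_ops[OF r, of "j - Suc k"], of "dpath X j k x" 1] Suc by simp
  qed (use x in simp)
  assume i: "i < n"
  have z: "(bb X i * aa X i) ^ k * y \<in> ops (dimv X i) 1" if "y \<in> ops (dimv X i) 1" for y k
    using that by (induct k) (auto simp: mult.assoc intro!: ops_mult[OF bb_ops[OF r i] ops_mult[OF aa_ops[OF r i]]])
  show ?thesis unfolding pbas_def using up[of "i - j"] down[of "j - i"] i by (intro z) auto
qed

lemma pbas_power: "pbas X j x i (a + b) = (bb X i * aa X i) ^ a * pbas X j x i b"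
  by (simp add: pbas_def power_add mult.assoc)

text \<open>The space at vertex 0 is zero. Walking in from it upwards kills the power
  \<open>min i j\<close>; walking in from the other side, where the arrow leaving vertex
  \<open>n - 1\<close> ends in vertex 0, kills the power \<open>n - max i j\<close>.\<close>

lemma pbas_zero: 
  assumes i: "i < n" and k: "pdim j i \<le> k"
  shows "pbas X j x i k = 0"
proof -
  have X0: "pbas X j x 0 k = 0" for k
    using pbas_ops[of 0 k] pmod_0[OF X] n_ge2 by (auto dest: gen_mult_zero)
  have low: "i \<le> j ==> pbas X j x i i = 0" for i
  proof (induct i)
    case (Suc i)
    then show ?case using pbas_aa[of i i] j by simp
  qed (simp add: X0)
  have low': "i < n ==> pbas X j x i (min i j) = 0" for i
  proof (induct i)
    case (Suc i)
    show ?case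
    proof (cases "Suc i \<le> j")
      case True
      then show ?thesis using low[of "Suc i"] by (simp add: min_def)
    next
      case False
      then have "min i j = j" "min (Suc i) j = j" by auto
      then show ?thesis using Suc pbas_aa[of i j] False by simp
    qed
  qed (simp add: X0)
  have last: "bb X (n - 1) * aa X (n - 1) = 0"
  proof -
    have "aa X (n - 1) \<in> ops 0 (dimv X (n - 1))"
      using aa_ops[OF pmod_rep[OF X], of "n - 1"] n_ge2 pmod_0[OF X] by (simp add: sc_if)
    then show ?thesis using ops_zero_dim(1) by fastforce
  qed
  have high: "i \<ge> j ==> i \<le> n - 1 ==> pbas X j x i (n - i) = 0" for i
  proof (induct "n - 1 - i" arbitrary: i)
    case 0
    then have "i = n - 1" "n - i = Suc 0" using n_ge2 by auto
    then show ?case using last by (simp add: pbas_def)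
  next
    case (Suc d)
    then have "pbas X j x (Suc i) (n - Suc i) = 0" using n_ge2 by (intro Suc(1)) auto
    then show ?case using pbas_bb[of i "n - Suc i"] Suc by (simp add: Suc_diff_Suc)
  qed
  have high': "i \<le> j ==> pbas X j x i (n - j) = 0" for i
  proof (induct "j - i" arbitrary: i)
    case 0
    then show ?case using high[of j] j by auto
  next
    case (Suc d)
    then have "pbas X j x (Suc i) (n - j) = 0" by (intro Suc(1)) auto
    moreover have "Suc i \<le> j" using Suc(2) by arith
    ultimately show ?case using pbas_bb[of i "n - j"] j by simp
  qed
  have "pbas X j x i (pdim j i) = 0"
    using low'[OF i] high[of i] high'[of i] i by (auto simp: pdim_def min_def max_def split: if_splits)
  then show ?thesis using pbas_power[of i "k - pdim j i" "pdim j i"] k by simp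
qed

lemma indproj_map: "\<exists>f\<in>hom (indproj j) X. f j * (eye (pdim j j) * un 0 0) = x"
proof -
  define f where "f i = (if i < n then \<Sum>k<pdim j i. pbas X j x i k * un 0 k else 0)" for i
  \<comment> \<open>The formula holds for every \<open>c\<close>: beyond the dimension both sides
    vanish, so basis vectors shifted out of range cause no trouble in the commutation
    checks.\<close>
  have fk: "f i * un c 0 = pbas X j x i c" if "i < n" for i c
  proof (cases "c < pdim j i")
    case True
    have "f i * un c 0 = (\<Sum>k<pdim j i. pbas X j x i k * (un 0 k * un c 0))"
      using that unfolding f_def by (simp add: sum_distrib_right mult.assoc)
    also have "\<dots> = (\<Sum>k<pdim j i. if c = k then pbas X j x i k * un 0 0 else 0)"
      by (intro sum.cong refl) (auto simp: un_un)
    also have "\<dots> = pbas X j x i c * un 0 0" using True by simp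
    also have "\<dots> = pbas X j x i c" using ops_r[OF pbas_ops[OF that, of c]] by (simp add: eye_sum One_nat_def)
    finally show ?thesis .
  next
    case False
    have "f i * un c 0 = (\<Sum>k<pdim j i. pbas X j x i k * (un 0 k * un c 0))"
      using that unfolding f_def by (simp add: sum_distrib_right mult.assoc)
    also have "\<dots> = 0" using False by (intro sum.neutral) (simp add: un_un)
    finally show ?thesis using pbas_zero[OF that, of c] False by simp
  qed
  have fo: "f i \<in> ops (dimv X i) (dimv (indproj j :: 'k qrep) i)" if "i < n" for i
    using that unfolding f_def by (auto intro!: ops_sum ops_mult[OF pbas_ops ops_un])
  note r = pmod_rep[OF X]
  have shun: "sh s * un c 0 = (un (c + s) 0 :: 'k lop)" for s c
    by transfer (auto simp: fun_eq_iff)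
  have "f \<in> hom (indproj j) X"
  proof (rule homI)
    fix i assume i: "i < n"
    note d = aa_ops[OF indproj_rep i, of j] bb_ops[OF indproj_rep i, of j] aa_ops[OF r i] bb_ops[OF r i]
    show "f i \<in> ops (dimv X i) (dimv (indproj j :: 'k qrep) i)" by (rule fo[OF i])
    have bd: "pdim j (Suc i) \<le> pdim j i + (if Suc i \<le> j then 1 else 0)" "pdim j i \<le> pdim j (Suc i) + (if Suc i \<le> j then 0 else 1)"
      using pdim_Suc[of i j] i j by auto
    show "f (sc n i) * aa (indproj j) i = aa X i * f i"
    proof (cases "sc n i = 0")
      case True
      then show ?thesis using ops_mult[OF fo[OF sc_lt[OF i]] d(1)] ops_mult[OF d(3) fo[OF i]] pmod_0[OF X] ops_zero_dim
        by (metis (no_types, lifting))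
    next
      case False
      then have si: "sc n i = Suc i" "Suc i < n" using i by (auto simp: sc_if split: if_splits)
      show ?thesis
      proof (rule ops_cols_eqI[OF ops_mult[OF fo[OF sc_lt[OF i]] d(1)] ops_mult[OF d(3) fo[OF i]]])
        fix c assume c: "c < dimv (indproj j :: 'k qrep) i"
        then have c': "c < pdim j i" using i by simp
        have "aa (indproj j) i * un c 0 = eye (pdim j (Suc i)) * (un (c + (if Suc i \<le> j then 1 else 0)) 0 :: 'k lop)"
          using c' i by (simp add: indproj_aa mult.assoc eye_un shun)
        then have "f (sc n i) * aa (indproj j) i * un c 0 = f (Suc i) * eye (pdim j (Suc i)) * un (c + (if Suc i \<le> j then 1 else 0)) 0"
          using si by (simp add: mult.assoc)
        also have "f (Suc i) * eye (pdim j (Suc i)) = f (Suc i)"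
          using ops_r[OF fo[OF si(2)]] si by simp
        also have "f (Suc i) * un (c + (if Suc i \<le> j then 1 else 0)) 0 = aa X i * f i * un c 0"
          using pbas_aa[OF si(2), of c] by (simp add: mult.assoc fk i si One_nat_def)
        finally show "f (sc n i) * aa (indproj j) i * un c 0 = aa X i * f i * un c 0" .
      qed
    qed
    show "f i * bb (indproj j) i = bb X i * f (sc n i)"
    proof (cases "sc n i = 0")
      case True
      then have "dimv (indproj j :: 'k qrep) (sc n i) = 0" by simp
      then show ?thesis using ops_mult[OF fo[OF i] d(2)] ops_mult[OF d(4) fo[OF sc_lt[OF i]]] ops_zero_dim
        by (metis (no_types, lifting))
    next
      case False
      then have si: "sc n i = Suc i" "Suc i < n" using i by (auto simp: sc_if split: if_splits)
      show ?thesis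
      proof (rule ops_cols_eqI[OF ops_mult[OF fo[OF i] d(2)] ops_mult[OF d(4) fo[OF sc_lt[OF i]]]])
        fix c assume c: "c < dimv (indproj j :: 'k qrep) (sc n i)"
        then have c': "c < pdim j (Suc i)" using si by simp
        have "bb (indproj j) i * un c 0 = eye (pdim j i) * (un (c + (if Suc i \<le> j then 0 else 1)) 0 :: 'k lop)"
          using c' i by (simp add: indproj_bb mult.assoc eye_un shun)
        then have "f i * bb (indproj j) i * un c 0 = f i * eye (pdim j i) * un (c + (if Suc i \<le> j then 0 else 1)) 0"
          by (simp add: mult.assoc)
        also have "f i * eye (pdim j i) = f i"
          using ops_r[OF fo[OF i]] i by simp
        also have "f i * un (c + (if Suc i \<le> j then 0 else 1)) 0 = bb X i * f (sc n i) * un c 0"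
          using pbas_bb[OF si(2), of c] by (simp add: mult.assoc fk i si One_nat_def)
        finally show "f i * bb (indproj j) i * un c 0 = bb X i * f (sc n i) * un c 0" .
      qed
    qed
  qed (simp add: f_def)
  moreover have "f j * (eye (pdim j j) * un 0 0) = x"
  proof -
    have "f j * eye (pdim j j) = f j" using ops_r[OF fo[OF j]] j by simp
    then show ?thesis using fk[OF j, of 0] pbas_start by (simp flip: mult.assoc)
  qed
  ultimately show ?thesis by blast
qed

end

text \<open>Arrows leading away from \<open>j\<close> reach the first basis vector at each vertex,
  and one step down and up again multiplies by the central element. The factor
  \<open>eye (pdim j j)\<close> makes the generator zero for \<open>j = 0\<close>, where the module
  itself is zero.\<close>

lemma indproj_generated:
  assumes j: "j < n"
  shows "generated (indproj j :: 'k::field qrep) {()} (%_. j) (%_. eye (pdim j j) * un 0 0)"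
  unfolding generated_def
proof (intro allI impI subsetI)
  let ?P = "indproj j :: 'k qrep"
  fix N :: "nat => 'k lop set" and i :: nat and x :: "'k lop"
  assume "closed_family ?P N & (\<forall>t\<in>{()}. eye (pdim j j) * un 0 0 \<in> N j)"
  then have N: "closed_family ?P N" and g: "eye (pdim j j) * un 0 0 \<in> N j" by auto
  assume i: "i < n" and x: "x \<in> ops (dimv ?P i) 1"
  have shun: "sh s * un c 0 = (un (c + s) 0 :: 'k lop)" for s c
    by transfer (auto simp: fun_eq_iff)
  define V :: "nat => nat => 'k lop" where "V i k = eye (pdim j i) * un k 0" for i k
  have Va: "aa ?P i * V i k = V (Suc i) (k + (if Suc i \<le> j then 1 else 0))" if "i < n" for i k
    using pdim_Suc[of i j] that j by (auto simp: V_def indproj_aa mult.assoc eye_un shun)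
  have Vb: "bb ?P i * V (Suc i) k = V i (k + (if Suc i \<le> j then 0 else 1))" if "i < n" for i k
    using pdim_Suc[of i j] that j by (auto simp: V_def indproj_bb mult.assoc eye_un shun)
  have up: "V i k \<in> N i ==> Suc i < n ==> V (Suc i) (k + (if Suc i \<le> j then 1 else 0)) \<in> N (Suc i)" for i k
    using closed_familyD(4)[OF N, of i "V i k"] Va[of i k] by (simp add: sc_if)
  have down: "V (Suc i) k \<in> N (Suc i) ==> Suc i < n ==> V i (k + (if Suc i \<le> j then 0 else 1)) \<in> N i" for i k
    using closed_familyD(5)[OF N, of i "V (Suc i) k"] Vb[of i k] by (simp add: sc_if)
  have "V i 0 \<in> N i" if "j \<le> i" "i < n" for i
    using that
  proof (induct "i - j" arbitrary: i)
    case 0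
    then show ?case using g by (simp add: V_def)
  next
    case (Suc d)
    then obtain i' where i': "i = Suc i'" by (cases i) auto
    then have "V i' 0 \<in> N i'" using Suc by (intro Suc(1)) auto
    moreover have "\<not> Suc i' \<le> j" using Suc(2) i' by arith
    ultimately show ?case using up[of i' 0] i' Suc(4) by simp
  qed
  moreover have "V i 0 \<in> N i" if "i \<le> j" for i
    using that
  proof (induct "j - i" arbitrary: i)
    case 0
    then show ?case using g by (simp add: V_def)
  next
    case (Suc d)
    then have "V (Suc i) 0 \<in> N (Suc i)" by (intro Suc(1)) auto
    moreover have "Suc i \<le> j" using Suc(2) by arith
    ultimately show ?case using down[of i 0] j by simp
  qed
  ultimately have V0: "V i 0 \<in> N i" using i by (cases "i \<le> j") auto
  have Vk: "V i k \<in> N i" for k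
  proof (cases "i = 0")
    case True
    then show ?thesis using closed_familyD(1)[OF N i] by (simp add: V_def)
  next
    case False
    then obtain i' where i': "i = Suc i'" by (cases i) auto
    show ?thesis
    proof (induct k)
      case 0
      show ?case by (rule V0)
    next
      case (Suc k)
      then show ?case using down[of i' k] up[of i' "k + (if Suc i' \<le> j then 0 else 1)"] i' i by (cases "Suc i' \<le> j") (simp_all add: One_nat_def)
    qed
  qed
  have un: "un k 0 \<in> N i" if "k < dimv ?P i" for k
    using Vk[of k] that i by (simp add: V_def eye_un)
  have "x = (\<Sum>k<dimv ?P i. scl (ent x k 0) * un k 0)" by (rule ops_col_expand[OF x])
  moreover have "(\<Sum>k<dimv ?P i. scl (ent x k 0) * un k 0) \<in> N i"
    using un by (intro closed_family_sum[OF N i] closed_familyD(3)[OF N i]) simp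
  ultimately show "x \<in> N i" by metis
qed

lemma indproj_free:
  assumes j: "j < n"
  shows "free (indproj j :: 'k::field qrep) {()} (%_. j) (%_. eye (pdim j j) * un 0 0)"
  unfolding free_def
proof (intro conjI allI impI ballI)
  have "eye (pdim j j) * un 0 0 \<in> ops (pdim j j) 1"
    by (auto simp: eye_un intro!: ops_un)
  then show "eye (pdim j j) * un 0 0 \<in> ops (dimv (indproj j :: 'k qrep) j) 1" using j by simp
qed (use assms indproj_pmod indproj_generated indproj_map in auto)

lemma free_exists:
  assumes "finite I" "\<And>t. t \<in> I ==> c t < n"
  shows "\<exists>(P :: 'k::field qrep) g. free P I c g"
  using assms
proof (induct I rule: finite_induct)
  case empty
  have "generated (indproj 0 :: 'k qrep) {} c (%_. 0)"
    unfolding generated_def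
  proof (intro allI impI subsetI)
    fix N :: "nat => 'k lop set" and i and x :: "'k lop"
    assume N: "closed_family (indproj 0) N & (\<forall>t\<in>{}. 0 \<in> N (c t))" and i: "i < n"
      and x: "x \<in> ops (dimv (indproj 0 :: 'k qrep) i) 1"
    have "x = 0" using x i by (auto dest: gen_mult_zero)
    then show "x \<in> N i" using closed_familyD(1)[OF conjunct1[OF N] i] by simp
  qed
  then have "free (indproj 0 :: 'k qrep) {} c (%_. 0)"
    unfolding free_def using indproj_pmod[of 0] n_ge2 by (auto intro!: exI[where x = 0])
  then show ?case by blast
next
  case (insert t I)
  then obtain P :: "'k qrep" and g where P: "free P I c g" by auto
  have "c t < n" using insert by simp
  from free_sum[OF indproj_free[OF this] P]
  have F: "free (rsum (indproj (c t)) P) ({()} <+> I) (case_sum (%_. c t) c)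
    (case_sum (%ta. in1 (indproj (c t)) P (c t) * (eye (pdim (c t) (c t)) * un 0 0)) (%t'. in2 (indproj (c t)) P (c t') * g t'))" .
  have "bij_betw (%s. if s = t then Inl () else Inr s) (insert t I) ({()} <+> I)"
    using insert(2) by (auto simp: bij_betw_def inj_on_def image_iff)
  from free_reindex[OF F this]
  have "free (rsum (indproj (c t)) P) (insert t I) (%s. case_sum (%_. c t) c (if s = t then Inl () else Inr s))
    (%s. case_sum (%ta. in1 (indproj (c t)) P (c t) * (eye (pdim (c t) (c t)) * un 0 0))
      (%t'. in2 (indproj (c t)) P (c t') * g t') (if s = t then Inl () else Inr s))" .
  moreover have "(%s. case_sum (%_. c t) c (if s = t then Inl () else Inr s)) = c"
    by auto
  ultimately show ?case by metis
qed

end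

text \<open>The idempotent \<open>f * g\<close> has rank \<open>d\<close>, so its complement has
  rank 0.\<close>

lemma square_inverse:
  assumes "f \<in> ops d d" "g \<in> ops d d" "g * f = eye d"
  shows "f * g = eye d"
proof -
  have sp: "splits (f * g) d d f g" using assms by (simp add: splits_def)
  note d = splitsD[OF sp]
  have "eye d - f * g \<in> ops d d" "(eye d - f * g) * (eye d - f * g) = eye d - f * g"
    using d(3,16,18,20) by (auto intro!: ops_diff simp: algebra_simps)
  then obtain s p q where sp': "splits (eye d - f * g) d s p q" using idempotent_splits by blast
  have "s = 0" using splits_dim_add[OF sp sp'] by simp
  then have "p = 0" using splitsD(1)[OF sp'] ops_zero_dim(2) by simp
  then have "eye d - f * g = 0" using splitsD(4)[OF sp'] by simp
  then show ?thesis by simp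
qed

context cyclic
begin

section \<open>Projective modules are free\<close>

text \<open>Nakayama's lemma: splitting off top components again and again pushes the remainder into
  longer and longer paths, which vanish by nilpotency.\<close>

lemma top_generates:
  assumes P: "flmod n P" and top: "\<And>i. i < n ==> is_top P i (m i) (u i) (v i) (x i) (y i)"
    and N: "closed_family P N" and u: "\<And>i k. i < n ==> k < m i ==> u i * un k 0 \<in> N i"
    and i: "i < n" and z: "z \<in> ops (dimv P i) 1"
  shows "z \<in> N i"
proof -
  note r = flmodD(1)[OF P]
  obtain K where K: "\<forall>i<n. \<forall>w. length w = K --> pth P i w = 0" using flmodD(4)[OF P] by blast
  \<comment> \<open>\<open>L\<close> bounds the number of arrows still missing until the path
    \<open>w\<close> is long enough to vanish.\<close>
  have "i < n ==> z \<in> ops (dimv P i) 1 ==> K \<le> length w + L ==> pth P i w * z \<in> N (pend i w)" for L i w z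
  proof (induct L arbitrary: i w z)
    case 0
    then show ?case using pth_zero_mono[OF r K, of w i] closed_familyD(1)[OF N, of "pend i w"] by simp
  next
    case (Suc L)
    note t = top[OF Suc(2), unfolded is_top_def]
    have "z = (u i * v i + (aa P (pr n i) * x i + bb P i * y i)) * z"
      using t Suc(3) by (simp add: ops_l)
    then have z: "z = u i * (v i * z) + (aa P (pr n i) * (x i * z) + bb P i * (y i * z))"
      by (simp only: distrib_right mult.assoc)
    have vz: "v i * z \<in> ops (m i) 1" using t Suc(3) ops_mult by blast
    have "u i * (v i * z) = (\<Sum>k<m i. scl (ent (v i * z) k 0) * (u i * un k 0))"
      by (subst (1) ops_col_expand[OF vz]) (simp add: sum_distrib_left scl_left_comm[of "u i"])
    also have "\<dots> \<in> N i"
      by (intro closed_family_sum[OF N Suc(2)] closed_familyD(3)[OF N Suc(2)] u[OF Suc(2)]) simp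
    finally have 1: "pth P i w * (u i * (v i * z)) \<in> N (pend i w)"
      using t vz by (intro closed_family_pth[OF N Suc(2) _ _ r]) (auto intro: ops_mult)
    have "x i * z \<in> ops (dimv P (pr n i)) 1" "y i * z \<in> ops (dimv P (sc n i)) 1"
      using t Suc(3) ops_mult by blast+
    then have 2: "pth P i w * (aa P (pr n i) * (x i * z)) \<in> N (pend i w)"
      "pth P i w * (bb P i * (y i * z)) \<in> N (pend i w)"
      using Suc(1)[of "pr n i" "x i * z" "True # w"] Suc(1)[of "sc n i" "y i * z" "False # w"] Suc(2,4)
      by (simp_all add: mult.assoc)
    have "pth P i w * z = pth P i w * (u i * (v i * z)) +
      (pth P i w * (aa P (pr n i) * (x i * z)) + pth P i w * (bb P i * (y i * z)))"
      by (subst z) (simp only: distrib_left)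
    then show ?case using 1 2 closed_familyD(2)[OF N, of "pend i w"] Suc(2) by simp
  qed
  from this[of i z "[]" K] show ?thesis using i z by (simp add: ops_l)
qed

text \<open>Indices for \<open>m i\<close> generators at each vertex \<open>i\<close>; vertex 0 is
  left out since the modules vanish there.\<close>

definition gset :: "(nat => nat) => (nat \<times> nat) set" where
  "gset m = {(i, k). 1 \<le> i & i < n & k < m i}"

lemma gset_finite [simp]: "finite (gset m)"
proof -
  have "gset m \<subseteq> (SIGMA i:{..<n}. {..<m i})" by (auto simp: gset_def)
  then show ?thesis by (rule finite_subset) auto
qed

lemma surjh_of_elements:
  assumes f: "f \<in> hom X Y" and el: "\<And>i x. i < n ==> x \<in> ops (dimv Y i) 1 ==> \<exists>y\<in>ops (dimv X i) 1. f i * y = x"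
  shows "surjh X Y f"
  unfolding surjh_def
proof (intro conjI allI impI f)
  fix i assume i: "i < n"
  show "\<exists>s\<in>ops (dimv X i) (dimv Y i). f i * s = eye (dimv Y i)"
    by (rule right_inverse_of_elements) (use el[OF i] in \<open>auto intro: ops_un\<close>)
qed

text \<open>A free cover \<open>p\<close> splits. The complementary idempotent \<open>e\<close> maps
  into the radical because the generators go to a basis of the top of \<open>P\<close>; being
  idempotent, it maps into all powers of the radical, hence to zero by nilpotency.\<close>

lemma projective_free:
  fixes P :: "'k::field qrep"
  assumes proj: "projective n P"
  shows "\<exists>g. free P (gset (homS_dim n P)) fst g"
proof -
  have pm: "pmod n P" using proj by (rule projective_pmod)
  note flP = pmod_flmod[OF pm] and rP = pmod_rep[OF pm]
  have "\<exists>m u v x y. is_top P i m u v x y" if "i < n" for i using top_exists[OF rP that] .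
  then obtain m u v x y where top: "\<And>i. i < n ==> is_top P i (m i) (u i) (v i) (x i) (y i)"
    by metis
  have hm: "homS_dim n P i = m i" if "i < n" for i using homS_dim_top[OF rP that top[OF that]] .
  define I where "I = gset (homS_dim n P)"
  define g where "g t = u (fst t) * (un (snd t) 0 :: 'k lop)" for t
  have It: "1 \<le> fst t" "fst t < n" "snd t < m (fst t)" if "t \<in> I" for t
    using that hm by (auto simp: I_def gset_def)
  have g: "fst t < n & g t \<in> ops (dimv P (fst t)) 1" if "t \<in> I" for t
    using It[OF that] top[of "fst t"] by (auto simp: g_def is_top_def intro!: ops_mult[of _ _ "m (fst t)"] ops_un)
  have fin: "finite I" by (simp add: I_def)
  obtain F :: "'k qrep" and gF where F: "free F I fst gF"
    using free_exists[OF fin, of fst] It by blast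
  note F' = freeD[OF F]
  obtain p where p: "p \<in> hom F P" "\<And>t. t \<in> I ==> p (fst t) * gF t = g t"
    using F'(6)[OF pm, of g] g by blast
  have "surjh F P p"
  proof (rule surjh_of_elements[OF p(1)])
    fix i and z :: "'k lop" assume i: "i < n" and z: "z \<in> ops (dimv P i) 1"
    define N where "N i = {z. \<exists>w\<in>ops (dimv F i) 1. p i * w = z}" for i
    have N: "closed_family P N"
    proof (rule closed_familyI)
      fix i and x x' :: "'k lop" and s :: 'k assume i: "i < n"
      show "0 \<in> N i" by (auto simp: N_def intro!: bexI[of _ 0])
      show "x \<in> N i ==> x' \<in> N i ==> x + x' \<in> N i"
        by (auto simp: N_def) (metis distrib_left ops_add)
      show "x \<in> N i ==> scl s * x \<in> N i"
        by (auto simp: N_def) (metis scl_left_comm ops_scl)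
      show "x \<in> N i ==> aa P i * x \<in> N (sc n i)"
        using homD(3)[OF p(1) i] ops_mult[OF aa_ops[OF F'(2) i]]
        by (auto simp: N_def simp flip: mult.assoc) (metis mult.assoc)
      show "x \<in> N (sc n i) ==> bb P i * x \<in> N i"
        using homD(4)[OF p(1) i] ops_mult[OF bb_ops[OF F'(2) i]]
        by (auto simp: N_def simp flip: mult.assoc) (metis mult.assoc)
    qed
    have "u i * un k 0 \<in> N i" if i: "i < n" and k: "k < m i" for i k
    proof (cases "i = 0")
      case True
      then have "u i = 0" using top[OF i] pmod_0[OF pm] ops_zero_dim(1) by (auto simp: is_top_def)
      then show ?thesis by (auto simp: N_def intro!: bexI[of _ 0])
    next
      case False
      then have t: "(i, k) \<in> I" using i k hm by (simp add: I_def gset_def)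
      then show ?thesis using p(2)[OF t] F'(4)[OF t] by (auto simp: N_def g_def)
    qed
    then have "z \<in> N i" using top_generates[OF flP top N _ i z] by blast
    then show "\<exists>y\<in>ops (dimv F i) 1. p i * y = z" by (simp add: N_def)
  qed
  then obtain s where s: "s \<in> hom P F" "p * s = idn P"
    using projective_lift[OF proj F'(1) pm _ hom_idn[OF rP]] by blast
  define e where "e = idn F - s * p"
  have e: "e \<in> hom F F" unfolding e_def using s p F'(2) by (intro hom_diff hom_comp hom_idn) auto
  have pe: "p * e = 0"
    unfolding e_def using s(2) hom_id_l[OF p(1)] hom_id_r[OF p(1)]
    by (simp add: right_diff_distrib flip: mult.assoc)
  have ee: "e * e = e"
    by (subst (1) e_def) (simp add: left_diff_distrib mult.assoc pe hom_id_l[OF e])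
  have pe': "p i * (e i * z) = 0" and ee': "e i * (e i * z) = e i * z" for i z
    using fun_cong[OF pe, of i] fun_cong[OF ee, of i] by (simp_all flip: mult.assoc)
  \<comment> \<open>The predicate says that \<open>w\<close> lies in the radical of \<open>F\<close>
    at the vertex \<open>i\<close>.\<close>
  define R where "R i w \<longleftrightarrow> (\<exists>a\<in>ops (dimv F (pr n i)) 1. \<exists>b\<in>ops (dimv F (sc n i)) 1.
    w = aa F (pr n i) * a + bb F i * b)" for i w
  have RI: "R i (aa F (pr n i) * a + bb F i * b)" if "a \<in> ops (dimv F (pr n i)) 1" "b \<in> ops (dimv F (sc n i)) 1" for i a b
    using that unfolding R_def by blast
  have R0: "R i 0" for i using RI[OF ops_0 ops_0, of i] by simp
  have Radd: "R i (w + w')" if h: "R i w" "R i w'" for i w w'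
  proof -
    obtain a b where 1: "a \<in> ops (dimv F (pr n i)) 1" "b \<in> ops (dimv F (sc n i)) 1" "w = aa F (pr n i) * a + bb F i * b"
      using h(1) unfolding R_def by blast
    obtain a' b' where 2: "a' \<in> ops (dimv F (pr n i)) 1" "b' \<in> ops (dimv F (sc n i)) 1" "w' = aa F (pr n i) * a' + bb F i * b'"
      using h(2) unfolding R_def by blast
    have "w + w' = aa F (pr n i) * (a + a') + bb F i * (b + b')"
      by (simp add: 1(3) 2(3) distrib_left)
    then show ?thesis using RI[OF ops_add[OF 1(1) 2(1)] ops_add[OF 1(2) 2(2)]] by simp
  qed
  have Rscl: "R i (scl c * w)" if h: "R i w" for i c w
  proof -
    obtain a b where 1: "a \<in> ops (dimv F (pr n i)) 1" "b \<in> ops (dimv F (sc n i)) 1" "w = aa F (pr n i) * a + bb F i * b"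
      using h unfolding R_def by blast
    have "scl c * w = aa F (pr n i) * (scl c * a) + bb F i * (scl c * b)"
      by (simp add: 1(3) distrib_left scl_left_comm[of "aa F _"] scl_left_comm[of "bb F _"])
    then show ?thesis using RI[OF ops_scl[OF 1(1)] ops_scl[OF 1(2)]] by simp
  qed
  define N where "N i = {z\<in>ops (dimv F i) 1. R i (e i * z)}" for i
  have N: "closed_family F N"
  proof (rule closed_familyI)
    fix i and z z' :: "'k lop" and c :: 'k assume i: "i < n"
    show "0 \<in> N i" by (simp add: N_def R0)
    show "z \<in> N i ==> z' \<in> N i ==> z + z' \<in> N i"
      by (simp add: N_def ops_add Radd distrib_left)
    show "z \<in> N i ==> scl c * z \<in> N i"
      by (simp add: N_def ops_scl Rscl scl_left_comm[of "e i"])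
    have ez: "z \<in> ops (dimv F i) 1 ==> e i * z \<in> ops (dimv F i) 1" if "i < n" for i z
      using ops_mult[OF homD(2)[OF e that]] .
    show "aa F i * z \<in> N (sc n i)" if z: "z \<in> N i"
    proof -
      have zo: "z \<in> ops (dimv F i) 1" using z by (simp add: N_def)
      have "e (sc n i) * (aa F i * z) = aa F i * (e i * z)"
        using homD(3)[OF e i] by (simp flip: mult.assoc)
      moreover have "R (sc n i) (aa F i * (e i * z))"
        using RI[of "e i * z" "sc n i" 0] ez[OF i zo] i by simp
      ultimately show ?thesis using ops_mult[OF aa_ops[OF F'(2) i] zo] by (simp add: N_def)
    qed
    show "bb F i * z \<in> N i" if z: "z \<in> N (sc n i)"
    proof -
      have zo: "z \<in> ops (dimv F (sc n i)) 1" using z by (simp add: N_def)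
      have "e i * (bb F i * z) = bb F i * (e (sc n i) * z)"
        using homD(4)[OF e i] by (simp flip: mult.assoc)
      moreover have "R i (bb F i * (e (sc n i) * z))"
        using RI[of 0 i "e (sc n i) * z"] ez[OF sc_lt[OF i] zo] by simp
      ultimately show ?thesis using ops_mult[OF bb_ops[OF F'(2) i] zo] by (simp add: N_def)
    qed
  qed
  have "gF t \<in> N (fst t)" if t: "t \<in> I" for t
  proof -
    define i where "i = fst t"
    have i: "i < n" using It[OF t] by (simp add: i_def)
    have gt: "gF t \<in> ops (dimv F i) 1" using F'(4)[OF t] by (simp add: i_def)
    have eg: "e i * gF t \<in> ops (dimv F i) 1" using ops_mult[OF homD(2)[OF e i] gt] .
    have gens: "fst t < n & gF t \<in> ops (dimv F (fst t)) 1" if "t \<in> I" for t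
      using F'(3,4)[OF that] by simp
    have "\<exists>l a b. e i * gF t = (\<Sum>t\<in>{t\<in>I. fst t = i}. scl (l t) * gF t) + (aa F (pr n i) * a + bb F i * b) &
      a \<in> ops (dimv F (pr n i)) 1 & b \<in> ops (dimv F (sc n i)) 1"
      by (rule generated_span[OF F'(2,5) fin gens i eg])
    then obtain l a b where ab: "e i * gF t = (\<Sum>t\<in>{t\<in>I. fst t = i}. scl (l t) * gF t) + (aa F (pr n i) * a + bb F i * b)"
      "a \<in> ops (dimv F (pr n i)) 1" "b \<in> ops (dimv F (sc n i)) 1"
      by (elim exE conjE) (rule that)
    note tp = top[OF i, unfolded is_top_def]
    have vpa: "v i * (p i * (aa F (pr n i) * a)) = 0" "v i * (p i * (bb F i * b)) = 0"
    proof -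
      have c: "p i * aa F (pr n i) = aa P (pr n i) * p (pr n i)" "p i * bb F i = bb P i * p (sc n i)"
        using homD(3)[OF p(1), of "pr n i"] homD(4)[OF p(1) i] i by simp_all
      have "v i * (p i * (aa F (pr n i) * a)) = v i * (p i * aa F (pr n i)) * a"
        "v i * (p i * (bb F i * b)) = v i * (p i * bb F i) * b" by (simp_all add: mult.assoc)
      then show "v i * (p i * (aa F (pr n i) * a)) = 0" "v i * (p i * (bb F i * b)) = 0"
        unfolding c using tp by (simp_all flip: mult.assoc)
    qed
    have vpg: "v i * (p i * gF s) = un (snd s) 0" if "s \<in> {t\<in>I. fst t = i}" for s
      using p(2)[of s] that tp It(3)[of s] by (auto simp: g_def eye_un simp flip: mult.assoc)
    \<comment> \<open>\<open>p * e = 0\<close>, and passing to the top of \<open>P\<close> turns the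
      generators at \<open>i\<close> into distinct unit columns, so all coefficients
      \<open>l\<close> vanish.\<close>
    have "0 = v i * (p i * (e i * gF t))" by (simp add: pe')
    also have "\<dots> = (\<Sum>s\<in>{t\<in>I. fst t = i}. scl (l s) * (v i * (p i * gF s)))"
      unfolding ab(1) by (simp add: distrib_left sum_distrib_left vpa scl_left_comm[of "v i"] scl_left_comm[of "p i"])
    also have "\<dots> = (\<Sum>s\<in>{t\<in>I. fst t = i}. scl (l s) * un (snd s) 0)"
      by (intro sum.cong refl) (simp add: vpg)
    finally have z: "(\<Sum>s\<in>{t\<in>I. fst t = i}. scl (l s) * un (snd s) 0) = (0 :: 'k lop)" by simp
    have "l s = 0" if s: "s \<in> {t\<in>I. fst t = i}" for s
    proof -
      have "0 = ent (\<Sum>s\<in>{t\<in>I. fst t = i}. scl (l s) * un (snd s) 0) (snd s) 0" by (simp add: z)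
      also have "\<dots> = (\<Sum>s'\<in>{t\<in>I. fst t = i}. if s = s' then l s' else 0)"
        unfolding ent_sum ent_scl ent_un using s by (intro sum.cong refl) (auto simp: prod_eq_iff)
      also have "\<dots> = l s" using s fin by (simp add: sum.delta)
      finally show ?thesis by simp
    qed
    then have "(\<Sum>t\<in>{t\<in>I. fst t = i}. scl (l t) * gF t) = 0" by (intro sum.neutral) auto
    then have "e i * gF t = aa F (pr n i) * a + bb F i * b" using ab(1) by simp
    then have "R i (e i * gF t)" using RI[OF ab(2,3)] by simp
    then show ?thesis using gt by (simp add: N_def i_def)
  qed
  then have rad: "z \<in> N i" if "i < n" "z \<in> ops (dimv F i) 1" for i z
    using generatedD[OF F'(5) N _ that] by blast
  obtain K where K: "\<forall>i<n. \<forall>w. length w = K --> pth F i w = 0" using flmodD(4)[OF pmod_flmod[OF F'(1)]] by blast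
  \<comment> \<open>Each use of \<open>e * e = e\<close> puts one more arrow in front, until the
    path has length \<open>K\<close>.\<close>
  have "i < n ==> z \<in> ops (dimv F i) 1 ==> K \<le> length w + L ==> pth F i w * (e i * z) = 0" for L i w z
  proof (induct L arbitrary: i w z)
    case 0
    then show ?case using pth_zero_mono[OF F'(2) K, of w i] by simp
  next
    case (Suc L)
    obtain a b where ab: "a \<in> ops (dimv F (pr n i)) 1" "b \<in> ops (dimv F (sc n i)) 1"
      "e i * z = aa F (pr n i) * a + bb F i * b" using rad[OF Suc(2,3)] unfolding N_def R_def by auto
    have c: "e i * aa F (pr n i) = aa F (pr n i) * e (pr n i)" "e i * bb F i = bb F i * e (sc n i)"
      using homD(3)[OF e, of "pr n i"] homD(4)[OF e Suc(2)] Suc(2) by simp_all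
    have "e i * z = e i * (aa F (pr n i) * a + bb F i * b)" using ee'[of i z] ab(3) by simp
    also have "\<dots> = aa F (pr n i) * (e (pr n i) * a) + bb F i * (e (sc n i) * b)"
      using c by (simp add: distrib_left flip: mult.assoc)
    finally have "pth F i w * (e i * z) = pth F (pr n i) (True # w) * (e (pr n i) * a) + pth F (sc n i) (False # w) * (e (sc n i) * b)"
      using Suc(2) by (simp add: distrib_left mult.assoc)
    also have "\<dots> = 0"
      using Suc(1)[OF pr_lt[OF Suc(2)] ab(1), of "True # w"] Suc(1)[OF sc_lt[OF Suc(2)] ab(2), of "False # w"] Suc(4) by simp
    finally show ?case .
  qed
  from this[of _ _ "[]" K] have e0: "e i * z = 0" if "i < n" "z \<in> ops (dimv F i) 1" for i z
    using that ops_l'[OF homD(2)[OF e that(1)], of z] by simp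
  have "e = 0"
  proof
    fix i show "e i = 0 i"
    proof (cases "i < n")
      case True
      have "e i = 0" by (rule ops_cols_eqI[OF homD(2)[OF e True] ops_0]) (simp add: e0[OF True] ops_un)
      then show ?thesis by simp
    qed (simp add: homD(1)[OF e])
  qed
  then have "s * p = idn F" by (simp add: e_def)
  then have "free P I fst (%t. p (fst t) * gF t)"
    using free_transport[OF F p(1) s(1) _ s(2) pm] by simp
  then show ?thesis unfolding I_def by blast
qed

definition iso :: "'k::field qrep => 'k qrep => bool" where
  "iso P Q \<longleftrightarrow> (\<exists>f\<in>hom P Q. \<exists>h\<in>hom Q P. h * f = idn P & f * h = idn Q)"

text \<open>A projective module is free on as many generators as its top prescribes, and free
  modules on the same index set are isomorphic.\<close>

lemma projective_iso_iff:
  assumes P: "projective n P" and Q: "projective n Q"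
  shows "iso P Q \<longleftrightarrow> (\<forall>i. 1 \<le> i & i < n --> homS_dim n P i = homS_dim n Q i)"
proof
  obtain g where g: "free P (gset (homS_dim n P)) fst g" using projective_free[OF P] by blast
  obtain h where h: "free Q (gset (homS_dim n Q)) fst h" using projective_free[OF Q] by blast
  show "iso P Q" if "\<forall>i. 1 \<le> i & i < n --> homS_dim n P i = homS_dim n Q i"
  proof -
    have "gset (homS_dim n Q) = gset (homS_dim n P)" using that by (auto simp: gset_def)
    then show ?thesis using free_iso[OF g] h unfolding iso_def by metis
  qed
  assume "iso P Q"
  then obtain f h where "f \<in> hom P Q" "h \<in> hom Q P" "h * f = idn P" "f * h = idn Q" by (auto simp: iso_def)
  from free_transport[OF g this projective_pmod[OF Q]]
  have h': "free Q (gset (homS_dim n P)) fst (%t. f (fst t) * g t)" .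
  then show "\<forall>i. 1 \<le> i & i < n --> homS_dim n P i = homS_dim n Q i"
    using homS_dim_free[OF g gset_finite] homS_dim_free[OF h' gset_finite] by simp
qed

lemma rsum_projective:
  assumes "projective n P" "projective n Q"
  shows "projective n (rsum P Q)"
proof -
  obtain g where g: "free P (gset (homS_dim n P)) fst g" using projective_free[OF assms(1)] by blast
  obtain h where h: "free Q (gset (homS_dim n Q)) fst h" using projective_free[OF assms(2)] by blast
  show ?thesis by (rule free_projective[OF free_sum[OF g h]])
qed

lemma homS_dim_rsum:
  assumes "projective n P" "projective n Q" "1 \<le> i" "i < n"
  shows "homS_dim n (rsum P Q) i = homS_dim n P i + homS_dim n Q i"
proof -
  obtain g where g: "free P (gset (homS_dim n P)) fst g" using projective_free[OF assms(1)] by blast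
  obtain h where h: "free Q (gset (homS_dim n Q)) fst h" using projective_free[OF assms(2)] by blast
  let ?I = "gset (homS_dim n P)" and ?J = "gset (homS_dim n Q)"
  have "homS_dim n (rsum P Q) i = card {t \<in> ?I <+> ?J. case_sum fst fst t = i}"
    by (rule homS_dim_free[OF free_sum[OF g h] _ assms(3,4)]) simp
  also have "{t \<in> ?I <+> ?J. case_sum fst fst t = i} = {t\<in>?I. fst t = i} <+> {t\<in>?J. fst t = i}"
    by auto
  also have "card \<dots> = card {t\<in>?I. fst t = i} + card {t\<in>?J. fst t = i}"
    by (rule card_Plus) auto
  finally show ?thesis using homS_dim_free[OF g _ assms(3,4)] homS_dim_free[OF h _ assms(3,4)] by simp
qed

end

context cyclic
begin

section \<open>Two-term complexes up to homotopy\<close>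

definition dd :: "'k::field cx => nat => 'k lop" where "dd U = fam (dif U)"

lemma cxD:
  assumes "is_cx n U"
  shows "projective n (c1 U)" "projective n (c0 U)" "is_rep n (c1 U)" "is_rep n (c0 U)"
    "dd U \<in> hom (c1 U) (c0 U)" "pmod n (c1 U)" "pmod n (c0 U)"
  using assms morphism_hom[of "c1 U" "c0 U" "dif U"]
  by (auto simp: is_cx_def dd_def projective_rep projective_pmod)

definition mkcx :: "'k::field qrep => 'k qrep => (nat => 'k lop) => 'k cx" where
  "mkcx P1 P0 d = \<lparr>c1 = P1, c0 = P0, dif = unfam P1 P0 d\<rparr>"

lemma mkcx_simps [simp]: "c1 (mkcx P1 P0 d) = P1" "c0 (mkcx P1 P0 d) = P0"
  by (simp_all add: mkcx_def)
lemma mkcx_dd: "d \<in> hom P1 P0 ==> dd (mkcx P1 P0 d) = d"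
  by (simp add: mkcx_def dd_def fam_unfam)
lemma mkcx_cx: "projective n P1 ==> projective n P0 ==> d \<in> hom P1 P0 ==> is_cx n (mkcx P1 P0 d)"
  by (simp add: is_cx_def mkcx_def unfam_morphism projective_rep)

definition heq :: "'k::field cx => 'k cx => bool" where
  "heq U V \<longleftrightarrow> (\<exists>f1\<in>hom (c1 U) (c1 V). \<exists>f0\<in>hom (c0 U) (c0 V). \<exists>g1\<in>hom (c1 V) (c1 U). \<exists>g0\<in>hom (c0 V) (c0 U).
     \<exists>h\<in>hom (c0 U) (c1 U). \<exists>k\<in>hom (c0 V) (c1 V).
     f0 * dd U = dd V * f1 & g0 * dd V = dd U * g1 &
     g1 * f1 = idn (c1 U) + h * dd U & g0 * f0 = idn (c0 U) + dd U * h &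
     f1 * g1 = idn (c1 V) + k * dd V & f0 * g0 = idn (c0 V) + dd V * k)"

definition nullh :: "'k::field cx => bool" where
  "nullh U \<longleftrightarrow> (\<exists>h\<in>hom (c0 U) (c1 U). h * dd U = idn (c1 U) & dd U * h = idn (c0 U))"

text \<open>The vanishing of Hom(U, V[1]) in the homotopy category: between two-term complexes every
  morphism from degree -1 of \<open>U\<close> to degree 0 of \<open>V\<close> is a chain map, and
  the right-hand side lists the null-homotopic ones.\<close>

definition ext0 :: "'k::field cx => 'k cx => bool" where
  "ext0 U V \<longleftrightarrow> (\<forall>f\<in>hom (c1 U) (c0 V). \<exists>h0\<in>hom (c0 U) (c0 V). \<exists>h1\<in>hom (c1 U) (c1 V). f = h0 * dd U + dd V * h1)"

lemma fam_mult_morphism: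
  "morphism n Y Z F ==> morphism n X Y G ==> fam (%i. F i * G i) = fam F * fam G"
  by (rule fam_mult[of F "dimv Z" "dimv Y" G "dimv X"]) (auto dest: morphism_carrier)

lemma chmap_iff:
  assumes "is_cx n U" "is_cx n V"
  shows "chmap n U V F \<longleftrightarrow> morphism n (c1 U) (c1 V) (fst F) & morphism n (c0 U) (c0 V) (snd F) &
    fam (snd F) * dd U = dd V * fam (fst F)"
proof -
  have d: "morphism n (c1 U) (c0 U) (dif U)" "morphism n (c1 V) (c0 V) (dif V)"
    using assms by (auto simp: is_cx_def)
  have "(\<forall>i<n. snd F i * dif U i = dif V i * fst F i) \<longleftrightarrow> fam (snd F) * dd U = dd V * fam (fst F)"
    if m: "morphism n (c1 U) (c1 V) (fst F)" "morphism n (c0 U) (c0 V) (snd F)"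
    using fam_eq_iff[OF mult_carrier_mat[OF morphism_carrier[OF m(2)] morphism_carrier[OF d(1)]]
       mult_carrier_mat[OF morphism_carrier[OF d(2)] morphism_carrier[OF m(1)]]]
      fam_mult_morphism[OF m(2) d(1)] fam_mult_morphism[OF d(2) m(1)] by (simp add: dd_def)
  then show ?thesis unfolding chmap_def by blast
qed

lemma homot_iff:
  assumes U: "is_cx n U" and V: "is_cx n V"
    and F: "\<And>i. i < n ==> fst F i \<in> carrier_mat (dimv (c1 V) i) (dimv (c1 U) i)"
      "\<And>i. i < n ==> snd F i \<in> carrier_mat (dimv (c0 V) i) (dimv (c0 U) i)"
    and G: "\<And>i. i < n ==> fst G i \<in> carrier_mat (dimv (c1 V) i) (dimv (c1 U) i)"
      "\<And>i. i < n ==> snd G i \<in> carrier_mat (dimv (c0 V) i) (dimv (c0 U) i)"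
  shows "homot n U V F G \<longleftrightarrow> (\<exists>h\<in>hom (c0 U) (c1 V). fam (fst F) = fam (fst G) + h * dd U & fam (snd F) = fam (snd G) + dd V * h)"
proof -
  have d: "morphism n (c1 U) (c0 U) (dif U)" "morphism n (c1 V) (c0 V) (dif V)"
    using assms by (auto simp: is_cx_def)
  have "(\<forall>i<n. fst F i - fst G i = h i * dif U i & snd F i - snd G i = dif V i * h i) \<longleftrightarrow>
    fam (fst F) = fam (fst G) + fam h * dd U & fam (snd F) = fam (snd G) + dd V * fam h"
    if m: "morphism n (c0 U) (c1 V) h" for h
  proof -
    have "(\<forall>i<n. fst F i - fst G i = h i * dif U i) \<longleftrightarrow> fam (fst F) - fam (fst G) = fam h * dd U"
      using fam_eq_iff[OF minus_carrier_mat[OF G(1)] mult_carrier_mat[OF morphism_carrier[OF m] morphism_carrier[OF d(1)]]]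
        fam_mult_morphism[OF m d(1)] fam_diff[OF F(1) G(1)] by (simp add: dd_def)
    moreover have "(\<forall>i<n. snd F i - snd G i = dif V i * h i) \<longleftrightarrow> fam (snd F) - fam (snd G) = dd V * fam h"
      using fam_eq_iff[OF minus_carrier_mat[OF G(2)] mult_carrier_mat[OF morphism_carrier[OF d(2)] morphism_carrier[OF m]]]
        fam_mult_morphism[OF d(2) m] fam_diff[OF F(2) G(2)] by (simp add: dd_def)
    ultimately show ?thesis by (auto simp: diff_eq_eq add.commute)
  qed
  then have "homot n U V F G \<longleftrightarrow> (\<exists>h. morphism n (c0 U) (c1 V) h & (fam (fst F) = fam (fst G) + fam h * dd U & fam (snd F) = fam (snd G) + dd V * fam h))"
    unfolding homot_def by blast
  then show ?thesis
    using ex_morphism_iff[OF cxD(4)[OF U] cxD(3)[OF V], where P = "%h. fam (fst F) = fam (fst G) + h * dd U & fam (snd F) = fam (snd G) + dd V * h"]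
    by simp
qed

lemma idm_carrier: "idm X i \<in> carrier_mat (dimv X i) (dimv X i)"
  by (simp add: idm_def)

lemma zeroK_iff:
  assumes "is_cx n U"
  shows "zeroK n U \<longleftrightarrow> nullh U"
proof -
  have "zeroK n U \<longleftrightarrow> (\<exists>h\<in>hom (c0 U) (c1 U). idn (c1 U) = h * dd U & idn (c0 U) = dd U * h)"
    unfolding zeroK_def
    by (subst homot_iff[OF assms assms]) (auto simp: chid_def idm_carrier zmor_def[symmetric] intro: idm_carrier, auto simp: zmor_def)
  then show ?thesis unfolding nullh_def by (metis (no_types))
qed

lemma htpy_equiv_iff:
  assumes U: "is_cx n U" and V: "is_cx n V"
  shows "htpy_equiv n U V \<longleftrightarrow> heq U V"
proof -
  have hom2: "homot n X X (chcomp G F) (chid X) \<longleftrightarrow> (\<exists>h\<in>hom (c0 X) (c1 X).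
      fam (fst G) * fam (fst F) = idn (c1 X) + h * dd X & fam (snd G) * fam (snd F) = idn (c0 X) + dd X * h)"
    if X: "is_cx n X" and F: "chmap n X Y F" and G: "chmap n Y X G" for X Y :: "'a cx" and F G
  proof -
    have m: "morphism n (c1 X) (c1 Y) (fst F)" "morphism n (c0 X) (c0 Y) (snd F)"
      "morphism n (c1 Y) (c1 X) (fst G)" "morphism n (c0 Y) (c0 X) (snd G)"
      using F G by (auto simp: chmap_def)
    show ?thesis
      by (subst homot_iff[OF X X])
        (simp_all add: chcomp_def chid_def mcomp_def idm_carrier fam_mult_morphism[OF m(3) m(1)] fam_mult_morphism[OF m(4) m(2)]
          mult_carrier_mat[OF morphism_carrier[OF m(3)] morphism_carrier[OF m(1)]]
          mult_carrier_mat[OF morphism_carrier[OF m(4)] morphism_carrier[OF m(2)]])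
  qed
  show ?thesis
  proof
    assume "htpy_equiv n U V"
    then obtain F G where FG: "chmap n U V F" "chmap n V U G" "homot n U U (chcomp G F) (chid U)" "homot n V V (chcomp F G) (chid V)"
      by (auto simp: htpy_equiv_def)
    note h = FG(3)[unfolded hom2[OF U FG(1,2)]] FG(4)[unfolded hom2[OF V FG(2,1)]]
    note c = FG(1)[unfolded chmap_iff[OF U V]] FG(2)[unfolded chmap_iff[OF V U]]
    have "fam (fst F) \<in> hom (c1 U) (c1 V)" "fam (snd F) \<in> hom (c0 U) (c0 V)" "fam (fst G) \<in> hom (c1 V) (c1 U)"
      "fam (snd G) \<in> hom (c0 V) (c0 U)"
      using c cxD(3,4)[OF U] cxD(3,4)[OF V] by (auto intro: morphism_hom)
    then show "heq U V" unfolding heq_def using h c by blast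
  next
    assume "heq U V"
    then obtain f1 f0 g1 g0 h k where m: "f1 \<in> hom (c1 U) (c1 V)" "f0 \<in> hom (c0 U) (c0 V)" "g1 \<in> hom (c1 V) (c1 U)" "g0 \<in> hom (c0 V) (c0 U)"
     "h \<in> hom (c0 U) (c1 U)" "k \<in> hom (c0 V) (c1 V)" and eq:
     "f0 * dd U = dd V * f1" "g0 * dd V = dd U * g1"
     "g1 * f1 = idn (c1 U) + h * dd U" "g0 * f0 = idn (c0 U) + dd U * h"
     "f1 * g1 = idn (c1 V) + k * dd V" "f0 * g0 = idn (c0 V) + dd V * k" unfolding heq_def by blast
    define F where "F = (unfam (c1 U) (c1 V) f1, unfam (c0 U) (c0 V) f0)"
    define G where "G = (unfam (c1 V) (c1 U) g1, unfam (c0 V) (c0 U) g0)"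
    have s: "fam (fst F) = f1" "fam (snd F) = f0" "fam (fst G) = g1" "fam (snd G) = g0"
      using m by (simp_all add: F_def G_def fam_unfam)
    have F: "chmap n U V F" unfolding chmap_iff[OF U V] s
      using eq m cxD(3,4)[OF U] cxD(3,4)[OF V] by (simp add: F_def unfam_morphism)
    have G: "chmap n V U G" unfolding chmap_iff[OF V U] s
      using eq m cxD(3,4)[OF U] cxD(3,4)[OF V] by (simp add: G_def unfam_morphism)
    show "htpy_equiv n U V" unfolding htpy_equiv_def
      using F G hom2[OF U F G] hom2[OF V G F] s m eq by metis
  qed
qed

lemma rigid_iff:
  assumes U: "is_cx n U"
  shows "(\<forall>f. morphism n (c1 U) (c0 U) f -->
        (\<exists>h0 h1. morphism n (c0 U) (c0 U) h0 & morphism n (c1 U) (c1 U) h1 &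
            (\<forall>i<n. f i = h0 i * dif U i + dif U i * h1 i))) \<longleftrightarrow> ext0 U U"
proof -
  have d: "morphism n (c1 U) (c0 U) (dif U)" using assms by (auto simp: is_cx_def)
  note r = cxD(3,4)[OF U]
  have eq: "(\<forall>i<n. f i = h0 i * dif U i + dif U i * h1 i) \<longleftrightarrow> fam f = fam h0 * dd U + dd U * fam h1"
    if m: "morphism n (c1 U) (c0 U) f" "morphism n (c0 U) (c0 U) h0" "morphism n (c1 U) (c1 U) h1" for f h0 h1
  proof -
    note c = mult_carrier_mat[OF morphism_carrier[OF m(2)] morphism_carrier[OF d]]
      mult_carrier_mat[OF morphism_carrier[OF d] morphism_carrier[OF m(3)]]
    show ?thesis
      using fam_eq_iff[OF morphism_carrier[OF m(1)] add_carrier_mat[OF c(2)]] fam_add[OF c]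
        fam_mult_morphism[OF m(2) d] fam_mult_morphism[OF d m(3)] by (simp add: dd_def)
  qed
  show ?thesis
  proof
    assume L: "\<forall>f. morphism n (c1 U) (c0 U) f -->
        (\<exists>h0 h1. morphism n (c0 U) (c0 U) h0 & morphism n (c1 U) (c1 U) h1 &
            (\<forall>i<n. f i = h0 i * dif U i + dif U i * h1 i))"
    show "ext0 U U" unfolding ext0_def
    proof
      fix f assume f: "f \<in> hom (c1 U) (c0 U)"
      note m = unfam_morphism[OF r f]
      obtain h0 h1 where h: "morphism n (c0 U) (c0 U) h0" "morphism n (c1 U) (c1 U) h1"
        "\<forall>i<n. unfam (c1 U) (c0 U) f i = h0 i * dif U i + dif U i * h1 i" using L m by blast
      have "f = fam h0 * dd U + dd U * fam h1" using eq[OF m h(1,2)] h(3) fam_unfam[OF f] by simp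
      then show "\<exists>h0\<in>hom (c0 U) (c0 U). \<exists>h1\<in>hom (c1 U) (c1 U). f = h0 * dd U + dd U * h1"
        using morphism_hom[OF r(2,2) h(1)] morphism_hom[OF r(1,1) h(2)] by blast
    qed
  next
    assume E: "ext0 U U"
    show "\<forall>f. morphism n (c1 U) (c0 U) f -->
        (\<exists>h0 h1. morphism n (c0 U) (c0 U) h0 & morphism n (c1 U) (c1 U) h1 &
            (\<forall>i<n. f i = h0 i * dif U i + dif U i * h1 i))"
    proof (intro allI impI)
      fix f assume f: "morphism n (c1 U) (c0 U) f"
      obtain h0 h1 where h: "h0 \<in> hom (c0 U) (c0 U)" "h1 \<in> hom (c1 U) (c1 U)" "fam f = h0 * dd U + dd U * h1"
        using E morphism_hom[OF r f] unfolding ext0_def by blast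
      then show "\<exists>h0 h1. morphism n (c0 U) (c0 U) h0 & morphism n (c1 U) (c1 U) h1 &
            (\<forall>i<n. f i = h0 i * dif U i + dif U i * h1 i)"
        using eq[OF f unfam_morphism[OF r(2,2) h(1)] unfam_morphism[OF r(1,1) h(2)]]
          unfam_morphism[OF r(2,2) h(1)] unfam_morphism[OF r(1,1) h(2)] fam_unfam[OF h(1)] fam_unfam[OF h(2)] by auto
    qed
  qed
qed

lemma presilt_iff: "presilt n U \<longleftrightarrow> is_cx n U & basic n U & ext0 U U"
  unfolding presilt_def using rigid_iff by blast

lemma heq_refl: "is_cx n U ==> heq U U"
  unfolding heq_def
  by (intro bexI[of _ "idn (c1 U)"] bexI[of _ "idn (c0 U)"] bexI[of _ 0])
    (auto simp: cxD hom_id_l[OF cxD(5)] hom_id_r[OF cxD(5)] hom_id_l[OF hom_idn])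

lemma heq_sym: "heq U V ==> heq V U"
  unfolding heq_def by blast

text \<open>The homotopy for the composite is the outer one plus the inner one carried over by the
  outer equivalence, as in \<open>h + g1 * r * f0\<close>.\<close>

lemma heq_trans:
  assumes U: "is_cx n U" and V: "is_cx n V" and W: "is_cx n W" and UV: "heq U V" and VW: "heq V W"
  shows "heq U W"
proof -
  obtain f1 f0 g1 g0 h k where m: "f1 \<in> hom (c1 U) (c1 V)" "f0 \<in> hom (c0 U) (c0 V)" "g1 \<in> hom (c1 V) (c1 U)" "g0 \<in> hom (c0 V) (c0 U)"
     "h \<in> hom (c0 U) (c1 U)" "k \<in> hom (c0 V) (c1 V)" and eq:
     "f0 * dd U = dd V * f1" "g0 * dd V = dd U * g1"
     "g1 * f1 = idn (c1 U) + h * dd U" "g0 * f0 = idn (c0 U) + dd U * h"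
     "f1 * g1 = idn (c1 V) + k * dd V" "f0 * g0 = idn (c0 V) + dd V * k" using UV unfolding heq_def by blast
  obtain p1 p0 q1 q0 r s where m': "p1 \<in> hom (c1 V) (c1 W)" "p0 \<in> hom (c0 V) (c0 W)" "q1 \<in> hom (c1 W) (c1 V)" "q0 \<in> hom (c0 W) (c0 V)"
     "r \<in> hom (c0 V) (c1 V)" "s \<in> hom (c0 W) (c1 W)" and eq':
     "p0 * dd V = dd W * p1" "q0 * dd W = dd V * q1"
     "q1 * p1 = idn (c1 V) + r * dd V" "q0 * p0 = idn (c0 V) + dd V * r"
     "p1 * q1 = idn (c1 W) + s * dd W" "p0 * q0 = idn (c0 W) + dd W * s" using VW unfolding heq_def by blast
  have 1: "g1 * q1 * (p1 * f1) = idn (c1 U) + (h + g1 * r * f0) * dd U"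
  proof -
    have "g1 * q1 * (p1 * f1) = g1 * (q1 * p1) * f1" by (simp add: mult.assoc)
    also have "\<dots> = g1 * f1 + g1 * r * (dd V * f1)"
      unfolding eq' by (simp add: algebra_simps hom_id_l'[OF m(1)] hom_id_l[OF m(1)])
    also have "\<dots> = idn (c1 U) + (h + g1 * r * f0) * dd U"
      unfolding eq(3) eq(1)[symmetric] by (simp add: algebra_simps)
    finally show ?thesis .
  qed
  have 2: "g0 * q0 * (p0 * f0) = idn (c0 U) + dd U * (h + g1 * r * f0)"
  proof -
    have "g0 * q0 * (p0 * f0) = g0 * (q0 * p0) * f0" by (simp add: mult.assoc)
    also have "\<dots> = g0 * f0 + (g0 * dd V) * r * f0"
      unfolding eq' by (simp add: algebra_simps hom_id_l'[OF m(2)] hom_id_l[OF m(2)])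
    also have "\<dots> = idn (c0 U) + dd U * (h + g1 * r * f0)"
      unfolding eq by (simp add: algebra_simps)
    finally show ?thesis .
  qed
  have 3: "p1 * f1 * (g1 * q1) = idn (c1 W) + (s + p1 * k * q0) * dd W"
  proof -
    have "p1 * f1 * (g1 * q1) = p1 * (f1 * g1) * q1" by (simp add: mult.assoc)
    also have "\<dots> = p1 * q1 + p1 * k * (dd V * q1)"
      unfolding eq by (simp add: algebra_simps hom_id_l'[OF m'(3)] hom_id_l[OF m'(3)])
    also have "\<dots> = idn (c1 W) + (s + p1 * k * q0) * dd W"
      unfolding eq'(5) eq'(2)[symmetric] by (simp add: algebra_simps)
    finally show ?thesis .
  qed
  have 4: "p0 * f0 * (g0 * q0) = idn (c0 W) + dd W * (s + p1 * k * q0)"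
  proof -
    have "p0 * f0 * (g0 * q0) = p0 * (f0 * g0) * q0" by (simp add: mult.assoc)
    also have "\<dots> = p0 * q0 + (p0 * dd V) * k * q0"
      unfolding eq by (simp add: algebra_simps hom_id_l'[OF m'(4)] hom_id_l[OF m'(4)])
    also have "\<dots> = idn (c0 W) + dd W * (s + p1 * k * q0)"
      unfolding eq' by (simp add: algebra_simps)
    finally show ?thesis .
  qed
  have 5: "p0 * f0 * dd U = dd W * (p1 * f1)" by (metis eq(1) eq'(1) mult.assoc)
  have 6: "g0 * q0 * dd W = dd U * (g1 * q1)" by (metis eq(2) eq'(2) mult.assoc)
  have h: "h + g1 * r * f0 \<in> hom (c0 U) (c1 U)" "s + p1 * k * q0 \<in> hom (c0 W) (c1 W)"
    using m m' by (auto intro!: hom_add intro: hom_comp)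
  show ?thesis unfolding heq_def
    using 1 2 3 4 5 6 h hom_comp[OF m'(1) m(1)] hom_comp[OF m'(2) m(2)] hom_comp[OF m(3) m'(3)] hom_comp[OF m(4) m'(4)]
    by blast
qed

text \<open>Pull \<open>f\<close> back along \<open>f1\<close>, trivialise it over \<open>U\<close>,
  and push the result forward along \<open>g1\<close>; the homotopy \<open>k\<close> accounts for
  \<open>f1 * g1\<close> not being the identity.\<close>

lemma ext0_heq_left:
  assumes U: "is_cx n U" and U': "is_cx n U'" and heq: "heq U U'" and E: "ext0 U V" and V: "is_cx n V"
  shows "ext0 U' V"
  unfolding ext0_def
proof
  obtain f1 f0 g1 g0 h k where m: "f1 \<in> hom (c1 U) (c1 U')" "f0 \<in> hom (c0 U) (c0 U')" "g1 \<in> hom (c1 U') (c1 U)" "g0 \<in> hom (c0 U') (c0 U)"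
     "k \<in> hom (c0 U') (c1 U')" and eq:
     "g0 * dd U' = dd U * g1" "f1 * g1 = idn (c1 U') + k * dd U'" using heq unfolding heq_def by blast
  fix f assume f: "f \<in> hom (c1 U') (c0 V)"
  obtain h0 h1 where h: "h0 \<in> hom (c0 U) (c0 V)" "h1 \<in> hom (c1 U) (c1 V)" "f * f1 = h0 * dd U + dd V * h1"
    using E hom_comp[OF f m(1)] unfolding ext0_def by blast
  have "f * (f1 * g1) = (h0 * dd U + dd V * h1) * g1" by (simp flip: h(3) mult.assoc)
  then have "f = (h0 * g0 - f * k) * dd U' + dd V * (h1 * g1)"
    unfolding eq(2) using hom_id_r[OF f]
    by (simp add: algebra_simps mult.assoc eq(1))
  moreover have "h0 * g0 - f * k \<in> hom (c0 U') (c0 V)" "h1 * g1 \<in> hom (c1 U') (c1 V)"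
    using h m f by (auto intro!: hom_diff intro: hom_comp)
  ultimately show "\<exists>h0\<in>hom (c0 U') (c0 V). \<exists>h1\<in>hom (c1 U') (c1 V). f = h0 * dd U' + dd V * h1" by blast
qed

lemma ext0_heq_right:
  assumes V: "is_cx n V" and V': "is_cx n V'" and heq: "heq V V'" and E: "ext0 U V" and U: "is_cx n U"
  shows "ext0 U V'"
  unfolding ext0_def
proof
  obtain f1 f0 g1 g0 h k where m: "f1 \<in> hom (c1 V) (c1 V')" "f0 \<in> hom (c0 V) (c0 V')" "g1 \<in> hom (c1 V') (c1 V)" "g0 \<in> hom (c0 V') (c0 V)"
     "k \<in> hom (c0 V') (c1 V')" and eq:
     "f0 * dd V = dd V' * f1" "f0 * g0 = idn (c0 V') + dd V' * k" using heq unfolding heq_def by blast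
  fix f assume f: "f \<in> hom (c1 U) (c0 V')"
  obtain h0 h1 where h: "h0 \<in> hom (c0 U) (c0 V)" "h1 \<in> hom (c1 U) (c1 V)" "g0 * f = h0 * dd U + dd V * h1"
    using E hom_comp[OF m(4) f] unfolding ext0_def by blast
  have "f0 * g0 * f = f0 * (h0 * dd U + dd V * h1)" by (simp add: mult.assoc flip: h(3))
  then have "f + dd V' * (k * f) = f0 * h0 * dd U + (f0 * dd V) * h1"
    unfolding eq(2) using hom_id_l[OF f] by (simp add: algebra_simps)
  then have "f = (f0 * h0) * dd U + dd V' * (f1 * h1 - k * f)"
    unfolding eq(1) by (simp add: algebra_simps)
  moreover have "f0 * h0 \<in> hom (c0 U) (c0 V')" "f1 * h1 - k * f \<in> hom (c1 U) (c1 V')"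
    using h m f by (auto intro!: hom_diff intro: hom_comp)
  ultimately show "\<exists>h0\<in>hom (c0 U) (c0 V'). \<exists>h1\<in>hom (c1 U) (c1 V'). f = h0 * dd U + dd V' * h1" by blast
qed

lemma cxsum_simps [simp]: "c1 (cxsum U V) = rsum (c1 U) (c1 V)" "c0 (cxsum U V) = rsum (c0 U) (c0 V)"
  by (simp_all add: cxsum_def)

lemma cxsum_dd:
  assumes "is_cx n U" "is_cx n V"
  shows "dd (cxsum U V) = in1 (c0 U) (c0 V) * dd U * pj1 (c1 U) (c1 V) + in2 (c0 U) (c0 V) * dd V * pj2 (c1 U) (c1 V)"
proof
  fix i
  have d: "morphism n (c1 U) (c0 U) (dif U)" "morphism n (c1 V) (c0 V) (dif V)"
    using assms by (auto simp: is_cx_def)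
  show "dd (cxsum U V) i = (in1 (c0 U) (c0 V) * dd U * pj1 (c1 U) (c1 V) + in2 (c0 U) (c0 V) * dd V * pj2 (c1 U) (c1 V)) i"
  proof (cases "i < n")
    case True
    note o = opm_ops'[OF morphism_carrier[OF d(1) True]] opm_ops'[OF morphism_carrier[OF d(2) True]]
    show ?thesis using True morphism_carrier[OF d(1) True]
      by (simp add: dd_def fam_def cxsum_def opm_bdiag in1_def in2_def pj1_def pj2_def mult.assoc
        ops_l[OF o(1)] ops_r[OF o(1)] ops_l'[OF o(2)] ops_r'[OF o(2)])
  qed (simp add: dd_def fam_def in1_def in2_def)
qed

lemma cxsum_cx:
  assumes "is_cx n U" "is_cx n V"
  shows "is_cx n (cxsum U V)"
proof -
  let ?W = "cxsum U V"
  note U = cxD[OF assms(1)] and V = cxD[OF assms(2)]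
  have d: "morphism n (c1 U) (c0 U) (dif U)" "morphism n (c1 V) (c0 V) (dif V)"
    using assms by (auto simp: is_cx_def)
  have "dd ?W \<in> hom (c1 ?W) (c0 ?W)"
    unfolding cxsum_dd[OF assms] cxsum_simps
    using sum_maps_hom[OF U(3) V(3)] sum_maps_hom[OF U(4) V(4)] U V
    by (intro hom_add hom_comp) auto
  then have "morphism n (c1 ?W) (c0 ?W) (unfam (c1 ?W) (c0 ?W) (dd ?W))"
    using U V by (intro unfam_morphism) auto
  moreover have "unfam (c1 ?W) (c0 ?W) (dd ?W) i = dif ?W i" if i: "i < n" for i
  proof -
    have "dif ?W i \<in> carrier_mat (dimv (c0 ?W) i) (dimv (c1 ?W) i)"
      using morphism_carrier[OF d(1) i] morphism_carrier[OF d(2) i] by (simp add: cxsum_def bdiag_def)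
    then show ?thesis using i by (simp add: unfam_def dd_def fam_def matop_opm)
  qed
  ultimately have "morphism n (c1 ?W) (c0 ?W) (dif ?W)"
    unfolding morphism_def by simp
  then show ?thesis using rsum_projective[OF U(1) V(1)] rsum_projective[OF U(2) V(2)] by (simp add: is_cx_def)
qed

lemma ext0_sum_left:
  assumes U: "is_cx n U" and U': "is_cx n U'" and V: "is_cx n V"
  shows "ext0 (cxsum U U') V \<longleftrightarrow> ext0 U V & ext0 U' V"
proof -
  note u = cxD[OF U] and u' = cxD[OF U'] and v = cxD[OF V]
  note s1 = sum_maps_hom[OF u(3) u'(3)] and s0 = sum_maps_hom[OF u(4) u'(4)]
  note d = cxsum_dd[OF U U']
  have da: "dd (cxsum U U') * in1 (c1 U) (c1 U') = in1 (c0 U) (c0 U') * dd U"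
    "dd (cxsum U U') * in2 (c1 U) (c1 U') = in2 (c0 U) (c0 U') * dd U'"
    unfolding d by (simp_all add: distrib_right mult.assoc sum_maps hom_id_r[OF u(5)] hom_id_r[OF u'(5)])
  show ?thesis
  proof (intro iffI conjI)
    assume E: "ext0 (cxsum U U') V"
    show "ext0 U V" unfolding ext0_def
    proof
      fix f assume f: "f \<in> hom (c1 U) (c0 V)"
      obtain h0 h1 where h: "h0 \<in> hom (rsum (c0 U) (c0 U')) (c0 V)" "h1 \<in> hom (rsum (c1 U) (c1 U')) (c1 V)"
        "f * pj1 (c1 U) (c1 U') = h0 * dd (cxsum U U') + dd V * h1"
        using E hom_comp[OF f s1(3)] unfolding ext0_def cxsum_simps by blast
      have "f = f * pj1 (c1 U) (c1 U') * in1 (c1 U) (c1 U')"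
        by (simp add: mult.assoc sum_maps hom_id_r[OF f])
      also have "\<dots> = (h0 * in1 (c0 U) (c0 U')) * dd U + dd V * (h1 * in1 (c1 U) (c1 U'))"
        unfolding h(3) by (simp add: distrib_right mult.assoc da)
      finally show "\<exists>h0\<in>hom (c0 U) (c0 V). \<exists>h1\<in>hom (c1 U) (c1 V). f = h0 * dd U + dd V * h1"
        using hom_comp[OF h(1) s0(1)] hom_comp[OF h(2) s1(1)] by blast
    qed
    show "ext0 U' V" unfolding ext0_def
    proof
      fix f assume f: "f \<in> hom (c1 U') (c0 V)"
      obtain h0 h1 where h: "h0 \<in> hom (rsum (c0 U) (c0 U')) (c0 V)" "h1 \<in> hom (rsum (c1 U) (c1 U')) (c1 V)"
        "f * pj2 (c1 U) (c1 U') = h0 * dd (cxsum U U') + dd V * h1"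
        using E hom_comp[OF f s1(4)] unfolding ext0_def cxsum_simps by blast
      have "f = f * pj2 (c1 U) (c1 U') * in2 (c1 U) (c1 U')"
        by (simp add: mult.assoc sum_maps hom_id_r[OF f])
      also have "\<dots> = (h0 * in2 (c0 U) (c0 U')) * dd U' + dd V * (h1 * in2 (c1 U) (c1 U'))"
        unfolding h(3) by (simp add: distrib_right mult.assoc da)
      finally show "\<exists>h0\<in>hom (c0 U') (c0 V). \<exists>h1\<in>hom (c1 U') (c1 V). f = h0 * dd U' + dd V * h1"
        using hom_comp[OF h(1) s0(2)] hom_comp[OF h(2) s1(2)] by blast
    qed
  next
    assume E: "ext0 U V & ext0 U' V"
    show "ext0 (cxsum U U') V" unfolding ext0_def cxsum_simps
    proof
      fix f assume f: "f \<in> hom (rsum (c1 U) (c1 U')) (c0 V)"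
      obtain h0 h1 where h: "h0 \<in> hom (c0 U) (c0 V)" "h1 \<in> hom (c1 U) (c1 V)" "f * in1 (c1 U) (c1 U') = h0 * dd U + dd V * h1"
        using E hom_comp[OF f s1(1)] unfolding ext0_def by blast
      obtain k0 k1 where k: "k0 \<in> hom (c0 U') (c0 V)" "k1 \<in> hom (c1 U') (c1 V)" "f * in2 (c1 U) (c1 U') = k0 * dd U' + dd V * k1"
        using E hom_comp[OF f s1(2)] unfolding ext0_def by blast
      have "f = f * (in1 (c1 U) (c1 U') * pj1 (c1 U) (c1 U') + in2 (c1 U) (c1 U') * pj2 (c1 U) (c1 U'))"
        by (simp add: sum_maps hom_id_r[OF f])
      also have "\<dots> = (f * in1 (c1 U) (c1 U')) * pj1 (c1 U) (c1 U') + (f * in2 (c1 U) (c1 U')) * pj2 (c1 U) (c1 U')"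
        by (simp add: distrib_left mult.assoc)
      also have "\<dots> = (h0 * pj1 (c0 U) (c0 U') + k0 * pj2 (c0 U) (c0 U')) * dd (cxsum U U')
         + dd V * (h1 * pj1 (c1 U) (c1 U') + k1 * pj2 (c1 U) (c1 U'))"
        unfolding h(3) k(3) d by (simp add: algebra_simps sum_maps' hom_id_l'[OF u(5)] hom_id_l'[OF u'(5)])
      finally show "\<exists>h0\<in>hom (rsum (c0 U) (c0 U')) (c0 V). \<exists>h1\<in>hom (rsum (c1 U) (c1 U')) (c1 V). f = h0 * dd (cxsum U U') + dd V * h1"
        using hom_add[OF hom_comp[OF h(1) s0(3)] hom_comp[OF k(1) s0(4)]]
          hom_add[OF hom_comp[OF h(2) s1(3)] hom_comp[OF k(2) s1(4)]] by blast
    qed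
  qed
qed

lemma ext0_sum_right:
  assumes U: "is_cx n U" and U': "is_cx n U'" and V: "is_cx n V"
  shows "ext0 V (cxsum U U') \<longleftrightarrow> ext0 V U & ext0 V U'"
proof -
  note u = cxD[OF U] and u' = cxD[OF U'] and v = cxD[OF V]
  note s1 = sum_maps_hom[OF u(3) u'(3)] and s0 = sum_maps_hom[OF u(4) u'(4)]
  note d = cxsum_dd[OF U U']
  have da: "pj1 (c0 U) (c0 U') * dd (cxsum U U') = dd U * pj1 (c1 U) (c1 U')"
    "pj2 (c0 U) (c0 U') * dd (cxsum U U') = dd U' * pj2 (c1 U) (c1 U')"
    unfolding d by (simp_all add: distrib_left mult.assoc sum_maps' hom_id_l'[OF u(5)] hom_id_l'[OF u'(5)])
  show ?thesis
  proof (intro iffI conjI)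
    assume E: "ext0 V (cxsum U U')"
    show "ext0 V U" unfolding ext0_def
    proof
      fix f assume f: "f \<in> hom (c1 V) (c0 U)"
      obtain h0 h1 where h: "h0 \<in> hom (c0 V) (rsum (c0 U) (c0 U'))" "h1 \<in> hom (c1 V) (rsum (c1 U) (c1 U'))"
        "in1 (c0 U) (c0 U') * f = h0 * dd V + dd (cxsum U U') * h1"
        using E hom_comp[OF s0(1) f] unfolding ext0_def cxsum_simps by blast
      have "f = pj1 (c0 U) (c0 U') * (in1 (c0 U) (c0 U') * f)"
        by (simp add: sum_maps' hom_id_l[OF f])
      also have "\<dots> = (pj1 (c0 U) (c0 U') * h0) * dd V + dd U * (pj1 (c1 U) (c1 U') * h1)"
        unfolding h(3) by (simp add: distrib_left da flip: mult.assoc)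
      finally show "\<exists>h0\<in>hom (c0 V) (c0 U). \<exists>h1\<in>hom (c1 V) (c1 U). f = h0 * dd V + dd U * h1"
        using hom_comp[OF s0(3) h(1)] hom_comp[OF s1(3) h(2)] by blast
    qed
    show "ext0 V U'" unfolding ext0_def
    proof
      fix f assume f: "f \<in> hom (c1 V) (c0 U')"
      obtain h0 h1 where h: "h0 \<in> hom (c0 V) (rsum (c0 U) (c0 U'))" "h1 \<in> hom (c1 V) (rsum (c1 U) (c1 U'))"
        "in2 (c0 U) (c0 U') * f = h0 * dd V + dd (cxsum U U') * h1"
        using E hom_comp[OF s0(2) f] unfolding ext0_def cxsum_simps by blast
      have "f = pj2 (c0 U) (c0 U') * (in2 (c0 U) (c0 U') * f)"
        by (simp add: sum_maps' hom_id_l[OF f])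
      also have "\<dots> = (pj2 (c0 U) (c0 U') * h0) * dd V + dd U' * (pj2 (c1 U) (c1 U') * h1)"
        unfolding h(3) by (simp add: distrib_left da flip: mult.assoc)
      finally show "\<exists>h0\<in>hom (c0 V) (c0 U'). \<exists>h1\<in>hom (c1 V) (c1 U'). f = h0 * dd V + dd U' * h1"
        using hom_comp[OF s0(4) h(1)] hom_comp[OF s1(4) h(2)] by blast
    qed
  next
    assume E: "ext0 V U & ext0 V U'"
    show "ext0 V (cxsum U U')" unfolding ext0_def cxsum_simps
    proof
      fix f assume f: "f \<in> hom (c1 V) (rsum (c0 U) (c0 U'))"
      obtain h0 h1 where h: "h0 \<in> hom (c0 V) (c0 U)" "h1 \<in> hom (c1 V) (c1 U)" "pj1 (c0 U) (c0 U') * f = h0 * dd V + dd U * h1"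
        using E hom_comp[OF s0(3) f] unfolding ext0_def by blast
      obtain k0 k1 where k: "k0 \<in> hom (c0 V) (c0 U')" "k1 \<in> hom (c1 V) (c1 U')" "pj2 (c0 U) (c0 U') * f = k0 * dd V + dd U' * k1"
        using E hom_comp[OF s0(4) f] unfolding ext0_def by blast
      have "f = (in1 (c0 U) (c0 U') * pj1 (c0 U) (c0 U') + in2 (c0 U) (c0 U') * pj2 (c0 U) (c0 U')) * f"
        by (simp add: sum_maps hom_id_l[OF f])
      also have "\<dots> = in1 (c0 U) (c0 U') * (pj1 (c0 U) (c0 U') * f) + in2 (c0 U) (c0 U') * (pj2 (c0 U) (c0 U') * f)"
        by (simp add: distrib_right mult.assoc)
      also have "\<dots> = (in1 (c0 U) (c0 U') * h0 + in2 (c0 U) (c0 U') * k0) * dd V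
         + dd (cxsum U U') * (in1 (c1 U) (c1 U') * h1 + in2 (c1 U) (c1 U') * k1)"
        unfolding h(3) k(3) d by (simp add: algebra_simps sum_maps' hom_id_l[OF h(2)] hom_id_l[OF k(2)])
      finally show "\<exists>h0\<in>hom (c0 V) (rsum (c0 U) (c0 U')). \<exists>h1\<in>hom (c1 V) (rsum (c1 U) (c1 U')). f = h0 * dd V + dd (cxsum U U') * h1"
        using hom_add[OF hom_comp[OF s0(1) h(1)] hom_comp[OF s0(2) k(1)]]
          hom_add[OF hom_comp[OF s1(1) h(2)] hom_comp[OF s1(2) k(2)]] by blast
    qed
  qed
qed

text \<open>Minus the contraction of \<open>V\<close>, extended by zero, is a homotopy from the
  identity of the sum to the projection onto \<open>U\<close>.\<close>

lemma heq_sum_null: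
  assumes U: "is_cx n U" and V: "is_cx n V" and null: "nullh V"
  shows "heq U (cxsum U V)"
proof -
  note u = cxD[OF U] and v = cxD[OF V]
  note s1 = sum_maps_hom[OF u(3) v(3)] and s0 = sum_maps_hom[OF u(4) v(4)]
  note d = cxsum_dd[OF U V]
  obtain h where h: "h \<in> hom (c0 V) (c1 V)" "h * dd V = idn (c1 V)" "dd V * h = idn (c0 V)"
    using null by (auto simp: nullh_def)
  let ?k = "- (in2 (c1 U) (c1 V) * h * pj2 (c0 U) (c0 V))"
  have k: "?k \<in> hom (rsum (c0 U) (c0 V)) (rsum (c1 U) (c1 V))"
    using h s1 s0 by (intro hom_minus hom_comp) auto
  have e1: "in1 (c0 U) (c0 V) * dd U = dd (cxsum U V) * in1 (c1 U) (c1 V)"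
    unfolding d by (simp add: distrib_right mult.assoc sum_maps hom_id_r[OF u(5)])
  have e2: "pj1 (c0 U) (c0 V) * dd (cxsum U V) = dd U * pj1 (c1 U) (c1 V)"
    unfolding d by (simp add: distrib_left mult.assoc sum_maps' hom_id_l'[OF u(5)])
  have e3: "in1 (c1 U) (c1 V) * pj1 (c1 U) (c1 V) = idn (rsum (c1 U) (c1 V)) + ?k * dd (cxsum U V)"
  proof -
    have "?k * dd (cxsum U V) = - (in2 (c1 U) (c1 V) * ((h * dd V) * pj2 (c1 U) (c1 V)))"
      unfolding d by (simp add: algebra_simps sum_maps' hom_id_l'[OF v(5)])
    then show ?thesis using sum_maps(5)[of "c1 U" "c1 V"] h(2) hom_id_l[OF s1(4)] by (simp flip: sum_maps(5))
  qed
  have e4: "in1 (c0 U) (c0 V) * pj1 (c0 U) (c0 V) = idn (rsum (c0 U) (c0 V)) + dd (cxsum U V) * ?k"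
  proof -
    have "dd (cxsum U V) * ?k = - (in2 (c0 U) (c0 V) * ((dd V * h) * pj2 (c0 U) (c0 V)))"
      unfolding d by (simp add: algebra_simps sum_maps' hom_id_l'[OF h(1)])
    then show ?thesis using sum_maps(5)[of "c0 U" "c0 V"] h(3) hom_id_l[OF s0(4)] by (simp flip: sum_maps(5))
  qed
  have e5: "pj1 (c1 U) (c1 V) * in1 (c1 U) (c1 V) = idn (c1 U) + 0 * dd U"
    "pj1 (c0 U) (c0 V) * in1 (c0 U) (c0 V) = idn (c0 U) + dd U * 0" by (simp_all add: sum_maps)
  show ?thesis unfolding heq_def cxsum_simps
    using s1(1,3) s0(1,3) k hom_0 e1 e2 e3 e4 e5 by blast
qed

lemma heq_iso:
  assumes U: "is_cx n U" and V: "is_cx n V"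
    and f: "f1 \<in> hom (c1 U) (c1 V)" "f0 \<in> hom (c0 U) (c0 V)" "g1 \<in> hom (c1 V) (c1 U)" "g0 \<in> hom (c0 V) (c0 U)"
    and inv: "g1 * f1 = idn (c1 U)" "f1 * g1 = idn (c1 V)" "g0 * f0 = idn (c0 U)" "f0 * g0 = idn (c0 V)"
    and comm: "f0 * dd U = dd V * f1"
  shows "heq U V"
proof -
  have "g0 * dd V = g0 * (dd V * f1) * g1"
    using inv hom_id_r[OF cxD(5)[OF V]] by (simp add: mult.assoc)
  also have "\<dots> = g0 * (f0 * dd U) * g1" by (simp add: comm)
  also have "\<dots> = dd U * g1"
    using inv hom_id_l[OF hom_comp[OF cxD(5)[OF U] f(3)]] by (simp flip: mult.assoc)
  finally have "g0 * dd V = dd U * g1" .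
  then have "f0 * dd U = dd V * f1 & g0 * dd V = dd U * g1 &
     g1 * f1 = idn (c1 U) + 0 * dd U & g0 * f0 = idn (c0 U) + dd U * 0 &
     f1 * g1 = idn (c1 V) + 0 * dd V & f0 * g0 = idn (c0 V) + dd V * 0"
    using inv comm by simp
  then show ?thesis unfolding heq_def
    by (rule_tac bexI[of _ f1], rule_tac bexI[of _ f0], rule_tac bexI[of _ g1], rule_tac bexI[of _ g0],
      rule_tac bexI[of _ 0], rule_tac bexI[of _ 0]) (simp_all add: f)
qed

lemma clsCx_sum:
  assumes "is_cx n U" "is_cx n V"
  shows "clsCx n (cxsum U V) i = clsCx n U i + clsCx n V i"
  using cxD[OF assms(1)] cxD[OF assms(2)] by (auto simp: clsCx_def homS_dim_rsum)

lemma nullh_clsCx: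
  assumes U: "is_cx n U" and "nullh U"
  shows "clsCx n U = (%_. 0)"
proof -
  have "iso (c1 U) (c0 U)" using assms cxD(5)[OF U] unfolding nullh_def iso_def by blast
  then show ?thesis using projective_iso_iff[OF cxD(1,2)[OF U]] by (auto simp: clsCx_def)
qed

text \<open>The class is an Euler characteristic. The cone of a homotopy equivalence is
  contractible, so degree 0 of \<open>U\<close> plus degree -1 of \<open>V\<close> is isomorphic to
  degree 0 of \<open>V\<close> plus degree -1 of \<open>U\<close>.\<close>

lemma heq_clsCx:
  assumes U: "is_cx n U" and V: "is_cx n V" and heq: "heq U V"
  shows "clsCx n U = clsCx n V"
proof -
  have main: "\<exists>f\<in>hom (rsum (c0 U) (c1 V)) (rsum (c0 V) (c1 U)). \<exists>g\<in>hom (rsum (c0 V) (c1 U)) (rsum (c0 U) (c1 V)). g * f = idn (rsum (c0 U) (c1 V))"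
    if U: "is_cx n U" and V: "is_cx n V" and heq: "heq U V" for U V :: "'a cx"
  proof -
    note u = cxD[OF U] and v = cxD[OF V]
    obtain f1 f0 g1 g0 h k where m: "f1 \<in> hom (c1 U) (c1 V)" "f0 \<in> hom (c0 U) (c0 V)" "g1 \<in> hom (c1 V) (c1 U)" "g0 \<in> hom (c0 V) (c0 U)"
     "h \<in> hom (c0 U) (c1 U)" "k \<in> hom (c0 V) (c1 V)" and eq:
     "f0 * dd U = dd V * f1" "g0 * dd V = dd U * g1"
     "g1 * f1 = idn (c1 U) + h * dd U" "g0 * f0 = idn (c0 U) + dd U * h"
     "f1 * g1 = idn (c1 V) + k * dd V" "f0 * g0 = idn (c0 V) + dd V * k" using heq unfolding heq_def by blast
    note s = sum_maps_hom[OF u(4) v(3)] and t = sum_maps_hom[OF v(4) u(3)]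
    let ?i1 = "in1 (c0 U) (c1 V)" and ?i2 = "in2 (c0 U) (c1 V)" and ?p1 = "pj1 (c0 U) (c1 V)" and ?p2 = "pj2 (c0 U) (c1 V)"
    let ?j1 = "in1 (c0 V) (c1 U)" and ?j2 = "in2 (c0 V) (c1 U)" and ?q1 = "pj1 (c0 V) (c1 U)" and ?q2 = "pj2 (c0 V) (c1 U)"
    \<comment> \<open>\<open>A\<close> and \<open>B\<close> are the rows \<open>(f0, dd V)\<close>
      and \<open>(h, g1)\<close> of the map \<open>F\<close>; below, \<open>p\<close> and
      \<open>q\<close> are the components of an explicit left inverse of it.\<close>
    define A where "A = f0 * ?p1 + dd V * ?p2"
    define B where "B = h * ?p1 + g1 * ?p2"
    have A: "A \<in> hom (rsum (c0 U) (c1 V)) (c0 V)" unfolding A_def using m s v by (intro hom_add hom_comp) auto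
    have B: "B \<in> hom (rsum (c0 U) (c1 V)) (c1 U)" unfolding B_def using m s u by (intro hom_add hom_comp) auto
    define F where "F = ?j1 * A + ?j2 * B"
    define p where "p = g0 * ?q1 - dd U * ?q2"
    define q where "q = f1 * ?q2 - k * ?q1 + (k * f0 - f1 * h) * p"
    have p: "p \<in> hom (rsum (c0 V) (c1 U)) (c0 U)" unfolding p_def using m t u by (intro hom_diff hom_comp) auto
    have q: "q \<in> hom (rsum (c0 V) (c1 U)) (c1 V)" unfolding q_def
      using m t p by (intro hom_add hom_diff) (auto intro: hom_comp hom_diff)
    have F: "F \<in> hom (rsum (c0 U) (c1 V)) (rsum (c0 V) (c1 U))" unfolding F_def using A B t by (intro hom_add hom_comp) auto
    have qF: "?q1 * F = A" "?q2 * F = B"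
      unfolding F_def by (simp_all add: distrib_left sum_maps' hom_id_l[OF A] hom_id_l[OF B])
    have pF: "p * F = ?p1"
    proof -
      have "p * F = g0 * A - dd U * B" unfolding p_def by (simp add: left_diff_distrib mult.assoc qF)
      also have "\<dots> = (g0 * f0) * ?p1 + (g0 * dd V) * ?p2 - dd U * h * ?p1 - dd U * g1 * ?p2"
        unfolding A_def B_def by (simp add: algebra_simps)
      also have "\<dots> = ?p1" unfolding eq by (simp add: algebra_simps hom_id_l[OF s(3)])
      finally show ?thesis .
    qed
    have "q * F = f1 * B - k * A + (k * f0 - f1 * h) * ?p1"
      unfolding q_def by (simp add: distrib_right left_diff_distrib mult.assoc qF pF)
    also have "\<dots> = (f1 * g1) * ?p2 - k * dd V * ?p2"
      unfolding A_def B_def by (simp add: algebra_simps)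
    also have "\<dots> = ?p2" unfolding eq by (simp add: algebra_simps hom_id_l[OF s(4)])
    finally have qF': "q * F = ?p2" .
    have "(?i1 * p + ?i2 * q) * F = idn (rsum (c0 U) (c1 V))"
      by (simp add: distrib_right mult.assoc pF qF' sum_maps)
    moreover have "?i1 * p + ?i2 * q \<in> hom (rsum (c0 V) (c1 U)) (rsum (c0 U) (c1 V))"
      using p q s by (intro hom_add hom_comp) auto
    ultimately show ?thesis using F by blast
  qed
  let ?X = "rsum (c0 U) (c1 V)" and ?Y = "rsum (c0 V) (c1 U)"
  obtain f g where fg: "f \<in> hom ?X ?Y" "g \<in> hom ?Y ?X" "g * f = idn ?X" using main[OF U V heq] by blast
  obtain f' g' where fg': "f' \<in> hom ?Y ?X" "g' \<in> hom ?X ?Y" "g' * f' = idn ?Y" using main[OF V U heq_sym[OF heq]] by blast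
  \<comment> \<open>Exchanging \<open>U\<close> and \<open>V\<close> gives a split injection the
    other way, so the dimensions agree and the left inverse is two-sided.\<close>
  have dim: "dimv ?X i = dimv ?Y i" if i: "i < n" for i
  proof (rule le_antisym)
    have "g i * f i = eye (dimv ?X i)" using fun_cong[OF fg(3), of i] i by (simp add: idn_apply)
    then show "dimv ?X i \<le> dimv ?Y i" using dim_le[OF homD(2)[OF fg(2) i]] ops_r[OF homD(2)[OF fg(1) i]] by blast
    have "g' i * f' i = eye (dimv ?Y i)" using fun_cong[OF fg'(3), of i] i by (simp add: idn_apply)
    then show "dimv ?Y i \<le> dimv ?X i" using dim_le[OF homD(2)[OF fg'(2) i]] ops_r[OF homD(2)[OF fg'(1) i]] by blast
  qed
  have "f * g = idn ?Y"
  proof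
    fix i show "(f * g) i = idn ?Y i"
    proof (cases "i < n")
      case True
      have "g i * f i = eye (dimv ?X i)" using fun_cong[OF fg(3), of i] True by (simp add: idn_apply)
      then have "f i * g i = eye (dimv ?X i)"
        using square_inverse[of "f i" "dimv ?X i" "g i"] homD(2)[OF fg(1) True] homD(2)[OF fg(2) True] dim[OF True] by metis
      then show ?thesis using dim[OF True] True by (simp add: idn_apply)
    qed (simp add: idn_def homD(1)[OF fg(1)])
  qed
  then have iso: "iso ?X ?Y" using fg unfolding iso_def by blast
  note u = cxD[OF U] and v = cxD[OF V]
  have "homS_dim n (c0 U) i + homS_dim n (c1 V) i = homS_dim n (c0 V) i + homS_dim n (c1 U) i" if "1 \<le> i" "i < n" for i
    using iso projective_iso_iff[OF rsum_projective[OF u(2) v(1)] rsum_projective[OF v(2) u(1)]]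
      homS_dim_rsum[OF u(2) v(1) that] homS_dim_rsum[OF v(2) u(1) that] that by metis
  then show ?thesis by (force simp: clsCx_def fun_eq_iff)
qed

end

context cyclic
begin

section \<open>String modules\<close>

text \<open>A line on the vertices \<open>lo, ..., hi - 1\<close>. The edge between
  \<open>j - 1\<close> and \<open>j\<close> carries the upward arrow if \<open>R j\<close> and the
  downward arrow otherwise; the edge that closes the cycle is never present.\<close>

definition strmod :: "nat => nat => (nat => bool) => 'k::field qrep" where
  "strmod lo hi R = mkrep (%i. if lo \<le> i & i < hi then 1 else 0)
    (%i. if lo \<le> i & Suc i < hi & R (Suc i) then un 0 0 else 0)
    (%i. if lo \<le> i & Suc i < hi & \<not> R (Suc i) then un 0 0 else 0)"

lemma strmod_rep [simp]: "is_rep n (strmod lo hi R)"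
  by (simp add: strmod_def)
lemma strmod_dimv: "hi \<le> n ==> dimv (strmod lo hi R) i = (if lo \<le> i & i < hi then 1 else 0)"
  by (simp add: strmod_def)
lemma strmod_aa: "hi \<le> n ==> i < n ==> aa (strmod lo hi R) i = (if lo \<le> i & Suc i < hi & R (Suc i) then un 0 0 else 0)"
  unfolding strmod_def by (subst mkrep_aa) (auto simp: sc_if intro!: ops_un)
lemma strmod_bb: "hi \<le> n ==> i < n ==> bb (strmod lo hi R) i = (if lo \<le> i & Suc i < hi & \<not> R (Suc i) then un 0 0 else 0)"
  unfolding strmod_def by (subst mkrep_bb) (auto simp: sc_if intro!: ops_un)

lemma strmod_flmod:
  assumes hi: "hi \<le> n"
  shows "flmod n (strmod lo hi R :: 'k::field qrep)"
proof -
  let ?X = "strmod lo hi R :: 'k qrep"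
  \<comment> \<open>The numbers of upward and downward edges between \<open>lo\<close> and
    \<open>i\<close>. The weight \<open>up i + (n - dn i)\<close> increases along every arrow of the
    string.\<close>
  define up where "up i = card {j. lo < j & j \<le> i & R j}" for i
  define dn where "dn i = card {j. lo < j & j \<le> i & \<not> R j}" for i
  have up: "up (Suc i) = up i + (if R (Suc i) then 1 else 0)" if "lo \<le> i" for i
  proof -
    have "{j. lo < j & j \<le> Suc i & R j} = (if R (Suc i) then insert (Suc i) else id) {j. lo < j & j \<le> i & R j}"
      using that by (auto simp: le_Suc_eq)
    then show ?thesis by (simp add: up_def)
  qed
  have dn: "dn (Suc i) = dn i + (if R (Suc i) then 0 else 1)" if "lo \<le> i" for i
  proof -
    have "{j. lo < j & j \<le> Suc i & \<not> R j} = (if R (Suc i) then id else insert (Suc i)) {j. lo < j & j \<le> i & \<not> R j}"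
      using that by (auto simp: le_Suc_eq)
    then show ?thesis by (simp add: dn_def)
  qed
  have bd: "up i \<le> i" "dn i \<le> i" for i
  proof -
    have "up i \<le> card {1..i}" "dn i \<le> card {1..i}" unfolding up_def dn_def by (intro card_mono; auto)+
    then show "up i \<le> i" "dn i \<le> i" by simp_all
  qed
  have "nilp n ?X"
  proof (rule nilp_weight[of ?X "%i r. up i + (n - dn i)" "2 * n"])
    fix i r c assume i: "i < n"
    show "up i + (n - dn i) < up (sc n i) + (n - dn (sc n i))" if "ent (aa ?X i) r c \<noteq> 0"
    proof -
      have "lo \<le> i" "Suc i < hi" "R (Suc i)" using that by (auto simp: strmod_aa[OF hi i] split: if_splits)
      then show ?thesis using up[of i] dn[of i] hi i by (simp add: sc_if)
    qed
    show "up (sc n i) + (n - dn (sc n i)) < up i + (n - dn i)" if "ent (bb ?X i) r c \<noteq> 0"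
    proof -
      have "lo \<le> i" "Suc i < hi" "\<not> R (Suc i)" using that by (auto simp: strmod_bb[OF hi i] split: if_splits)
      then show ?thesis using up[of i] dn[of i] bd(2)[of i] hi i by (simp add: sc_if)
    qed
  next
    fix i r assume "i < n"
    then show "up i + (n - dn i) < 2 * n" using bd(1)[of i] by simp
  qed simp
  moreover have "aa ?X (pr n i) * bb ?X (pr n i) = bb ?X i * aa ?X i" if i: "i < n" for i
    using i by (auto simp: strmod_aa[OF hi] strmod_bb[OF hi] pr_lt pr_if un_un)
  ultimately show ?thesis using preproj_iff[of ?X] by (simp add: flmod_def)
qed

section \<open>The complexes attached to subsets\<close>

text \<open>The vector at vertex \<open>i\<close> obtained from the last \<open>s \<le> i\<close> in
  \<open>S\<close> by carrying \<open>x s\<close> upward along the arrows; it is zero if there is no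
  such \<open>s\<close>.\<close>

fun rec :: "'k::field qrep => nat set => (nat => 'k lop) => nat => 'k lop" where
  "rec X S x 0 = 0"
| "rec X S x (Suc i) = (if Suc i \<in> S then x (Suc i) else aa X i * rec X S x i)"

lemma rec_ops:
  assumes "is_rep n X" "\<And>s. s \<in> S ==> x s \<in> ops (dimv X (s mod n)) 1" "i < n"
  shows "rec X S x i \<in> ops (dimv X i) 1"
  using assms(3)
proof (induct i)
  case (Suc i)
  then have "sc n i = Suc i" "i < n" by (simp_all add: sc_if)
  then show ?case using Suc assms(2)[of "Suc i"] ops_mult[OF aa_ops[OF assms(1), of i]] by auto
qed simp

lemma rec_cong: "(\<And>s. s \<in> S ==> s \<le> i ==> x s = y s) ==> rec X S x i = rec X S y i"
  by (induct i) auto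

lemma rec_hom:
  assumes "f \<in> hom X Y" "i < n"
  shows "f i * rec X S x i = rec Y S (%s. f (s mod n) * x s) i"
  using assms(2)
proof (induct i)
  case (Suc i)
  then have s: "sc n i = Suc i" "i < n" by (simp_all add: sc_if)
  have "f (Suc i) * (aa X i * rec X S x i) = aa Y i * (f i * rec X S x i)"
    using homD(3)[OF assms(1) s(2)] s by (simp flip: mult.assoc)
  then show ?case using Suc by simp
qed simp

text \<open>Each \<open>s\<close> in \<open>S\<close> contributes P'(s) in degree 0 and P'(s - 1) in
  degree -1, so the class telescopes to the indicator of \<open>S\<close>. The differential compares
  the step down from \<open>s\<close> with the upward path from the preceding element of
  \<open>S\<close>. Consecutive elements create a contractible summand, the price for a uniform
  formula; \<open>s = n\<close> sits at vertex 0 through \<open>s mod n\<close>, where the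
  projective is zero.\<close>

definition isU :: "nat set => 'k::field cx => (nat => 'k lop) => (nat => 'k lop) => bool" where
  "isU S U g1 g0 \<longleftrightarrow> S \<subseteq> {1..n} & is_cx n U & free (c0 U) S (%s. s mod n) g0 & free (c1 U) S (%s. s - 1) g1 &
    (\<forall>s\<in>S. dd U (s - 1) * g1 s = bb (c0 U) (s - 1) * g0 s - rec (c0 U) S g0 (s - 1))"

lemma sc_pred: "s \<in> {1..n} ==> sc n (s - 1) = s mod n"
  by (auto simp: sc_if)

lemma bb_elt:
  assumes "is_rep n X" "s \<in> {1..n}" "x \<in> ops (dimv X (s mod n)) 1"
  shows "bb X (s - 1) * x \<in> ops (dimv X (s - 1)) 1"
proof -
  have "s - 1 < n" using assms(2) by auto
  then show ?thesis using ops_mult[OF bb_ops[OF assms(1), of "s - 1"], of x 1] sc_pred[OF assms(2)] assms(3) by simp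
qed

lemma aa_elt:
  assumes "is_rep n X" "s \<in> {1..n}" "x \<in> ops (dimv X (s - 1)) 1"
  shows "aa X (s - 1) * x \<in> ops (dimv X (s mod n)) 1"
proof -
  have "s - 1 < n" using assms(2) by auto
  then show ?thesis using ops_mult[OF aa_ops[OF assms(1), of "s - 1"], of x 1] sc_pred[OF assms(2)] assms(3) by simp
qed

lemma isU_exists:
  assumes S: "S \<subseteq> {1..n}"
  shows "\<exists>(U :: 'k::field cx) g1 g0. isU S U g1 g0"
proof -
  have fin: "finite S" using S finite_subset by blast
  obtain P0 :: "'k qrep" and g0 where P0: "free P0 S (%s. s mod n) g0"
    using free_exists[OF fin, of "%s. s mod n"] n_ge2 by auto
  have "s - 1 < n" if "s \<in> S" for s using subsetD[OF S that] n_ge2 by auto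
  then obtain P1 :: "'k qrep" and g1 where P1: "free P1 S (%s. s - 1) g1"
    using free_exists[OF fin, of "%s. s - 1"] by blast
  note p0 = freeD[OF P0] and p1 = freeD[OF P1]
  have "bb P0 (s - 1) * g0 s - rec P0 S g0 (s - 1) \<in> ops (dimv P0 (s - 1)) 1" if s: "s \<in> S" for s
    using s S p1(3)[OF s] by (intro ops_diff bb_elt[OF p0(2)] rec_ops[OF p0(2)] p0(4)) auto
  then obtain d where d: "d \<in> hom P1 P0" "\<forall>s\<in>S. d (s - 1) * g1 s = bb P0 (s - 1) * g0 s - rec P0 S g0 (s - 1)"
    using p1(6)[OF p0(1), of "%s. bb P0 (s - 1) * g0 s - rec P0 S g0 (s - 1)"] by auto
  have "isU S (mkcx P1 P0 d) g1 g0"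
    unfolding isU_def using S P0 P1 d mkcx_cx[OF free_projective[OF P1] free_projective[OF P0] d(1)] mkcx_dd[OF d(1)] by simp
  then show ?thesis by blast
qed

lemma isU_cls:
  assumes U: "isU S U g1 g0"
  shows "clsCx n U i = (if 1 \<le> i & i < n then (if i \<in> S then 1 else 0) - (if Suc i \<in> S then 1 else 0) else 0)"
proof (cases "1 \<le> i & i < n")
  case True
  have S: "S \<subseteq> {1..n}" and F: "free (c0 U) S (%s. s mod n) g0" "free (c1 U) S (%s. s - 1) g1"
    using U by (auto simp: isU_def)
  have fin: "finite S" using S finite_subset by blast
  have "{s\<in>S. s mod n = i} = (if i \<in> S then {i} else {})"
  proof -
    have "s mod n = i \<longleftrightarrow> s = i" if "s \<in> S" for s
      using that S True by (cases "s = n") auto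
    then show ?thesis by auto
  qed
  moreover have "{s\<in>S. s - 1 = i} = (if Suc i \<in> S then {Suc i} else {})"
    using S True by auto
  ultimately show ?thesis
    using homS_dim_free[OF F(1) fin, of i] homS_dim_free[OF F(2) fin, of i] True by (simp add: clsCx_def)
next
  case False
  then show ?thesis unfolding clsCx_def by (simp only: if_False)
qed

text \<open>Both terms of \<open>U\<close> are free, so morphisms out of them are choices of
  vectors, and a null-homotopy is a solution of one equation per generator of degree -1.\<close>

lemma ext0_isU:
  assumes U: "isU S U g1 g0" and V: "is_cx n V"
    and solve: "\<And>y. (\<And>s. s \<in> S ==> y s \<in> ops (dimv (c0 V) (s - 1)) 1) ==>
      \<exists>x. (\<forall>s\<in>S. x s \<in> ops (dimv (c0 V) (s mod n)) 1) &
        (\<forall>s\<in>S. \<exists>w\<in>ops (dimv (c1 V) (s - 1)) 1.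
           y s = bb (c0 V) (s - 1) * x s - rec (c0 V) S x (s - 1) + dd V (s - 1) * w)"
  shows "ext0 U V"
  unfolding ext0_def
proof
  have S: "S \<subseteq> {1..n}" and cx: "is_cx n U" and F: "free (c0 U) S (%s. s mod n) g0" "free (c1 U) S (%s. s - 1) g1"
    and d: "\<And>s. s \<in> S ==> dd U (s - 1) * g1 s = bb (c0 U) (s - 1) * g0 s - rec (c0 U) S g0 (s - 1)"
    using U by (auto simp: isU_def)
  note f0 = freeD[OF F(1)] and f1 = freeD[OF F(2)] and v = cxD[OF V]
  fix f assume f: "f \<in> hom (c1 U) (c0 V)"
  have y: "f (s - 1) * g1 s \<in> ops (dimv (c0 V) (s - 1)) 1" if "s \<in> S" for s
    using ops_mult[OF homD(2)[OF f f1(3)[OF that]] f1(4)[OF that]] .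
  have "\<exists>x. (\<forall>s\<in>S. x s \<in> ops (dimv (c0 V) (s mod n)) 1) &
        (\<forall>s\<in>S. \<exists>w\<in>ops (dimv (c1 V) (s - 1)) 1.
           f (s - 1) * g1 s = bb (c0 V) (s - 1) * x s - rec (c0 V) S x (s - 1) + dd V (s - 1) * w)"
    by (rule solve) (rule y)
  then obtain x where x: "\<forall>s\<in>S. x s \<in> ops (dimv (c0 V) (s mod n)) 1"
    and w: "\<forall>s\<in>S. \<exists>w\<in>ops (dimv (c1 V) (s - 1)) 1.
        f (s - 1) * g1 s = bb (c0 V) (s - 1) * x s - rec (c0 V) S x (s - 1) + dd V (s - 1) * w"
    by (elim exE conjE) (rule that)
  from bchoice[OF w[unfolded Bex_def]] obtain w where w: "\<forall>s\<in>S. w s \<in> ops (dimv (c1 V) (s - 1)) 1 &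
      f (s - 1) * g1 s = bb (c0 V) (s - 1) * x s - rec (c0 V) S x (s - 1) + dd V (s - 1) * w s"
    by (elim exE) (rule that)
  obtain h0 where h0: "h0 \<in> hom (c0 U) (c0 V)" "\<forall>s\<in>S. h0 (s mod n) * g0 s = x s"
    using f0(6)[OF v(7), of x] x by blast
  obtain h1 where h1: "h1 \<in> hom (c1 U) (c1 V)" "\<forall>s\<in>S. h1 (s - 1) * g1 s = w s"
    using f1(6)[OF v(6), of w] w by blast
  have "f = h0 * dd U + dd V * h1"
  proof (rule free_hom_eq[OF F(2) v(4) f hom_add[OF hom_comp[OF h0(1) cxD(5)[OF cx]] hom_comp[OF v(5) h1(1)]]])
    fix s assume s: "s \<in> S"
    have s': "s \<in> {1..n}" "s - 1 < n" using s S f1(3)[OF s] by auto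
    have "h0 (s - 1) * (dd U (s - 1) * g1 s) = h0 (s - 1) * bb (c0 U) (s - 1) * g0 s - h0 (s - 1) * rec (c0 U) S g0 (s - 1)"
      unfolding d[OF s] by (simp add: right_diff_distrib mult.assoc)
    also have "h0 (s - 1) * bb (c0 U) (s - 1) * g0 s = bb (c0 V) (s - 1) * x s"
      using homD(4)[OF h0(1) s'(2)] h0(2) s sc_pred[OF s'(1)] by (simp add: mult.assoc)
    also have "h0 (s - 1) * rec (c0 U) S g0 (s - 1) = rec (c0 V) S x (s - 1)"
      unfolding rec_hom[OF h0(1) s'(2)] by (rule rec_cong) (use h0(2) in simp)
    finally have "h0 (s - 1) * (dd U (s - 1) * g1 s) = bb (c0 V) (s - 1) * x s - rec (c0 V) S x (s - 1)" .
    then show "f (s - 1) * g1 s = (h0 * dd U + dd V * h1) (s - 1) * g1 s"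
      using w s h1(2) by (simp add: distrib_right mult.assoc)
  qed
  then show "\<exists>h0\<in>hom (c0 U) (c0 V). \<exists>h1\<in>hom (c1 U) (c1 V). f = h0 * dd U + dd V * h1"
    using h0(1) h1(1) by blast
qed

section \<open>Extensions between the complexes of two subsets\<close>

text \<open>The span of \<open>I\<close> and \<open>a\<close> closed under the central element. With
  \<open>I\<close> the image of the differential it describes a cyclic module over the polynomials
  in that element, lifted from the cokernel.\<close>

inductive_set zspan :: "'k::field qrep => 'k lop set => 'k lop => nat => 'k lop set"
  for X :: "'k qrep" and I :: "'k lop set" and a :: "'k lop" and i :: nat where
  zs_I: "x \<in> I ==> x \<in> zspan X I a i"
| zs_a: "a \<in> zspan X I a i"
| zs_add: "x \<in> zspan X I a i ==> y \<in> zspan X I a i ==> x + y \<in> zspan X I a i"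
| zs_scl: "x \<in> zspan X I a i ==> scl s * x \<in> zspan X I a i"
| zs_z: "x \<in> zspan X I a i ==> bb X i * (aa X i * x) \<in> zspan X I a i"

context
  fixes T :: "nat set" and V :: "'k::field cx" and k1 k0 :: "nat => 'k lop"
  assumes V: "isU T V k1 k0"
begin

definition im :: "nat => 'k lop set" where "im i = {dd V i * w | w. w \<in> ops (dimv (c1 V) i) 1}"

lemma isU_facts:
  "T \<subseteq> {1..n}" "is_cx n V" "free (c0 V) T (%s. s mod n) k0" "free (c1 V) T (%s. s - 1) k1"
  "s \<in> T ==> dd V (s - 1) * k1 s = bb (c0 V) (s - 1) * k0 s - rec (c0 V) T k0 (s - 1)"
  using V by (auto simp: isU_def)

lemma im_add: "x \<in> im i ==> y \<in> im i ==> x + y \<in> im i"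
  unfolding im_def by (auto simp flip: distrib_left intro: ops_add)
lemma im_scl: "x \<in> im i ==> scl s * x \<in> im i"
  unfolding im_def by (auto simp flip: scl_left_comm intro: ops_scl)
lemma im_0: "0 \<in> im i"
  unfolding im_def by (auto intro!: exI[of _ 0])
lemma im_minus: "x \<in> im i ==> - x \<in> im i"
  using im_scl[of x i "-1"] by (simp add: scl_minus)
lemma im_aa: "i < n ==> x \<in> im i ==> aa (c0 V) i * x \<in> im (sc n i)"
proof -
  note v = cxD[OF isU_facts(2)]
  assume i: "i < n" and "x \<in> im i"
  then obtain w where w: "x = dd V i * w" "w \<in> ops (dimv (c1 V) i) 1" by (auto simp: im_def)
  have "aa (c0 V) i * x = dd V (sc n i) * (aa (c1 V) i * w)"
    using homD(3)[OF v(5) i] w(1) by (simp flip: mult.assoc)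
  then show ?thesis using ops_mult[OF aa_ops[OF v(3) i] w(2)] unfolding im_def by blast
qed
lemma im_bb: "i < n ==> x \<in> im (sc n i) ==> bb (c0 V) i * x \<in> im i"
proof -
  note v = cxD[OF isU_facts(2)]
  assume i: "i < n" and "x \<in> im (sc n i)"
  then obtain w where w: "x = dd V (sc n i) * w" "w \<in> ops (dimv (c1 V) (sc n i)) 1" by (auto simp: im_def)
  have "bb (c0 V) i * x = dd V i * (bb (c1 V) i * w)"
    using homD(4)[OF v(5) i] w(1) by (simp flip: mult.assoc)
  then show ?thesis using ops_mult[OF bb_ops[OF v(3) i] w(2)] unfolding im_def by blast
qed

lemma relation: "s \<in> T ==> bb (c0 V) (s - 1) * k0 s - rec (c0 V) T k0 (s - 1) \<in> im (s - 1)"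
  using isU_facts(5)[of s] freeD(4)[OF isU_facts(4), of s] unfolding im_def by (metis (mono_tags, lifting) mem_Collect_eq)

lemma central_V: "Suc i < n ==> aa (c0 V) i * (bb (c0 V) i * x) = bb (c0 V) (Suc i) * (aa (c0 V) (Suc i) * x)"
  using flmodD(3)[OF pmod_flmod[OF cxD(7)[OF isU_facts(2)]], of i] by (simp add: sc_if flip: mult.assoc)

text \<open>At each vertex the cokernel of the complex of \<open>T\<close> is cyclic over the
  central element, with generator \<open>rec\<close>. Stability under the arrows is where the
  relations of the complex are used.\<close>

lemma generators_span:
  assumes i: "i < n" and x: "x \<in> ops (dimv (c0 V) i) 1"
  shows "x \<in> zspan (c0 V) (im i) (rec (c0 V) T k0 i) i"
proof -
  let ?X = "c0 V"
  define N where "N i = zspan ?X (im i) (rec ?X T k0 i) i" for i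
  note v = cxD[OF isU_facts(2)]
  have N0: "0 \<in> N i" for i unfolding N_def by (rule zs_I[OF im_0])
  have "closed_family ?X N"
  proof (rule closed_familyI)
    fix i x assume i: "i < n"
    show "0 \<in> N i" by (rule N0)
    show "aa ?X i * x \<in> N (sc n i)" if x: "x \<in> N i"
    proof (cases "sc n i = 0")
      case True
      then have "aa ?X i \<in> ops 0 (dimv ?X i)" using aa_ops[OF v(4) i] pmod_0[OF v(7)] by simp
      then have "aa ?X i = 0" by (rule ops_zero_dim(1))
      then show ?thesis using N0 by simp
    next
      case False
      then have si: "sc n i = Suc i" "Suc i < n" using i by (auto simp: sc_if split: if_splits)
      have "aa ?X i * x \<in> zspan ?X (im (Suc i)) (rec ?X T k0 (Suc i)) (Suc i)"
        using x unfolding N_def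
      proof (induct rule: zspan.induct)
        case (zs_I x)
        then show ?case using im_aa[OF i zs_I] si by (auto intro: zspan.zs_I)
      next
        case zs_a
        show ?case
        proof (cases "Suc i \<in> T")
          case True
          \<comment> \<open>Modulo the image of the differential, \<open>rec\<close> at
            \<open>i\<close> is one step down from the next generator; stepping up again gives the
            central element applied to that generator.\<close>
          have "rec ?X T k0 i = bb ?X i * k0 (Suc i) + - (bb ?X i * k0 (Suc i) - rec ?X T k0 i)" by simp
          then have "aa ?X i * rec ?X T k0 i = bb ?X (Suc i) * (aa ?X (Suc i) * rec ?X T k0 (Suc i))
              + aa ?X i * - (bb ?X i * k0 (Suc i) - rec ?X T k0 i)"
            using central_V[OF si(2), of "k0 (Suc i)"] True by (metis distrib_left rec.simps(2))
          moreover have "aa ?X i * - (bb ?X i * k0 (Suc i) - rec ?X T k0 i) \<in> im (Suc i)"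
            using im_aa[OF i im_minus[OF relation[OF True, simplified]]] si by simp
          ultimately show ?thesis
            using zspan.zs_add[OF zspan.zs_z[OF zspan.zs_a] zspan.zs_I] by metis
        next
          case False
          have "rec ?X T k0 (Suc i) \<in> zspan ?X (im (Suc i)) (rec ?X T k0 (Suc i)) (Suc i)" by (rule zspan.zs_a)
          then show ?thesis using False by simp
        qed
      next
        case (zs_add x y)
        then show ?case using zspan.zs_add[OF zs_add(2,4)] by (simp add: distrib_left)
      next
        case (zs_scl x s)
        then show ?case using zspan.zs_scl[OF zs_scl(2)] by (simp add: scl_left_comm[of "aa ?X i"])
      next
        case (zs_z x)
        then show ?case using zspan.zs_z[OF zs_z(2)] central_V[OF si(2)] by simp
      qed
      then show ?thesis using si by (simp add: N_def)
    qed
    show "bb ?X i * x \<in> N i" if x: "x \<in> N (sc n i)"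
    proof (cases "sc n i = 0")
      case True
      then have "bb ?X i \<in> ops (dimv ?X i) 0" using bb_ops[OF v(4) i] pmod_0[OF v(7)] by simp
      then have "bb ?X i = 0" by (rule ops_zero_dim(2))
      then show ?thesis using N0 by simp
    next
      case False
      then have si: "sc n i = Suc i" "Suc i < n" using i by (auto simp: sc_if split: if_splits)
      have x': "x \<in> zspan ?X (im (Suc i)) (rec ?X T k0 (Suc i)) (Suc i)" using x si by (simp add: N_def)
      show ?thesis unfolding N_def
        using x'
      proof (induct rule: zspan.induct)
        case (zs_I x)
        then show ?case using im_bb[OF i] si by (auto intro: zspan.zs_I)
      next
        case zs_a
        show ?case
        proof (cases "Suc i \<in> T")
          case True
          have "bb ?X i * k0 (Suc i) = rec ?X T k0 i + (bb ?X i * k0 (Suc i) - rec ?X T k0 i)" by simp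
          moreover have "bb ?X i * k0 (Suc i) - rec ?X T k0 i \<in> im i" using relation[OF True] by simp
          ultimately show ?thesis
            using zspan.zs_add[OF zspan.zs_a zspan.zs_I] True by (metis rec.simps(2))
        next
          case False
          have "bb ?X i * (aa ?X i * rec ?X T k0 i) \<in> zspan ?X (im i) (rec ?X T k0 i) i" by (intro zspan.zs_z zspan.zs_a)
          then show ?thesis using False by simp
        qed
      next
        case (zs_add x y)
        then show ?case using zspan.zs_add[OF zs_add(2,4)] by (simp add: distrib_left)
      next
        case (zs_scl x s)
        then show ?case using zspan.zs_scl[OF zs_scl(2)] by (simp add: scl_left_comm[of "bb ?X i"])
      next
        case (zs_z x)
        then show ?case using zspan.zs_z[OF zs_z(2)] by (simp flip: central_V[OF si(2)])
      qed
    qed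
  qed (auto simp: N_def intro: zspan.zs_add zspan.zs_scl)
  moreover have "k0 s \<in> N (s mod n)" if s: "s \<in> T" for s
  proof (cases "s = n")
    case True
    then have "k0 s = 0" using freeD(4)[OF isU_facts(3) s] pmod_0[OF v(7)] ops_zero_dim(1) by simp
    then show ?thesis using N0 by simp
  next
    case False
    then have sn: "s < n" "1 \<le> s" using s isU_facts(1) by auto
    then have "rec ?X T k0 s = k0 s" using s by (cases s) auto
    then have "k0 s \<in> N s" unfolding N_def by (metis zspan.zs_a)
    then show ?thesis using sn by simp
  qed
  ultimately have "x \<in> N i" using generatedD[OF freeD(5)[OF isU_facts(3)] _ _ i x] by blast
  then show ?thesis by (simp add: N_def)
qed

text \<open>For \<open>s\<close> in \<open>T\<close> the cyclic generator at \<open>s - 1\<close>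
  is, modulo the image of the differential, the image of \<open>k0 s\<close> under the downward
  arrow, and the image of that arrow is stable under the central element.\<close>

lemma b_surjective:
  assumes s: "s \<in> T" and y: "y \<in> ops (dimv (c0 V) (s - 1)) 1"
  shows "\<exists>x\<in>ops (dimv (c0 V) (s mod n)) 1. y - bb (c0 V) (s - 1) * x \<in> im (s - 1)"
proof -
  let ?X = "c0 V"
  note v = cxD[OF isU_facts(2)]
  have s': "s \<in> {1..n}" "s - 1 < n" using subsetD[OF isU_facts(1) s] n_ge2 by auto
  have "y \<in> zspan ?X (im (s - 1)) (rec ?X T k0 (s - 1)) (s - 1)" by (rule generators_span[OF s'(2) y])
  then show ?thesis
  proof (induct rule: zspan.induct)
    case (zs_I x)
    then show ?case by (intro bexI[of _ 0]) auto
  next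
    case zs_a
    have "rec ?X T k0 (s - 1) - bb ?X (s - 1) * k0 s \<in> im (s - 1)"
      using im_minus[OF relation[OF s]] by simp
    then show ?case using freeD(4)[OF isU_facts(3) s] by blast
  next
    case (zs_add x y)
    then obtain p q where "p \<in> ops (dimv ?X (s mod n)) 1" "x - bb ?X (s - 1) * p \<in> im (s - 1)"
      "q \<in> ops (dimv ?X (s mod n)) 1" "y - bb ?X (s - 1) * q \<in> im (s - 1)" by blast
    moreover have "x + y - bb ?X (s - 1) * (p + q) = (x - bb ?X (s - 1) * p) + (y - bb ?X (s - 1) * q)"
      by (simp add: distrib_left)
    ultimately show ?case using im_add ops_add by metis
  next
    case (zs_scl x t)
    then obtain p where p: "p \<in> ops (dimv ?X (s mod n)) 1" "x - bb ?X (s - 1) * p \<in> im (s - 1)" by blast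
    have "scl t * x - bb ?X (s - 1) * (scl t * p) = scl t * (x - bb ?X (s - 1) * p)"
      by (simp add: right_diff_distrib scl_left_comm[of "bb ?X _"])
    then show ?case using im_scl[OF p(2)] ops_scl[OF p(1)] by metis
  next
    case (zs_z x)
    then obtain p where p: "p \<in> ops (dimv ?X (s mod n)) 1" "x - bb ?X (s - 1) * p \<in> im (s - 1)" by blast
    have "bb ?X (s - 1) * (aa ?X (s - 1) * x) - bb ?X (s - 1) * (aa ?X (s - 1) * (bb ?X (s - 1) * p))
        = bb ?X (s - 1) * (aa ?X (s - 1) * (x - bb ?X (s - 1) * p))"
      by (simp add: right_diff_distrib)
    then show ?case using im_bb[OF s'(2) im_aa[OF s'(2) p(2)]] aa_elt[OF v(4) s'(1) bb_elt[OF v(4) s'(1) p(1)]] by metis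
  qed
qed

text \<open>Away from \<open>T\<close> the cyclic generator at \<open>Suc i\<close> is by definition
  the image of the one at \<open>i\<close> under the upward arrow.\<close>

lemma a_surjective:
  assumes i: "Suc i \<notin> T" "Suc i < n" and y: "y \<in> ops (dimv (c0 V) (Suc i)) 1"
  shows "\<exists>x\<in>ops (dimv (c0 V) i) 1. y - aa (c0 V) i * x \<in> im (Suc i)"
proof -
  let ?X = "c0 V"
  note v = cxD[OF isU_facts(2)]
  have i': "i < n" "sc n i = Suc i" using i by (auto simp: sc_if)
  have gens: "s \<in> T ==> k0 s \<in> ops (dimv ?X (s mod n)) 1" for s using freeD(4)[OF isU_facts(3)] .
  have "y \<in> zspan ?X (im (Suc i)) (rec ?X T k0 (Suc i)) (Suc i)" by (rule generators_span[OF i(2) y])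
  then show ?thesis
  proof (induct rule: zspan.induct)
    case (zs_I x)
    then show ?case by (intro bexI[of _ 0]) auto
  next
    case zs_a
    then show ?case using i rec_ops[OF v(4) gens i'(1)] im_0 by (intro bexI[of _ "rec ?X T k0 i"]) auto
  next
    case (zs_add x y)
    then obtain p q where "p \<in> ops (dimv ?X i) 1" "x - aa ?X i * p \<in> im (Suc i)"
      "q \<in> ops (dimv ?X i) 1" "y - aa ?X i * q \<in> im (Suc i)" by blast
    moreover have "x + y - aa ?X i * (p + q) = (x - aa ?X i * p) + (y - aa ?X i * q)"
      by (simp add: distrib_left)
    ultimately show ?case using im_add ops_add by metis
  next
    case (zs_scl x t)
    then obtain p where p: "p \<in> ops (dimv ?X i) 1" "x - aa ?X i * p \<in> im (Suc i)" by blast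
    have "scl t * x - aa ?X i * (scl t * p) = scl t * (x - aa ?X i * p)"
      by (simp add: right_diff_distrib scl_left_comm[of "aa ?X _"])
    then show ?case using im_scl[OF p(2)] ops_scl[OF p(1)] by metis
  next
    case (zs_z x)
    then obtain p where p: "p \<in> ops (dimv ?X i) 1" "x - aa ?X i * p \<in> im (Suc i)" by blast
    have "bb ?X (Suc i) * (aa ?X (Suc i) * x) - aa ?X i * (bb ?X i * (aa ?X i * p))
        = aa ?X i * (bb ?X i * (x - aa ?X i * p))"
      by (simp add: right_diff_distrib central_V[OF i(2), of x])
    moreover have "aa ?X i * (bb ?X i * (x - aa ?X i * p)) \<in> im (Suc i)"
      using im_aa[OF i'(1) im_bb[OF i'(1)]] p(2) i'(2) by metis
    moreover have "bb ?X i * (aa ?X i * p) \<in> ops (dimv ?X i) 1"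
      using ops_mult[OF bb_ops[OF v(4) i'(1)] ops_mult[OF aa_ops[OF v(4) i'(1)] p(1)]] .
    ultimately show ?case by metis
  qed
qed

text \<open>The equation for \<open>s\<close> involves \<open>x s\<close> and earlier values only.
  Since \<open>s\<close> lies in \<open>T\<close>, the downward arrow is surjective on the cokernel,
  and the equations are solved in increasing order.\<close>

lemma solve_subset:
  assumes S: "S \<subseteq> T" and y: "\<And>s. s \<in> S ==> y s \<in> ops (dimv (c0 V) (s - 1)) 1"
  shows "\<exists>x. (\<forall>s\<in>S. x s \<in> ops (dimv (c0 V) (s mod n)) 1) &
    (\<forall>s\<in>S. y s - (bb (c0 V) (s - 1) * x s - rec (c0 V) S x (s - 1)) \<in> im (s - 1))"
proof -
  let ?X = "c0 V"
  note v = cxD[OF isU_facts(2)]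
  have "m \<le> n ==> \<exists>x. (\<forall>s\<in>S. x s \<in> ops (dimv ?X (s mod n)) 1) &
    (\<forall>s\<in>S. s \<le> m --> y s - (bb ?X (s - 1) * x s - rec ?X S x (s - 1)) \<in> im (s - 1))" for m
  proof (induct m)
    case 0
    then show ?case using S isU_facts(1) by (intro exI[of _ "%_. 0"]) auto
  next
    case (Suc m)
    then obtain x where x: "\<forall>s\<in>S. x s \<in> ops (dimv ?X (s mod n)) 1"
      "\<forall>s\<in>S. s \<le> m --> y s - (bb ?X (s - 1) * x s - rec ?X S x (s - 1)) \<in> im (s - 1)" by auto
    show ?case
    proof (cases "Suc m \<in> S")
      case False
      then show ?thesis using x by (metis le_Suc_eq)
    next
      case True
      have "y (Suc m) + rec ?X S x m \<in> ops (dimv ?X m) 1"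
        using y[OF True] Suc(2) rec_ops[OF v(4), of S x m] x(1) by (simp add: ops_add)
      then obtain z where z: "z \<in> ops (dimv ?X (Suc m mod n)) 1" "y (Suc m) + rec ?X S x m - bb ?X m * z \<in> im m"
        using b_surjective[of "Suc m" "y (Suc m) + rec ?X S x m"] True S by auto
      let ?x = "x(Suc m := z)"
      have r: "rec ?X S ?x i = rec ?X S x i" if "i \<le> m" for i
        by (rule rec_cong) (use that in auto)
      have "y s - (bb ?X (s - 1) * ?x s - rec ?X S ?x (s - 1)) \<in> im (s - 1)" if "s \<in> S" "s \<le> Suc m" for s
      proof (cases "s = Suc m")
        case True
        then show ?thesis using z(2) r[of m] by (simp add: algebra_simps)
      next
        case False
        then show ?thesis using x(2) that r[of "s - 1"] by auto
      qed
      moreover have "\<forall>s\<in>S. ?x s \<in> ops (dimv ?X (s mod n)) 1" using x(1) z(1) by auto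
      ultimately show ?thesis by blast
    qed
  qed
  from this[of n] show ?thesis using S isU_facts(1) by (meson atLeastAtMost_iff order_refl subsetD)
qed

text \<open>For \<open>s\<close> outside \<open>T\<close> the downward arrow need not be surjective,
  so \<open>x s\<close> cannot be chosen last. Instead the value of \<open>rec\<close> at the
  current vertex is prescribed and the prescription is carried back to smaller vertices.\<close>

lemma solve_superset:
  assumes S: "T \<subseteq> S" "S \<subseteq> {1..n}" and y: "\<And>s. s \<in> S ==> y s \<in> ops (dimv (c0 V) (s - 1)) 1"
  shows "\<exists>x. (\<forall>s\<in>S. x s \<in> ops (dimv (c0 V) (s mod n)) 1) &
    (\<forall>s\<in>S. y s - (bb (c0 V) (s - 1) * x s - rec (c0 V) S x (s - 1)) \<in> im (s - 1))"
proof -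
  let ?X = "c0 V"
  note v = cxD[OF isU_facts(2)]
  \<comment> \<open>The target \<open>w\<close> for \<open>rec\<close> at \<open>m\<close> is
    arbitrary. An element of \<open>S\<close> at \<open>Suc m\<close> takes the value
    \<open>w\<close> itself and prescribes the target one vertex lower; outside \<open>S\<close> the
    target is lifted through the upward arrow.\<close>
  have step: "m < n ==> w \<in> ops (dimv ?X m) 1 ==> \<exists>x. (\<forall>s\<in>S. x s \<in> ops (dimv ?X (s mod n)) 1) & rec ?X S x m - w \<in> im m &
    (\<forall>s\<in>S. s \<le> m --> y s - (bb ?X (s - 1) * x s - rec ?X S x (s - 1)) \<in> im (s - 1))" for m w
  proof (induct m arbitrary: w)
    case 0
    then have "w = 0" using pmod_0[OF v(7)] ops_zero_dim(1) by simp
    then show ?case using S im_0 by (intro exI[of _ "%_. 0"]) auto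
  next
    case (Suc m)
    have sm: "sc n m = Suc m" "m < n" using Suc(2) by (auto simp: sc_if)
    show ?case
    proof (cases "Suc m \<in> S")
      case False
      obtain w' where w': "w' \<in> ops (dimv ?X m) 1" "w - aa ?X m * w' \<in> im (Suc m)"
        using a_surjective[of m w] Suc False S(1) by blast
      obtain x where x: "\<forall>s\<in>S. x s \<in> ops (dimv ?X (s mod n)) 1" "rec ?X S x m - w' \<in> im m"
        "\<forall>s\<in>S. s \<le> m --> y s - (bb ?X (s - 1) * x s - rec ?X S x (s - 1)) \<in> im (s - 1)"
        using Suc(1)[OF sm(2) w'(1)] by (elim exE conjE) (rule that)
      have "rec ?X S x (Suc m) - w = aa ?X m * (rec ?X S x m - w') + - (w - aa ?X m * w')"
        using False by (simp add: algebra_simps)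
      then have "rec ?X S x (Suc m) - w \<in> im (Suc m)"
        using im_add[OF im_aa[OF sm(2) x(2), unfolded sm(1)] im_minus[OF w'(2)]] by (simp only:)
      moreover have "\<forall>s\<in>S. s \<le> Suc m --> y s - (bb ?X (s - 1) * x s - rec ?X S x (s - 1)) \<in> im (s - 1)"
        using x(3) False by (metis le_Suc_eq)
      ultimately show ?thesis using x(1) by blast
    next
      case True
      have bw: "bb ?X m * w \<in> ops (dimv ?X m) 1" using ops_mult[OF bb_ops[OF v(4) sm(2)]] Suc(3) sm by simp
      have "bb ?X m * w - y (Suc m) \<in> ops (dimv ?X m) 1" using bw y[OF True] by (simp add: ops_diff)
      from Suc(1)[OF sm(2) this]
      obtain x where x: "\<forall>s\<in>S. x s \<in> ops (dimv ?X (s mod n)) 1" "rec ?X S x m - (bb ?X m * w - y (Suc m)) \<in> im m"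
        "\<forall>s\<in>S. s \<le> m --> y s - (bb ?X (s - 1) * x s - rec ?X S x (s - 1)) \<in> im (s - 1)"
        by (elim exE conjE) (rule that)
      let ?x = "x(Suc m := w)"
      have r: "rec ?X S ?x i = rec ?X S x i" if "i \<le> m" for i
        by (rule rec_cong) (use that in auto)
      have "y s - (bb ?X (s - 1) * ?x s - rec ?X S ?x (s - 1)) \<in> im (s - 1)" if "s \<in> S" "s \<le> Suc m" for s
      proof (cases "s = Suc m")
        case True
        then show ?thesis using x(2) r[of m] by (simp add: algebra_simps)
      next
        case False
        then show ?thesis using x(3) that r[of "s - 1"] by auto
      qed
      moreover have "rec ?X S ?x (Suc m) - w \<in> im (Suc m)" using True im_0 by simp
      moreover have "\<forall>s\<in>S. ?x s \<in> ops (dimv ?X (s mod n)) 1" using x(1) Suc(2,3) by simp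
      ultimately show ?thesis by blast
    qed
  qed
  \<comment> \<open>For \<open>s = n\<close> the vector \<open>x n\<close> lives at vertex 0 and is
    zero, so its equation prescribes \<open>rec\<close> at \<open>n - 1\<close>.\<close>
  define w where "w = (if n \<in> S then - y n else 0)"
  have "w \<in> ops (dimv ?X (n - 1)) 1" using y by (simp add: w_def ops_minus)
  from step[OF _ this] n_ge2 obtain x where x: "\<forall>s\<in>S. x s \<in> ops (dimv ?X (s mod n)) 1" "rec ?X S x (n - 1) - w \<in> im (n - 1)"
      "\<forall>s\<in>S. s \<le> n - 1 --> y s - (bb ?X (s - 1) * x s - rec ?X S x (s - 1)) \<in> im (s - 1)"
    by auto
  have "y s - (bb ?X (s - 1) * x s - rec ?X S x (s - 1)) \<in> im (s - 1)" if s: "s \<in> S" for s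
  proof (cases "s = n")
    case True
    then have "x s \<in> ops 0 1" using x(1) s pmod_0[OF v(7)] by force
    then have "x s = 0" by (rule ops_zero_dim(1))
    then show ?thesis using x(2) True s by (simp add: w_def add.commute)
  next
    case False
    then have "s \<le> n - 1" using subsetD[OF S(2) s] by auto
    then show ?thesis using x(3) s by blast
  qed
  then show ?thesis using x(1) by blast
qed

lemma ext0_comparable:
  assumes U: "isU S U g1 g0" and cmp: "S \<subseteq> T \<or> T \<subseteq> S"
  shows "ext0 U V"
proof (rule ext0_isU[OF U isU_facts(2)])
  fix y :: "nat => 'k lop" assume y: "\<And>s. s \<in> S ==> y s \<in> ops (dimv (c0 V) (s - 1)) 1"
  have S: "S \<subseteq> {1..n}" using U by (simp add: isU_def)
  obtain x where x: "\<forall>s\<in>S. x s \<in> ops (dimv (c0 V) (s mod n)) 1"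
    "\<forall>s\<in>S. y s - (bb (c0 V) (s - 1) * x s - rec (c0 V) S x (s - 1)) \<in> im (s - 1)"
    using cmp solve_subset[OF _ y] solve_superset[OF _ S y] by metis
  have "\<exists>w\<in>ops (dimv (c1 V) (s - 1)) 1. y s = bb (c0 V) (s - 1) * x s - rec (c0 V) S x (s - 1) + dd V (s - 1) * w"
    if s: "s \<in> S" for s
  proof -
    obtain w where "y s - (bb (c0 V) (s - 1) * x s - rec (c0 V) S x (s - 1)) = dd V (s - 1) * w" "w \<in> ops (dimv (c1 V) (s - 1)) 1"
      using bspec[OF x(2) s] unfolding im_def mem_Collect_eq by (elim exE conjE) (rule that)
    then show ?thesis by (intro bexI[of _ w]) (auto simp: diff_eq_eq add.commute)
  qed
  then show "\<exists>x. (\<forall>s\<in>S. x s \<in> ops (dimv (c0 V) (s mod n)) 1) &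
        (\<forall>s\<in>S. \<exists>w\<in>ops (dimv (c1 V) (s - 1)) 1.
           y s = bb (c0 V) (s - 1) * x s - rec (c0 V) S x (s - 1) + dd V (s - 1) * w)"
    using x(1) by blast
qed

text \<open>A crossing of \<open>T\<close> and \<open>S\<close> at \<open>a\<close>, \<open>b\<close> gives a string module that is a quotient of the cokernel
  of the complex of \<open>S\<close> and to which the complex of \<open>T\<close> has a nonzero extension.\<close>

lemma crossing_ext:
  assumes U: "isU S U g1 g0" and ab: "a < b" "a \<in> S" "a \<notin> T" "b \<in> T" "b \<notin> S"
    and agree: "\<And>i. a < i ==> i < b ==> i \<in> S \<longleftrightarrow> i \<in> T"
  shows "\<not> ext0 V U"
proof
  assume E: "ext0 V U"
  have S: "S \<subseteq> {1..n}" and cx: "is_cx n U" and F: "free (c0 U) S (%s. s mod n) g0" "free (c1 U) S (%s. s - 1) g1"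
    and d: "\<And>s. s \<in> S ==> dd U (s - 1) * g1 s = bb (c0 U) (s - 1) * g0 s - rec (c0 U) S g0 (s - 1)"
    using U by (auto simp: isU_def)
  note f0 = freeD[OF F(1)] and f1 = freeD[OF F(2)] and u = cxD[OF cx] and v = cxD[OF isU_facts(2)]
  have a1: "1 \<le> a" and bn: "b \<le> n" using ab S isU_facts(1) by auto
  \<comment> \<open>The edge into \<open>i\<close> points down for \<open>i\<close> in
    \<open>S\<close> and up otherwise, which is what lets the map \<open>p\<close> below annihilate
    the differential of \<open>U\<close>.\<close>
  define X :: "'k qrep" where "X = strmod a b (%i. i \<notin> S)"
  have rX: "is_rep n X" by (simp add: X_def)
  have dX: "dimv X i = (if a \<le> i & i < b then 1 else 0)" for i unfolding X_def by (rule strmod_dimv[OF bn])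
  have pX: "pmod n X" using strmod_flmod[OF bn] dX[of 0] a1 by (simp add: pmod_def X_def)
  have aX: "aa X i = (if a \<le> i & Suc i < b & Suc i \<notin> S then un 0 0 else 0)" if "i < n" for i
    unfolding X_def by (simp add: strmod_aa[OF bn that])
  have bX: "bb X i = (if a \<le> i & Suc i < b & Suc i \<in> S then un 0 0 else 0)" if "i < n" for i
    unfolding X_def by (simp add: strmod_bb[OF bn that])
  define gx :: "nat => 'k lop" where "gx s = (if a \<le> s & s < b then un 0 0 else 0)" for s
  have "gx s \<in> ops (dimv X (s mod n)) 1" for s
    using bn by (auto simp: gx_def dX intro!: ops_un)
  then obtain p where p: "p \<in> hom (c0 U) X" "\<forall>s\<in>S. p (s mod n) * g0 s = gx s"
    using f0(6)[OF pX, of gx] by blast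
  have recX: "i < n ==> rec X S gx i = (if a \<le> i & i < b then un 0 0 else 0)" for i
  proof (induct i)
    case 0
    then show ?case using a1 by simp
  next
    case (Suc i)
    then have i: "i < n" by simp
    show ?case
    proof (cases "Suc i \<in> S")
      case True
      then show ?thesis by (simp add: gx_def)
    next
      case False
      then have "Suc i \<noteq> a" using ab by auto
      then show ?thesis using Suc False aX[OF i] by (auto simp: un_un)
    qed
  qed
  have recU: "p i * rec (c0 U) S g0 i = rec X S gx i" if "i < n" for i
    unfolding rec_hom[OF p(1) that] by (rule rec_cong) (use p(2) in simp)
  have pD: "p * dd U = 0"
  proof (rule free_hom_eq[OF F(2) rX hom_comp[OF p(1) u(5)] hom_0])
    fix s assume s: "s \<in> S"
    have s': "s \<in> {1..n}" "s - 1 < n" using s S f1(3)[OF s] by auto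
    have "p (s - 1) * (dd U (s - 1) * g1 s) = p (s - 1) * bb (c0 U) (s - 1) * g0 s - p (s - 1) * rec (c0 U) S g0 (s - 1)"
      unfolding d[OF s] by (simp add: right_diff_distrib mult.assoc)
    also have "p (s - 1) * bb (c0 U) (s - 1) * g0 s = bb X (s - 1) * gx s"
      using homD(4)[OF p(1) s'(2)] p(2) s sc_pred[OF s'(1)] by (simp add: mult.assoc)
    also have "p (s - 1) * rec (c0 U) S g0 (s - 1) = rec X S gx (s - 1)" by (rule recU[OF s'(2)])
    also have "bb X (s - 1) * gx s - rec X S gx (s - 1) = 0"
    proof -
      obtain m where m: "s = Suc m" using s'(1) by (cases s) auto
      \<comment> \<open>At \<open>s = b\<close> the relation would fail: the string has no vertex
        \<open>b\<close>, but \<open>rec\<close> at \<open>b - 1\<close> is its last basis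
        vector.\<close>
      have "s \<noteq> b" using s ab by blast
      then have "Suc m < b \<longleftrightarrow> m < b" unfolding m by auto
      then show ?thesis using s s'(2) unfolding m by (auto simp: recX bX gx_def un_un)
    qed
    finally show "(p * dd U) (s - 1) * g1 s = 0 (s - 1) * g1 s" by (simp add: mult.assoc)
  qed
  have b1: "b - 1 < n" "b \<in> {1..n}" using ab bn by auto
  \<comment> \<open>A class in Hom(V, U[1]) concentrated at the generator of \<open>T\<close>
    belonging to \<open>b\<close>; under \<open>p\<close> it becomes the last basis vector of the
    string.\<close>
  define yy where "yy s = (if s = b then rec (c0 U) S g0 (b - 1) else 0)" for s
  have "yy s \<in> ops (dimv (c0 U) (s - 1)) 1" for s
    using rec_ops[OF u(4) f0(4) b1(1)] by (simp add: yy_def)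
  then obtain f where f: "f \<in> hom (c1 V) (c0 U)" "\<forall>s\<in>T. f (s - 1) * k1 s = yy s"
    using freeD(6)[OF isU_facts(4) u(7), of yy] by blast
  obtain h0 h1 where h: "h0 \<in> hom (c0 V) (c0 U)" "h1 \<in> hom (c1 V) (c1 U)" "f = h0 * dd V + dd U * h1"
    using E f(1) unfolding ext0_def by blast
  define q where "q = p * h0"
  have q: "q \<in> hom (c0 V) X" unfolding q_def by (rule hom_comp[OF p(1) h(1)])
  have "p * f = p * h0 * dd V + (p * dd U) * h1" unfolding h(3) by (simp add: distrib_left mult.assoc)
  then have pf: "p * f = q * dd V" unfolding pD q_def by simp
  define x where "x s = q (s mod n) * k0 s" for s
  have x: "x s \<in> ops (dimv X (s mod n)) 1" if "s \<in> T" for s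
    unfolding x_def using ops_mult[OF homD(2)[OF q] freeD(4)[OF isU_facts(3) that]] n_ge2 by simp
  have eq: "p (s - 1) * yy s = bb X (s - 1) * x s - rec X T x (s - 1)" if s: "s \<in> T" for s
  proof -
    have s': "s \<in> {1..n}" "s - 1 < n" using s isU_facts(1) freeD(3)[OF isU_facts(4) s] by auto
    have "p (s - 1) * yy s = (p * f) (s - 1) * k1 s" using f(2) s by (simp add: mult.assoc)
    also have "\<dots> = q (s - 1) * (bb (c0 V) (s - 1) * k0 s - rec (c0 V) T k0 (s - 1))"
      unfolding pf using isU_facts(5)[OF s] by (simp add: mult.assoc)
    also have "\<dots> = (q (s - 1) * bb (c0 V) (s - 1)) * k0 s - q (s - 1) * rec (c0 V) T k0 (s - 1)"
      by (simp add: right_diff_distrib mult.assoc)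
    also have "(q (s - 1) * bb (c0 V) (s - 1)) * k0 s = bb X (s - 1) * x s"
      using homD(4)[OF q s'(2)] sc_pred[OF s'(1)] by (simp add: x_def mult.assoc)
    also have "q (s - 1) * rec (c0 V) T k0 (s - 1) = rec X T x (s - 1)"
      unfolding rec_hom[OF q s'(2)] x_def ..
    finally show ?thesis .
  qed
  \<comment> \<open>A null-homotopy would give a solution along \<open>T\<close> that starts with
    zero, because \<open>a\<close> is not in \<open>T\<close> and the string has no vertex below
    \<open>a\<close>. Inside, \<open>S\<close> and \<open>T\<close> agree, so each further generator
    meets an invertible downward edge and must vanish as well; the zero travels up to
    \<open>b - 1\<close>.\<close>
  have rec0: "a \<le> m ==> m < b ==> rec X T x m = 0" for m
  proof (induct m rule: dec_induct)
    case base
    obtain a' where a': "a = Suc a'" using a1 by (cases a) auto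
    have "a' < n" using a' ab bn by simp
    then show ?case using a' ab aX[of a'] by simp
  next
    case (step m)
    then have r: "rec X T x m = 0" and mn: "m < n" using bn by auto
    show ?case
    proof (cases "Suc m \<in> T")
      case True
      then have mS: "Suc m \<in> S" using agree[of "Suc m"] step by auto
      have "0 = bb X m * x (Suc m)"
        using eq[OF True] r step by (simp add: yy_def)
      then have "0 = un 0 0 * x (Suc m)" using bX[OF mn] mS step by simp
      moreover have "x (Suc m) \<in> ops 1 1" using x[OF True] dX[of "Suc m"] step bn by simp
      then have "x (Suc m) = un 0 0 * x (Suc m)" using ops_l[of "x (Suc m)" 1 1] by (simp add: eye_sum One_nat_def)
      ultimately show ?thesis using True by simp
    next
      case False
      then show ?thesis using r by simp
    qed
  qed
  have "p (b - 1) * rec (c0 U) S g0 (b - 1) = bb X (b - 1) * x b - rec X T x (b - 1)"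
    using eq[OF ab(4)] by (simp add: yy_def)
  moreover have "p (b - 1) * rec (c0 U) S g0 (b - 1) = un 0 0"
    using recU[OF b1(1)] recX[OF b1(1)] ab by auto
  moreover have "bb X (b - 1) = 0" using bX[OF b1(1)] ab by auto
  moreover have "rec X T x (b - 1) = 0" using ab by (intro rec0) auto
  ultimately have "(un 0 0 :: 'k lop) = 0" by simp
  then have "ent (un 0 0 :: 'k lop) 0 0 = 0" by simp
  then show False by (simp add: ent_un)
qed

end

text \<open>Among all pairs that witness incomparability, with the roles of the two sets
  interchangeable, one takes a pair at minimal distance: a disagreement in between would give a
  closer pair.\<close>

lemma crossing_exists:
  assumes "\<not> (S \<subseteq> T \<or> T \<subseteq> (S :: nat set))"
  shows "\<exists>A B a b. ((A, B) = (S, T) \<or> (A, B) = (T, S)) & a < b & a \<in> A & a \<notin> B & b \<in> B & b \<notin> A &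
    (\<forall>i. a < i & i < b --> (i \<in> A \<longleftrightarrow> i \<in> B))"
proof -
  define P where "P d = (\<exists>A B a b. ((A, B) = (S, T) \<or> (A, B) = (T, S)) & a < b & a \<in> A & a \<notin> B & b \<in> B & b \<notin> A & b - a = d)" for d
  obtain a b where ab: "a \<in> S" "a \<notin> T" "b \<in> T" "b \<notin> S" using assms by blast
  have "\<exists>d. P d"
  proof (cases "a < b")
    case True
    then show ?thesis unfolding P_def using ab by blast
  next
    case False
    then have "b < a" using ab by (metis nat_neq_iff)
    then show ?thesis unfolding P_def using ab by blast
  qed
  then have "P (LEAST d. P d)" and least: "\<And>d. P d ==> (LEAST d. P d) \<le> d" using LeastI_ex Least_le by metis+
  then obtain A B a b where h: "(A, B) = (S, T) \<or> (A, B) = (T, S)" "a < b" "a \<in> A" "a \<notin> B" "b \<in> B" "b \<notin> A" "b - a = (LEAST d. P d)"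
    unfolding P_def by blast
  have "i \<in> A \<longleftrightarrow> i \<in> B" if i: "a < i" "i < b" for i
  proof (rule ccontr)
    assume "\<not> (i \<in> A \<longleftrightarrow> i \<in> B)"
    then consider "i \<in> A" "i \<notin> B" | "i \<in> B" "i \<notin> A" by blast
    then show False
    proof cases
      case 1
      then have "P (b - i)" unfolding P_def using h i by blast
      then show False using least[of "b - i"] h(7) i by linarith
    next
      case 2
      then have "P (i - a)" unfolding P_def using h i by blast
      then show False using least[of "i - a"] h(7) i by linarith
    qed
  qed
  then show ?thesis using h by blast
qed

lemma ext0_iff_comparable:
  assumes U: "isU S U g1 g0" and V: "isU T V k1 k0"
  shows "ext0 U V & ext0 V U \<longleftrightarrow> S \<subseteq> T \<or> T \<subseteq> S"
proof
  assume "S \<subseteq> T \<or> T \<subseteq> S"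
  then show "ext0 U V & ext0 V U" using ext0_comparable[OF V U] ext0_comparable[OF U V] by blast
next
  assume E: "ext0 U V & ext0 V U"
  show "S \<subseteq> T \<or> T \<subseteq> S"
  proof (rule ccontr)
    assume nc: "\<not> (S \<subseteq> T \<or> T \<subseteq> S)"
    obtain A B a b where h: "(A, B) = (S, T) \<or> (A, B) = (T, S)" "a < b" "a \<in> A" "a \<notin> B" "b \<in> B" "b \<notin> A"
      "\<forall>i. a < i & i < b --> (i \<in> A \<longleftrightarrow> i \<in> B)" using crossing_exists[OF nc] by (elim exE conjE) (rule that)
    from h(1) show False
    proof
      assume "(A, B) = (S, T)"
      then show False using crossing_ext[OF V U, of a b] h E by auto
    next
      assume "(A, B) = (T, S)"
      then show False using crossing_ext[OF U V, of a b] h E by auto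
    qed
  qed
qed

end

section \<open>Rigid complexes are determined by their classes\<close>

lemma fun_sum_apply: "(\<Sum>a\<in>A. f a) i = (\<Sum>a\<in>A. f a i)"
  for f :: "'a => 'b => 'c::comm_monoid_add"
  by (induct A rule: infinite_finite_induct) auto

text \<open>Over a finite field the product of all \<open>X - a\<close>, plus 1, has no
  root.\<close>

lemma alg_closed_infinite:
  assumes "alg_closed TYPE('k::field)"
  shows "infinite (UNIV :: 'k set)"
proof
  assume fin: "finite (UNIV :: 'k set)"
  define p :: "'k poly" where "p = (\<Prod>a\<in>UNIV. [:- a, 1:])"
  have d: "degree p = card (UNIV :: 'k set)"
    unfolding p_def by (subst degree_prod_sum_eq) auto
  moreover have "card (UNIV :: 'k set) > 0" using fin by (simp add: card_gt_0_iff)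
  ultimately have d1: "degree p \<ge> 1" by linarith
  then have "degree (p + 1) \<ge> 1" by (subst degree_add_eq_left) (auto simp: )
  then obtain x where "poly (p + 1) x = 0" using assms by (auto simp: alg_closed_def)
  moreover have "poly p x = 0" unfolding p_def poly_prod using fin by (intro prod_zero) auto
  ultimately show False by simp
qed

text \<open>Cramer's rule for \<open>(1 - t M) c = t c0 \<mu>\<close> over the polynomials in
  \<open>t\<close>: \<open>C0\<close> is the determinant and \<open>C\<close> is \<open>t\<close>
  times the adjugate applied to \<open>\<mu>\<close>, so no division occurs. At \<open>t = 0\<close>
  the determinant is 1.\<close>

lemma polynomial_cramer:
  fixes M :: "nat => nat => 'k::field"
  shows "\<exists>C0 C. poly C0 0 = 1 & (\<forall>j<N. poly (C j) 0 = 0) &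
    (\<forall>t. \<forall>l<N. poly (C l) t = t * poly C0 t * \<mu> l + t * (\<Sum>j<N. M l j * poly (C j) t))"
proof -
  define A :: "'k poly mat" where "A = mat N N (%(l, j). (if l = j then 1 else 0) - [:0, M l j:])"
  have A: "A \<in> carrier_mat N N" by (simp add: A_def)
  note adj = adj_mat[OF A]
  define C0 where "C0 = det A"
  define C where "C l = [:0, 1:] * (\<Sum>k<N. adj_mat A $$ (l, k) * [:\<mu> k:])" for l
  have main: "(\<Sum>j<N. A $$ (l, j) * C j) = [:0, 1:] * C0 * [:\<mu> l:]" if l: "l < N" for l
  proof -
    have e: "(\<Sum>j<N. A $$ (l, j) * adj_mat A $$ (j, k)) = (if l = k then C0 else 0)" if k: "k < N" for k
    proof -
      have "(A * adj_mat A) $$ (l, k) = (det A \<cdot>\<^sub>m 1\<^sub>m N) $$ (l, k)" using adj(2) by simp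
      then show ?thesis using A adj(1) l k by (simp add: scalar_prod_def atLeast0LessThan C0_def)
    qed
    have "(\<Sum>j<N. A $$ (l, j) * C j) = (\<Sum>j<N. \<Sum>k<N. [:0, 1:] * [:\<mu> k:] * (A $$ (l, j) * adj_mat A $$ (j, k)))"
      unfolding C_def sum_distrib_left by (intro sum.cong) (simp_all only: ac_simps)
    also have "\<dots> = (\<Sum>k<N. \<Sum>j<N. [:0, 1:] * [:\<mu> k:] * (A $$ (l, j) * adj_mat A $$ (j, k)))"
      by (rule sum.swap)
    also have "\<dots> = (\<Sum>k<N. [:0, 1:] * [:\<mu> k:] * (if l = k then C0 else 0))"
      by (intro sum.cong refl) (simp only: sum_distrib_left[symmetric] e lessThan_iff)
    also have "\<dots> = [:0, 1:] * [:\<mu> l:] * C0"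
      using l by (simp add: if_distrib[of "%x. _ * x"] cong: if_cong)
    finally show ?thesis by (simp only: ac_simps)
  qed
  have ev: "poly (C l) t = t * poly C0 t * \<mu> l + t * (\<Sum>j<N. M l j * poly (C j) t)" if l: "l < N" for l t
  proof -
    have "poly (\<Sum>j<N. A $$ (l, j) * C j) t = t * poly C0 t * \<mu> l" unfolding main[OF l] by simp
    moreover have "poly (\<Sum>j<N. A $$ (l, j) * C j) t = (\<Sum>j<N. (if l = j then poly (C j) t else 0) - t * (M l j * poly (C j) t))"
      unfolding poly_sum by (intro sum.cong refl) (use l in \<open>auto simp: A_def algebra_simps\<close>)
    moreover have "\<dots> = poly (C l) t - t * (\<Sum>j<N. M l j * poly (C j) t)"
      using l by (simp add: sum_subtractf sum_distrib_left)
    ultimately show ?thesis by (simp add: algebra_simps)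
  qed
  have hom0: "comm_ring_hom (%p :: 'k poly. poly p 0)" by (unfold_locales; auto)
  have "map_mat (%p. poly p 0) A = 1\<^sub>m N" by (rule eq_matI) (auto simp: A_def)
  then have "poly C0 0 = 1" using comm_ring_hom.hom_det[OF hom0, of A] by (simp add: C0_def)
  moreover have "poly (C j) 0 = 0" for j by (simp add: C_def)
  ultimately show ?thesis using ev by blast
qed

lemma det_ops_inverse:
  fixes f :: "'k::field lop"
  assumes f: "f \<in> ops d d" and det: "det (matop d d f) \<noteq> 0"
  shows "\<exists>h\<in>ops d d. h * f = eye d"
proof -
  let ?A = "matop d d f"
  have A: "?A \<in> carrier_mat d d" by simp
  note adj = adj_mat[OF A]
  have "opm (adj_mat ?A) * f = opm (adj_mat ?A * ?A)"
    using opm_mult[of "adj_mat ?A" ?A] opm_matop[OF f] adj(1) by simp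
  also have "\<dots> = scl (det ?A) * eye d" unfolding adj(3)
    by (rule ops_eqI[of _ d d]) (auto simp: ent_opm ent_scl ent_eye intro!: ops_scl opm_ops')
  finally have "(scl (1 / det ?A) * opm (adj_mat ?A)) * f = eye d"
    using det by (simp add: mult.assoc scl_mult')
  then show ?thesis using opm_ops'[OF adj(1)] ops_scl by blast
qed

text \<open>The determinant is a polynomial in \<open>t\<close> with value 1 at 0, so it has
  finitely many zeros.\<close>

lemma generic_inverse:
  fixes q :: "nat => 'k::field lop"
  assumes q: "\<And>j. j < N ==> q j \<in> ops d d" and C0: "poly C0 0 = 1" and C: "\<And>j. j < N ==> poly (C j) 0 = 0"
  shows "finite {t. \<not> (\<exists>h\<in>ops d d. h * (scl (poly C0 t) * eye d + (\<Sum>j<N. scl (poly (C j) t) * q j)) = eye d)}"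
proof -
  define g where "g t = scl (poly C0 t) * eye d + (\<Sum>j<N. scl (poly (C j) t) * q j)" for t
  have g: "g t \<in> ops d d" for t unfolding g_def using q by (intro ops_add ops_sum ops_scl ops_eye) auto
  define Q where "Q = mat d d (%(r, s). (if r = s then C0 else 0) + (\<Sum>j<N. C j * [:ent (q j) r s:]))"
  have ev: "poly (det Q) t = det (matop d d (g t))" for t
  proof -
    have hom: "comm_ring_hom (%p :: 'k poly. poly p t)" by (unfold_locales; auto)
    have "map_mat (%p. poly p t) Q = matop d d (g t)"
      by (rule eq_matI) (auto simp: Q_def g_def ent_add ent_scl ent_sum ent_eye poly_sum mult.commute)
    then show ?thesis using comm_ring_hom.hom_det[OF hom, of Q] by simp
  qed
  have "g 0 = eye d" using C0 C by (simp add: g_def)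
  then have "poly (det Q) 0 = 1" unfolding ev by (simp add: matop_eye)
  then have "finite {t. poly (det Q) t = 0}" by (intro poly_roots_finite) auto
  then show ?thesis
    by (rule rev_finite_subset) (use det_ops_inverse[OF g] ev in \<open>auto simp: g_def\<close>)
qed

context cyclic
begin

lemma hom_scl: "f \<in> hom X Y ==> (%i. scl c * f i) \<in> hom X Y"
  by (rule homI) (simp_all add: homD[of f X Y] ops_scl mult.assoc scl_left_comm[of _ c])

text \<open>Vertexwise inverses of a morphism commute with the arrows automatically.\<close>

lemma hom_inverse:
  assumes g: "g \<in> hom X Y" and dim: "\<And>i. i < n ==> dimv X i = dimv Y i" and X: "is_rep n X" "is_rep n Y"
    and inv: "\<And>i. i < n ==> \<exists>h\<in>ops (dimv X i) (dimv X i). h * g i = eye (dimv X i)"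
  shows "\<exists>k\<in>hom Y X. k * g = idn X & g * k = idn Y"
proof -
  obtain h where h: "\<And>i. i < n ==> h i \<in> ops (dimv X i) (dimv X i) & h i * g i = eye (dimv X i)"
    using inv by metis
  define k where "k i = (if i < n then h i else 0)" for i
  have gi: "g i \<in> ops (dimv X i) (dimv X i)" if "i < n" for i using homD(2)[OF g that] dim[OF that] by simp
  have gk: "g i * h i = eye (dimv X i)" if "i < n" for i
    using square_inverse[of "g i" "dimv X i" "h i"] gi[OF that] h[OF that] by simp
  have "k \<in> hom Y X"
  proof (rule homI)
    fix i assume i: "i < n"
    have s: "sc n i < n" using sc_lt[OF i] .
    have aX: "aa X i \<in> ops (dimv X (sc n i)) (dimv X i)" using aa_ops[OF X(1) i] .
    have aY: "aa Y i \<in> ops (dimv X (sc n i)) (dimv X i)" using aa_ops[OF X(2) i] dim i s by simp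
    have bX: "bb X i \<in> ops (dimv X i) (dimv X (sc n i))" using bb_ops[OF X(1) i] .
    have bY: "bb Y i \<in> ops (dimv X i) (dimv X (sc n i))" using bb_ops[OF X(2) i] dim i s by simp
    show "k i \<in> ops (dimv X i) (dimv Y i)" using h[OF i] dim[OF i] i by (simp add: k_def)
    have "h (sc n i) * aa Y i = h (sc n i) * aa Y i * (g i * h i)" using gk[OF i] ops_r[OF ops_mult[OF conjunct1[OF h[OF s]] aY]] by simp
    also have "\<dots> = h (sc n i) * (aa Y i * g i) * h i" by (simp add: mult.assoc)
    also have "\<dots> = h (sc n i) * (g (sc n i) * aa X i) * h i" using homD(3)[OF g i] by simp
    also have "\<dots> = (h (sc n i) * g (sc n i)) * aa X i * h i" by (simp add: mult.assoc)
    also have "\<dots> = aa X i * h i" using h[OF s] ops_l[OF aX] by simp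
    finally show "k (sc n i) * aa Y i = aa X i * k i" using i s by (simp add: k_def)
    have "h i * bb Y i = h i * bb Y i * (g (sc n i) * h (sc n i))" using gk[OF s] ops_r[OF ops_mult[OF conjunct1[OF h[OF i]] bY]] by simp
    also have "\<dots> = h i * (bb Y i * g (sc n i)) * h (sc n i)" by (simp add: mult.assoc)
    also have "\<dots> = h i * (g i * bb X i) * h (sc n i)" using homD(4)[OF g i] by simp
    also have "\<dots> = (h i * g i) * bb X i * h (sc n i)" by (simp add: mult.assoc)
    also have "\<dots> = bb X i * h (sc n i)" using h[OF i] ops_l[OF bX] by simp
    finally show "k i * bb Y i = bb X i * k (sc n i)" using i s by (simp add: k_def)
  qed (simp add: k_def)
  moreover have "k * g = idn X" using h by (auto simp: fun_eq_iff k_def idn_def)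
  moreover have "g * k = idn Y" using gk dim by (auto simp: fun_eq_iff k_def idn_def)
  ultimately show ?thesis by blast
qed

text \<open>Morphisms out of a free module that send one generator to a unit column and the others
  to zero span all morphisms.\<close>

lemma hom_finite_span:
  fixes P X :: "'k::field qrep"
  assumes P: "projective n P" and X: "pmod n X"
  shows "\<exists>(N :: nat) F. (\<forall>j<N. F j \<in> hom P X) & (\<forall>f\<in>hom P X. \<exists>l. f = (%i. \<Sum>j<N. scl (l j) * F j i))"
proof -
  let ?I = "gset (homS_dim n P)"
  obtain g where g: "free P ?I fst g" using projective_free[OF P] by blast
  note G = freeD[OF g]
  define J where "J = Sigma ?I (%t. {..<dimv X (fst t)})"
  have finJ: "finite J" by (simp add: J_def)
  have "\<exists>f\<in>hom P X. \<forall>s\<in>?I. f (fst s) * g s = (if s = fst j then un (snd j) 0 else 0)" if "j \<in> J" for j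
    by (rule G(6)[OF X]) (use that in \<open>auto simp: J_def intro!: ops_un\<close>)
  then obtain H where H: "\<And>j. j \<in> J ==> H j \<in> hom P X"
    "\<And>j s. j \<in> J ==> s \<in> ?I ==> H j (fst s) * g s = (if s = fst j then un (snd j) 0 else 0)" by metis
  obtain b where b: "bij_betw b {..<card J} J" using ex_bij_betw_nat_finite[OF finJ] atLeast0LessThan by metis
  have span: "\<exists>l. f = (%i. \<Sum>j\<in>J. scl (l j) * H j i)" if f: "f \<in> hom P X" for f
  proof -
    define l where "l j = ent (f (fst (fst j)) * g (fst j)) (snd j) 0" for j
    have hs: "(%i. \<Sum>j\<in>J. scl (l j) * H j i) = (\<Sum>j\<in>J. (%i. scl (l j) * H j i))"
      by (rule ext) (simp add: fun_sum_apply)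
    have "f = (%i. \<Sum>j\<in>J. scl (l j) * H j i)"
    proof (rule free_hom_eq[OF g pmod_rep[OF X] f])
      show "(%i. \<Sum>j\<in>J. scl (l j) * H j i) \<in> hom P X" unfolding hs by (intro hom_sum hom_scl H)
      fix s assume s: "s \<in> ?I"
      have fx: "f (fst s) * g s \<in> ops (dimv X (fst s)) 1"
        by (rule ops_mult[OF homD(2)[OF f G(3)[OF s]] G(4)[OF s]])
      have "(\<Sum>j\<in>J. scl (l j) * H j (fst s)) * g s = (\<Sum>j\<in>J. scl (l j) * (if s = fst j then un (snd j) 0 else 0))"
        unfolding sum_distrib_right by (intro sum.cong refl) (simp add: H(2)[OF _ s] mult.assoc)
      also have "\<dots> = (\<Sum>t\<in>?I. \<Sum>k<dimv X (fst t). scl (l (t, k)) * (if s = t then un k 0 else 0))"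
        unfolding J_def by (subst sum.Sigma) (auto intro!: sum.cong)
      also have "\<dots> = (\<Sum>t\<in>?I. if s = t then \<Sum>k<dimv X (fst t). scl (l (t, k)) * un k 0 else 0)"
        by (intro sum.cong refl) auto
      also have "\<dots> = (\<Sum>k<dimv X (fst s). scl (l (s, k)) * un k 0)" using s by simp
      also have "\<dots> = f (fst s) * g s" using ops_col_expand[OF fx] by (simp add: l_def)
      finally show "f (fst s) * g s = (\<Sum>j\<in>J. scl (l j) * H j (fst s)) * g s" by simp
    qed
    then show ?thesis by blast
  qed
  have "\<exists>l. f = (%i. \<Sum>j<card J. scl (l j) * H (b j) i)" if f: "f \<in> hom P X" for f
  proof -
    obtain l where "f = (%i. \<Sum>j\<in>J. scl (l j) * H j i)" using span[OF f] by blast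
    then have "f = (%i. \<Sum>j<card J. scl (l (b j)) * H (b j) i)"
      using sum.reindex_bij_betw[OF b, of "%j. scl (l j) * H j _"] by simp
    then show ?thesis by (rule exI[of _ "%j. l (b j)"])
  qed
  moreover have "\<forall>j<card J. H (b j) \<in> hom P X" using H(1) bij_betwE[OF b] by blast
  ultimately show ?thesis by (intro exI[of _ "card J"] exI[of _ "%j. H (b j)"]) blast
qed

text \<open>A rigid differential \<open>d\<close> has an open orbit: on the line from \<open>d\<close> to \<open>e\<close> the base change
  realising \<open>d + t (e - d)\<close> from \<open>d\<close> is found by Cramer's rule over the polynomials in \<open>t\<close>.\<close>

lemma rigid_generic:
  fixes R1 R0 :: "'k::field qrep"
  assumes R1: "projective n R1" and R0: "projective n R0" and d: "d \<in> hom R1 R0" and e: "e \<in> hom R1 R0"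
    and rigid: "\<And>f. f \<in> hom R1 R0 ==> \<exists>p\<in>hom R0 R0. \<exists>q\<in>hom R1 R1. f = p * d + d * q"
  shows "\<exists>B. finite B & (\<forall>t. t \<notin> B --> (\<exists>g0\<in>hom R0 R0. \<exists>g1\<in>hom R1 R1. \<exists>h0\<in>hom R0 R0. \<exists>h1\<in>hom R1 R1.
    h0 * g0 = idn R0 & g0 * h0 = idn R0 & h1 * g1 = idn R1 & g1 * h1 = idn R1 &
    (\<forall>i. g0 i * d i = (d i + scl t * (e i - d i)) * g1 i)))"
proof -
  note rep1 = projective_rep[OF R1] and rep0 = projective_rep[OF R0]
  obtain N :: nat and F where F: "\<And>j. j < N ==> F j \<in> hom R1 R0"
    and span: "\<And>f. f \<in> hom R1 R0 ==> \<exists>l. f = (%i. \<Sum>j<N. scl (l j) * F j i)"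
    using hom_finite_span[OF R1 projective_pmod[OF R0]] by blast
  \<comment> \<open>Rigidity says that every direction is tangent to the orbit of \<open>d\<close>.
    The sign is chosen to match the linearisation of \<open>g0 * d = (d + t m) * g1\<close>.\<close>
  have "\<exists>p q. p \<in> hom R0 R0 & q \<in> hom R1 R1 & F j = p * d - d * q" if j: "j < N" for j
  proof -
    obtain p q where pq: "p \<in> hom R0 R0" "q \<in> hom R1 R1" "F j = p * d + d * q"
      using rigid[OF F[OF j]] by blast
    then have "F j = p * d - d * (- q)" by simp
    then show ?thesis using pq(1) hom_minus[OF pq(2)] by blast
  qed
  then obtain p q where pq: "\<And>j. j < N ==> p j \<in> hom R0 R0" "\<And>j. j < N ==> q j \<in> hom R1 R1"
    "\<And>j. j < N ==> F j = p j * d - d * q j" by metis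
  define m where "m = e - d"
  have m: "m \<in> hom R1 R0" unfolding m_def by (rule hom_diff[OF e d])
  obtain \<mu> where mu: "m = (%i. \<Sum>l<N. scl (\<mu> l) * F l i)" using span[OF m] by blast
  have "\<exists>l. m * q j = (%i. \<Sum>t<N. scl (l t) * F t i)" if "j < N" for j
    using span[OF hom_comp[OF m pq(2)[OF that]]] .
  then obtain M where M: "\<And>j. j < N ==> m * q j = (%i. \<Sum>l<N. scl (M j l) * F l i)" by metis
  \<comment> \<open>With \<open>g0\<close> and \<open>g1\<close> equal to \<open>C0\<close> times
    the identity plus the combinations of the \<open>p j\<close> and \<open>q j\<close> with
    coefficients \<open>C j\<close>, comparing the coefficients of the \<open>F l\<close> in
    \<open>g0 * d = (d + t m) * g1\<close> gives this system.\<close>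
  obtain C0 C where C: "poly C0 0 = 1" "\<And>j. j < N ==> poly (C j) 0 = 0"
    "\<And>t l. l < N ==> poly (C l) t = t * poly C0 t * \<mu> l + t * (\<Sum>j<N. M j l * poly (C j) t)"
    using polynomial_cramer[of N \<mu> "%l j. M j l"] by auto
  let ?g0 = "%t i. scl (poly C0 t) * idn R0 i + (\<Sum>j<N. scl (poly (C j) t) * p j i)"
  let ?g1 = "%t i. scl (poly C0 t) * idn R1 i + (\<Sum>j<N. scl (poly (C j) t) * q j i)"
  have comb: "(%i. scl (poly C0 t) * idn R i + (\<Sum>j<N. scl (poly (C j) t) * r j i)) \<in> hom R R"
    if R: "is_rep n R" and r: "\<And>j. j < N ==> r j \<in> hom R R" for R :: "'k qrep" and r t
  proof -
    have "(%i. scl (poly C0 t) * idn R i + (\<Sum>j<N. scl (poly (C j) t) * r j i)) =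
      (%i. scl (poly C0 t) * idn R i) + (\<Sum>j<N. (%i. scl (poly (C j) t) * r j i))"
      by (rule ext) (simp add: fun_sum_apply)
    moreover have "\<dots> \<in> hom R R" by (intro hom_add hom_sum hom_scl) (use R r in auto)
    ultimately show ?thesis by simp
  qed
  define bad where "bad R r i = {t. \<not> (\<exists>h\<in>ops (dimv R i) (dimv R i).
     h * (scl (poly C0 t) * eye (dimv R i) + (\<Sum>j<N. scl (poly (C j) t) * r j i)) = eye (dimv R i))}"
    for R :: "'k qrep" and r i
  have fin: "finite (bad R r i)" if "\<And>j. j < N ==> r j \<in> hom R R" "i < n" for R :: "'k qrep" and r i
    unfolding bad_def by (rule generic_inverse[OF _ C(1,2)]) (use that(2) homD(2)[OF that(1)] in auto)
  define B where "B = (\<Union>i<n. bad R0 p i \<union> bad R1 q i)"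
  have "finite B" unfolding B_def using fin pq by auto
  moreover have "\<exists>g0\<in>hom R0 R0. \<exists>g1\<in>hom R1 R1. \<exists>h0\<in>hom R0 R0. \<exists>h1\<in>hom R1 R1.
    h0 * g0 = idn R0 & g0 * h0 = idn R0 & h1 * g1 = idn R1 & g1 * h1 = idn R1 &
    (\<forall>i. g0 i * d i = (d i + scl t * (e i - d i)) * g1 i)" if t: "t \<notin> B" for t
  proof -
    have g0: "?g0 t \<in> hom R0 R0" by (rule comb[OF rep0 pq(1)])
    have g1: "?g1 t \<in> hom R1 R1" by (rule comb[OF rep1 pq(2)])
    obtain h0 where h0: "h0 \<in> hom R0 R0" "h0 * ?g0 t = idn R0" "?g0 t * h0 = idn R0"
      using hom_inverse[OF g0 refl rep0 rep0] t by (auto simp: B_def bad_def idn_def)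
    obtain h1 where h1: "h1 \<in> hom R1 R1" "h1 * ?g1 t = idn R1" "?g1 t * h1 = idn R1"
      using hom_inverse[OF g1 refl rep1 rep1] t by (auto simp: B_def bad_def idn_def)
    have "?g0 t i * d i = (d i + scl t * (e i - d i)) * ?g1 t i" for i
    proof -
      let ?c = "%j. poly (C j) t" and ?z = "poly C0 t"
      have id: "idn R0 i * d i = d i" "d i * idn R1 i = d i" "m i * idn R1 i = m i"
        using fun_cong[OF hom_id_l[OF d], of i] fun_cong[OF hom_id_r[OF d], of i] fun_cong[OF hom_id_r[OF m], of i] by auto
      have Fj: "p j i * d i = F j i + d i * q j i" if "j < N" for j
        using fun_cong[OF pq(3)[OF that], of i] by simp
      have L: "?g0 t i * d i = scl ?z * d i + (\<Sum>j<N. scl (?c j) * F j i) + (\<Sum>j<N. scl (?c j) * (d i * q j i))"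
      proof -
        have "(\<Sum>j<N. scl (?c j) * p j i) * d i = (\<Sum>j<N. scl (?c j) * F j i + scl (?c j) * (d i * q j i))"
          unfolding sum_distrib_right by (intro sum.cong refl) (simp add: mult.assoc Fj distrib_left)
        then show ?thesis by (simp add: distrib_right mult.assoc id sum.distrib)
      qed
      have R: "(d i + scl t * m i) * ?g1 t i = scl ?z * d i + (\<Sum>j<N. scl (?c j) * (d i * q j i)) +
        (scl (t * ?z) * m i + (\<Sum>j<N. scl (t * ?c j) * (m i * q j i)))"
      proof -
        have "d i * ?g1 t i = scl ?z * d i + (\<Sum>j<N. scl (?c j) * (d i * q j i))"
          unfolding distrib_left sum_distrib_left scl_left_comm id ..
        moreover have "scl t * m i * ?g1 t i = scl (t * ?z) * m i + (\<Sum>j<N. scl (t * ?c j) * (m i * q j i))"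
          unfolding mult.assoc distrib_left sum_distrib_left scl_left_comm[of "m i"] id by (simp only: scl_mult')
        ultimately show ?thesis by (simp only: distrib_right)
      qed
      have "scl (t * ?z) * m i = (\<Sum>l<N. scl (t * ?z * \<mu> l) * F l i)"
        using fun_cong[OF mu, of i] by (simp add: sum_distrib_left scl_mult')
      moreover have "(\<Sum>j<N. scl (t * ?c j) * (m i * q j i)) = (\<Sum>l<N. scl (t * (\<Sum>j<N. M j l * ?c j)) * F l i)"
      proof -
        have "(\<Sum>j<N. scl (t * ?c j) * (m i * q j i)) = (\<Sum>j<N. \<Sum>l<N. scl (t * (M j l * ?c j)) * F l i)"
        proof (intro sum.cong refl)
          fix j assume "j \<in> {..<N}"
          then have "m i * q j i = (\<Sum>l<N. scl (M j l) * F l i)" using fun_cong[OF M, of j i] by simp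
          then show "scl (t * ?c j) * (m i * q j i) = (\<Sum>l<N. scl (t * (M j l * ?c j)) * F l i)"
            by (simp add: sum_distrib_left scl_mult' ac_simps)
        qed
        also have "\<dots> = (\<Sum>l<N. \<Sum>j<N. scl (t * (M j l * ?c j)) * F l i)" by (rule sum.swap)
        finally show ?thesis by (simp add: sum_distrib_left scl_sum sum_distrib_right)
      qed
      moreover have "(\<Sum>l<N. scl (?c l) * F l i) =
        (\<Sum>l<N. scl (t * ?z * \<mu> l) * F l i) + (\<Sum>l<N. scl (t * (\<Sum>j<N. M j l * ?c j)) * F l i)"
        unfolding sum.distrib[symmetric] distrib_right[symmetric] scl_add[symmetric]
        by (intro sum.cong refl arg_cong[where f = "%x. scl x * F _ i"]) (rule C(3), simp)
      ultimately have "?g0 t i * d i = (d i + scl t * m i) * ?g1 t i"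
        unfolding L R by (simp only: ac_simps)
      then show ?thesis by (simp add: m_def)
    qed
    then show ?thesis using g0 g1 h0 h1 by blast
  qed
  ultimately show ?thesis by blast
qed

text \<open>The line through \<open>d\<close> and \<open>e\<close> meets the orbit of each of them
  in all but finitely many points. A parameter that is good for both puts one point into both
  orbits; seen from \<open>e\<close> it has the parameter \<open>1 - t\<close>.\<close>

lemma rigid_same_terms:
  fixes R1 R0 :: "'k::field qrep"
  assumes inf: "infinite (UNIV :: 'k set)" and U: "is_cx n U" and V: "is_cx n V"
    and c1: "c1 U = R1" "c1 V = R1" and c0: "c0 U = R0" "c0 V = R0" and E: "ext0 U U" "ext0 V V"
  shows "heq U V"
proof -
  note u = cxD[OF U, unfolded c1 c0] and v = cxD[OF V, unfolded c1 c0]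
  define d where "d = dd U"
  define e where "e = dd V"
  have d: "d \<in> hom R1 R0" and e: "e \<in> hom R1 R0" using u(5) v(5) by (auto simp: d_def e_def)
  have rd: "\<exists>p\<in>hom R0 R0. \<exists>q\<in>hom R1 R1. f = p * d + d * q" if "f \<in> hom R1 R0" for f
    using E(1) that unfolding ext0_def c1 c0 d_def by blast
  have re: "\<exists>p\<in>hom R0 R0. \<exists>q\<in>hom R1 R1. f = p * e + e * q" if "f \<in> hom R1 R0" for f
    using E(2) that unfolding ext0_def c1 c0 e_def by blast
  obtain B where B: "finite B" "\<And>t. t \<notin> B ==> (\<exists>g0\<in>hom R0 R0. \<exists>g1\<in>hom R1 R1. \<exists>h0\<in>hom R0 R0. \<exists>h1\<in>hom R1 R1.
    h0 * g0 = idn R0 & g0 * h0 = idn R0 & h1 * g1 = idn R1 & g1 * h1 = idn R1 &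
    (\<forall>i. g0 i * d i = (d i + scl t * (e i - d i)) * g1 i))"
    using rigid_generic[OF u(1,2) d e rd] by blast
  obtain B' where B': "finite B'" "\<And>t. t \<notin> B' ==> (\<exists>g0\<in>hom R0 R0. \<exists>g1\<in>hom R1 R1. \<exists>h0\<in>hom R0 R0. \<exists>h1\<in>hom R1 R1.
    h0 * g0 = idn R0 & g0 * h0 = idn R0 & h1 * g1 = idn R1 & g1 * h1 = idn R1 &
    (\<forall>i. g0 i * e i = (e i + scl t * (d i - e i)) * g1 i))"
    using rigid_generic[OF u(1,2) e d re] by blast
  have "finite (B \<union> (%t. 1 - t) ` B')" using B B' by simp
  then obtain t where t: "t \<notin> B" "t \<notin> (%t. 1 - t) ` B'"
    using inf ex_new_if_finite by blast
  have t': "1 - t \<notin> B'" using t(2) by (metis diff_diff_cancel image_eqI add_diff_cancel_left' diff_add_cancel)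
  obtain g0 g1 h0 h1 where g: "g0 \<in> hom R0 R0" "g1 \<in> hom R1 R1" "h0 \<in> hom R0 R0" "h1 \<in> hom R1 R1"
    "h0 * g0 = idn R0" "g0 * h0 = idn R0" "h1 * g1 = idn R1" "g1 * h1 = idn R1"
    "\<And>i. g0 i * d i = (d i + scl t * (e i - d i)) * g1 i" using B(2)[OF t(1)] by blast
  obtain k0 k1 l0 l1 where k: "k0 \<in> hom R0 R0" "k1 \<in> hom R1 R1" "l0 \<in> hom R0 R0" "l1 \<in> hom R1 R1"
    "l0 * k0 = idn R0" "k0 * l0 = idn R0" "l1 * k1 = idn R1" "k1 * l1 = idn R1"
    "\<And>i. k0 i * e i = (e i + scl (1 - t) * (d i - e i)) * k1 i" using B'(2)[OF t'] by blast
  define x where "x i = d i + scl t * (e i - d i)" for i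
  have gx: "g0 * d = x * g1" using g(9) by (auto simp: fun_eq_iff x_def)
  have kx: "k0 * e = x * k1" using k(9) by (auto simp: fun_eq_iff x_def algebra_simps scl_diff)
  have lx: "l0 * x = e * l1"
  proof -
    have "x \<in> hom R1 R0"
    proof -
      have "x = d + (%i. scl t * (e - d) i)" by (auto simp: fun_eq_iff x_def)
      then show ?thesis using hom_add[OF d hom_scl[OF hom_diff[OF e d]]] by simp
    qed
    then have "l0 * x = l0 * x * (k1 * l1)" using hom_id_r[OF hom_comp[OF k(3)]] k(8) by simp
    also have "\<dots> = l0 * (x * k1) * l1" by (simp add: mult.assoc)
    also have "\<dots> = (l0 * k0) * (e * l1)" unfolding kx[symmetric] by (simp add: mult.assoc)
    also have "\<dots> = e * l1" using k(5) hom_id_l[OF hom_comp[OF e k(4)]] by simp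
    finally show ?thesis .
  qed
  have m4: "(a * b) * (b' * c) = a * (b * b') * c" for a b b' c :: "nat => 'k lop" by (simp add: mult.assoc)
  show ?thesis
  proof (rule heq_iso[OF U V, of "l1 * g1" "l0 * g0" "h1 * k1" "h0 * k0", unfolded c1 c0])
    show "l1 * g1 \<in> hom R1 R1" "l0 * g0 \<in> hom R0 R0" "h1 * k1 \<in> hom R1 R1" "h0 * k0 \<in> hom R0 R0"
      using g k by (auto intro: hom_comp)
    show "h1 * k1 * (l1 * g1) = idn R1" unfolding m4 k(8) hom_id_r[OF g(4)] by (rule g(7))
    show "l1 * g1 * (h1 * k1) = idn R1" unfolding m4 g(8) hom_id_r[OF k(4)] by (rule k(7))
    show "h0 * k0 * (l0 * g0) = idn R0" unfolding m4 k(6) hom_id_r[OF g(3)] by (rule g(5))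
    show "l0 * g0 * (h0 * k0) = idn R0" unfolding m4 g(6) hom_id_r[OF k(3)] by (rule k(5))
    have "l0 * g0 * d = l0 * (x * g1)" using gx by (simp add: mult.assoc)
    also have "\<dots> = e * (l1 * g1)" using lx by (metis mult.assoc)
    finally show "l0 * g0 * dd U = dd V * (l1 * g1)" by (simp add: d_def e_def)
  qed
qed

lemma cone_null: "projective n P ==> is_cx n (mkcx P P (idn P)) & nullh (mkcx P P (idn P))"
proof -
  assume P: "projective n P"
  have i: "idn P \<in> hom P P" using projective_rep[OF P] by simp
  show ?thesis using mkcx_cx[OF P P i] hom_id_l[OF i] i by (auto simp: nullh_def mkcx_dd intro!: bexI[of _ "idn P"])
qed

lemma complex_transport:
  fixes U :: "'k::field cx"
  assumes U: "is_cx n U" and P: "projective n P1" "projective n P0" and iso: "iso (c1 U) P1" "iso (c0 U) P0"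
  shows "\<exists>V. is_cx n V & c1 V = P1 & c0 V = P0 & heq U V"
proof -
  note u = cxD[OF U]
  obtain f1 h1 where 1: "f1 \<in> hom (c1 U) P1" "h1 \<in> hom P1 (c1 U)" "h1 * f1 = idn (c1 U)" "f1 * h1 = idn P1"
    using iso(1) by (auto simp: iso_def)
  obtain f0 h0 where 0: "f0 \<in> hom (c0 U) P0" "h0 \<in> hom P0 (c0 U)" "h0 * f0 = idn (c0 U)" "f0 * h0 = idn P0"
    using iso(2) by (auto simp: iso_def)
  let ?d = "f0 * dd U * h1"
  let ?V = "mkcx P1 P0 ?d"
  have d: "?d \<in> hom P1 P0" by (intro hom_comp[of _ "c1 U"] hom_comp[of _ "c0 U"] 0 1 u)
  have V: "is_cx n ?V" by (rule mkcx_cx[OF P d])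
  have "f0 * dd U = dd ?V * f1"
    unfolding mkcx_dd[OF d] using hom_id_r[OF hom_comp[OF 0(1) u(5)]] 1(3) by (simp add: mult.assoc)
  then have "heq U ?V" by (intro heq_iso[OF U V, of f1 f0 h1 h0]) (simp_all add: 0 1)
  then show ?thesis using V by (intro exI[of _ ?V]) simp
qed

lemma ext0_heq:
  assumes "is_cx n U" "is_cx n U'" "is_cx n V" "is_cx n V'" "heq U U'" "heq V V'"
  shows "ext0 U V \<longleftrightarrow> ext0 U' V'"
proof
  show "ext0 U V ==> ext0 U' V'"
    using ext0_heq_left[OF assms(1,2,5) _ assms(3)] ext0_heq_right[OF assms(3,4,6) _ assms(2)] by blast
  show "ext0 U' V' ==> ext0 U V"
    using ext0_heq_left[OF assms(2,1) heq_sym[OF assms(5)] _ assms(4)]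
      ext0_heq_right[OF assms(4,3) heq_sym[OF assms(6)] _ assms(1)] by blast
qed

text \<open>After adding contractible complexes, two complexes of the same class have isomorphic terms.\<close>

lemma rigid_class_determines:
  fixes U V :: "'k::field cx"
  assumes inf: "infinite (UNIV :: 'k set)" and U: "is_cx n U" and V: "is_cx n V"
    and E: "ext0 U U" "ext0 V V" and cls: "clsCx n U = clsCx n V"
  shows "heq U V"
proof -
  note u = cxD[OF U] and v = cxD[OF V]
  let ?Z = "mkcx (c1 V) (c1 V) (idn (c1 V))" and ?Z' = "mkcx (c1 U) (c1 U) (idn (c1 U))"
  let ?U = "cxsum U ?Z" and ?V = "cxsum V ?Z'"
  have Z: "is_cx n ?Z" "nullh ?Z" and Z': "is_cx n ?Z'" "nullh ?Z'" using cone_null[OF v(1)] cone_null[OF u(1)] by auto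
  have cU: "is_cx n ?U" and cV: "is_cx n ?V" using cxsum_cx[OF U Z(1)] cxsum_cx[OF V Z'(1)] .
  have hU: "heq U ?U" and hV: "heq V ?V" using heq_sum_null[OF U Z] heq_sum_null[OF V Z'] .
  note cu = cxD[OF cU] and cv = cxD[OF cV]
  have c: "homS_dim n (c0 U) i + homS_dim n (c1 V) i = homS_dim n (c0 V) i + homS_dim n (c1 U) i"
    if "1 \<le> i" "i < n" for i
  proof -
    have "clsCx n U i = clsCx n V i" using cls by simp
    then have "real (homS_dim n (c0 U) i + homS_dim n (c1 V) i) = real (homS_dim n (c0 V) i + homS_dim n (c1 U) i)"
      using that by (simp add: clsCx_def)
    then show ?thesis by (simp only: of_nat_eq_iff)
  qed
  have "iso (c1 ?U) (c1 ?V)" unfolding projective_iso_iff[OF cu(1) cv(1)]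
    using homS_dim_rsum[OF u(1) v(1)] homS_dim_rsum[OF v(1) u(1)] by simp
  moreover have "iso (c0 ?U) (c0 ?V)" unfolding projective_iso_iff[OF cu(2) cv(2)]
    using homS_dim_rsum[OF u(2) v(1)] homS_dim_rsum[OF v(2) u(1)] c by simp
  ultimately obtain W where W: "is_cx n W" "c1 W = c1 ?V" "c0 W = c0 ?V" "heq ?U W"
    using complex_transport[OF cU cv(1,2)] by blast
  have UW: "heq U W" by (rule heq_trans[OF U cU W(1) hU W(4)])
  have "ext0 W W" using ext0_heq[OF U W(1) U W(1) UW UW] E(1) by simp
  moreover have "ext0 ?V ?V" using ext0_heq[OF V cV V cV hV hV] E(2) by simp
  ultimately have "heq W ?V" by (intro rigid_same_terms[OF inf W(1) cV W(2) refl W(3) refl])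
  then show ?thesis using heq_trans[OF U W(1) cV UW] heq_trans[OF U cV V _ heq_sym[OF hV]] by blast
qed

end

declare One_nat_def [simp]

section \<open>The Weyl group action on the hyperplane\<close>

abbreviation pinv :: "(nat => nat) => nat => nat" where "pinv \<equiv> inv_into UNIV"

definition sw :: "nat => nat => nat" where
  "sw j i = (if i = j then Suc j else if i = Suc j then j else i)"

lemma sw_sw [simp]: "sw j (sw j i) = i"
  by (auto simp: sw_def)

lemma sw_permutes: "1 \<le> j ==> j < n ==> sw j permutes {1..n}"
  unfolding permutes_def
proof (intro conjI allI impI)
  fix y
  show "\<exists>!x. sw j x = y" by (rule ex1I[of _ "sw j y"]) auto
qed (auto simp: sw_def)

lemma sw_image: "i \<noteq> j ==> sw j ` {1..i} = {1..i}" if "1 \<le> j"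
proof -
  assume ij: "i \<noteq> j"
  have "sw j ` {1..i} \<subseteq> {1..i}" using ij that by (auto simp: sw_def)
  then show ?thesis by (metis card_image card_subset_eq finite_atLeastAtMost inj_on_def sw_sw)
qed

text \<open>The weighted sum measures disorder. An adjacent transposition changes it by a single
  difference, which drives both the sorting argument and the induction on permutations
  below.\<close>

lemma sum_sw:
  fixes f :: "nat => real"
  assumes "1 \<le> j" "j < n"
  shows "(\<Sum>i\<in>{1..n}. real i * f (sw j i)) = (\<Sum>i\<in>{1..n}. real i * f i) + f j - f (Suc j)"
proof -
  have "{1..n} = insert j (insert (Suc j) ({1..n} - {j, Suc j}))" using assms by auto
  then have e: "sum g {1..n} = g j + (g (Suc j) + sum g ({1..n} - {j, Suc j}))" for g :: "nat => real"
    by (metis (no_types, lifting) Diff_iff finite_Diff finite_atLeastAtMost finite_insert insertCI insert_iff n_not_Suc_n sum.insert)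
  have "(\<Sum>i\<in>{1..n} - {j, Suc j}. real i * f (sw j i)) = (\<Sum>i\<in>{1..n} - {j, Suc j}. real i * f i)"
    by (intro sum.cong) (auto simp: sw_def)
  then show ?thesis unfolding e[of "%i. real i * f (sw j i)"] e[of "%i. real i * f i"]
    by (simp add: sw_def algebra_simps)
qed

text \<open>\<open>cone_open\<close> sums over a set of vectors; injectivity permits one coefficient
  per index instead.\<close>

lemma cone_open_image:
  assumes "finite J" "inj_on g J"
  shows "cone_open (g ` J) = {%i. \<Sum>j\<in>J. l j * g j i | l. \<forall>j\<in>J. l j > 0}"
proof (intro equalityI subsetI)
  fix v assume "v \<in> cone_open (g ` J)"
  then obtain l where "\<forall>x\<in>g ` J. l x > 0" "v = (%i. \<Sum>x\<in>g ` J. l x * x i)" by (auto simp: cone_open_def)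
  then show "v \<in> {%i. \<Sum>j\<in>J. l j * g j i | l. \<forall>j\<in>J. l j > 0}"
    using assms by (auto simp: sum.reindex intro!: exI[of _ "%j. l (g j)"])
next
  fix v assume "v \<in> {%i. \<Sum>j\<in>J. l j * g j i | l. \<forall>j\<in>J. l j > 0}"
  then obtain l where l: "\<forall>j\<in>J. l j > 0" "v = (%i. \<Sum>j\<in>J. l j * g j i)" by auto
  let ?l = "%x. l (the_inv_into J g x)"
  have inv: "the_inv_into J g (g j) = j" if "j \<in> J" for j using the_inv_into_f_f[OF assms(2) that] .
  have "v = (%i. \<Sum>x\<in>g ` J. ?l x * x i)"
    unfolding l(2) sum.reindex[OF assms(2)] using inv by (auto intro!: sum.cong)
  moreover have "\<forall>x\<in>g ` J. ?l x > 0" using inv l(1) by auto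
  ultimately show "v \<in> cone_open (g ` J)" unfolding cone_open_def mem_Collect_eq by (intro exI[of _ ?l] conjI)
qed

lemma gen_grp_comp: "w \<in> gen_grp S ==> u \<in> gen_grp S ==> w \<circ> u \<in> gen_grp S"
proof (induct rule: gen_grp.induct)
  case (gen_step s w)
  have "s \<circ> (w \<circ> u) \<in> gen_grp S" by (rule gen_grp.gen_step[OF gen_step(1) gen_step(3)[OF gen_step(4)]])
  then show ?case by (simp only: comp_assoc)
qed simp

lemma increasing_permutation:
  assumes p: "p permutes {1..n}" and inc: "\<And>j. 1 \<le> j ==> j < n ==> p j < p (Suc j)"
  shows "p = id"
proof
  fix i
  have low: "1 \<le> i ==> i \<le> n ==> i \<le> p i" for i
  proof (induct i)
    case (Suc i)
    show ?case
    proof (cases "i = 0")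
      case True
      then show ?thesis using permutes_in_image[OF p, of 1] Suc by auto
    next
      case False
      then show ?thesis using Suc inc[of i] by auto
    qed
  qed simp
  have up: "1 \<le> i ==> i \<le> n ==> p i \<le> i" for i
  proof (induct "n - i" arbitrary: i)
    case 0
    then show ?case using permutes_in_image[OF p, of n] by auto
  next
    case (Suc d)
    then have i: "i < n" by arith
    then have "p (Suc i) \<le> Suc i" using Suc(1)[of "Suc i"] Suc(2) by arith
    then show ?case using inc[of i] Suc(3) i by auto
  qed
  show "p i = id i"
    using low[of i] up[of i] permutes_not_in[OF p, of i] by (cases "i \<in> {1..n}") auto
qed

context cyclic
begin

text \<open>Coordinates on \<open>H\<close>: the coefficient at vertex \<open>i\<close> is the
  difference of neighbouring coordinates, with vertex 0 closing the cycle. The sum of the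
  coefficients over the vertices from \<open>p\<close> to \<open>q - 1\<close> is then
  \<open>x p - x q\<close>.\<close>

definition hv :: "(nat => real) => nat => real" where
  "hv x i = (if 1 \<le> i & i < n then x i - x (Suc i) else if i = 0 then x n - x 1 else 0)"

lemma hv_add: "hv (%i. x i + y i) i = hv x i + hv y i"
  and hv_scale: "hv (%i. c * x i) i = c * hv x i"
  and hv_zero: "hv (%i. 0) i = 0"
  by (auto simp: hv_def algebra_simps)

lemma hv_telescope: "1 \<le> p ==> p \<le> n ==> (\<Sum>j\<in>{p..<n}. hv x j) = x p - x n"
proof (induct "n - p" arbitrary: p)
  case (Suc d)
  then have "(\<Sum>j\<in>{Suc p..<n}. hv x j) = x (Suc p) - x n" by auto
  moreover have "{p..<n} = insert p {Suc p..<n}" using Suc by auto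
  moreover have "p < n" using Suc(2) by simp
  ultimately show ?case using Suc by (simp add: hv_def)
qed simp

lemma hv_eq_iff: "hv x = hv y \<longleftrightarrow> (\<exists>c. \<forall>i\<in>{1..n}. x i = y i + c)"
proof
  assume e: "hv x = hv y"
  have "x p - x n = y p - y n" if "p \<in> {1..n}" for p
    using hv_telescope[of p x] hv_telescope[of p y] that e by simp
  then show "\<exists>c. \<forall>i\<in>{1..n}. x i = y i + c" by (intro exI[of _ "x n - y n"]) (auto simp: algebra_simps)
next
  assume "\<exists>c. \<forall>i\<in>{1..n}. x i = y i + c"
  then obtain c where "\<forall>i\<in>{1..n}. x i = y i + c" by blast
  then show "hv x = hv y" using n_ge2 by (auto simp: hv_def fun_eq_iff)
qed

lemma hv_Hsp: "hv x \<in> Hsp n"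
proof -
  have "{..<n} = insert 0 {1..<n}" using n_ge2 by auto
  then have "(\<Sum>i<n. hv x i) = 0"
    using hv_telescope[of 1 x] n_ge2 by (simp add: hv_def[of x 0])
  then show ?thesis using n_ge2 by (auto simp: Hsp_def K0_def hv_def)
qed

text \<open>The inverse of \<open>hv\<close>, normalised by the value 0 at \<open>n\<close>.\<close>

definition coord :: "(nat => real) => nat => real" where "coord \<theta> i = (\<Sum>j\<in>{i..<n}. \<theta> j)"

lemma hv_coord: "1 \<le> i ==> i < n ==> hv (coord \<theta>) i = \<theta> i"
proof -
  assume i: "1 \<le> i" "i < n"
  then have "{i..<n} = insert i {Suc i..<n}" by auto
  then show ?thesis using i by (simp add: hv_def coord_def)
qed

lemma Hsp_hv: "\<theta> \<in> Hsp n ==> \<theta> = hv (coord \<theta>)"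
proof
  fix i assume t: "\<theta> \<in> Hsp n"
  have "{..<n} = insert 0 {1..<n}" using n_ge2 by auto
  then have "\<theta> 0 = - (\<Sum>j\<in>{1..<n}. \<theta> j)" using t by (simp add: Hsp_def)
  then show "\<theta> i = hv (coord \<theta>) i"
    using hv_coord[of i \<theta>] t by (auto simp: hv_def coord_def Hsp_def K0_def)
qed

text \<open>In these coordinates a reflection is a transposition of neighbours. For
  \<open>n = 2\<close> both neighbours of vertex 1 are vertex 0, and the coefficient is added there
  twice.\<close>

lemma sref_hv: "1 \<le> j ==> j < n ==> sref n j (hv x) = hv (x \<circ> sw j)"
proof
  fix i assume j: "1 \<le> j" "j < n"
  have p: "pr n j = j - 1" using j pr_if by auto
  have s: "sc n j = (if Suc j = n then 0 else Suc j)" using j sc_if by auto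
  show "sref n j (hv x) i = hv (x \<circ> sw j) i"
    using j n_ge2 unfolding sref_def p s by (auto simp: hv_def sw_def)
qed

lemma sref_lin: "sref n j (%i. x i + y i) = (%i. sref n j x i + sref n j y i)"
  by (auto simp: sref_def fun_eq_iff)
lemma sref_scale: "sref n j (%i. c * x i) = (%i. c * sref n j x i)"
  by (auto simp: sref_def fun_eq_iff algebra_simps)
lemma sref_fix: "x j = 0 ==> sref n j x = x"
  by (auto simp: sref_def fun_eq_iff)

lemma Wp_WpJ: "Wp n = WpJ n {}"
  by (simp add: Wp_def WpJ_def)
lemma WpJ_subset: "w \<in> WpJ n J ==> w \<in> Wp n"
  unfolding WpJ_def Wp_def
proof (induct rule: gen_grp.induct)
  case (gen_step s w)
  then show ?case by (intro gen_grp.gen_step) auto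
qed (rule gen_grp.gen_id)

lemma WpJ_lin:
  assumes "w \<in> WpJ n J"
  shows "w (%i. x i + y i) = (%i. w x i + w y i)" "w (%i. c * x i) = (%i. c * w x i)"
  using assms unfolding WpJ_def
  by (induct rule: gen_grp.induct) (auto simp: sref_lin sref_scale)

lemma WpJ_sum:
  assumes "w \<in> WpJ n J" "finite A"
  shows "w (%i. \<Sum>a\<in>A. l a * f a i) = (%i. \<Sum>a\<in>A. l a * w (f a) i)"
  using assms(2)
proof (induct rule: finite_induct)
  case empty
  then show ?case using WpJ_lin(2)[OF assms(1), of 0 "%_. 0"] by simp
next
  case (insert a A)
  then show ?case using WpJ_lin(1)[OF assms(1), of "%i. l a * f a i" "%i. \<Sum>a\<in>A. l a * f a i"]
    WpJ_lin(2)[OF assms(1), of "l a" "f a"] by simp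
qed

lemma WpJ_fix:
  assumes "w \<in> WpJ n J" "\<And>j. 1 \<le> j ==> j < n ==> j \<notin> J ==> x j = 0"
  shows "w x = x"
  using assms(1) unfolding WpJ_def
  by (induct rule: gen_grp.induct) (auto simp: sref_fix assms(2))

text \<open>The action is by precomposition, so composition of group elements reverses the order of
  the permutations.\<close>

definition acts :: "((nat => real) => (nat => real)) => (nat => nat) => bool" where
  "acts w p \<longleftrightarrow> p permutes {1..n} & (\<forall>x. w (hv x) = hv (x \<circ> p))"

text \<open>The transposition at an index outside \<open>J\<close> preserves \<open>{1..j}\<close>
  for every \<open>j\<close> in \<open>J\<close>, so the parabolic subgroup lands in a Young
  subgroup.\<close>

lemma WpJ_acts:
  assumes "w \<in> WpJ n J"
  shows "\<exists>p. acts w p & (\<forall>j\<in>J. p ` {1..j} = {1..j})"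
  using assms unfolding WpJ_def
proof (induct rule: gen_grp.induct)
  case gen_id
  have "acts id id" unfolding acts_def using permutes_id by (simp only: comp_id id_apply simp_thms)
  moreover have "\<forall>j\<in>J. id ` {1..j} = {1..j}" by auto
  ultimately show ?case by blast
next
  case (gen_step s w)
  then obtain j where j: "s = sref n j" "1 \<le> j" "j < n" "j \<notin> J" by auto
  obtain p where p: "acts w p" "\<forall>j\<in>J. p ` {1..j} = {1..j}" using gen_step by blast
  have "acts (s \<circ> w) (p \<circ> sw j)"
    using p j sref_hv[OF j(2,3)] permutes_compose[OF sw_permutes[OF j(2,3)]] by (auto simp: acts_def comp_assoc)
  moreover have "(p \<circ> sw j) ` {1..i} = {1..i}" if "i \<in> J" for i
    using p(2) that j sw_image[OF j(2), of i] by (metis image_comp)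
  ultimately show ?case by blast
qed

text \<open>Conversely a permutation preserving these initial segments is sorted by adjacent
  transpositions outside \<open>J\<close>, as bubble sort never has to move anything across a
  preserved boundary.\<close>

lemma acts_WpJ:
  assumes "p permutes {1..n}" "J \<subseteq> {1..<n}" "\<And>j. j \<in> J ==> p ` {1..j} = {1..j}"
  shows "\<exists>w\<in>WpJ n J. acts w p"
  using assms(1,3)
\<comment> \<open>The weighted sum grows by at least 1 whenever a descent is removed, and it is
  bounded by \<open>n ^ 3\<close>.\<close>
proof (induct "nat \<lfloor>real n ^ 3 - (\<Sum>i\<in>{1..n}. real i * real (p i))\<rfloor>" arbitrary: p rule: less_induct)
  case less
  show ?case
  proof (cases "\<exists>j. 1 \<le> j & j < n & \<not> p j < p (Suc j)")
    case False
    then have "p = id" using increasing_permutation[OF less(2)] by blast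
    then show ?thesis unfolding acts_def WpJ_def by (intro bexI[OF _ gen_grp.gen_id]) (auto simp: permutes_id)
  next
    case True
    then obtain j where j: "1 \<le> j" "j < n" "\<not> p j < p (Suc j)" by blast
    have "p j \<noteq> p (Suc j)" using permutes_inj[OF less(2)] by (metis injD n_not_Suc_n)
    then have gt: "p (Suc j) < p j" using j by simp
    \<comment> \<open>A descent at \<open>j\<close> would carry a value above \<open>j\<close> to a
      position at most \<open>j\<close>, or a value at most \<open>j\<close> beyond it, contrary to
      the preservation of \<open>{1..j}\<close>.\<close>
    have jJ: "j \<notin> J"
    proof
      assume "j \<in> J"
      then have im: "p ` {1..j} = {1..j}" using less(3) by blast
      then have "p j \<le> j" using j by fastforce
      moreover have "p (Suc j) \<notin> {1..j}"
      proof
        assume "p (Suc j) \<in> {1..j}"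
        then obtain i where "i \<in> {1..j}" "p i = p (Suc j)" using im by (metis imageE)
        then show False using injD[OF permutes_inj[OF less(2)], of i "Suc j"] by simp
      qed
      moreover have "p (Suc j) \<in> {1..n}" using permutes_in_image[OF less(2), of "Suc j"] j by auto
      ultimately show False using gt by auto
    qed
    let ?q = "p \<circ> sw j"
    have q: "?q permutes {1..n}" using permutes_compose[OF sw_permutes[OF j(1,2)] less(2)] .
    have qJ: "?q ` {1..i} = {1..i}" if "i \<in> J" for i
      using less(3)[OF that] sw_image[OF j(1), of i] jJ that by (metis image_comp)
    have sq: "(\<Sum>i\<in>{1..n}. real i * real (?q i)) = (\<Sum>i\<in>{1..n}. real i * real (p i)) + real (p j) - real (p (Suc j))"
      using sum_sw[OF j(1,2), of "%i. real (p i)"] by simp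
    have bd: "(\<Sum>i\<in>{1..n}. real i * real (r i)) \<le> real n ^ 3" if "r permutes {1..n}" for r
    proof -
      have "real i * real (r i) \<le> real n * real n" if "i \<in> {1..n}" for i
        using that permutes_in_image[OF \<open>r permutes {1..n}\<close>, of i] by (intro mult_mono) auto
      then have "(\<Sum>i\<in>{1..n}. real i * real (r i)) \<le> real (card {1..n}) * (real n * real n)"
        by (rule sum_bounded_above)
      then show ?thesis by (simp add: power3_eq_cube)
    qed
    have "nat \<lfloor>real n ^ 3 - (\<Sum>i\<in>{1..n}. real i * real (?q i))\<rfloor> < nat \<lfloor>real n ^ 3 - (\<Sum>i\<in>{1..n}. real i * real (p i))\<rfloor>"
    proof -
      have "real (p j) - real (p (Suc j)) \<ge> 1" using gt by simp
      then show ?thesis using bd[OF q] sq by linarith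
    qed
    from less(1)[OF this q qJ] obtain w where w: "w \<in> WpJ n J" "acts w ?q" by blast
    have "sref n j \<circ> w \<in> WpJ n J"
      using w(1) j jJ unfolding WpJ_def by (intro gen_grp.gen_step) auto
    moreover have "acts (sref n j \<circ> w) p"
      using w(2) less(2) sref_hv[OF j(1,2)] by (auto simp: acts_def comp_assoc) (simp add: comp_def)
    ultimately show ?thesis by blast
  qed
qed

text \<open>Group elements are functions on all real families, not just on \<open>H\<close>. Every
  family differs from one in \<open>H\<close> by a vector that vanishes at the vertices
  \<open>1, ..., n - 1\<close>, and all reflections in question fix such a vector.\<close>

lemma Wp_eqI:
  assumes "w \<in> Wp n" "w' \<in> Wp n" "\<And>x. w (hv x) = w' (hv x)"
  shows "w = w'"
proof
  fix \<theta>
  define r where "r i = \<theta> i - hv (coord \<theta>) i" for i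
  have r0: "r j = 0" if "1 \<le> j" "j < n" for j using hv_coord[OF that] by (simp add: r_def)
  have t: "\<theta> = (%i. hv (coord \<theta>) i + r i)" by (simp add: r_def)
  have "v \<theta> = (%i. v (hv (coord \<theta>)) i + r i)" if "v \<in> Wp n" for v
    using that WpJ_lin(1)[of v "{}" "hv (coord \<theta>)" r] WpJ_fix[of v "{}" r] r0 t unfolding Wp_WpJ by metis
  then show "w \<theta> = w' \<theta>" using assms by metis
qed

text \<open>Weakly decreasing with strict descents exactly at \<open>J\<close>: the fundamental face
  of type \<open>J\<close> in coordinates.\<close>

definition Decr :: "nat set => (nat => real) => bool" where
  "Decr J y \<longleftrightarrow> (\<forall>j\<in>{1..<n}. y (Suc j) \<le> y j & (y (Suc j) < y j \<longleftrightarrow> j \<in> J))"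

lemma Decr_le: "Decr J y ==> 1 \<le> p ==> p \<le> q ==> q \<le> n ==> y q \<le> y p"
proof (induct "q - p" arbitrary: q)
  case (Suc d)
  then obtain q' where q: "q = Suc q'" by (cases q) auto
  have q': "p \<le> q'" "d = q' - p" using Suc(2) q by auto
  have "y q' \<le> y p" by (rule Suc(1)[OF q'(2) Suc(3,4) q'(1)]) (use Suc(6) q in simp)
  moreover have "q' \<in> {1..<n}" using q' Suc q by simp
  then have "y (Suc q') \<le> y q'" using Suc(3) by (auto simp: Decr_def)
  ultimately show ?case using q by simp
qed simp

lemma Decr_less_iff:
  assumes "Decr J y" "1 \<le> p" "p \<le> q" "q \<le> n"
  shows "y q < y p \<longleftrightarrow> (\<exists>j\<in>J. p \<le> j & j < q)"
  using assms(3,4)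
proof (induct q rule: dec_induct)
  case (step q)
  have "y (Suc q) \<le> y q" "y (Suc q) < y q \<longleftrightarrow> q \<in> J" using assms step by (auto simp: Decr_def)
  moreover have "y q \<le> y p" using Decr_le[OF assms(1)] assms step by auto
  ultimately show ?case using step by (auto simp: less_Suc_eq)
qed simp

lemma inj_Pdiff: "inj_on (Pdiff n) {1..<n}"
proof (rule inj_onI)
  fix a b assume "a \<in> {1..<n}" "b \<in> {1..<n}" "Pdiff n a = Pdiff n b"
  then have "Pdiff n a a = Pdiff n b a" by simp
  then show "a = b" using \<open>a \<in> _\<close> by (auto simp: Pdiff_def split: if_splits)
qed

text \<open>The coefficient of \<open>Pdiff n j\<close> is the descent of \<open>y\<close> at
  \<open>j\<close>; conversely \<open>y p\<close> is the sum of the coefficients with index at least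
  \<open>p\<close>.\<close>

lemma cone_Pdiff:
  assumes J: "J \<subseteq> {1..<n}"
  shows "cone_open (Pdiff n ` J) = {hv y | y. Decr J y}"
proof -
  have fin: "finite J" using J finite_subset by blast
  have inj: "inj_on (Pdiff n) J" using inj_Pdiff J inj_on_subset by blast
  have Pd: "(\<Sum>j\<in>J. l j * Pdiff n j i) = (if i \<in> J then l i else if i = 0 then - (\<Sum>j\<in>J. l j) else 0)" for l i
  proof -
    have "(\<Sum>j\<in>J. l j * Pdiff n j i) = (\<Sum>j\<in>J. if i = j then l j else if i = 0 then - l j else 0)"
      by (intro sum.cong) (auto simp: Pdiff_def)
    also have "\<dots> = (if i \<in> J then l i else if i = 0 then - (\<Sum>j\<in>J. l j) else 0)"
    proof -
      have J0: "0 \<notin> J" using J by auto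
      consider "i \<in> J" | "i \<notin> J" "i = 0" | "i \<notin> J" "i \<noteq> 0" by blast
      then show ?thesis
      proof cases
        case 1
        then have "(\<Sum>j\<in>J. if i = j then l j else if i = 0 then - l j else 0) = (\<Sum>j\<in>J. if i = j then l j else 0)"
          using J0 by (intro sum.cong) auto
        then show ?thesis using 1 fin by simp
      next
        case 2
        then have "(\<Sum>j\<in>J. if i = j then l j else if i = 0 then - l j else 0) = (\<Sum>j\<in>J. - l j)"
          by (intro sum.cong) auto
        then show ?thesis using 2 by (simp add: sum_negf)
      next
        case 3
        then have "(\<Sum>j\<in>J. if i = j then l j else if i = 0 then - l j else 0) = 0"
          by (intro sum.neutral) auto
        then show ?thesis using 3 by simp
      qed
    qed
    finally show ?thesis .
  qed
  show ?thesis unfolding cone_open_image[OF fin inj]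
  proof (intro equalityI subsetI)
    fix v assume "v \<in> {%i. \<Sum>j\<in>J. l j * Pdiff n j i | l. \<forall>j\<in>J. l j > 0}"
    then obtain l where l: "\<forall>j\<in>J. l j > 0" "v = (%i. \<Sum>j\<in>J. l j * Pdiff n j i)" by auto
    define y where "y p = (\<Sum>j\<in>{j\<in>J. p \<le> j}. l j)" for p
    have step: "y j - y (Suc j) = (if j \<in> J then l j else 0)" for j
    proof -
      have "{i\<in>J. j \<le> i} = (if j \<in> J then insert j {i\<in>J. Suc j \<le> i} else {i\<in>J. Suc j \<le> i})"
        by (auto simp: Suc_le_eq le_less)
      then show ?thesis using fin by (simp add: y_def)
    qed
    have "Decr J y" unfolding Decr_def
    proof
      fix j assume "j \<in> {1..<n}"
      show "y (Suc j) \<le> y j & (y (Suc j) < y j) = (j \<in> J)"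
        using step[of j] l(1) by (cases "j \<in> J") force+
    qed
    moreover have "v = hv y"
    proof
      fix i
      have "{j\<in>J. n \<le> j} = {}" "{j\<in>J. 1 \<le> j} = J" using J by auto
      then have "y n - y 1 = - (\<Sum>j\<in>J. l j)" by (simp only: y_def sum.empty diff_0)
      then show "v i = hv y i" unfolding l(2) Pd hv_def using step[of i] J n_ge2 by auto
    qed
    ultimately show "v \<in> {hv y | y. Decr J y}" by blast
  next
    fix v assume "v \<in> {hv y | y. Decr J y}"
    then obtain y where y: "Decr J y" "v = hv y" by auto
    let ?l = "%j. y j - y (Suc j)"
    have pos: "\<forall>j\<in>J. ?l j > 0" using y(1) J by (auto simp: Decr_def)
    have z: "hv y j = 0" if "j \<in> {1..<n} - J" for j
      using y(1) that by (force simp: Decr_def hv_def)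
    have "y 1 - y n = (\<Sum>j\<in>{1..<n}. hv y j)" using hv_telescope[of 1 y] n_ge2 by simp
    also have "\<dots> = (\<Sum>j\<in>J. hv y j)" by (rule sum.mono_neutral_right) (use J z in auto)
    also have "\<dots> = (\<Sum>j\<in>J. ?l j)" by (intro sum.cong) (use J in \<open>auto simp: hv_def\<close>)
    finally have "y n - y 1 = - (\<Sum>j\<in>J. ?l j)" by simp
    then have "v = (%i. \<Sum>j\<in>J. ?l j * Pdiff n j i)"
      unfolding Pd y(2) using J z n_ge2 by (auto simp: hv_def fun_eq_iff)
    then show "v \<in> {%i. \<Sum>j\<in>J. l j * Pdiff n j i | l. \<forall>j\<in>J. l j > 0}"
      using pos unfolding mem_Collect_eq by (intro exI[of _ ?l] conjI)
  qed
qed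

section \<open>Weak orderings, pieces and their flags\<close>

text \<open>Membership in the same face of the braid arrangement.\<close>

definition same_pat :: "(nat => real) => (nat => real) => bool" where
  "same_pat x y \<longleftrightarrow> (\<forall>p\<in>{1..n}. \<forall>q\<in>{1..n}. x p < x q \<longleftrightarrow> y p < y q)"

lemma same_pat_refl: "same_pat x x" and same_pat_sym: "same_pat x y ==> same_pat y x"
  and same_pat_trans: "same_pat x y ==> same_pat y z ==> same_pat x z"
  by (auto simp: same_pat_def)

lemma same_pat_hv: "hv x = hv y ==> same_pat x y"
  unfolding hv_eq_iff same_pat_def by fastforce

lemma same_pat_perm:
  assumes p: "p permutes {1..n}"
  shows "same_pat (x \<circ> p) (y \<circ> p) \<longleftrightarrow> same_pat x y"
proof
  assume h: "same_pat (x \<circ> p) (y \<circ> p)"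
  show "same_pat x y" unfolding same_pat_def
  proof (intro ballI)
    fix s t assume "s \<in> {1..n}" "t \<in> {1..n}"
    then have "s \<in> p ` {1..n}" "t \<in> p ` {1..n}" using permutes_image[OF p] by auto
    then obtain s' t' where "s' \<in> {1..n}" "s = p s'" "t' \<in> {1..n}" "t = p t'" by blast
    then show "x s < x t \<longleftrightarrow> y s < y t" using h by (simp add: same_pat_def)
  qed
next
  assume "same_pat x y"
  then show "same_pat (x \<circ> p) (y \<circ> p)" using permutes_in_image[OF p] by (simp add: same_pat_def)
qed

lemma Decr_same_pat: "Decr J y ==> Decr J y' \<longleftrightarrow> same_pat y y'"
proof
  assume y: "Decr J y"
  show "same_pat y y'" if y': "Decr J y'"
    unfolding same_pat_def
  proof (intro ballI)
    fix p q assume pq: "p \<in> {1..n}" "q \<in> {1..n}"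
    show "y p < y q \<longleftrightarrow> y' p < y' q"
    proof (cases "p \<le> q")
      case True
      then show ?thesis using Decr_le[OF y, of p q] Decr_le[OF y', of p q] pq by auto
    next
      case False
      then show ?thesis using Decr_less_iff[OF y, of q p] Decr_less_iff[OF y', of q p] pq by auto
    qed
  qed
  show "Decr J y'" if "same_pat y y'"
    unfolding Decr_def
  proof (intro ballI)
    fix j assume j: "j \<in> {1..<n}"
    then have "j \<in> {1..n}" "Suc j \<in> {1..n}" by auto
    then have "y j < y (Suc j) \<longleftrightarrow> y' j < y' (Suc j)" "y (Suc j) < y j \<longleftrightarrow> y' (Suc j) < y' j"
      using that unfolding same_pat_def by blast+
    then show "y' (Suc j) \<le> y' j & (y' (Suc j) < y' j) = (j \<in> J)" using y j by (force simp: Decr_def)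
  qed
qed

lemma piece_eq:
  assumes J: "J \<subseteq> {1..<n}" and w: "acts w p"
  shows "piece n J w = {hv (y \<circ> p) | y. Decr J y}"
  using w unfolding piece_def cone_Pdiff[OF J] acts_def by (auto simp: image_iff) metis

lemma piece_pattern:
  assumes J: "J \<subseteq> {1..<n}" and w: "acts w p" and x: "hv x \<in> piece n J w"
  shows "piece n J w = {hv x' | x'. same_pat x x'}"
proof -
  have p: "p permutes {1..n}" using w by (simp add: acts_def)
  obtain y where y: "hv x = hv (y \<circ> p)" "Decr J y" using x unfolding piece_eq[OF J w] by auto
  have xy: "same_pat x (y \<circ> p)" using y(1) by (rule same_pat_hv)
  show ?thesis unfolding piece_eq[OF J w]
  proof (intro equalityI subsetI)
    fix v assume "v \<in> {hv (y \<circ> p) | y. Decr J y}"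
    then obtain y' where "v = hv (y' \<circ> p)" "Decr J y'" by auto
    then show "v \<in> {hv x' | x'. same_pat x x'}"
      using same_pat_trans[OF xy] same_pat_perm[OF p] Decr_same_pat[OF y(2)] by blast
  next
    fix v assume "v \<in> {hv x' | x'. same_pat x x'}"
    then obtain x' where x': "v = hv x'" "same_pat x x'" by auto
    have e: "x' = (x' \<circ> pinv p) \<circ> p" using permutes_inv_o(2)[OF p] by (simp add: comp_assoc)
    have "same_pat (y \<circ> p) ((x' \<circ> pinv p) \<circ> p)" using same_pat_trans[OF same_pat_sym[OF xy] x'(2)] e by simp
    then have "Decr J (x' \<circ> pinv p)" using same_pat_perm[OF p] Decr_same_pat[OF y(2)] by blast
    moreover have "v = hv ((x' \<circ> pinv p) \<circ> p)" using x'(1) by (simp only: e[symmetric])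
    ultimately show "v \<in> {hv (y \<circ> p) | y. Decr J y}" by blast
  qed
qed

text \<open>A permutation minimising the weighted sum sorts \<open>x\<close> in decreasing order,
  since no adjacent transposition can lower the sum further.\<close>

lemma sorting_permutation:
  fixes x :: "nat => real"
  shows "\<exists>p. p permutes {1..n} & (\<forall>j\<in>{1..<n}. (x \<circ> p) (Suc j) \<le> (x \<circ> p) j)"
proof -
  let ?P = "{p. p permutes {1..n}}"
  let ?f = "%p. \<Sum>i\<in>{1..n}. real i * x (p i)"
  have fin: "finite ?P" by (rule finite_permutations) simp
  have "?P \<noteq> {}" using permutes_id by blast
  define p where "p = arg_min_on ?f ?P"
  have p: "p permutes {1..n}" using arg_min_if_finite(1)[OF fin \<open>?P \<noteq> {}\<close>, of ?f] by (simp add: p_def)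
  have min: "?f p \<le> ?f q" if "q permutes {1..n}" for q
    using arg_min_least[OF fin \<open>?P \<noteq> {}\<close>, of q ?f] that by (simp add: p_def)
  have "x (p (Suc j)) \<le> x (p j)" if j: "j \<in> {1..<n}" for j
  proof -
    have j': "1 \<le> j" "j < n" using j by auto
    have "p \<circ> sw j permutes {1..n}" using permutes_compose[OF sw_permutes[OF j'] p] .
    from min[OF this] show ?thesis using sum_sw[OF j', of "%i. x (p i)"] by simp
  qed
  then show ?thesis using p by auto
qed

lemma piece_exists: "\<exists>J w p. J \<subseteq> {1..<n} & w \<in> Wp n & acts w p & hv x \<in> piece n J w"
proof -
  obtain q where q: "q permutes {1..n}" "\<And>j. j\<in>{1..<n} ==> (x \<circ> q) (Suc j) \<le> (x \<circ> q) j"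
    using sorting_permutation[of x] by blast
  define J where "J = {j\<in>{1..<n}. (x \<circ> q) (Suc j) < (x \<circ> q) j}"
  have J: "J \<subseteq> {1..<n}" by (auto simp: J_def)
  have D: "Decr J (x \<circ> q)" using q(2) by (auto simp: Decr_def J_def)
  obtain w where w: "w \<in> Wp n" "acts w (pinv q)"
    using acts_WpJ[OF permutes_inv[OF q(1)], of "{}"] by (auto simp: Wp_WpJ)
  have "x = (x \<circ> q) \<circ> pinv q" using permutes_inv_o(1)[OF q(1)] by (simp add: comp_assoc)
  then have "hv x = hv ((x \<circ> q) \<circ> pinv q)" by (rule arg_cong)
  then have "hv x \<in> piece n J w" unfolding piece_eq[OF J w(2)] using D by blast
  then show ?thesis using J w by blast
qed

lemma Wp_acts: "w \<in> Wp n ==> \<exists>p. acts w p"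
  using WpJ_acts[of w "{}"] by (auto simp: Wp_WpJ)

lemma piece_Hsp: "J \<subseteq> {1..<n} ==> w \<in> Wp n ==> piece n J w \<subseteq> Hsp n"
proof -
  assume J: "J \<subseteq> {1..<n}" and w: "w \<in> Wp n"
  obtain p where "acts w p" using Wp_acts[OF w] by blast
  then show ?thesis unfolding piece_eq[OF J \<open>acts w p\<close>] using hv_Hsp by auto
qed

lemma Hsp_pieces: "Hsp n = \<Union> {piece n J w | J w. J \<subseteq> {1..<n} & w \<in> Wp n}"
proof
  show "Hsp n \<subseteq> \<Union> {piece n J w | J w. J \<subseteq> {1..<n} & w \<in> Wp n}"
  proof
    fix \<theta> assume "\<theta> \<in> Hsp n"
    then have "\<theta> = hv (coord \<theta>)" by (rule Hsp_hv)
    then show "\<theta> \<in> \<Union> {piece n J w | J w. J \<subseteq> {1..<n} & w \<in> Wp n}"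
      using piece_exists[of "coord \<theta>"] by auto
  qed
  show "\<Union> {piece n J w | J w. J \<subseteq> {1..<n} & w \<in> Wp n} \<subseteq> Hsp n" using piece_Hsp by blast
qed

text \<open>Vectors of the cone have zero coefficients at the vertices \<open>1, ..., n - 1\<close>
  outside \<open>J\<close>, so the generating reflections of \<open>WpJ n J\<close> fix the cone
  pointwise.\<close>

lemma piece_coset:
  assumes J: "J \<subseteq> {1..<n}" and u: "u \<in> WpJ n J"
  shows "piece n J (w \<circ> u) = piece n J w"
proof -
  have "u v = v" if "v \<in> cone_open (Pdiff n ` J)" for v
  proof (rule WpJ_fix[OF u])
    fix j assume "1 \<le> j" "j < n" "j \<notin> J"
    then show "v j = 0" using that unfolding cone_Pdiff[OF J] by (force simp: Decr_def hv_def)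
  qed
  then have "u ` cone_open (Pdiff n ` J) = cone_open (Pdiff n ` J)" by force
  then show ?thesis by (simp only: piece_def image_comp[symmetric])
qed

text \<open>The proper nonempty superlevel sets of \<open>x\<close>, described without thresholds:
  the flag of subsets that belongs to the face of \<open>x\<close>.\<close>

definition Up :: "(nat => real) => nat set set" where
  "Up x = {S. S \<subseteq> {1..n} & S \<noteq> {} & S \<noteq> {1..n} & (\<forall>p\<in>S. \<forall>q\<in>{1..n} - S. x q < x p)}"

lemma Up_same_pat: "same_pat x y ==> Up x = Up y"
  unfolding Up_def same_pat_def by (intro Collect_cong) blast

lemma Up_Decr:
  assumes J: "J \<subseteq> {1..<n}" and y: "Decr J y"
  shows "Up y = (%j. {1..j}) ` J"
proof (intro equalityI subsetI)
  fix S assume S: "S \<in> Up y"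
  have fin: "finite S" using S finite_subset[of S "{1..n}"] by (auto simp: Up_def)
  define m where "m = Max S"
  have mS: "m \<in> S" using S fin by (auto simp: m_def Up_def)
  have 1: "q \<in> S" if "1 \<le> q" "q \<le> m" for q
  proof (rule ccontr)
    assume "q \<notin> S"
    moreover have "m \<le> n" using mS S by (auto simp: Up_def)
    ultimately have "y q < y m" using mS S that by (auto simp: Up_def)
    then show False using Decr_le[OF y that] \<open>m \<le> n\<close> by simp
  qed
  have 2: "q \<in> {1..m}" if "q \<in> S" for q using that fin S by (auto simp: m_def Up_def)
  have Sm: "S = {1..m}"
  proof (intro equalityI subsetI)
    fix q assume "q \<in> {1..m}"
    then show "q \<in> S" by (intro 1) auto
  qed (rule 2)
  have m: "m \<in> {1..<n}" using S Sm mS by (auto simp: Up_def)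
  then have "Suc m \<in> {1..n} - S" unfolding Sm by auto
  then have "y (Suc m) < y m" using S mS by (auto simp: Up_def)
  then have "m \<in> J" using y m by (auto simp: Decr_def)
  then show "S \<in> (%j. {1..j}) ` J" using Sm by blast
next
  fix S assume "S \<in> (%j. {1..j}) ` J"
  then obtain j where j: "j \<in> J" "S = {1..j}" by blast
  then have "j \<in> {1..<n}" using J by auto
  moreover have "y q < y p" if "p \<in> {1..j}" "q \<in> {1..n} - {1..j}" for p q
  proof -
    have pq: "1 \<le> p" "p \<le> q" "q \<le> n" and "p \<le> j" "j < q" using that by auto
    then have "\<exists>i\<in>J. p \<le> i & i < q" using j(1) by blast
    then show ?thesis using Decr_less_iff[OF y pq] by simp
  qed
  ultimately show "S \<in> Up y" using j by (auto simp: Up_def)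
qed

lemma Up_perm:
  assumes p: "p permutes {1..n}"
  shows "Up (y \<circ> p) = (%S. pinv p ` S) ` Up y"
proof -
  have im: "pinv p ` {1..n} = {1..n}" using permutes_image[OF permutes_inv[OF p]] .
  have pi: "p (pinv p i) = i" "pinv p (p i) = i" for i using permutes_inverses[OF p] by auto
  have pin: "p i \<in> {1..n} \<longleftrightarrow> i \<in> {1..n}" "pinv p i \<in> {1..n} \<longleftrightarrow> i \<in> {1..n}" for i
    using permutes_in_image[OF p] permutes_in_image[OF permutes_inv[OF p]] by auto
  have mem: "i \<in> pinv p ` S \<longleftrightarrow> p i \<in> S" for i S
    using pi by (metis image_iff)
  have *: "pinv p ` S \<in> Up (y \<circ> p)" if S: "S \<in> Up y" for S
  proof -
    have "pinv p ` S \<subseteq> {1..n}" using S pin unfolding Up_def by blast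
    moreover have "pinv p ` S \<noteq> {1..n}"
    proof
      assume "pinv p ` S = {1..n}"
      then have "pinv p ` S = pinv p ` {1..n}" using im by simp
      then have "S = {1..n}" by (rule inj_image_eq_iff[OF permutes_inj[OF permutes_inv[OF p]], THEN iffD1])
      then show False using S by (simp add: Up_def)
    qed
    moreover have "(y \<circ> p) b < (y \<circ> p) a" if "a \<in> pinv p ` S" "b \<in> {1..n} - pinv p ` S" for a b
    proof -
      have "p a \<in> S" using that(1) by (simp only: mem)
      moreover have "p b \<in> {1..n} - S" using that(2) by (simp only: Diff_iff mem pin not_False_eq_True)
      ultimately show ?thesis using S unfolding Up_def by simp
    qed
    ultimately show ?thesis using S unfolding Up_def by blast
  qed
  show ?thesis
  proof (intro equalityI subsetI)
    fix S assume S: "S \<in> Up (y \<circ> p)"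
    have mem': "i \<in> p ` S \<longleftrightarrow> pinv p i \<in> S" for i S using pi by (metis image_iff)
    have "p ` S \<subseteq> {1..n}" using S pin unfolding Up_def by blast
    moreover have "p ` S \<noteq> {1..n}"
    proof
      assume "p ` S = {1..n}"
      then have "p ` S = p ` {1..n}" using permutes_image[OF p] by simp
      then have "S = {1..n}" by (rule inj_image_eq_iff[OF permutes_inj[OF p], THEN iffD1])
      then show False using S by (simp add: Up_def)
    qed
    moreover have "y b < y a" if "a \<in> p ` S" "b \<in> {1..n} - p ` S" for a b
    proof -
      have "pinv p a \<in> S" using that(1) by (simp only: mem')
      moreover have "pinv p b \<in> {1..n} - S" using that(2) by (simp only: Diff_iff mem' pin not_False_eq_True)
      ultimately have "(y \<circ> p) (pinv p b) < (y \<circ> p) (pinv p a)" using S unfolding Up_def by blast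
      then show ?thesis by (simp add: pi)
    qed
    ultimately have "p ` S \<in> Up y" using S unfolding Up_def by blast
    moreover have "pinv p ` (p ` S) = S" using pi by (simp add: image_image)
    ultimately show "S \<in> (%S. pinv p ` S) ` Up y" by (metis image_eqI)
  qed (use * in auto)
qed

lemma piece_Up:
  assumes J: "J \<subseteq> {1..<n}" and w: "acts w p" and x: "hv x \<in> piece n J w"
  shows "Up x = (%j. pinv p ` {1..j}) ` J"
proof -
  have p: "p permutes {1..n}" using w by (simp add: acts_def)
  obtain y where y: "hv x = hv (y \<circ> p)" "Decr J y" using x unfolding piece_eq[OF J w] by auto
  have "Up x = Up (y \<circ> p)" by (rule Up_same_pat[OF same_pat_hv[OF y(1)]])
  then show ?thesis using Up_perm[OF p] Up_Decr[OF J y(2)] by (simp add: image_image)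
qed

text \<open>A common point determines its flag. The cardinalities of the members recover
  \<open>J\<close>, and equality of the members shows that \<open>p' \<circ> pinv p\<close>
  preserves every \<open>{1..j}\<close> with \<open>j\<close> in \<open>J\<close>, so it comes from
  an element of \<open>WpJ n J\<close>.\<close>

lemma piece_disjoint:
  assumes J: "J \<subseteq> {1..<n}" "J' \<subseteq> {1..<n}" and w: "w \<in> Wp n" "w' \<in> Wp n"
    and ne: "piece n J w \<inter> piece n J' w' \<noteq> {}"
  shows "J = J' & (\<exists>u\<in>WpJ n J. w' = w \<circ> u)"
proof -
  obtain p p' where p: "acts w p" and p': "acts w' p'" using w Wp_acts by blast
  have pp: "p permutes {1..n}" "p' permutes {1..n}" using p p' by (auto simp: acts_def)
  obtain v where v: "v \<in> piece n J w" "v \<in> piece n J' w'" using ne by blast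
  have "v \<in> Hsp n" by (rule subsetD[OF piece_Hsp[OF J(1) w(1)] v(1)])
  then obtain x where "v = hv x" using Hsp_hv by blast
  then have x: "hv x \<in> piece n J w" "hv x \<in> piece n J' w'" using v by simp_all
  have U: "Up x = (%j. pinv p ` {1..j}) ` J" "Up x = (%j. pinv p' ` {1..j}) ` J'"
    using piece_Up[OF J(1) p x(1)] piece_Up[OF J(2) p' x(2)] .
  have c: "card (pinv q ` {1..j}) = j" if "q permutes {1..n}" for q and j :: nat
    using card_image[OF inj_on_subset[OF permutes_inj[OF permutes_inv[OF that]]], of "{1..j}"] by simp
  have "J = card ` Up x" using U(1) c[OF pp(1)] by (simp add: image_image)
  moreover have "J' = card ` Up x" using U(2) c[OF pp(2)] by (simp add: image_image)
  ultimately have JJ: "J = J'" by simp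
  have eq: "pinv p ` {1..j} = pinv p' ` {1..j}" if "j \<in> J" for j
  proof -
    have "pinv p ` {1..j} \<in> (%j. pinv p' ` {1..j}) ` J'" using U that by blast
    then obtain i where "pinv p ` {1..j} = pinv p' ` {1..i}" by blast
    then show ?thesis using c[OF pp(1), of j] c[OF pp(2), of i] by simp
  qed
  let ?t = "p' \<circ> pinv p"
  have t: "?t permutes {1..n}" using permutes_compose[OF permutes_inv[OF pp(1)] pp(2)] .
  have "?t ` {1..j} = {1..j}" if "j \<in> J" for j
  proof -
    have "?t ` {1..j} = p' ` pinv p' ` {1..j}" using eq[OF that] by (metis image_comp)
    then show ?thesis using permutes_inverses(1)[OF pp(2)] by (simp add: image_image)
  qed
  then obtain u where u: "u \<in> WpJ n J" "acts u ?t" using acts_WpJ[OF t J(1)] by blast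
  have "w' = w \<circ> u"
  proof (rule Wp_eqI[OF w(2)])
    show "w \<circ> u \<in> Wp n" using gen_grp_comp w(1) WpJ_subset[OF u(1)] unfolding Wp_def by blast
    show "w' (hv y) = (w \<circ> u) (hv y)" for y
    proof -
      have "(w \<circ> u) (hv y) = hv (y \<circ> (p' \<circ> pinv p) \<circ> p)" using u p by (simp add: acts_def comp_assoc)
      also have "y \<circ> (p' \<circ> pinv p) \<circ> p = y \<circ> p'" using permutes_inv_o(2)[OF pp(1)] by (simp add: comp_assoc)
      finally have "(w \<circ> u) (hv y) = hv (y \<circ> p')" .
      moreover have "w' (hv y) = hv (y \<circ> p')" using p' unfolding acts_def by blast
      ultimately show ?thesis by (simp only:)
    qed
  qed
  then show ?thesis using JJ u by blast
qed

subsection \<open>Chains of subsets\<close>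

text \<open>The image under \<open>iota\<close> of the class of the complex of \<open>S\<close>, and
  the ray of \<open>H\<close> attached to \<open>S\<close>.\<close>

definition vS :: "nat set => nat => real" where "vS S = hv (%i. if i \<in> S then 1 else 0)"

lemma Pdiff_vS: "j \<in> {1..<n} ==> Pdiff n j = vS {1..j}"
  by (auto simp: fun_eq_iff Pdiff_def vS_def hv_def)

text \<open>The rays of the face of \<open>x\<close> are the indicator vectors of its superlevel
  sets. This is transported from the fundamental face, where \<open>Pdiff n j\<close> is the
  indicator vector of \<open>{1..j}\<close>.\<close>

lemma cone_Up: "cone_open (vS ` Up x) = {hv x' | x'. same_pat x x'}"
proof -
  obtain J w p where J: "J \<subseteq> {1..<n}" and w: "w \<in> Wp n" "acts w p" and x: "hv x \<in> piece n J w"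
    using piece_exists[of x] by blast
  have p: "p permutes {1..n}" using w by (simp add: acts_def)
  have fin: "finite J" using J finite_subset by blast
  define ind :: "nat => nat => real" where "ind j = (%i. if i \<in> {1..j} then 1 else 0)" for j
  have mem: "i \<in> pinv p ` T \<longleftrightarrow> p i \<in> T" for i T
    using permutes_inverses[OF p] by (metis image_iff)
  have wP: "w (Pdiff n j) = hv (ind j \<circ> p)" if "j \<in> J" for j
  proof -
    have "j \<in> {1..<n}" using that J by blast
    then have "Pdiff n j = hv (ind j)" using Pdiff_vS by (simp only: vS_def ind_def)
    then show ?thesis using w(2) by (simp add: acts_def)
  qed
  have wV: "w (Pdiff n j) = vS (pinv p ` {1..j})" if "j \<in> J" for j
  proof -
    have "ind j \<circ> p = (%i. if i \<in> pinv p ` {1..j} then 1 else 0)"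
      by (simp only: mem ind_def comp_def)
    then show ?thesis using wP[OF that] by (simp only: vS_def)
  qed
  have inj: "inj_on (%j. w (Pdiff n j)) J"
  proof (rule inj_onI)
    have ne: False if "a < b" "1 \<le> a" "b < n" "same_pat (ind a) (ind b)" for a b
    proof -
      have "ind a b < ind a a \<longleftrightarrow> ind b b < ind b a" using that unfolding same_pat_def by simp
      then show False using that by (simp add: ind_def)
    qed
    fix a b assume ab: "a \<in> J" "b \<in> J" "w (Pdiff n a) = w (Pdiff n b)"
    then have "same_pat (ind a) (ind b)" using wP same_pat_hv same_pat_perm[OF p] by metis
    moreover have "1 \<le> a" "a < n" "1 \<le> b" "b < n" using ab J by auto
    ultimately show "a = b" using ne[of a b] ne[of b a] same_pat_sym by (metis nat_neq_iff)
  qed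
  have im: "vS ` Up x = (%j. w (Pdiff n j)) ` J"
    unfolding piece_Up[OF J w(2) x] image_image using wV by (intro image_cong) simp_all
  have inj': "inj_on (Pdiff n) J" using inj_Pdiff J inj_on_subset by blast
  have "w ` cone_open (Pdiff n ` J) = {w (%i. \<Sum>j\<in>J. l j * Pdiff n j i) | l. \<forall>j\<in>J. l j > 0}"
    unfolding cone_open_image[OF fin inj'] by blast
  also have "\<dots> = cone_open (vS ` Up x)"
    unfolding im cone_open_image[OF fin inj] WpJ_sum[OF w(1)[unfolded Wp_WpJ] fin, of _ "Pdiff n"] ..
  finally have "cone_open (vS ` Up x) = w ` cone_open (Pdiff n ` J)" ..
  then show ?thesis using piece_pattern[OF J w(2) x] by (simp add: piece_def)
qed

text \<open>Lists instead of sets, since rigid complexes that are not basic repeat a subset. The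
  empty and the full set are excluded: their indicators are constant and give the zero
  vector.\<close>

definition chain :: "nat set list => bool" where
  "chain L \<longleftrightarrow> (\<forall>S\<in>set L. S \<subseteq> {1..n} & S \<noteq> {} & S \<noteq> {1..n}) & (\<forall>S\<in>set L. \<forall>T\<in>set L. S \<subseteq> T \<or> T \<subseteq> S)"

definition xL :: "nat set list => nat => real" where
  "xL L i = (\<Sum>S\<leftarrow>L. if i \<in> S then 1 else 0)"

lemma xL_simps [simp]: "xL [] i = 0" "xL (S # L) i = (if i \<in> S then 1 else 0) + xL L i"
  by (auto simp: xL_def)

lemma hv_xL: "hv (xL L) i = (\<Sum>S\<leftarrow>L. vS S i)"
proof (induct L)
  case Nil
  then show ?case by (simp add: hv_def)
next
  case (Cons S L)
  have "hv (xL (S # L)) i = vS S i + hv (xL L) i"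
  proof -
    have "xL (S # L) = (%i. (if i \<in> S then 1 else 0) + xL L i)" by (rule ext) simp
    then show ?thesis by (simp only: vS_def hv_add)
  qed
  then show ?case using Cons by (simp only: list.map sum_list.Cons)
qed

lemma xL_le: "\<forall>S\<in>set L. q \<in> S --> p \<in> S ==> xL L q \<le> xL L p"
  by (induct L) (auto intro: add_mono)

lemma xL_less: "\<forall>S\<in>set L. q \<in> S --> p \<in> S ==> S \<in> set L ==> p \<in> S ==> q \<notin> S ==> xL L q < xL L p"
proof (induct L)
  case (Cons T L)
  have le: "xL L q \<le> xL L p" using Cons(2) by (intro xL_le) simp
  show ?case
  proof (cases "S = T")
    case True
    then show ?thesis using le Cons(4,5) by simp
  next
    case False
    then have "xL L q < xL L p" using Cons by simp
    then show ?thesis using Cons(2) by simp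
  qed
qed simp

text \<open>Along a chain, for two points one always belongs to at least as many members as the
  other, and strictly more exactly when some member separates them.\<close>

lemma chain_Up:
  assumes "chain L"
  shows "Up (xL L) = set L"
proof (intro equalityI subsetI)
  have cmp: "(\<forall>S\<in>set L. q \<in> S --> p \<in> S) \<or> (\<forall>S\<in>set L. p \<in> S --> q \<in> S)" for p q
    using assms unfolding chain_def by blast
  have lt: "xL L q < xL L p" if "S \<in> set L" "p \<in> S" "q \<notin> S" for S p q
    using cmp[of q p] xL_less[of L q p S] that by blast
  have ge: "\<exists>T\<in>set L. p \<in> T & q \<notin> T" if "xL L q < xL L p" for p q
    using xL_le[of L p q] that by (meson leD)
  fix S assume "S \<in> set L"
  then show "S \<in> Up (xL L)" using assms lt unfolding Up_def chain_def by blast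
next
  have cmp: "(\<forall>S\<in>set L. q \<in> S --> p \<in> S) \<or> (\<forall>S\<in>set L. p \<in> S --> q \<in> S)" for p q
    using assms unfolding chain_def by blast
  have lt: "xL L q < xL L p" if "S \<in> set L" "p \<in> S" "q \<notin> S" for S p q
    using cmp[of q p] xL_less[of L q p S] that by blast
  have ge: "\<exists>T\<in>set L. p \<in> T & q \<notin> T" if "xL L q < xL L p" for p q
    using xL_le[of L p q] that by (meson leD)
  fix S assume S: "S \<in> Up (xL L)"
  have fin: "finite S" "finite ({1..n} - S)" using S finite_subset[of S "{1..n}"] by (auto simp: Up_def)
  have ne: "S \<noteq> {}" "{1..n} - S \<noteq> {}" using S by (auto simp: Up_def)
  \<comment> \<open>The lowest point of \<open>S\<close> and, below, the highest point outside are
    separated by some member \<open>T\<close> of the chain; extremality of both forces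
    \<open>T = S\<close>.\<close>
  define p where "p = arg_min_on (xL L) S"
  define q where "q = arg_min_on (%i. - xL L i) ({1..n} - S)"
  have p: "p \<in> S" "\<And>r. r \<in> S ==> xL L p \<le> xL L r"
    unfolding p_def using arg_min_if_finite(1)[OF fin(1) ne(1)] arg_min_least[OF fin(1) ne(1)] by auto
  have q: "q \<in> {1..n} - S" "\<And>r. r \<in> {1..n} - S ==> xL L r \<le> xL L q"
    unfolding q_def using arg_min_if_finite(1)[OF fin(2) ne(2), of "%i. - xL L i"] arg_min_least[OF fin(2) ne(2), of _ "%i. - xL L i"] by auto
  have "xL L q < xL L p" using S p(1) q(1) by (auto simp: Up_def)
  then obtain T where T: "T \<in> set L" "p \<in> T" "q \<notin> T" using ge by blast
  have "S \<subseteq> T" using lt[OF T(1,2)] p(2) by (meson leD subsetI)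
  moreover have "T \<subseteq> S"
  proof
    fix r assume r: "r \<in> T"
    then have "r \<in> {1..n}" using T(1) assms unfolding chain_def by blast
    then show "r \<in> S" using lt[OF T(1) r T(3)] q(2)[of r] by (meson DiffI leD)
  qed
  ultimately show "S \<in> set L" using T by auto
qed

lemma chain_subset: "chain L ==> set L' \<subseteq> set L ==> chain L'"
  unfolding chain_def by blast

text \<open>The superlevel sets reveal which subsets occur; multiplicities follow by removing one
  occurrence at a time.\<close>

lemma chain_unique:
  assumes "chain L" "chain L'" "hv (xL L) = hv (xL L')"
  shows "mset L = mset L'"
  using assms
proof (induct L arbitrary: L')
  case Nil
  have "set L' = {}" using chain_Up[OF Nil(1)] chain_Up[OF Nil(2)] Up_same_pat[OF same_pat_hv[OF Nil(3)]] by simp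
  then show ?case by simp
next
  case (Cons S L)
  have "S \<in> set L'" using chain_Up[OF Cons(2)] chain_Up[OF Cons(3)] Up_same_pat[OF same_pat_hv[OF Cons(4)]] by auto
  moreover have c: "hv (xL L) = hv (xL (remove1 S L'))"
  proof
    fix i
    have e: "(\<Sum>T\<leftarrow>L'. f T) = f S + (\<Sum>T\<leftarrow>remove1 S L'. f T)" for f :: "nat set => real"
      using sum_list_map_remove1[OF \<open>S \<in> set L'\<close>, of f] .
    have "hv (xL (S # L)) i = hv (xL L') i" by (rule fun_cong[OF Cons(4)])
    then show "hv (xL L) i = hv (xL (remove1 S L')) i"
      unfolding hv_xL using e[of "%T. vS T i"] by simp
  qed
  moreover have "chain L" by (rule chain_subset[OF Cons(2)]) auto
  moreover have "chain (remove1 S L')" by (rule chain_subset[OF Cons(3) set_remove1_subset])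
  ultimately have "mset L = mset (remove1 S L')" using Cons(1) by blast
  then show ?case using \<open>S \<in> set L'\<close> by simp
qed

text \<open>The layer-cake decomposition: after subtraction of its minimum, an integral function is
  the sum of the indicators of its superlevel sets at the levels \<open>1, 2, ...\<close>.\<close>

lemma integral_chain:
  assumes "\<forall>i\<in>{1..n}. x i \<in> \<int>"
  shows "\<exists>L. chain L & hv x = hv (xL L)"
proof -
  define m where "m = Min (x ` {1..n})"
  have ne: "x ` {1..n} \<noteq> {}" using n_ge2 by auto
  have m: "m \<in> x ` {1..n}" "\<And>i. i \<in> {1..n} ==> m \<le> x i"
    unfolding m_def using Min_in[OF _ ne] by auto
  define f where "f i = nat \<lfloor>x i - m\<rfloor>" for i
  have f: "real (f i) = x i - m" if "i \<in> {1..n}" for i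
  proof -
    have "x i - m \<in> \<int>" using assms that m(1) by (auto intro: Ints_diff)
    then obtain z where z: "x i - m = of_int z" by (auto elim: Ints_cases)
    then show ?thesis using m(2)[OF that] by (simp add: f_def)
  qed
  define D where "D = Max (f ` {1..n})"
  have D: "f i \<le> D" if "i \<in> {1..n}" for i using that by (simp add: D_def)
  have "D \<in> f ` {1..n}" unfolding D_def using n_ge2 by (intro Max_in) auto
  define S where "S k = {i\<in>{1..n}. k \<le> f i}" for k
  \<comment> \<open>Level 0 would give the full set and levels above the maximum \<open>D\<close>
    the empty set.\<close>
  define L where "L = map S [1..<Suc D]"
  obtain i0 where i0: "i0 \<in> {1..n}" "x i0 = m" using m(1) by auto
  have "chain L" unfolding chain_def
  proof (intro conjI ballI)
    fix T assume "T \<in> set L"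
    then obtain k where k: "1 \<le> k" "k \<le> D" "T = S k" by (auto simp: L_def)
    show "T \<subseteq> {1..n}" using k by (auto simp: S_def)
    show "T \<noteq> {}" using \<open>D \<in> f ` {1..n}\<close> k by (auto simp: S_def)
    have "i0 \<notin> T" using k i0 by (auto simp: S_def f_def)
    then show "T \<noteq> {1..n}" using i0 by blast
  next
    fix T T' assume "T \<in> set L" "T' \<in> set L"
    then obtain k k' where "T = S k" "T' = S k'" by (auto simp: L_def)
    then show "T \<subseteq> T' \<or> T' \<subseteq> T" by (cases "k \<le> k'") (auto simp: S_def)
  qed
  moreover have "xL L i = x i - m" if i: "i \<in> {1..n}" for i
  proof -
    have "xL (map S [1..<Suc E]) i = real (min E (f i))" for E
    proof (induct E)
      case (Suc E)
      have "xL (l1 @ l2) i = xL l1 i + xL l2 i" for l1 l2 by (simp add: xL_def)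
      then show ?case using Suc i by (auto simp: S_def min_def)
    qed simp
    then show ?thesis using D[OF i] f[OF i] by (simp add: L_def min_def)
  qed
  then have "hv x = hv (xL L)" unfolding hv_eq_iff by (intro exI[of _ m]) auto
  ultimately show ?thesis by blast
qed

lemma chain_cone_piece:
  assumes L: "chain L"
  shows "\<exists>J w. J \<subseteq> {1..<n} & w \<in> Wp n & cone_open (vS ` set L) = piece n J w"
proof -
  obtain J w p where J: "J \<subseteq> {1..<n}" and w: "w \<in> Wp n" "acts w p" and x: "hv (xL L) \<in> piece n J w"
    using piece_exists[of "xL L"] by blast
  have "cone_open (vS ` set L) = piece n J w"
    using cone_Up[of "xL L"] piece_pattern[OF J w(2) x] chain_Up[OF L] by simp
  then show ?thesis using J w by blast
qed

lemma piece_chain_cone: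
  assumes J: "J \<subseteq> {1..<n}" and w: "w \<in> Wp n"
  shows "\<exists>L. chain L & distinct L & cone_open (vS ` set L) = piece n J w"
proof -
  obtain p where p: "acts w p" using Wp_acts[OF w] by blast
  \<comment> \<open>A sample point, showing that the piece is nonempty: it is the sum of all
    \<open>Pdiff n j\<close> with \<open>j\<close> in \<open>J\<close>, in coordinates.\<close>
  have "Decr J (%i. real (card {j\<in>J. i \<le> j}))" unfolding Decr_def
  proof
    fix i assume i: "i \<in> {1..<n}"
    have fin: "finite {j\<in>J. Suc i \<le> j}" using J finite_subset[of "{j\<in>J. Suc i \<le> j}" "{1..<n}"] by auto
    have "{j\<in>J. i \<le> j} = (if i \<in> J then insert i {j\<in>J. Suc i \<le> j} else {j\<in>J. Suc i \<le> j})"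
      by (auto simp: Suc_le_eq le_less)
    then show "real (card {j \<in> J. Suc i \<le> j}) \<le> real (card {j \<in> J. i \<le> j}) &
         (real (card {j \<in> J. Suc i \<le> j}) < real (card {j \<in> J. i \<le> j})) = (i \<in> J)"
      using fin by auto
  qed
  then obtain y where y: "Decr J y" by blast
  define x where "x = y \<circ> p"
  have x: "hv x \<in> piece n J w" unfolding piece_eq[OF J p] x_def using y by blast
  have "finite (Up x)" by (rule finite_subset[of _ "Pow {1..n}"]) (auto simp: Up_def)
  then obtain L where L: "set L = Up x" "distinct L" using finite_distinct_list by blast
  have "S \<subseteq> T \<or> T \<subseteq> S" if "S \<in> Up x" "T \<in> Up x" for S T
  proof (rule ccontr)
    assume "\<not> (S \<subseteq> T \<or> T \<subseteq> S)"
    then obtain a b where "a \<in> S" "a \<notin> T" "b \<in> T" "b \<notin> S" by blast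
    then have "x b < x a" "x a < x b" using that unfolding Up_def by blast+
    then show False by simp
  qed
  then have "chain L" unfolding chain_def L by (auto simp: Up_def)
  moreover have "cone_open (vS ` set L) = piece n J w"
    unfolding L cone_Up piece_pattern[OF J p x] ..
  ultimately show ?thesis using L by blast
qed

end

declare One_nat_def [simp del]

section \<open>Bricks\<close>

lemma eye_eq_0_iff: "(eye d :: 'k::field lop) = 0 \<longleftrightarrow> d = 0"
proof
  assume e: "(eye d :: 'k lop) = 0"
  have "ent (eye d :: 'k lop) 0 0 = 0" unfolding e by simp
  then show "d = 0" by (auto simp: ent_eye split: if_splits)
qed simp

text \<open>\<open>k\<close> will be the rank of \<open>a\<close>. The three blocks have
  \<open>k p\<close>, \<open>(q - k) k\<close> and \<open>(p - k) (q - k)\<close> entries, that is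
  \<open>p q\<close> scalar equations in total, instead of the \<open>2 p q\<close> equations of
  both commutation relations.\<close>

definition edge_system :: "nat => nat => 'k::field lop => 'k lop => nat => 'k lop => 'k lop => 'k lop => 'k lop => 'k lop => bool" where
  "edge_system p q a b k u v w x y \<longleftrightarrow> k \<le> p & k \<le> q & u \<in> ops k q & v \<in> ops (q - k) q & w \<in> ops p k &
    x \<in> ops (p - k) p & y \<in> ops q (q - k) &
    (\<forall>f\<in>ops p p. \<forall>f'\<in>ops q q. u * (f' * a - a * f) = 0 & v * (f' * a - a * f) * w = 0 & x * (f * b - b * f') * y = 0
      --> f' * a = a * f & f * b = b * f')"

text \<open>If \<open>a b = 0\<close> and \<open>b a = 0\<close>, then \<open>p q\<close> scalar equations suffice for commutation with both
  \<open>a\<close> and \<open>b\<close>: the kernel-to-cokernel block of the \<open>a\<close>-equation is vacuous, and only the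
  corresponding block of the \<open>b\<close>-equation is needed.\<close>

lemma edge_system_exists:
  fixes a b :: "'k::field lop"
  assumes a: "a \<in> ops q p" and b: "b \<in> ops p q" and z: "a * b = 0" "b * a = 0"
  shows "\<exists>k u v w x y. edge_system p q a b k u v w x y"
proof -
  obtain g where g: "g \<in> ops p q" "a * g * a = a" "g * a * g = g" using generalized_inverse[OF a] by blast
  have ag: "a * g \<in> ops q q" "a * g * (a * g) = a * g" using a g ops_mult by (auto simp: mult.assoc)
  have ga: "g * a \<in> ops p p" "g * a * (g * a) = g * a" using a g ops_mult by (auto simp: mult.assoc)
  have ag': "eye q - a * g \<in> ops q q" "(eye q - a * g) * (eye q - a * g) = eye q - a * g"
    using ag ops_diff[OF ops_eye ag(1)] by (simp_all add: left_diff_distrib right_diff_distrib ops_l[OF ag(1)] ops_r[OF ag(1)])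
  have ga': "eye p - g * a \<in> ops p p" "(eye p - g * a) * (eye p - g * a) = eye p - g * a"
    using ga ops_diff[OF ops_eye ga(1)] by (simp_all add: left_diff_distrib right_diff_distrib ops_l[OF ga(1)] ops_r[OF ga(1)])
  obtain k u0 u where 1: "splits (a * g) q k u0 u" using idempotent_splits[OF ag] by blast
  obtain k' y v where 2: "splits (eye q - a * g) q k' y v" using idempotent_splits[OF ag'] by blast
  obtain l' x0 x where 4: "splits (eye p - g * a) p l' x0 x" using idempotent_splits[OF ga'] by blast
  note s1 = splitsD[OF 1] and s2 = splitsD[OF 2] and s4 = splitsD[OF 4]
  have 3: "splits (g * a) p k (g * u0) (u * a)"
  proof -
    have "g * u0 * (u * a) = g * (u0 * u) * a" by (simp add: mult.assoc)
    also have "\<dots> = g * a" unfolding s1(4) using g by (simp add: mult.assoc)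
    moreover have "u * a * (g * u0) = u * (a * g * u0)" by (simp add: mult.assoc)
    moreover have "\<dots> = eye k" using s1(22) s1(6) by simp
    ultimately show ?thesis unfolding splits_def
      using ops_mult[OF g(1) s1(1)] ops_mult[OF s1(2) a] by simp
  qed
  have kq: "k + k' = q" by (rule splits_dim_add[OF 1 2])
  have kp: "k + l' = p" by (rule splits_dim_add[OF 3 4])
  have "edge_system p q a b k u v (g * u0) x y" unfolding edge_system_def
  proof (intro conjI ballI impI)
    show "k \<le> p" "k \<le> q" using kq kp by auto
    show "u \<in> ops k q" by (rule s1(2))
    show "v \<in> ops (q - k) q" "y \<in> ops q (q - k)" using s2(1,2) kq by auto
    show "g * u0 \<in> ops p k" by (rule ops_mult[OF g(1) s1(1)])
    show "x \<in> ops (p - k) p" using s4(2) kp by auto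
    fix f f' assume f: "f \<in> ops p p" and f': "f' \<in> ops q q"
      and h: "u * (f' * a - a * f) = 0 & v * (f' * a - a * f) * (g * u0) = 0 & x * (f * b - b * f') * y = 0"
    define D where "D = f' * a - a * f"
    define E where "E = f * b - b * f'"
    have D: "D \<in> ops q p" unfolding D_def using f f' a by (intro ops_diff ops_mult)
    have E: "E \<in> ops p q" unfolding E_def using f f' b by (intro ops_diff ops_mult)
    have uD: "u * D = 0" and vDw: "v * D * (g * u0) = 0" and xEy: "x * E * y = 0" using h by (auto simp: D_def E_def)
    have va: "v * a = 0"
    proof -
      have "v * a = v * (eye q - a * g) * a" using s2(24) by simp
      also have "\<dots> = v * (eye q * a - a * g * a)" by (simp add: mult.assoc left_diff_distrib)
      finally show ?thesis using g(2) ops_l[OF a] by simp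
    qed
    have aga: "a * (g * a) = a" using g(2) by (simp add: mult.assoc)
    \<comment> \<open>On the kernel of \<open>a\<close> only the term with \<open>v * a\<close>
      survives, so this block of the first relation holds by itself.\<close>
    have "v * D * (eye p - g * a) = v * (f' * (a * eye p - a * (g * a))) - v * a * f * (eye p - g * a)"
      unfolding D_def by (simp add: left_diff_distrib right_diff_distrib mult.assoc)
    then have vD1: "v * D * (eye p - g * a) = 0" using va aga ops_r[OF a] by simp
    have "v * D * (g * a) = v * D * (g * u0) * (u * a)" using splitsD(4)[OF 3] by (metis mult.assoc)
    then have vD2: "v * D * (g * a) = 0" using vDw by simp
    have "v * D = v * D * eye p" using ops_r[OF D] by (simp add: mult.assoc)
    also have "\<dots> = v * D * (eye p - g * a) + v * D * (g * a)" by (simp add: right_diff_distrib)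
    finally have vD: "v * D = 0" using vD1 vD2 by simp
    have "D = a * g * D + (eye q - a * g) * D" using ops_l[OF D] by (simp add: left_diff_distrib)
    also have "\<dots> = u0 * (u * D) + y * (v * D)" using s1(4) s2(4) by (simp flip: mult.assoc)
    finally have D0: "D = 0" using uD vD by simp
    then have fa: "f' * a = a * f" by (simp add: D_def)
    \<comment> \<open>Once \<open>f' * a = a * f\<close> is known, \<open>a * b = 0\<close> and
      \<open>b * a = 0\<close> make \<open>E\<close> vanish on the image of \<open>a\<close> and
      take values in the kernel of \<open>a\<close>; only the block from the cokernel to the kernel
      is left.\<close>
    have "E * (a * g) = f * (b * a) * g - b * (f' * a) * g" unfolding E_def by (simp add: left_diff_distrib mult.assoc)
    also have "\<dots> = f * (b * a) * g - (b * a) * f * g" unfolding fa by (simp add: mult.assoc)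
    finally have E1: "E * (a * g) = 0" using z by simp
    have "g * a * E = g * (a * f) * b - g * (a * b) * f'" unfolding E_def by (simp add: right_diff_distrib mult.assoc)
    also have "\<dots> = g * f' * (a * b) - g * (a * b) * f'" unfolding fa[symmetric] by (simp add: mult.assoc)
    finally have E2: "g * a * E = 0" using z by simp
    have "E = (eye p - g * a) * E * (eye q - a * g)"
      using E1 E2 ops_l[OF E] ops_r[OF E] by (simp add: left_diff_distrib right_diff_distrib)
    also have "\<dots> = x0 * (x * E * y) * v" unfolding s4(4)[symmetric] s2(4)[symmetric] by (simp only: mult.assoc)
    finally have "E = 0" using xEy by simp
    then show "f' * a = a * f" "f * b = b * f'" using fa by (auto simp: E_def)
  qed
  then show ?thesis by blast
qed

lemma eigenvector_exists:
  fixes f :: "'k::field lop"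
  assumes ac: "alg_closed TYPE('k)" and f: "f \<in> ops d d" and d: "0 < d"
  shows "\<exists>c x. x \<in> ops d 1 & x \<noteq> 0 & f * x = scl c * x"
proof -
  let ?A = "matop d d f"
  have A: "?A \<in> carrier_mat d d" by simp
  have "degree (char_poly ?A) = d" using degree_monic_char_poly[OF A] by simp
  then have "1 \<le> degree (char_poly ?A)" using d by linarith
  then obtain c where "poly (char_poly ?A) c = 0" using ac unfolding alg_closed_def by blast
  then obtain v where v: "v \<in> carrier_vec d" "v \<noteq> 0\<^sub>v d" "?A *\<^sub>v v = c \<cdot>\<^sub>v v"
    using eigenvalue_root_char_poly[OF A] by (auto simp: eigenvalue_def eigenvector_def)
  define x where "x = opm (mat d 1 (%(r, _). v $ r))"
  have x: "x \<in> ops d 1" unfolding x_def by (intro opm_ops') simp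
  have ex: "ent x r 0 = v $ r" if "r < d" for r using that by (simp add: x_def ent_opm)
  have "x \<noteq> 0"
  proof
    assume "x = 0"
    then have "v $ r = 0" if "r < d" for r using ex[OF that] by simp
    then have "v = 0\<^sub>v d" using v(1) by (intro eq_vecI) auto
    then show False using v(2) by blast
  qed
  moreover have "f * x = scl c * x"
  proof (rule ops_eqI[OF ops_mult[OF f x] ops_scl[OF x]])
    fix r j :: nat assume r: "r < d" "j < 1"
    have "ent (f * x) r 0 = (\<Sum>t<d. ent f r t * v $ t)" using ent_mult[OF ops_r[OF f], of x r 0] ex by simp
    also have "\<dots> = (?A *\<^sub>v v) $ r" using r v(1) by (simp add: scalar_prod_def atLeast0LessThan)
    also have "\<dots> = c * v $ r" using v(1,3) r by simp
    finally show "ent (f * x) r j = ent (scl c * x) r j" using r ex by (simp add: ent_scl)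
  qed
  ultimately show ?thesis using x by blast
qed

context cyclic
begin

text \<open>Every nonzero endomorphism is invertible. The zero module satisfies this too, so
  statements about bricks that need a vector assume a vertex with positive dimension.\<close>

definition brick :: "'k::field qrep => bool" where
  "brick X \<longleftrightarrow> flmod n X & (\<forall>f\<in>hom X X. f = 0 \<or> (\<forall>i<n. \<exists>g\<in>ops (dimv X i) (dimv X i). g * f i = eye (dimv X i)))"

definition dimsum :: "'k::field qrep => nat" where "dimsum X = (\<Sum>i<n. dimv X i)"

text \<open>\<open>r\<close> is the rank of \<open>f\<close> at each vertex. Among the quotients of
  \<open>X\<close> are the image and the cokernel of \<open>f\<close>, among the submodules its
  image and its kernel. They are cut out by idempotents built from vertexwise generalized inverses
  \<open>g\<close>, although \<open>g\<close> itself is not a morphism.\<close>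

lemma endo_splits:
  fixes X :: "'k::field qrep"
  assumes X: "flmod n X" and f: "f \<in> hom X X"
  shows "\<exists>r. (\<forall>i<n. r i \<le> dimv X i) &
    (\<exists>Y Z. flmod n Y & flmod n Z & (\<exists>p. surjh X Y p) & (\<exists>p. surjh X Z p) & (\<forall>i<n. dimv Y i = r i & dimv Z i = dimv X i - r i)) &
    (\<exists>Y Z. flmod n Y & flmod n Z & (\<exists>p. injh Y X p) & (\<exists>p. injh Z X p) & (\<forall>i<n. dimv Y i = r i & dimv Z i = dimv X i - r i)) &
    ((\<forall>i<n. r i = 0) --> f = 0) &
    ((\<forall>i<n. r i = dimv X i) --> (\<forall>i<n. \<exists>g\<in>ops (dimv X i) (dimv X i). g * f i = eye (dimv X i)))"
proof -
  let ?d = "dimv X"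
  note rX = flmodD(1)[OF X]
  have fi: "f i \<in> ops (?d i) (?d i)" if "i < n" for i using homD(2)[OF f that] .
  have "\<exists>g. g \<in> ops (?d i) (?d i) & f i * g * f i = f i & g * f i * g = g" if "i < n" for i
    using generalized_inverse[OF fi[OF that]] by blast
  then obtain g where g: "\<And>i. i < n ==> g i \<in> ops (?d i) (?d i) & f i * g i * f i = f i & g i * f i * g i = g i" by metis
  have gi: "g i \<in> ops (?d i) (?d i)" if "i < n" for i using g[OF that] by blast
  have G: "f i * (g i * f i) = f i" "f i * (g i * (f i * x)) = f i * x" "g i * (f i * g i) = g i" "g i * (f i * (g i * x)) = g i * x"
    if "i < n" for i x using g[OF that] by (metis mult.assoc)+
  have gf: "g i * f i \<in> ops (?d i) (?d i)" and fg: "f i * g i \<in> ops (?d i) (?d i)" if "i < n" for i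
    using ops_mult[OF gi[OF that] fi[OF that]] ops_mult[OF fi[OF that] gi[OF that]] .
  have gf2: "g i * f i * (g i * f i) = g i * f i" and fg2: "f i * g i * (f i * g i) = f i * g i" if "i < n" for i
    using G[OF that] by (simp_all add: mult.assoc)
  have cgf: "eye (?d i) - g i * f i \<in> ops (?d i) (?d i)" "(eye (?d i) - g i * f i) * (eye (?d i) - g i * f i) = eye (?d i) - g i * f i"
    if "i < n" for i using ops_diff[OF ops_eye gf[OF that]] gf2[OF that]
      by (simp_all add: left_diff_distrib right_diff_distrib ops_l[OF gf[OF that]] ops_r[OF gf[OF that]])
  have cfg: "eye (?d i) - f i * g i \<in> ops (?d i) (?d i)" "(eye (?d i) - f i * g i) * (eye (?d i) - f i * g i) = eye (?d i) - f i * g i"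
    if "i < n" for i using ops_diff[OF ops_eye fg[OF that]] fg2[OF that]
      by (simp_all add: left_diff_distrib right_diff_distrib ops_l[OF fg[OF that]] ops_r[OF fg[OF that]])
  have "\<exists>r u v. splits (g i * f i) (?d i) r u v" if "i < n" for i using idempotent_splits[OF gf[OF that] gf2[OF that]] .
  then obtain r u v where s1: "\<And>i. i < n ==> splits (g i * f i) (?d i) (r i) (u i) (v i)" by metis
  have "\<exists>r u v. splits (eye (?d i) - g i * f i) (?d i) r u v" if "i < n" for i using idempotent_splits[OF cgf[OF that]] .
  then obtain r2 u2 v2 where s2: "\<And>i. i < n ==> splits (eye (?d i) - g i * f i) (?d i) (r2 i) (u2 i) (v2 i)" by metis
  have "\<exists>r u v. splits (eye (?d i) - f i * g i) (?d i) r u v" if "i < n" for i using idempotent_splits[OF cfg[OF that]] .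
  then obtain r4 u4 v4 where s4: "\<And>i. i < n ==> splits (eye (?d i) - f i * g i) (?d i) (r4 i) (u4 i) (v4 i)" by metis
  have s3: "splits (f i * g i) (?d i) (r i) (f i * u i) (v i * g i)" if i: "i < n" for i
  proof -
    note s = splitsD[OF s1[OF i]]
    have "f i * u i * (v i * g i) = f i * (u i * v i) * g i" by (simp add: mult.assoc)
    then have 1: "f i * u i * (v i * g i) = f i * g i" unfolding s(4) using G[OF i] by (simp add: mult.assoc)
    have "v i * g i * (f i * u i) = v i * (g i * f i * u i)" by (simp add: mult.assoc)
    then have "v i * g i * (f i * u i) = eye (r i)" using s(22) s(6) by simp
    then show ?thesis unfolding splits_def using 1 ops_mult[OF fi[OF i] s(1)] ops_mult[OF s(2) gi[OF i]] by simp
  qed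
  have r2: "r2 i = ?d i - r i" "r i \<le> ?d i" and r4: "r4 i = ?d i - r i" if "i < n" for i
    using splits_dim_add[OF s1[OF that] s2[OF that]] splits_dim_add[OF s3[OF that] s4[OF that]] by auto
  have A: "f (sc n i) * aa X i = aa X i * f i" "f (sc n i) * (aa X i * x) = aa X i * (f i * x)"
    and B: "f i * bb X i = bb X i * f (sc n i)" "f i * (bb X i * x) = bb X i * (f (sc n i) * x)" if "i < n" for i x
    using homD(3,4)[OF f that] by (metis mult.assoc)+
  have E: "eye (?d (sc n i)) * aa X i = aa X i" "eye (?d (sc n i)) * (aa X i * x) = aa X i * x" "aa X i * eye (?d i) = aa X i"
    "eye (?d i) * bb X i = bb X i" "eye (?d i) * (bb X i * x) = bb X i * x" "bb X i * eye (?d (sc n i)) = bb X i"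
    if "i < n" for i x
    using aa_ops[OF rX that] bb_ops[OF rX that] by (simp_all add: ops_l ops_r ops_l')
  obtain Q1 q1 where Q1: "flmod n Q1" "surjh X Q1 q1" "\<forall>i<n. dimv Q1 i = r i"
  proof -
    have "\<exists>Y p. flmod n Y & surjh X Y p & (\<forall>i<n. dimv Y i = r i & p i = v i)"
    proof (rule quotient_rep[OF X s1])
      fix i assume i: "i < n"
      show "g (sc n i) * f (sc n i) * aa X i * (g i * f i) = g (sc n i) * f (sc n i) * aa X i"
        by (simp add: mult.assoc A[OF i] G[OF i])
      show "g i * f i * bb X i * (g (sc n i) * f (sc n i)) = g i * f i * bb X i"
        by (simp add: mult.assoc B[OF i] G[OF sc_lt[OF i]])
    qed
    then show ?thesis using that by blast
  qed
  obtain Q2 q2 where Q2: "flmod n Q2" "surjh X Q2 q2" "\<forall>i<n. dimv Q2 i = r4 i"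
  proof -
    have "\<exists>Y p. flmod n Y & surjh X Y p & (\<forall>i<n. dimv Y i = r4 i & p i = v4 i)"
    proof (rule quotient_rep[OF X s4])
      fix i assume i: "i < n"
      note G1 = G[OF i] and G2 = G[OF sc_lt[OF i]] and A' = A[OF i, symmetric] and B' = B[OF i, symmetric]
      show "(eye (?d (sc n i)) - f (sc n i) * g (sc n i)) * aa X i * (eye (?d i) - f i * g i) = (eye (?d (sc n i)) - f (sc n i) * g (sc n i)) * aa X i"
        by (simp add: left_diff_distrib right_diff_distrib mult.assoc E[OF i] A' G2)
      show "(eye (?d i) - f i * g i) * bb X i * (eye (?d (sc n i)) - f (sc n i) * g (sc n i)) = (eye (?d i) - f i * g i) * bb X i"
        by (simp add: left_diff_distrib right_diff_distrib mult.assoc E[OF i] B' G1)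
    qed
    then show ?thesis using that by blast
  qed
  obtain Z1 z1 where Z1: "flmod n Z1" "injh Z1 X z1" "\<forall>i<n. dimv Z1 i = r i"
  proof -
    have "\<exists>Y p. flmod n Y & injh Y X p & (\<forall>i<n. dimv Y i = r i & p i = f i * u i)"
    proof (rule sub_rep[OF X s3])
      fix i assume i: "i < n"
      note G1 = G[OF i] and G2 = G[OF sc_lt[OF i]] and A' = A[OF i, symmetric] and B' = B[OF i, symmetric]
      show "f (sc n i) * g (sc n i) * aa X i * (f i * g i) = aa X i * (f i * g i)"
        by (simp add: mult.assoc A' G2)
      show "f i * g i * bb X i * (f (sc n i) * g (sc n i)) = bb X i * (f (sc n i) * g (sc n i))"
        by (simp add: mult.assoc B' G1)
    qed
    then show ?thesis using that by blast
  qed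
  obtain Z2 z2 where Z2: "flmod n Z2" "injh Z2 X z2" "\<forall>i<n. dimv Z2 i = r2 i"
  proof -
    have "\<exists>Y p. flmod n Y & injh Y X p & (\<forall>i<n. dimv Y i = r2 i & p i = u2 i)"
    proof (rule sub_rep[OF X s2])
      fix i assume i: "i < n"
      note G1 = G[OF i] and G2 = G[OF sc_lt[OF i]]
      show "(eye (?d (sc n i)) - g (sc n i) * f (sc n i)) * aa X i * (eye (?d i) - g i * f i) = aa X i * (eye (?d i) - g i * f i)"
        by (simp add: left_diff_distrib right_diff_distrib mult.assoc E[OF i] A[OF i] G1 ops_r[OF fi[OF i]])
      show "(eye (?d i) - g i * f i) * bb X i * (eye (?d (sc n i)) - g (sc n i) * f (sc n i)) = bb X i * (eye (?d (sc n i)) - g (sc n i) * f (sc n i))"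
        by (simp add: left_diff_distrib right_diff_distrib mult.assoc E[OF i] B[OF i] G2 ops_r[OF fi[OF sc_lt[OF i]]])
    qed
    then show ?thesis using that by blast
  qed
  have zero: "f = 0" if "\<forall>i<n. r i = 0"
  proof
    fix i
    show "f i = 0 i"
    proof (cases "i < n")
      case True
      have "u i \<in> ops (?d i) 0" using splitsD(1)[OF s1[OF True]] that True by simp
      then have "u i = 0" by (rule ops_zero_dim(2))
      then have "u i * v i = 0" by simp
      then have "g i * f i = 0" using splitsD(4)[OF s1[OF True]] by simp
      then show ?thesis using G(1)[OF True] by simp
    qed (use homD(1)[OF f] in simp)
  qed
  have full: "\<exists>h\<in>ops (?d i) (?d i). h * f i = eye (?d i)" if "\<forall>i<n. r i = ?d i" and i: "i < n" for i
  proof -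
    have ri: "r i = ?d i" using that by simp
    note s = splitsD[OF s1[OF i], unfolded ri]
    have "u i * v i = eye (?d i)" using square_inverse[OF s(2,1)] square_inverse[OF s(1,2) s(6)] by simp
    then show ?thesis using s(4) gi[OF i] by auto
  qed
  have 1: "\<exists>Y Z. flmod n Y & flmod n Z & (\<exists>p. surjh X Y p) & (\<exists>p. surjh X Z p) & (\<forall>i<n. dimv Y i = r i & dimv Z i = ?d i - r i)"
    by (intro exI[of _ Q1] exI[of _ Q2]) (use Q1 Q2 r4 in auto)
  have 2: "\<exists>Y Z. flmod n Y & flmod n Z & (\<exists>p. injh Y X p) & (\<exists>p. injh Z X p) & (\<forall>i<n. dimv Y i = r i & dimv Z i = ?d i - r i)"
    by (intro exI[of _ Z1] exI[of _ Z2]) (use Z1 Z2 r2(1) in auto)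
  have 3: "\<forall>i<n. r i \<le> ?d i" using r2(2) by blast
  have 4: "(\<forall>i<n. r i = 0) --> f = 0" using zero by blast
  have 5: "(\<forall>i<n. r i = ?d i) --> (\<forall>i<n. \<exists>g\<in>ops (?d i) (?d i). g * f i = eye (?d i))" using full by blast
  show ?thesis by (rule exI[of _ r], rule conjI[OF 3 conjI[OF 1 conjI[OF 2 conjI[OF 4 5]]]])
qed

text \<open>At minimal total dimension an endomorphism that is neither zero nor invertible would
  split the dimension vector into those of two strictly smaller quotients (or submodules), one of
  which inherits \<open>P\<close>. The parameter \<open>E\<close> covers both versions.\<close>

lemma minimal_brick:
  fixes P :: "'k::field qrep => bool"
  assumes ex: "P X0" and fl: "\<And>X. P X ==> flmod n X"
    and E: "E = (%X Y :: 'k qrep. \<exists>p. surjh X Y p) \<or> E = (%X Y. \<exists>p. injh Y X p)"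
    and step: "\<And>X Y Z. P X ==> flmod n Y ==> flmod n Z ==> E X Y ==> E X Z ==>
      (\<And>i. i < n ==> dimv X i = dimv Y i + dimv Z i) ==> P Y \<or> P Z"
  shows "\<exists>X. P X & brick X"
proof -
  obtain X where X: "P X" "\<And>Y. P Y ==> dimsum X \<le> dimsum Y"
    using ex_has_least_nat[of P X0 dimsum] ex by blast
  have "brick X" unfolding brick_def
  proof (intro conjI ballI)
    show flX: "flmod n X" by (rule fl[OF X(1)])
    fix f assume f: "f \<in> hom X X"
    from endo_splits[OF flX f] obtain r where R: "(\<forall>i<n. r i \<le> dimv X i) &
      (\<exists>Y Z. flmod n Y & flmod n Z & (\<exists>p. surjh X Y p) & (\<exists>p. surjh X Z p) & (\<forall>i<n. dimv Y i = r i & dimv Z i = dimv X i - r i)) &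
      (\<exists>Y Z. flmod n Y & flmod n Z & (\<exists>p. injh Y X p) & (\<exists>p. injh Z X p) & (\<forall>i<n. dimv Y i = r i & dimv Z i = dimv X i - r i)) &
      ((\<forall>i<n. r i = 0) --> f = 0) &
      ((\<forall>i<n. r i = dimv X i) --> (\<forall>i<n. \<exists>g\<in>ops (dimv X i) (dimv X i). g * f i = eye (dimv X i)))" by (rule exE)
    note R1 = R[THEN conjunct1] and R' = R[THEN conjunct2]
    note R2 = R'[THEN conjunct1] and R'' = R'[THEN conjunct2]
    note R3 = R''[THEN conjunct1] and R4 = R''[THEN conjunct2, THEN conjunct1] and R5 = R''[THEN conjunct2, THEN conjunct2]
    have "(\<forall>i<n. r i = 0) \<or> (\<forall>i<n. r i = dimv X i)"
    proof (rule ccontr)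
      assume neg: "\<not> ((\<forall>i<n. r i = 0) \<or> (\<forall>i<n. r i = dimv X i))"
      then obtain i j where ij: "i < n" "r i \<noteq> 0" "j < n" "r j \<noteq> dimv X j" by blast
      have "\<exists>Y Z. flmod n Y & flmod n Z & E X Y & E X Z & (\<forall>i<n. dimv Y i = r i & dimv Z i = dimv X i - r i)"
        using E
      proof
        assume "E = (%X Y. \<exists>p. surjh X Y p)"
        then show ?thesis using R2 by (simp only:)
      next
        assume "E = (%X Y. \<exists>p. injh Y X p)"
        then show ?thesis using R3 by (simp only:)
      qed
      then obtain Y Z where YZ: "flmod n Y" "flmod n Z" "E X Y" "E X Z" "\<forall>i<n. dimv Y i = r i & dimv Z i = dimv X i - r i"
        by (elim exE conjE) (rule that)
      have "P Y \<or> P Z" by (rule step[OF X(1) YZ(1-4)]) (use YZ(5) R1 in auto)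
      moreover have "dimsum Y < dimsum X" unfolding dimsum_def
      proof (rule sum_strict_mono_ex1)
        show "\<forall>i\<in>{..<n}. dimv Y i \<le> dimv X i" using YZ(5) R1 by auto
        show "\<exists>i\<in>{..<n}. dimv Y i < dimv X i" using YZ(5) R1 ij by (intro bexI[of _ j]) (auto simp: le_neq_implies_less)
      qed simp
      moreover have "dimsum Z < dimsum X" unfolding dimsum_def
      proof (rule sum_strict_mono_ex1)
        show "\<forall>i\<in>{..<n}. dimv Z i \<le> dimv X i" using YZ(5) by auto
        have "r i \<le> dimv X i" using R1 ij by blast
        then show "\<exists>i\<in>{..<n}. dimv Z i < dimv X i" using YZ(5) ij by (intro bexI[of _ i]) auto
      qed simp
      ultimately show False using X(2) by (meson leD)
    qed
    then show "f = 0 \<or> (\<forall>i<n. \<exists>g\<in>ops (dimv X i) (dimv X i). g * f i = eye (dimv X i))" using R4 R5 by blast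
  qed
  then show ?thesis using X(1) by blast
qed

lemma pth_cycle:
  assumes "is_rep n X" "i < n"
  shows "pth X i (concat (replicate m [True, False])) = eye (dimv X i) * (bb X i * aa X i) ^ m"
  using assms(2)
proof (induct m)
  case (Suc m)
  then show ?case by (simp add: pr_sc mult.assoc power_commutes)
qed simp

text \<open>The central element acts as an endomorphism. It is nilpotent, so on a nonzero brick it
  cannot be invertible and must vanish.\<close>

lemma brick_relations:
  assumes X: "brick X" and d: "i0 < n" "0 < dimv X i0" and i: "i < n"
  shows "bb X i * aa X i = 0" "aa X i * bb X i = 0"
proof -
  have fl: "flmod n X" using X by (simp add: brick_def)
  note r = flmodD(1)[OF fl]
  define z where "z i = (if i < n then bb X i * aa X i else 0)" for i
  have z: "z \<in> hom X X"
  proof (rule homI)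
    fix i assume i: "i < n"
    show "z i \<in> ops (dimv X i) (dimv X i)" using ops_mult[OF bb_ops[OF r i] aa_ops[OF r i]] i by (simp add: z_def)
    have e: "bb X (sc n i) * aa X (sc n i) = aa X i * bb X i" using flmodD(3)[OF fl i] by simp
    show "z (sc n i) * aa X i = aa X i * z i" using i sc_lt[OF i] e by (simp add: z_def mult.assoc)
    show "z i * bb X i = bb X i * z (sc n i)" using i sc_lt[OF i] e by (simp add: z_def mult.assoc)
  qed (simp add: z_def)
  have "z = 0"
  proof (rule ccontr)
    assume "z \<noteq> 0"
    then obtain h where h: "h \<in> ops (dimv X i0) (dimv X i0)" "h * z i0 = eye (dimv X i0)"
      using X z d(1) unfolding brick_def by blast
    obtain N where N: "\<forall>i<n. \<forall>w. length w = N --> pth X i w = 0" using flmodD(4)[OF fl] by blast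
    \<comment> \<open>The \<open>N\<close>-th power of the central element is a closed path of
      length \<open>2 N\<close>.\<close>
    have "length (concat (replicate N [True, False])) = N * 2" by (induct N) auto
    then have "pth X i0 (concat (replicate N [True, False])) = 0"
      by (intro pth_zero_mono[OF r N _ d(1)]) simp
    then have "eye (dimv X i0) * z i0 ^ N = 0" using pth_cycle[OF r d(1), of N] d(1) by (simp add: z_def)
    then have "(eye (dimv X i0) :: 'a lop) = 0"
    proof (induct N)
      case (Suc N)
      have "h * (eye (dimv X i0) * (z i0 * z i0 ^ N)) = (h * eye (dimv X i0)) * z i0 * z i0 ^ N" by (simp only: mult.assoc)
      also have "\<dots> = eye (dimv X i0) * z i0 ^ N" using ops_r[OF h(1)] h(2) by simp
      finally show ?case using Suc by simp
    qed simp
    then show False using d(2) by (simp add: eye_eq_0_iff)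
  qed
  then have zz: "bb X i * aa X i = 0" if "i < n" for i using that by (auto simp: z_def fun_eq_iff) metis
  then show "bb X i * aa X i = 0" using i by blast
  show "aa X i * bb X i = 0" using flmodD(3)[OF fl i] zz[OF sc_lt[OF i]] by simp
qed

text \<open>Schur's lemma: subtracting an eigenvalue at one vertex leaves an endomorphism that kills
  a nonzero vector, hence is zero.\<close>

lemma brick_endo_scalar:
  fixes X :: "'k::field qrep"
  assumes ac: "alg_closed TYPE('k)" and X: "brick X" and d: "i0 < n" "0 < dimv X i0" and f: "f \<in> hom X X"
  shows "\<exists>c. \<forall>i<n. f i = scl c * eye (dimv X i)"
proof -
  have r: "is_rep n X" using X flmodD(1) by (auto simp: brick_def)
  obtain c x where x: "x \<in> ops (dimv X i0) 1" "x \<noteq> 0" "f i0 * x = scl c * x"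
    using eigenvector_exists[OF ac homD(2)[OF f d(1)] d(2)] by (elim exE conjE) (rule that)
  define h where "h i = f i - (if i < n then scl c * eye (dimv X i) else 0)" for i
  have h: "h \<in> hom X X"
  proof (rule homI)
    fix i assume i: "i < n"
    note a = aa_ops[OF r i] and b = bb_ops[OF r i]
    show "h i \<in> ops (dimv X i) (dimv X i)" using i homD(2)[OF f i] by (auto simp: h_def intro!: ops_diff ops_scl)
    show "h (sc n i) * aa X i = aa X i * h i"
      using i sc_lt[OF i] homD(3)[OF f i] ops_l[OF a] ops_r[OF a]
      by (simp add: h_def left_diff_distrib right_diff_distrib mult.assoc scl_left_comm[of "aa X i"])
    show "h i * bb X i = bb X i * h (sc n i)"
      using i sc_lt[OF i] homD(4)[OF f i] ops_l[OF b] ops_r[OF b]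
      by (simp add: h_def left_diff_distrib right_diff_distrib mult.assoc scl_left_comm[of "bb X i"])
  qed (simp add: h_def homD(1)[OF f])
  have hx: "h i0 * x = 0" using x(3) d(1) ops_l[OF x(1)] by (simp add: h_def left_diff_distrib mult.assoc)
  have "h = 0"
  proof (rule ccontr)
    assume "h \<noteq> 0"
    then obtain g where g: "g * h i0 = eye (dimv X i0)" using X h d(1) unfolding brick_def by blast
    have "x = g * (h i0 * x)" using g ops_l[OF x(1)] by (simp flip: mult.assoc)
    then show False using hx x(2) by simp
  qed
  then have h0: "h i = 0" for i by simp
  have "f i = scl c * eye (dimv X i)" if "i < n" for i using that h0[of i] by (simp add: h_def)
  then show ?thesis by blast
qed

text \<open>Endomorphisms are cut out by \<open>\<Sum> d\<^sub>i d\<^sub>i\<^sub>+\<^sub>1\<close> linear equations in \<open>\<Sum> d\<^sub>i\<^sup>2\<close> unknowns, and the solution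
  space of a brick is one-dimensional.\<close>

lemma brick_dimension_bound:
  fixes X :: "'k::field qrep"
  assumes ac: "alg_closed TYPE('k)" and X: "brick X" and i0: "i0 < n" "0 < dimv X i0"
  shows "(\<Sum>i<n. dimv X i * dimv X i) \<le> 1 + (\<Sum>i<n. dimv X i * dimv X (sc n i))"
proof (rule ccontr)
  assume neg: "\<not> ?thesis"
  let ?d = "dimv X"
  have r: "is_rep n X" using X flmodD(1) by (auto simp: brick_def)
  have "\<exists>k u v w x y. edge_system (?d i) (?d (sc n i)) (aa X i) (bb X i) k u v w x y" if "i < n" for i
    using edge_system_exists[OF aa_ops[OF r that] bb_ops[OF r that]] brick_relations[OF X i0 that] by blast
  then obtain k U V W N Y where es: "\<And>i. i < n ==> edge_system (?d i) (?d (sc n i)) (aa X i) (bb X i) (k i) (U i) (V i) (W i) (N i) (Y i)"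
    by metis
  \<comment> \<open>The unknowns are all matrix entries of a candidate endomorphism, indexed by
    vertex, row and column.\<close>
  define F where "F x i = (\<Sum>r<?d i. \<Sum>c<?d i. scl (x (i, r, c)) * un r c)" for x :: "nat \<times> nat \<times> nat => 'k" and i
  have Fops: "F x i \<in> ops (?d i) (?d i)" for x i unfolding F_def by (intro ops_sum ops_scl ops_un) auto
  have Flin: "F (%t. x t + c * y t) i = F x i + scl c * F y i" for x y c i
    by (simp add: F_def scl_add scl_mult distrib_right sum.distrib sum_distrib_left mult.assoc)
  have Fent: "ent (F x i) r c = x (i, r, c)" if "r < ?d i" "c < ?d i" for x i r c
  proof -
    have "ent (F x i) r c = (\<Sum>r'<?d i. if r = r' then \<Sum>c'<?d i. if c = c' then x (i, r', c') else 0 else 0)"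
    proof -
      have m: "z * (if P then 1 else 0) = (if P then z else 0)" for z :: 'k and P by simp
      show ?thesis unfolding F_def ent_sum ent_scl ent_un m by (intro sum.cong refl) (auto intro!: sum.cong)
    qed
    then show ?thesis using that by simp
  qed
  define D where "D x i = F x (sc n i) * aa X i - aa X i * F x i" for x i
  define E where "E x i = F x i * bb X i - bb X i * F x (sc n i)" for x i
  have Dlin: "D (%t. x t + c * y t) i = D x i + scl c * D y i" for x y c i
    unfolding D_def Flin by (simp add: distrib_left distrib_right right_diff_distrib mult.assoc scl_left_comm[of "aa X i"])
  have Elin: "E (%t. x t + c * y t) i = E x i + scl c * E y i" for x y c i
    unfolding E_def Flin by (simp add: distrib_left distrib_right right_diff_distrib mult.assoc scl_left_comm[of "bb X i"])
  define Phi where "Phi x i j = (if j = 0 then U i * D x i else if j = 1 then V i * D x i * W i else N i * E x i * Y i)"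
    for x i and j :: nat
  have Plin: "Phi (%t. x t + c * y t) i j = Phi x i j + scl c * Phi y i j" for x y c i j
    unfolding Phi_def Dlin Elin
    by (simp add: distrib_left distrib_right mult.assoc scl_left_comm[of "U i"] scl_left_comm[of "V i"] scl_left_comm[of "N i"])
  define rows where "rows i j = (if j = 0 then k i else if j = 1 then ?d (sc n i) - k i else ?d i - k i)" for i and j :: nat
  define cols where "cols i j = (if j = 0 then ?d i else if j = 1 then k i else ?d (sc n i) - k i)" for i and j :: nat
  have Pops: "Phi x i j \<in> ops (rows i j) (cols i j)" if i: "i < n" for x i j
  proof -
    have "D x i \<in> ops (?d (sc n i)) (?d i)" "E x i \<in> ops (?d i) (?d (sc n i))"
      unfolding D_def E_def using aa_ops[OF r i] bb_ops[OF r i] Fops by (auto intro!: ops_diff intro: ops_mult)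
    then show ?thesis using es[OF i] unfolding Phi_def rows_def cols_def edge_system_def
      by (auto intro: ops_mult)
  qed
  \<comment> \<open>The extra equation \<open>None\<close> demands that one diagonal entry vanish.
    It excludes the nonzero scalars and accounts for the summand 1 in the bound.\<close>
  define L where "L j x = (case j of None => x (i0, 0, 0) | Some (i, j, r, c) => ent (Phi x i j) r c)"
    for j and x :: "nat \<times> nat \<times> nat => 'k"
  define J0 where "J0 = (SIGMA i:{..<n}. SIGMA j:{..<3}. {..<rows i j} \<times> {..<cols i j})"
  define J where "J = insert None (Some ` J0)"
  define I where "I = (SIGMA i:{..<n}. {..<?d i} \<times> {..<?d i})"
  have fin: "finite J" "finite I" "finite J0" unfolding J_def I_def J0_def by auto
  have "card J0 = (\<Sum>i<n. \<Sum>j<3. rows i j * cols i j)"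
    unfolding J0_def by (simp add: card_SigmaI)
  also have "\<dots> = (\<Sum>i<n. ?d i * ?d (sc n i))"
  proof (intro sum.cong refl)
    fix i assume "i \<in> {..<n}"
    then have le: "k i \<le> ?d i" "k i \<le> ?d (sc n i)" using es by (auto simp: edge_system_def)
    obtain p where p: "?d i = k i + p" using le(1) le_Suc_ex by blast
    obtain q where q: "?d (sc n i) = k i + q" using le(2) le_Suc_ex by blast
    show "(\<Sum>j<3. rows i j * cols i j) = ?d i * ?d (sc n i)"
      unfolding rows_def cols_def p q by (simp add: numeral_3_eq_3 lessThan_Suc algebra_simps)
  qed
  finally have cJ0: "card J0 = (\<Sum>i<n. ?d i * ?d (sc n i))" .
  have "card J = Suc (card J0)" unfolding J_def using fin(3) by (subst card_insert_disjoint) (auto simp: card_image)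
  then have "card J < card I" using neg cJ0 unfolding I_def by (simp add: card_SigmaI)
  from homogeneous_system[OF fin(1,2) this, of L]
  obtain x where x: "\<exists>t\<in>I. x t \<noteq> 0" "\<forall>j\<in>J. L j x = 0"
  proof -
    have "L j (%t. x t + c * y t) = L j x + c * L j y" for j x c y
      unfolding L_def Plin ent_add ent_scl by (auto split: option.splits prod.splits)
    then show ?thesis using homogeneous_system[OF fin(1,2) \<open>card J < card I\<close>, of L] that by blast
  qed
  have Phi0: "Phi x i j = 0" if "i < n" "j < 3" for i j
  proof (rule ops_eqI[OF Pops[OF that(1)] ops_0])
    fix r c assume "r < rows i j" "c < cols i j"
    then have "Some (i, j, r, c) \<in> J" using that by (auto simp: J_def J0_def)
    then show "ent (Phi x i j) r c = ent 0 r c" using x(2) by (force simp: L_def)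
  qed
  have comm: "F x (sc n i) * aa X i = aa X i * F x i & F x i * bb X i = bb X i * F x (sc n i)" if i: "i < n" for i
  proof -
    have "U i * D x i = 0" "V i * D x i * W i = 0" "N i * E x i * Y i = 0"
      using Phi0[OF i, of 0] Phi0[OF i, of 1] Phi0[OF i, of 2] by (auto simp: Phi_def)
    then show ?thesis using es[OF i] Fops unfolding edge_system_def D_def E_def by blast
  qed
  define f where "f i = (if i < n then F x i else 0)" for i
  have "f \<in> hom X X" by (rule homI) (use Fops comm sc_lt in \<open>auto simp: f_def\<close>)
  then obtain c where c: "\<And>i. i < n ==> f i = scl c * eye (?d i)" using brick_endo_scalar[OF ac X i0] by blast
  have "None \<in> J" by (simp add: J_def)
  then have "x (i0, 0, 0) = 0" using x(2) by (force simp: L_def)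
  then have "ent (f i0) 0 0 = 0" using Fent[of 0 i0 0 x] i0 by (simp add: f_def)
  then have "c = 0" using c[OF i0(1)] i0(2) by (simp add: ent_scl ent_eye)
  then have F0: "F x i = 0" if "i < n" for i using c[OF that] that by (simp add: f_def)
  obtain i s c where t: "i < n" "s < ?d i" "c < ?d i" "x (i, s, c) \<noteq> 0" using x(1) by (auto simp: I_def)
  then show False using Fent[of s i c x] F0[OF t(1)] by simp
qed

text \<open>Around the cycle the sum of the squared differences is twice the sum of the squares
  minus twice the sum of the neighbouring products.\<close>

lemma brick_dimension_squares:
  fixes X :: "'k::field qrep"
  assumes ac: "alg_closed TYPE('k)" and X: "brick X"
  shows "(\<Sum>i<n. (int (dimv X (sc n i)) - int (dimv X i))\<^sup>2) \<le> 2"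
proof (cases "\<exists>i<n. 0 < dimv X i")
  case True
  let ?d = "%i. int (dimv X i)"
  obtain i0 where "i0 < n" "0 < dimv X i0" using True by blast
  from brick_dimension_bound[OF ac X this]
  have "int (\<Sum>i<n. dimv X i * dimv X i) \<le> int (1 + (\<Sum>i<n. dimv X i * dimv X (sc n i)))" by (simp only: of_nat_le_iff)
  then have b: "(\<Sum>i<n. ?d i * ?d i) \<le> 1 + (\<Sum>i<n. ?d i * ?d (sc n i))" by simp
  have s: "(\<Sum>i<n. ?d (sc n i) * ?d (sc n i)) = (\<Sum>i<n. ?d i * ?d i)"
    by (rule sum.reindex_bij_witness[of _ "pr n" "sc n"]) (auto simp: sc_pr pr_sc sc_lt pr_lt)
  have "(\<Sum>i<n. (?d (sc n i) - ?d i)\<^sup>2) = (\<Sum>i<n. ?d (sc n i) * ?d (sc n i) + ?d i * ?d i - 2 * (?d i * ?d (sc n i)))"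
    by (intro sum.cong refl) (simp add: power2_eq_square algebra_simps)
  also have "\<dots> = 2 * (\<Sum>i<n. ?d i * ?d i) - 2 * (\<Sum>i<n. ?d i * ?d (sc n i))"
    by (simp add: sum.distrib sum_subtractf s sum_distrib_left)
  finally show ?thesis using b by simp
next
  case False
  then show ?thesis using sc_lt by simp
qed

section \<open>Semistable string modules\<close>

lemma surjh_dim: "surjh X Y f ==> i < n ==> dimv Y i \<le> dimv X i"
  unfolding surjh_def using dim_le homD(2) ops_r by metis
lemma injh_dim: "injh Y X f ==> i < n ==> dimv Y i \<le> dimv X i"
  unfolding injh_def using dim_le homD(2) ops_r by metis

lemma surjh_zero: "surjh X Y f ==> i < n ==> f i = 0 ==> dimv Y i = 0"
  unfolding surjh_def using eye_eq_0_iff by (metis mult_zero_left)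
lemma injh_zero: "injh Y X f ==> i < n ==> f i = 0 ==> dimv Y i = 0"
  unfolding injh_def using eye_eq_0_iff by (metis mult_zero_right)

lemma un_eye_1: "(un 0 0 :: 'k::field lop) = eye 1"
  by (simp add: eye_Suc One_nat_def)

context
  fixes lo hi :: nat and R :: "nat => bool" and X :: "'k::field qrep"
  assumes hi: "hi \<le> n" and X_def: "X = strmod lo hi R"
begin

lemma str_dim: "dimv X i = (if lo \<le> i & i < hi then 1 else 0)"
  unfolding X_def by (rule strmod_dimv[OF hi])

lemma str_edge:
  assumes "lo \<le> i" "Suc i < hi"
  shows "R (Suc i) ==> aa X i = eye 1" "\<not> R (Suc i) ==> bb X i = eye 1" "i < n" "sc n i = Suc i" "Suc i < n"
  using assms hi unfolding X_def by (auto simp: strmod_aa strmod_bb sc_if un_eye_1)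

text \<open>A quotient of the string that vanishes at the source of an edge vanishes at its target,
  as the edge is an isomorphism in the string.\<close>

lemma str_quotient:
  assumes f: "surjh X Y f" and i: "lo \<le> i" "Suc i < hi"
  shows "R (Suc i) ==> dimv Y (Suc i) \<le> dimv Y i" "\<not> R (Suc i) ==> dimv Y i \<le> dimv Y (Suc i)"
proof -
  note e = str_edge[OF i]
  have fh: "f \<in> hom X Y" using f by (simp add: surjh_def)
  have b: "dimv Y i \<le> 1" "dimv Y (Suc i) \<le> 1" using surjh_dim[OF f e(3)] surjh_dim[OF f e(5)] str_dim i by auto
  have o: "f i \<in> ops (dimv Y i) 1" "f (Suc i) \<in> ops (dimv Y (Suc i)) 1"
    using homD(2)[OF fh e(3)] homD(2)[OF fh e(5)] str_dim i by auto
  show "dimv Y (Suc i) \<le> dimv Y i" if R: "R (Suc i)"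
  proof (cases "dimv Y i = 0")
    case True
    then have "f i = 0" using o(1) ops_zero_dim(1) by simp
    then have "f (Suc i) = 0" using homD(3)[OF fh e(3)] e(1)[OF R] e(4) ops_r[OF o(2)] by simp
    then show ?thesis using surjh_zero[OF f e(5)] by simp
  qed (use b in linarith)
  show "dimv Y i \<le> dimv Y (Suc i)" if R: "\<not> R (Suc i)"
  proof (cases "dimv Y (Suc i) = 0")
    case True
    then have "f (Suc i) = 0" using o(2) ops_zero_dim(1) by simp
    then have "f i = 0" using homD(4)[OF fh e(3)] e(2)[OF R] e(4) ops_r[OF o(1)] by simp
    then show ?thesis using surjh_zero[OF f e(3)] by simp
  qed (use b in linarith)
qed

text \<open>A submodule of the string that vanishes at the target of an edge vanishes at its
  source.\<close>

lemma str_sub: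
  assumes f: "injh Y X f" and i: "lo \<le> i" "Suc i < hi"
  shows "R (Suc i) ==> dimv Y i \<le> dimv Y (Suc i)" "\<not> R (Suc i) ==> dimv Y (Suc i) \<le> dimv Y i"
proof -
  note e = str_edge[OF i]
  have fh: "f \<in> hom Y X" using f by (simp add: injh_def)
  have b: "dimv Y i \<le> 1" "dimv Y (Suc i) \<le> 1" using injh_dim[OF f e(3)] injh_dim[OF f e(5)] str_dim i by auto
  have o: "f i \<in> ops 1 (dimv Y i)" "f (Suc i) \<in> ops 1 (dimv Y (Suc i))"
    using homD(2)[OF fh e(3)] homD(2)[OF fh e(5)] str_dim i by auto
  show "dimv Y i \<le> dimv Y (Suc i)" if R: "R (Suc i)"
  proof (cases "dimv Y (Suc i) = 0")
    case True
    then have "f (Suc i) = 0" using o(2) ops_zero_dim(2) by simp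
    then have "f i = 0" using homD(3)[OF fh e(3)] e(1)[OF R] e(4) ops_l[OF o(1)] by simp
    then show ?thesis using injh_zero[OF f e(3)] by simp
  qed (use b in linarith)
  show "dimv Y (Suc i) \<le> dimv Y i" if R: "\<not> R (Suc i)"
  proof (cases "dimv Y i = 0")
    case True
    then have "f i = 0" using o(1) ops_zero_dim(2) by simp
    then have "f (Suc i) = 0" using homD(4)[OF fh e(3)] e(2)[OF R] e(4) ops_l[OF o(2)] by simp
    then show ?thesis using injh_zero[OF f e(5)] by simp
  qed (use b in linarith)
qed

end

text \<open>Summation by parts: the difference of the two sides is the sum of the terms assumed
  nonnegative.\<close>

lemma abel_bound:
  fixes y :: "nat => real"
  assumes "lo < hi" "\<And>m. lo < m ==> m < hi ==> 0 \<le> (y (m - 1) - y m) * (\<Sum>i\<in>{lo..<m}. t i)"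
  shows "y (hi - 1) * (\<Sum>i\<in>{lo..<hi}. t i) \<le> (\<Sum>i\<in>{lo..<hi}. t i * y i)"
proof -
  have "lo + k < hi ==> y (lo + k) * (\<Sum>i\<in>{lo..<Suc (lo + k)}. t i) \<le> (\<Sum>i\<in>{lo..<Suc (lo + k)}. t i * y i)" for k
  proof (induct k)
    case (Suc k)
    have "0 \<le> (y (lo + k) - y (Suc (lo + k))) * (\<Sum>i\<in>{lo..<Suc (lo + k)}. t i)"
      using assms(2)[of "Suc (lo + k)"] Suc(2) by simp
    then show ?case using Suc by (simp add: algebra_simps)
  qed simp
  from this[of "hi - lo - 1"] show ?thesis using assms(1) by simp
qed

lemma thval_interval:
  assumes "hi \<le> n" "\<And>i. i < n ==> \<not> (lo \<le> i & i < hi) ==> dimv Y i = 0"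
  shows "thval n t Y = (\<Sum>i\<in>{lo..<hi}. t i * real (dimv Y i))"
  unfolding thval_def by (rule sum.mono_neutral_right) (use assms in auto)

lemma thval_strmod: "hi \<le> n ==> thval n t (strmod lo hi R :: 'k::field qrep) = (\<Sum>i\<in>{lo..<hi}. t i)"
  by (subst thval_interval[of hi lo]) (auto simp: strmod_dimv)

lemma Tbar_iff: "X \<in> Tbar n t \<longleftrightarrow> flmod n X & (\<forall>Y f. flmod n Y & surjh X Y f --> 0 \<le> thval n t Y)"
  unfolding Tbar_def mem_Collect_eq using surj_mor_surjh surjh_surj_mor flmodD(1) by metis

lemma Fbar_iff: "X \<in> Fbar n t \<longleftrightarrow> flmod n X & (\<forall>Y f. flmod n Y & injh Y X f --> thval n t Y \<le> 0)"
  unfolding Fbar_def mem_Collect_eq using inj_mor_injh injh_inj_mor flmodD(1) by metis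

text \<open>Orienting every edge of the string by the sign of the partial sum up to it makes the string
  module semistable.\<close>

lemma strmod_semistable:
  fixes t :: "nat => real"
  assumes lh: "lo < hi" "hi \<le> n"
  defines "X \<equiv> strmod lo hi (%j. 0 \<le> (\<Sum>i\<in>{lo..<j}. t i)) :: 'k::field qrep"
  shows "0 \<le> (\<Sum>i\<in>{lo..<hi}. t i) ==> X \<in> Tbar n t" "(\<Sum>i\<in>{lo..<hi}. t i) \<le> 0 ==> X \<in> Fbar n t"
proof -
  let ?R = "%j. 0 \<le> (\<Sum>i\<in>{lo..<j}. t i)"
  have XX: "X = strmod lo hi ?R" by (simp add: X_def)
  have flX: "flmod n X" unfolding X_def by (rule strmod_flmod[OF lh(2)])
  have out: "dimv X i = 0" if "\<not> (lo \<le> i & i < hi)" for i using str_dim[OF lh(2) XX, of i] that by auto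
  show "X \<in> Tbar n t" if tot: "0 \<le> (\<Sum>i\<in>{lo..<hi}. t i)"
    unfolding Tbar_iff
  proof (intro conjI allI impI flX)
    fix Y :: "'k qrep" and f assume Y: "flmod n Y & surjh X Y f"
    have z: "dimv Y i = 0" if "i < n" "\<not> (lo \<le> i & i < hi)" for i
      using surjh_dim[of X Y f i] Y that out[of i] by simp
    have "real (dimv Y (hi - 1)) * (\<Sum>i\<in>{lo..<hi}. t i) \<le> (\<Sum>i\<in>{lo..<hi}. t i * real (dimv Y i))"
    proof (rule abel_bound[OF lh(1)])
      fix m assume m: "lo < m" "m < hi"
      then obtain i where i: "m = Suc i" "lo \<le> i" by (cases m) auto
      note q = str_quotient[OF lh(2) XX conjunct2[OF Y] i(2), folded i(1), OF m(2)]
      show "0 \<le> (real (dimv Y (m - 1)) - real (dimv Y m)) * (\<Sum>i\<in>{lo..<m}. t i)"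
      proof (cases "?R m")
        case True
        then show ?thesis using q(1) i(1) by (intro mult_nonneg_nonneg) auto
      next
        case False
        then show ?thesis using q(2) i(1) by (intro mult_nonpos_nonpos) auto
      qed
    qed
    moreover have "0 \<le> real (dimv Y (hi - 1)) * (\<Sum>i\<in>{lo..<hi}. t i)" using tot by simp
    ultimately show "0 \<le> thval n t Y" using thval_interval[OF lh(2) z] by simp
  qed
  show "X \<in> Fbar n t" if tot: "(\<Sum>i\<in>{lo..<hi}. t i) \<le> 0"
    unfolding Fbar_iff
  proof (intro conjI allI impI flX)
    fix Y :: "'k qrep" and f assume Y: "flmod n Y & injh Y X f"
    have z: "dimv Y i = 0" if "i < n" "\<not> (lo \<le> i & i < hi)" for i
      using injh_dim[of Y X f i] Y that out[of i] by simp
    \<comment> \<open>The inequalities for submodules are opposite to those for quotients, so the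
      bound is applied to \<open>- t\<close>.\<close>
    have "real (dimv Y (hi - 1)) * (\<Sum>i\<in>{lo..<hi}. - t i) \<le> (\<Sum>i\<in>{lo..<hi}. - t i * real (dimv Y i))"
    proof (rule abel_bound[OF lh(1)])
      fix m assume m: "lo < m" "m < hi"
      then obtain i where i: "m = Suc i" "lo \<le> i" by (cases m) auto
      note q = str_sub[OF lh(2) XX conjunct2[OF Y] i(2), folded i(1), OF m(2)]
      show "0 \<le> (real (dimv Y (m - 1)) - real (dimv Y m)) * (\<Sum>i\<in>{lo..<m}. - t i)"
      proof (cases "?R m")
        case True
        then show ?thesis using q(1) i(1) by (intro mult_nonpos_nonpos) (auto simp: sum_negf)
      next
        case False
        then show ?thesis using q(2) i(1) by (intro mult_nonneg_nonneg) (auto simp: sum_negf)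
      qed
    qed
    moreover have "real (dimv Y (hi - 1)) * (\<Sum>i\<in>{lo..<hi}. t i) \<le> 0" using tot by (simp add: mult_nonneg_nonpos)
    ultimately show "thval n t Y \<le> 0" using thval_interval[OF lh(2) z, where t = t] by (simp add: sum_negf)
  qed
qed

lemma idn_surjh: "is_rep n X ==> surjh X X (idn X)" and idn_injh: "is_rep n X ==> injh X X (idn X)"
proof -
  have e: "\<exists>s\<in>ops (dimv X i) (dimv X i). idn X i * s = eye (dimv X i)" "\<exists>s\<in>ops (dimv X i) (dimv X i). s * idn X i = eye (dimv X i)" if "i < n" for i
    using that by (auto simp: idn_apply intro!: bexI[of _ "eye (dimv X i)"])
  show "is_rep n X ==> surjh X X (idn X)" "is_rep n X ==> injh X X (idn X)"
    unfolding surjh_def injh_def using e by simp_all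
qed

lemma Tbar_value: "X \<in> Tbar n t ==> 0 \<le> thval n t X" and Fbar_value: "X \<in> Fbar n t ==> thval n t X \<le> 0"
  unfolding Tbar_iff Fbar_iff using idn_surjh[OF flmodD(1)] idn_injh[OF flmodD(1)] by blast+

text \<open>A string module semistable for \<open>t\<close> stays in the same class for
  \<open>t'\<close>, and evaluating \<open>t'\<close> on the module itself gives the sign of the
  interval sum.\<close>

lemma TF_equiv_interval:
  assumes TF: "TF_equiv TYPE('k::field) n t t'" and lh: "lo < hi" "hi \<le> n"
  shows "0 \<le> (\<Sum>i\<in>{lo..<hi}. t i) ==> 0 \<le> (\<Sum>i\<in>{lo..<hi}. t' i)" "(\<Sum>i\<in>{lo..<hi}. t i) \<le> 0 ==> (\<Sum>i\<in>{lo..<hi}. t' i) \<le> 0"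
  using strmod_semistable[OF lh, of t, where 'k = 'k] TF thval_strmod[OF lh(2), where 'k = 'k]
    Tbar_value[where 'a = 'k] Fbar_value[where 'a = 'k] unfolding TF_equiv_def by metis+

section \<open>Transfer of TF membership through bricks\<close>

lemma surjh_comp:
  assumes "surjh X Y f" "surjh Y Z g"
  shows "surjh X Z (g * f)"
  unfolding surjh_def
proof (intro conjI allI impI)
  have h: "f \<in> hom X Y" "g \<in> hom Y Z" using assms by (auto simp: surjh_def)
  show "g * f \<in> hom X Z" by (rule hom_comp[OF h(2,1)])
  fix i assume i: "i < n"
  obtain s where s: "s \<in> ops (dimv X i) (dimv Y i)" "f i * s = eye (dimv Y i)" using assms(1) i by (auto simp: surjh_def)
  obtain q where q: "q \<in> ops (dimv Y i) (dimv Z i)" "g i * q = eye (dimv Z i)" using assms(2) i by (auto simp: surjh_def)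
  have "(g * f) i * (s * q) = g i * (f i * s) * q" by (simp add: mult.assoc)
  then have "(g * f) i * (s * q) = eye (dimv Z i)" using s q ops_r[OF homD(2)[OF h(2) i]] by simp
  then show "\<exists>s\<in>ops (dimv X i) (dimv Z i). (g * f) i * s = eye (dimv Z i)" using ops_mult[OF s(1) q(1)] by blast
qed

lemma injh_comp:
  assumes "injh X Y f" "injh Y Z g"
  shows "injh X Z (g * f)"
  unfolding injh_def
proof (intro conjI allI impI)
  have h: "f \<in> hom X Y" "g \<in> hom Y Z" using assms by (auto simp: injh_def)
  show "g * f \<in> hom X Z" by (rule hom_comp[OF h(2,1)])
  fix i assume i: "i < n"
  obtain s where s: "s \<in> ops (dimv X i) (dimv Y i)" "s * f i = eye (dimv X i)" using assms(1) i by (auto simp: injh_def)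
  obtain q where q: "q \<in> ops (dimv Y i) (dimv Z i)" "q * g i = eye (dimv Y i)" using assms(2) i by (auto simp: injh_def)
  have "s * q * (g * f) i = s * (q * g i) * f i" by (simp add: mult.assoc)
  then have "s * q * (g * f) i = eye (dimv X i)" using s q ops_r[OF s(1)] by simp
  then show "\<exists>s\<in>ops (dimv X i) (dimv Z i). s * (g * f) i = eye (dimv X i)" using ops_mult[OF s(1) q(1)] by blast
qed

lemma thval_add: "(\<And>i. i < n ==> dimv X i = dimv Y i + dimv Z i) ==> thval n t X = thval n t Y + thval n t Z"
  unfolding thval_def sum.distrib[symmetric] by (intro sum.cong) (auto simp: algebra_simps)

text \<open>\<open>Tbar n t\<close> is closed under quotients, so a failure for \<open>t'\<close>
  yields a module in \<open>Tbar n t\<close> with negative \<open>t'\<close>-value. If its dimension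
  vector is the sum of those of two quotients, one of them has a negative value again; a minimal
  such module is a brick, where the hypothesis applies.\<close>

lemma Tbar_transfer:
  fixes X :: "'k::field qrep"
  assumes br: "\<And>B :: 'k qrep. brick B ==> 0 \<le> thval n t B ==> 0 \<le> thval n t' B" and X: "X \<in> Tbar n t"
  shows "X \<in> Tbar n t'"
proof (rule ccontr)
  assume "X \<notin> Tbar n t'"
  then obtain Y f where Y: "flmod n Y" "surjh X Y f" "thval n t' Y < 0" using X unfolding Tbar_iff by (auto simp: not_le)
  let ?P = "%B :: 'k qrep. B \<in> Tbar n t & thval n t' B < 0"
  have quot: "B' \<in> Tbar n t" if "B \<in> Tbar n t" "flmod n B'" "surjh B B' p" for B B' :: "'k qrep" and p
    using that surjh_comp[OF that(3)] unfolding Tbar_iff by blast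
  have "\<exists>B. ?P B & brick B"
  proof (rule minimal_brick[of ?P Y "%X Y. \<exists>p. surjh X Y p"])
    show "?P Y" using quot[OF X Y(1,2)] Y(3) by simp
    fix B B1 B2 :: "'k qrep"
    assume B: "?P B" and B1: "flmod n B1" "\<exists>p. surjh B B1 p" and B2: "flmod n B2" "\<exists>p. surjh B B2 p"
      and d: "\<And>i. i < n ==> dimv B i = dimv B1 i + dimv B2 i"
    have "B1 \<in> Tbar n t" "B2 \<in> Tbar n t" using quot[of B B1] quot[of B B2] B B1 B2 by auto
    then show "?P B1 \<or> ?P B2" using thval_add[OF d, of t'] B by auto
  qed (auto simp: Tbar_iff)
  then obtain B where "?P B" "brick B" by blast
  then show False using br[of B] Tbar_value[of B t] by auto
qed

lemma Fbar_transfer: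
  fixes X :: "'k::field qrep"
  assumes br: "\<And>B :: 'k qrep. brick B ==> thval n t B \<le> 0 ==> thval n t' B \<le> 0" and X: "X \<in> Fbar n t"
  shows "X \<in> Fbar n t'"
proof (rule ccontr)
  assume "X \<notin> Fbar n t'"
  then obtain Y f where Y: "flmod n Y" "injh Y X f" "0 < thval n t' Y" using X unfolding Fbar_iff by (auto simp: not_le)
  let ?P = "%B :: 'k qrep. B \<in> Fbar n t & 0 < thval n t' B"
  have quot: "B' \<in> Fbar n t" if "B \<in> Fbar n t" "flmod n B'" "injh B' B p" for B B' :: "'k qrep" and p
    using that injh_comp[OF _ that(3)] unfolding Fbar_iff by blast
  have "\<exists>B. ?P B & brick B"
  proof (rule minimal_brick[of ?P Y "%X Y. \<exists>p. injh Y X p"])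
    show "?P Y" using quot[OF X Y(1,2)] Y(3) by simp
    fix B B1 B2 :: "'k qrep"
    assume B: "?P B" and B1: "flmod n B1" "\<exists>p. injh B1 B p" and B2: "flmod n B2" "\<exists>p. injh B2 B p"
      and d: "\<And>i. i < n ==> dimv B i = dimv B1 i + dimv B2 i"
    have "B1 \<in> Fbar n t" "B2 \<in> Fbar n t" using quot[of B B1] quot[of B B2] B B1 B2 by auto
    then show "?P B1 \<or> ?P B2" using thval_add[OF d, of t'] B by auto
  qed (auto simp: Fbar_iff)
  then obtain B where "?P B" "brick B" by blast
  then show False using br[of B] Fbar_value[of B t] by auto
qed

end

context cyclic
begin

section \<open>Presilting complexes and chains of subsets\<close>

lemma iota_hv:
  assumes "\<And>i. 1 \<le> i ==> i < n ==> c i = hv x i"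
  shows "iota n c = hv x"
proof
  fix i
  have "(\<Sum>j\<in>{1..<n}. c j) = (\<Sum>j\<in>{1..<n}. hv x j)" using assms by (intro sum.cong) auto
  also have "\<dots> = x 1 - x n" using hv_telescope[of 1 x] n_ge2 by simp
  finally show "iota n c i = hv x i" using assms[of i] by (auto simp: iota_def hv_def)
qed

lemma iota_sum: "iota n (%i. \<Sum>x\<in>A. l x * f x i) = (%i. \<Sum>x\<in>A. l x * iota n (f x) i)"
proof
  fix i
  have "(\<Sum>j\<in>{1..<n}. \<Sum>x\<in>A. l x * f x j) = (\<Sum>x\<in>A. l x * (\<Sum>j\<in>{1..<n}. f x j))"
    by (subst sum.swap) (simp add: sum_distrib_left)
  then show "iota n (%i. \<Sum>x\<in>A. l x * f x i) i = (\<Sum>x\<in>A. l x * iota n (f x) i)"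
    by (simp add: iota_def sum_negf)
qed

lemma iota_add: "iota n (%i. x i + y i) i = iota n x i + iota n y i"
  by (simp add: iota_def sum.distrib)

lemma iota_clsCx_inj:
  assumes "iota n (clsCx n U) = iota n (clsCx n V)"
  shows "clsCx n U = clsCx n V"
proof
  fix i
  have "iota n (clsCx n U) i = iota n (clsCx n V) i" using assms by simp
  then show "clsCx n U i = clsCx n V i" by (cases "1 \<le> i & i < n") (auto simp: iota_def clsCx_def)
qed

definition US :: "nat set => 'k::field cx" where
  "US S = (SOME U. \<exists>g1 g0. isU S U g1 g0)"

text \<open>The complex of the empty set is a zero object up to homotopy and serves as the empty
  sum.\<close>

primrec UL :: "nat set list => 'k::field cx" where
  "UL [] = US {}"
| "UL (S # L) = cxsum (US S) (UL L)"

definition subs :: "nat set list => bool" where "subs L \<longleftrightarrow> (\<forall>S\<in>set L. S \<subseteq> {1..n})"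

lemma subs_simps [simp]: "subs []" "subs (S # L) \<longleftrightarrow> S \<subseteq> {1..n} & subs L"
  by (auto simp: subs_def)

lemma chain_subs: "chain L ==> subs L"
  by (auto simp: chain_def subs_def)

lemma US_isU: "S \<subseteq> {1..n} ==> \<exists>g1 g0. isU S (US S :: 'k::field cx) g1 g0"
  unfolding US_def using isU_exists[of S, where 'k = 'k] by (rule someI_ex)

lemma US_cx: "S \<subseteq> {1..n} ==> is_cx n (US S :: 'k::field cx)"
  using US_isU[of S, where 'k = 'k] by (auto simp: isU_def)

lemma UL_cx: "subs L ==> is_cx n (UL L :: 'k::field cx)"
  by (induct L) (auto intro!: cxsum_cx US_cx)

definition cmpt :: "'k::field cx => 'k cx => bool" where
  "cmpt U V \<longleftrightarrow> ext0 U V & ext0 V U"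

lemma cmpt_sym: "cmpt U V \<longleftrightarrow> cmpt V U"
  by (auto simp: cmpt_def)

lemma cmpt_sum:
  "is_cx n U ==> is_cx n U' ==> is_cx n V ==> cmpt V (cxsum U U') \<longleftrightarrow> cmpt V U & cmpt V U'"
  unfolding cmpt_def using ext0_sum_left[of U U' V] ext0_sum_right[of U U' V] by blast

lemma cmpt_heq:
  assumes "is_cx n U" "is_cx n U'" "is_cx n V" "is_cx n V'" "heq U U'" "heq V V'"
  shows "cmpt U V \<longleftrightarrow> cmpt U' V'"
  unfolding cmpt_def using ext0_heq[OF assms] ext0_heq[OF assms(3,4,1,2,6,5)] by blast

lemma cmpt_US:
  assumes "S \<subseteq> {1..n}" "T \<subseteq> {1..n}"
  shows "cmpt (US S :: 'k::field cx) (US T) \<longleftrightarrow> S \<subseteq> T \<or> T \<subseteq> S"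
proof -
  obtain g1 g0 where "isU S (US S :: 'k cx) g1 g0" using US_isU[OF assms(1)] by (elim exE) (rule that)
  moreover obtain k1 k0 where "isU T (US T :: 'k cx) k1 k0" using US_isU[OF assms(2)] by (elim exE) (rule that)
  ultimately show ?thesis unfolding cmpt_def by (rule ext0_iff_comparable)
qed

lemma cmpt_US_UL:
  assumes S: "S \<subseteq> {1..n}" and L: "subs L"
  shows "cmpt (US S :: 'k::field cx) (UL L) \<longleftrightarrow> (\<forall>T\<in>set L. S \<subseteq> T \<or> T \<subseteq> S)"
  using L
proof (induct L)
  case Nil
  then show ?case using cmpt_US[OF S, of "{}"] by simp
next
  case (Cons T L)
  then have T: "T \<subseteq> {1..n}" "subs L" by auto
  show ?case using cmpt_sum[OF US_cx[OF T(1)] UL_cx[OF T(2)] US_cx[OF S], where 'a = 'k] cmpt_US[OF S T(1), where 'k = 'k] Cons(1)[OF T(2)] by simp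
qed

lemma cmpt_UL:
  assumes L: "subs L" and L': "subs L'"
  shows "cmpt (UL L :: 'k::field cx) (UL L') \<longleftrightarrow> (\<forall>S\<in>set L. \<forall>T\<in>set L'. S \<subseteq> T \<or> T \<subseteq> S)"
  using L
proof (induct L)
  case Nil
  then show ?case using cmpt_US_UL[OF _ L', of "{}", where 'k = 'k] by simp
next
  case (Cons S L)
  then have S: "S \<subseteq> {1..n}" "subs L" by auto
  have "cmpt (UL (S # L) :: 'k cx) (UL L') \<longleftrightarrow> cmpt (UL L') (cxsum (US S) (UL L) :: 'k cx)"
    using cmpt_sym by simp
  also have "\<dots> \<longleftrightarrow> cmpt (US S :: 'k cx) (UL L') & cmpt (UL L :: 'k cx) (UL L')"
    using cmpt_sum[OF US_cx[OF S(1)] UL_cx[OF S(2)] UL_cx[OF L'], where 'a = 'k] cmpt_sym by blast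
  finally show ?case using cmpt_US_UL[OF S(1) L', where 'k = 'k] Cons(1)[OF S(2)] by simp
qed

lemma chain_iff_rigid:
  assumes "\<forall>S\<in>set L. S \<subseteq> {1..n} & S \<noteq> {} & S \<noteq> {1..n}"
  shows "chain L \<longleftrightarrow> ext0 (UL L :: 'k::field cx) (UL L)"
proof -
  have "subs L" using assms by (auto simp: subs_def)
  then show ?thesis using cmpt_UL[of L L, where 'k = 'k] assms unfolding chain_def cmpt_def by blast
qed

lemma chain_rigid: "chain L ==> ext0 (UL L :: 'k::field cx) (UL L)"
  using chain_iff_rigid[of L, where 'k = 'k] by (auto simp: chain_def)

lemma iota_US: "S \<subseteq> {1..n} ==> iota n (clsCx n (US S :: 'k::field cx)) = vS S"
  unfolding vS_def
proof (rule iota_hv)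
  fix i assume S: "S \<subseteq> {1..n}" and i: "1 \<le> i" "i < n"
  obtain g1 g0 where "isU S (US S :: 'k cx) g1 g0" using US_isU[OF S] by (elim exE) (rule that)
  from isU_cls[OF this, of i] show "clsCx n (US S :: 'k cx) i = hv (%i. if i \<in> S then 1 else 0) i"
    using i by (simp add: hv_def)
qed

lemma iota_UL: "subs L ==> iota n (clsCx n (UL L :: 'k::field cx)) = hv (xL L)"
proof (induct L)
  case Nil
  have "vS {} = hv (xL [])" by (auto simp: vS_def hv_def fun_eq_iff)
  then show ?case unfolding UL.simps using iota_US[OF empty_subsetI, where 'k = 'k] by (simp only:)
next
  case (Cons S L)
  then have S: "S \<subseteq> {1..n}" "subs L" by auto
  have "clsCx n (UL (S # L) :: 'k cx) = (%i. clsCx n (US S :: 'k cx) i + clsCx n (UL L :: 'k cx) i)"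
    using clsCx_sum[OF US_cx[OF S(1)] UL_cx[OF S(2)], where 'a = 'k] by (simp add: fun_eq_iff)
  then have e: "iota n (clsCx n (UL (S # L) :: 'k cx)) i = vS S i + hv (xL L) i" for i
    using iota_add iota_US[OF S(1), where 'k = 'k] Cons(1)[OF S(2)] by simp
  show ?case
  proof
    fix i
    show "iota n (clsCx n (UL (S # L) :: 'k cx)) i = hv (xL (S # L)) i"
      using e[of i] by (simp only: hv_xL list.map sum_list.Cons)
  qed
qed

lemma chain_Nil [simp]: "chain []"
  by (simp add: chain_def)

lemma chain_single: "chain [S] \<longleftrightarrow> S \<subseteq> {1..n} & S \<noteq> {} & S \<noteq> {1..n}"
  by (auto simp: chain_def)

lemma nullh_heq:
  assumes U: "is_cx n U" and V: "is_cx n V" and heq: "heq U V" and null: "nullh V"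
  shows "nullh U"
proof -
  obtain f1 f0 g1 g0 h k where f: "f1 \<in> hom (c1 U) (c1 V)" "f0 \<in> hom (c0 U) (c0 V)" "g1 \<in> hom (c1 V) (c1 U)"
    "g0 \<in> hom (c0 V) (c0 U)" "h \<in> hom (c0 U) (c1 U)" "k \<in> hom (c0 V) (c1 V)" and eq:
    "f0 * dd U = dd V * f1" "g0 * dd V = dd U * g1" "g1 * f1 = idn (c1 U) + h * dd U" "g0 * f0 = idn (c0 U) + dd U * h"
    using heq unfolding heq_def by (elim bexE conjE) (rule that)
  obtain q where q: "q \<in> hom (c0 V) (c1 V)" "q * dd V = idn (c1 V)" "dd V * q = idn (c0 V)"
    using null by (auto simp: nullh_def)
  let ?h = "g1 * q * f0 - h"
  have "g1 * q * f0 * dd U = g1 * (q * dd V) * f1" using eq(1) by (simp add: mult.assoc)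
  then have "?h * dd U = idn (c1 U)" using q(2) hom_id_r[OF f(3)] eq(3) by (simp add: left_diff_distrib)
  moreover have "dd U * (g1 * q * f0) = g0 * (dd V * q) * f0" using eq(2) by (simp flip: mult.assoc)
  then have "dd U * ?h = idn (c0 U)" using q(3) hom_id_r[OF f(4)] eq(4) by (simp add: right_diff_distrib)
  moreover have "?h \<in> hom (c0 U) (c1 U)" using f q by (intro hom_diff hom_comp[OF hom_comp]) auto
  ultimately show ?thesis unfolding nullh_def by blast
qed

lemma nullh_US_empty: "nullh (US {} :: 'k::field cx)"
proof -
  obtain g1 g0 where "isU {} (US {} :: 'k cx) g1 g0" using US_isU[OF empty_subsetI] by (elim exE) (rule that)
  then have cx: "is_cx n (US {} :: 'k cx)" and F: "free (c0 (US {} :: 'k cx)) {} (%s. s mod n) g0" "free (c1 (US {} :: 'k cx)) {} (%s. s - 1) g1"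
    by (auto simp: isU_def)
  note c = cxD[OF cx]
  have "idn (c0 (US {} :: 'k cx)) = 0" by (rule free_hom_eq[OF F(1) c(4)]) (use c in auto)
  moreover have "idn (c1 (US {} :: 'k cx)) = 0" by (rule free_hom_eq[OF F(2) c(3)]) (use c in auto)
  ultimately show ?thesis unfolding nullh_def by (intro bexI[of _ 0]) auto
qed

text \<open>A contractible complex has class zero, and the only chain whose indicators sum to zero
  modulo constants is the empty one.\<close>

lemma nullh_UL_iff:
  assumes L: "chain L"
  shows "nullh (UL L :: 'k::field cx) \<longleftrightarrow> L = []"
proof
  assume "nullh (UL L :: 'k cx)"
  then have "clsCx n (UL L :: 'k cx) = (%_. 0)" by (rule nullh_clsCx[OF UL_cx[OF chain_subs[OF L]]])
  moreover have "clsCx n (UL [] :: 'k cx) = (%_. 0)"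
    using nullh_clsCx[OF US_cx nullh_US_empty] by simp
  ultimately have "hv (xL L) = hv (xL [])"
    using iota_UL[OF chain_subs[OF L], where 'k = 'k] iota_UL[OF subs_simps(1), where 'k = 'k] by metis
  then show "L = []" using chain_unique[OF L chain_Nil] by simp
qed (simp add: nullh_US_empty)

section \<open>Rigid complexes as sums of subset complexes\<close>

context
  fixes K :: "'k::field itself"
  assumes inf: "infinite (UNIV :: 'k set)"
begin

text \<open>Both sums are rigid and have the same class, which replaces an explicit isomorphism
  permuting the summands.\<close>

lemma UL_perm:
  assumes "chain L" "mset L = mset L'"
  shows "heq (UL L :: 'k cx) (UL L')"
proof -
  have L': "chain L'" using chain_subset[OF assms(1), of L'] assms(2) by (metis order_refl set_mset_mset)
  have "hv (xL L) = hv (xL L')"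
    unfolding fun_eq_iff hv_xL using assms(2) by (metis mset_map sum_mset_sum_list)
  then have "clsCx n (UL L :: 'k cx) = clsCx n (UL L' :: 'k cx)"
    using iota_UL[OF chain_subs[OF assms(1)], where 'k = 'k] iota_UL[OF chain_subs[OF L'], where 'k = 'k]
    by (intro iota_clsCx_inj) simp
  then show ?thesis
    by (intro rigid_class_determines[OF inf] UL_cx chain_subs chain_rigid assms(1) L')
qed

text \<open>The class of any complex is integral and therefore a sum of indicators along a chain;
  the complex of that chain is rigid of the same class.\<close>

lemma rigid_chain:
  fixes U :: "'k cx"
  assumes U: "is_cx n U" and E: "ext0 U U"
  shows "\<exists>L. chain L & heq U (UL L)"
proof -
  let ?x = "coord (clsCx n U)"
  have i: "iota n (clsCx n U) = hv ?x" by (rule iota_hv) (simp add: hv_coord)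
  have "?x i \<in> \<int>" for i unfolding coord_def clsCx_def by (intro Ints_sum) auto
  then obtain L where L: "chain L" "hv ?x = hv (xL L)" using integral_chain[of ?x] by blast
  have "clsCx n U = clsCx n (UL L :: 'k cx)"
    using iota_UL[OF chain_subs[OF L(1)], where 'k = 'k] i L(2) by (intro iota_clsCx_inj) simp
  then have "heq U (UL L)"
    by (intro rigid_class_determines[OF inf U _ E] UL_cx chain_subs chain_rigid L(1))
  then show ?thesis using L by blast
qed

lemma UL_heq_mset:
  assumes "chain L" "chain L'" "heq (UL L :: 'k cx) (UL L')"
  shows "mset L = mset L'"
proof -
  have "clsCx n (UL L :: 'k cx) = clsCx n (UL L' :: 'k cx)"
    using heq_clsCx[OF UL_cx UL_cx assms(3)] chain_subs assms(1,2) by blast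
  then show ?thesis
    using chain_unique[OF assms(1,2)] iota_UL[OF chain_subs[OF assms(1)], where 'k = 'k]
      iota_UL[OF chain_subs[OF assms(2)], where 'k = 'k] by simp
qed

text \<open>The substitute for Krull-Schmidt. Both summands are rigid, hence come from chains; they
  are compatible with each other, so the two chains together form a chain, which must be
  \<open>L\<close> by uniqueness.\<close>

lemma chain_decompose:
  fixes V W :: "'k cx"
  assumes L: "chain L" and V: "is_cx n V" and W: "is_cx n W" and heq: "heq (UL L) (cxsum V W)"
  shows "\<exists>LV LW. chain LV & chain LW & heq V (UL LV) & heq W (UL LW) & mset L = mset LV + mset LW"
proof -
  note cL = UL_cx[OF chain_subs[OF L], where 'k = 'k] and cVW = cxsum_cx[OF V W]
  have "cmpt (UL L :: 'k cx) (UL L)" using chain_rigid[OF L, where 'k = 'k] by (simp add: cmpt_def)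
  then have "cmpt (cxsum V W) (cxsum V W)" using cmpt_heq[OF cL cVW cL cVW heq heq] by simp
  then have E: "cmpt V V" "cmpt W W" "cmpt V W"
    using cmpt_sum[OF V W cVW] cmpt_sum[OF V W V] cmpt_sum[OF V W W] cmpt_sym by blast+
  obtain LV where LV: "chain LV" "heq V (UL LV)" using rigid_chain[OF V] E(1) by (auto simp: cmpt_def)
  obtain LW where LW: "chain LW" "heq W (UL LW)" using rigid_chain[OF W] E(2) by (auto simp: cmpt_def)
  note cV = UL_cx[OF chain_subs[OF LV(1)], where 'k = 'k] and cW = UL_cx[OF chain_subs[OF LW(1)], where 'k = 'k]
  have "cmpt (UL LV :: 'k cx) (UL LW)" using cmpt_heq[OF V cV W cW LV(2) LW(2)] E(3) by simp
  then have "\<forall>S\<in>set LV. \<forall>T\<in>set LW. S \<subseteq> T \<or> T \<subseteq> S"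
    using cmpt_UL[OF chain_subs[OF LV(1)] chain_subs[OF LW(1)], where 'k = 'k] by simp
  then have ch: "chain (LV @ LW)" using LV(1) LW(1) unfolding chain_def by (auto simp: ball_Un)
  have "hv (xL L) = hv (xL (LV @ LW))"
  proof
    fix i
    have "clsCx n (UL L :: 'k cx) = (%i. clsCx n (UL LV :: 'k cx) i + clsCx n (UL LW :: 'k cx) i)"
      using heq_clsCx[OF cL cVW heq] clsCx_sum[OF V W] heq_clsCx[OF V cV LV(2)] heq_clsCx[OF W cW LW(2)]
      by (simp add: fun_eq_iff)
    then have "iota n (clsCx n (UL L :: 'k cx)) i = iota n (clsCx n (UL LV :: 'k cx)) i + iota n (clsCx n (UL LW :: 'k cx)) i"
      by (simp add: iota_add)
    then show "hv (xL L) i = hv (xL (LV @ LW)) i"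
      unfolding iota_UL[OF chain_subs[OF L]] iota_UL[OF chain_subs[OF LV(1)]] iota_UL[OF chain_subs[OF LW(1)]]
      by (simp add: hv_xL)
  qed
  then have "mset L = mset LV + mset LW" using chain_unique[OF L ch] by simp
  then show ?thesis using LV LW by blast
qed

lemma US_UL: "S \<subseteq> {1..n} ==> heq (US S :: 'k cx) (UL [S])"
  using heq_sum_null[OF US_cx US_cx nullh_US_empty] by simp

text \<open>A decomposition would distribute the one-element multiset over two chains, so one of
  them is empty and its complex contractible.\<close>

lemma indec_US:
  assumes S: "chain [S]"
  shows "indec n (US S :: 'k cx)"
proof -
  have S': "S \<subseteq> {1..n}" using S by (simp add: chain_single)
  note cS = US_cx[OF S', where 'k = 'k] and cL = UL_cx[OF chain_subs[OF S], where 'k = 'k]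
  have "\<not> nullh (US S :: 'k cx)"
    using nullh_heq[OF cL cS heq_sym[OF US_UL[OF S']]] nullh_UL_iff[OF S, where 'k = 'k] by blast
  moreover have "nullh V1 \<or> nullh V2"
    if V: "is_cx n V1" "is_cx n V2" and h: "heq (US S) (cxsum V1 V2)" for V1 V2 :: "'k cx"
  proof -
    have "heq (UL [S]) (cxsum V1 V2)"
      by (rule heq_trans[OF cL cS cxsum_cx[OF V] heq_sym[OF US_UL[OF S']] h])
    from chain_decompose[OF S V this] obtain L1 L2 where L: "chain L1" "chain L2" "heq V1 (UL L1)" "heq V2 (UL L2)"
      "mset [S] = mset L1 + mset L2" by (elim exE conjE) (rule that)
    have "size (mset L1 + mset L2) = 1" using arg_cong[OF L(5), of size] by simp
    then have "L1 = [] \<or> L2 = []" by (cases L1; cases L2) auto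
    then show ?thesis
      using nullh_heq[OF V(1) UL_cx L(3)] nullh_heq[OF V(2) UL_cx L(4)] nullh_US_empty[where 'k = 'k] by auto
  qed
  ultimately show ?thesis
    unfolding indec_def zeroK_iff[OF cS] using cS zeroK_iff htpy_equiv_iff[OF cS cxsum_cx] by blast
qed

text \<open>A chain with at least two members splits off the complex of its first member, which is
  not contractible; the remaining chain would have to be empty.\<close>

lemma indec_chain:
  fixes V :: "'k cx"
  assumes V: "indec n V" and L: "chain L" and h: "heq V (UL L)"
  shows "\<exists>S. L = [S]"
proof (cases L)
  case Nil
  have cV: "is_cx n V" using V by (simp add: indec_def)
  have "nullh V" using nullh_heq[OF cV UL_cx h] nullh_US_empty[where 'k = 'k] Nil by auto
  then show ?thesis using V zeroK_iff[OF cV] by (simp add: indec_def)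
next
  case (Cons S L')
  have cV: "is_cx n V" using V by (simp add: indec_def)
  have S: "S \<subseteq> {1..n}" "chain [S]" and L': "chain L'" using L Cons by (auto simp: chain_def)
  note cS = US_cx[OF S(1), where 'k = 'k] and cL = UL_cx[OF chain_subs[OF L'], where 'k = 'k]
  have "htpy_equiv n V (cxsum (US S) (UL L'))" unfolding htpy_equiv_iff[OF cV cxsum_cx[OF cS cL]] using h Cons by simp
  then have "nullh (US S :: 'k cx) \<or> nullh (UL L' :: 'k cx)"
    using V cS cL unfolding indec_def zeroK_iff[OF cS, symmetric] zeroK_iff[OF cL, symmetric] by blast
  moreover have "\<not> nullh (US S :: 'k cx)" using indec_US[OF S(2)] zeroK_iff[OF cS] by (simp add: indec_def)
  ultimately show ?thesis using nullh_UL_iff[OF L', where 'k = 'k] Cons by simp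
qed

context
  fixes U :: "'k cx" and L
  assumes U: "is_cx n U" and L: "chain L" and UL: "heq U (UL L)"
begin

lemma summand_chain:
  assumes V: "summand n V U"
  shows "\<exists>LV LW. chain LV & heq V (UL LV) & mset L = mset LV + mset LW"
proof -
  obtain V' where V': "is_cx n V" "is_cx n V'" "htpy_equiv n U (cxsum V V')" using V by (auto simp: summand_def)
  have "heq U (cxsum V V')" using V' htpy_equiv_iff[OF U cxsum_cx] by blast
  then have "heq (UL L) (cxsum V V')"
    using heq_trans[OF UL_cx[OF chain_subs[OF L]] U cxsum_cx[OF V'(1,2)] heq_sym[OF UL]] by blast
  from chain_decompose[OF L V'(1,2) this] show ?thesis by blast
qed

lemma chain_summand:
  assumes W: "is_cx n W" and L': "chain L'" and h: "heq (UL L) (cxsum W (UL L'))"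
  shows "summand n W U"
proof -
  have c: "is_cx n (UL L' :: 'k cx)" by (rule UL_cx[OF chain_subs[OF L']])
  have "heq U (cxsum W (UL L'))" by (rule heq_trans[OF U UL_cx[OF chain_subs[OF L]] cxsum_cx[OF W c] UL h])
  then show ?thesis using htpy_equiv_iff[OF U cxsum_cx[OF W c]] W c by (auto simp: summand_def)
qed

lemma US_summand: "S \<in> set L ==> summand n (US S) U"
proof -
  assume S: "S \<in> set L"
  then have S': "S \<subseteq> {1..n}" using L by (auto simp: chain_def)
  have "heq (UL L :: 'k cx) (UL (S # remove1 S L))" using S by (intro UL_perm[OF L]) simp
  then show ?thesis
    using chain_summand[OF US_cx[OF S'], of "remove1 S L"] chain_subset[OF L set_remove1_subset] by simp
qed

lemma summand_classes:
  "{clsCx n V | V. indec n V & summand n V U} = (%S. clsCx n (US S :: 'k cx)) ` set L"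
proof (intro equalityI subsetI)
  fix c assume "c \<in> {clsCx n V | V. indec n V & summand n V U}"
  then obtain V where V: "indec n V" "summand n V U" "c = clsCx n V" by blast
  obtain LV LW where LV: "chain LV" "heq V (UL LV)" "mset L = mset LV + mset LW"
    using summand_chain[OF V(2)] by blast
  obtain S where S: "LV = [S]" using indec_chain[OF V(1) LV(1,2)] by blast
  have S': "S \<subseteq> {1..n}" using LV(1) S by (simp add: chain_single)
  have cV: "is_cx n V" using V(1) by (simp add: indec_def)
  have "c = clsCx n (UL [S] :: 'k cx)" using heq_clsCx[OF cV UL_cx LV(2)] V(3) S S' by simp
  also have "\<dots> = clsCx n (US S :: 'k cx)" using heq_clsCx[OF US_cx UL_cx US_UL[OF S']] S' by simp
  finally have "c = clsCx n (US S :: 'k cx)" .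
  moreover have "S \<in> set L" using LV(3) S by (metis list.set_intros(1) set_mset_mset union_iff)
  ultimately show "c \<in> (%S. clsCx n (US S :: 'k cx)) ` set L" by blast
next
  fix c assume "c \<in> (%S. clsCx n (US S :: 'k cx)) ` set L"
  then obtain S where S: "S \<in> set L" "c = clsCx n (US S :: 'k cx)" by blast
  have "chain [S]" using chain_subset[OF L, of "[S]"] S(1) by simp
  then show "c \<in> {clsCx n V | V. indec n V & summand n V U}"
    using indec_US US_summand[OF S(1)] S(2) by blast
qed

text \<open>The indecomposable summands have the classes of the complexes of the members of
  \<open>L\<close>, and \<open>iota\<close> turns these into indicator vectors, which differ for
  different members of the chain.\<close>

lemma iota_Ccone: "iota n ` Ccone n U = cone_open (vS ` set L)"
proof -
  have sub: "S \<subseteq> {1..n}" if "S \<in> set L" for S using L that by (auto simp: chain_def)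
  have vc: "iota n (clsCx n (US S :: 'k cx)) = vS S" if "S \<in> set L" for S using iota_US[OF sub[OF that]] .
  have inj: "inj_on vS (set L)"
  proof (rule inj_onI)
    fix S T assume ST: "S \<in> set L" "T \<in> set L" "vS S = vS T"
    have "chain [S]" "chain [T]" using chain_subset[OF L, of "[S]"] chain_subset[OF L, of "[T]"] ST by auto
    moreover have "hv (xL [S]) = hv (xL [T])" by (rule ext) (simp only: hv_xL list.map sum_list.Cons sum_list.Nil ST(3))
    ultimately show "S = T" using chain_unique[of "[S]" "[T]"] by simp
  qed
  have inj': "inj_on (%S. clsCx n (US S :: 'k cx)) (set L)"
    using inj vc unfolding inj_on_def by metis
  have "iota n ` Ccone n U = iota n ` {%i. \<Sum>S\<in>set L. l S * clsCx n (US S :: 'k cx) i | l. \<forall>S\<in>set L. l S > 0}"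
    unfolding Ccone_def summand_classes cone_open_image[OF finite_set inj'] ..
  also have "\<dots> = {iota n (%i. \<Sum>S\<in>set L. l S * clsCx n (US S :: 'k cx) i) | l. \<forall>S\<in>set L. l S > 0}" by blast
  also have "\<dots> = {%i. \<Sum>S\<in>set L. l S * iota n (clsCx n (US S :: 'k cx)) i | l. \<forall>S\<in>set L. l S > 0}"
    unfolding iota_sum ..
  also have "\<dots> = {%i. \<Sum>S\<in>set L. l S * vS S i | l. \<forall>S\<in>set L. l S > 0}"
    using vc by (simp cong: sum.cong)
  finally show ?thesis unfolding cone_open_image[OF finite_set inj] .
qed

lemma basic_iff: "basic n U \<longleftrightarrow> distinct L"
proof
  assume B: "basic n U"
  show "distinct L"
  proof (rule ccontr)
    assume "\<not> distinct L"
    then obtain xs ys zs S where "L = xs @ [S] @ ys @ [S] @ zs" using not_distinct_decomp by blast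
    then have m: "mset L = mset (S # S # (xs @ ys @ zs))" by simp
    let ?L = "S # S # (xs @ ys @ zs)"
    have chL: "chain ?L" using chain_subset[OF L, of ?L] m by (metis order_refl set_mset_mset)
    have ch: "chain (xs @ ys @ zs)" by (rule chain_subset[OF chL]) auto
    have S: "S \<subseteq> {1..n}" "chain [S]" using chL by (auto simp: chain_def)
    note cS = US_cx[OF S(1), where 'k = 'k] and cL = UL_cx[OF chain_subs[OF ch], where 'k = 'k]
    \<comment> \<open>Two bracketings of the same sum. Both are rigid with equal classes, hence
      homotopy equivalent.\<close>
    let ?A = "cxsum (US S) (cxsum (US S) (UL (xs @ ys @ zs))) :: 'k cx"
    let ?B = "cxsum (cxsum (US S) (US S)) (UL (xs @ ys @ zs)) :: 'k cx"
    have cA: "is_cx n ?A" and cB: "is_cx n ?B" and cSS: "is_cx n (cxsum (US S) (US S) :: 'k cx)"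
      using cxsum_cx cS cL by blast+
    have EA: "ext0 ?A ?A" using chain_rigid[OF chL, where 'k = 'k] by simp
    have cSL: "is_cx n (cxsum (US S) (UL (xs @ ys @ zs)) :: 'k cx)" by (rule cxsum_cx[OF cS cL])
    have EB: "ext0 ?B ?B"
      using EA unfolding ext0_sum_left[OF cS cSL cA] ext0_sum_left[OF cS cL cA] ext0_sum_right[OF cS cSL cS]
        ext0_sum_right[OF cS cL cS] ext0_sum_right[OF cS cSL cL] ext0_sum_right[OF cS cL cL]
        ext0_sum_left[OF cSS cL cB] ext0_sum_left[OF cS cS cB] ext0_sum_right[OF cSS cL cS] ext0_sum_right[OF cS cS cS]
        ext0_sum_right[OF cSS cL cL] ext0_sum_right[OF cS cS cL] by blast
    have "clsCx n ?A = clsCx n ?B"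
      using clsCx_sum[OF cS cSL] clsCx_sum[OF cS cL] clsCx_sum[OF cSS cL] clsCx_sum[OF cS cS] by (simp add: fun_eq_iff)
    then have AB: "heq ?A ?B" by (rule rigid_class_determines[OF inf cA cB EA EB])
    have "heq (UL L :: 'k cx) ?A" using UL_perm[OF L m] by simp
    then have "heq (UL L) ?B" using heq_trans[OF UL_cx[OF chain_subs[OF L]] cA cB _ AB] by blast
    then have "summand n (cxsum (US S) (US S)) U" by (rule chain_summand[OF cSS ch])
    then show False using B indec_US[OF S(2)] by (auto simp: basic_def)
  qed
next
  assume d: "distinct L"
  show "basic n U" unfolding basic_def
  proof (intro allI impI notI)
    fix V :: "'k cx" assume V: "indec n V" and s: "summand n (cxsum V V) U"
    have cV: "is_cx n V" using V by (simp add: indec_def)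
    obtain LV LW where LV: "chain LV" "heq (cxsum V V) (UL LV)" "mset L = mset LV + mset LW"
      using summand_chain[OF s] by blast
    obtain LA LB where LA: "chain LA" "heq V (UL LA)" "chain LB" "heq V (UL LB)" "mset LV = mset LA + mset LB"
      using chain_decompose[OF LV(1) cV cV heq_sym[OF LV(2)]] by blast
    obtain S T where ST: "LA = [S]" "LB = [T]" using indec_chain[OF V LA(1,2)] indec_chain[OF V LA(3,4)] by blast
    \<comment> \<open>Both chains represent the same indecomposable \<open>V\<close>, so their
      single members coincide and \<open>L\<close> contains that subset twice.\<close>
    have "heq (UL LA :: 'k cx) (UL LB)"
      by (rule heq_trans[OF UL_cx[OF chain_subs[OF LA(1)]] cV UL_cx[OF chain_subs[OF LA(3)]] heq_sym[OF LA(2)] LA(4)])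
    then have "S = T" using UL_heq_mset[OF LA(1,3)] ST by simp
    then have "mset L = mset (S # S # LW)" using LV(3) LA(5) ST by simp
    then have "distinct (S # S # LW)" using d mset_eq_imp_distinct_iff by blast
    then show False by simp
  qed
qed

end

lemma presilt_chain:
  assumes "presilt n (U :: 'k cx)"
  shows "\<exists>L. chain L & distinct L & heq U (UL L) & iota n ` Ccone n U = cone_open (vS ` set L)"
proof -
  have U: "is_cx n U" "basic n U" "ext0 U U" using assms by (auto simp: presilt_iff)
  obtain L where "chain L" "heq U (UL L)" using rigid_chain[OF U(1,3)] by blast
  then show ?thesis using basic_iff[OF U(1)] iota_Ccone[OF U(1)] U(2) by blast
qed

lemma chain_presilt:
  assumes "chain L" "distinct L"
  shows "presilt n (UL L :: 'k cx) & iota n ` Ccone n (UL L :: 'k cx) = cone_open (vS ` set L)"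
proof -
  have c: "is_cx n (UL L :: 'k cx)" by (rule UL_cx[OF chain_subs[OF assms(1)]])
  show ?thesis using basic_iff[OF c assms(1) heq_refl[OF c]] iota_Ccone[OF c assms(1) heq_refl[OF c]]
    chain_rigid[OF assms(1), where 'k = 'k] assms c by (simp add: presilt_iff)
qed

lemma pieces_presilting:
  "{piece n J w | J w. J \<subseteq> {1..<n} & w \<in> Wp n} = {iota n ` Ccone n U | U :: 'k cx. presilt n U}"
proof (intro equalityI subsetI)
  fix C assume "C \<in> {piece n J w | J w. J \<subseteq> {1..<n} & w \<in> Wp n}"
  then obtain J w where "J \<subseteq> {1..<n}" "w \<in> Wp n" "C = piece n J w" by blast
  then obtain L where "chain L" "distinct L" "C = cone_open (vS ` set L)" using piece_chain_cone by metis
  then show "C \<in> {iota n ` Ccone n U | U :: 'k cx. presilt n U}" using chain_presilt[of L] by blast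
next
  fix C assume "C \<in> {iota n ` Ccone n U | U :: 'k cx. presilt n U}"
  then obtain U :: "'k cx" where U: "presilt n U" "C = iota n ` Ccone n U" by blast
  then obtain L where "chain L" "C = cone_open (vS ` set L)" using presilt_chain[OF U(1)] by auto
  then show "C \<in> {piece n J w | J w. J \<subseteq> {1..<n} & w \<in> Wp n}" using chain_cone_piece[of L] by auto
qed

text \<open>A common point has only one flag, so both chains have the same members; as the complexes
  are basic, the chains agree as multisets.\<close>

lemma presilt_disjoint:
  fixes U U' :: "'k cx"
  assumes U: "presilt n U" and U': "presilt n U'" and ne: "iota n ` Ccone n U \<inter> iota n ` Ccone n U' \<noteq> {}"
  shows "htpy_equiv n U U'"
proof -
  obtain L where L: "chain L" "distinct L" "heq U (UL L)" "iota n ` Ccone n U = cone_open (vS ` set L)"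
    using presilt_chain[OF U] by blast
  obtain L' where L': "chain L'" "distinct L'" "heq U' (UL L')" "iota n ` Ccone n U' = cone_open (vS ` set L')"
    using presilt_chain[OF U'] by blast
  obtain x x' where x: "hv x = hv x'" "same_pat (xL L) x" "same_pat (xL L') x'"
    using ne cone_Up[of "xL L"] cone_Up[of "xL L'"] unfolding L(4) L'(4) chain_Up[OF L(1)] chain_Up[OF L'(1)] by auto
  have "set L = set L'"
    using Up_same_pat[OF x(2)] Up_same_pat[OF x(3)] Up_same_pat[OF same_pat_hv[OF x(1)]]
    unfolding chain_Up[OF L(1)] chain_Up[OF L'(1)] by simp
  then have "mset L = mset L'" using L(2) L'(2) by (metis set_eq_iff_mset_eq_distinct)
  then have h: "heq (UL L :: 'k cx) (UL L')" by (rule UL_perm[OF L(1)])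
  have c: "is_cx n U" "is_cx n U'" using U U' by (auto simp: presilt_iff)
  note cL = UL_cx[OF chain_subs[OF L(1)], where 'k = 'k] and cL' = UL_cx[OF chain_subs[OF L'(1)], where 'k = 'k]
  have "heq U U'" by (rule heq_trans[OF c(1) cL c(2) L(3) heq_trans[OF cL cL' c(2) h heq_sym[OF L'(3)]]])
  then show ?thesis using htpy_equiv_iff[OF c] by simp
qed

end

end

section \<open>TF equivalence on the hyperplane\<close>

text \<open>A nonzero integral vector of sum zero has a positive and a negative entry, and their
  squares already use up the bound 2.\<close>

lemma small_balanced_vector:
  fixes e :: "nat => int"
  assumes sum: "(\<Sum>i<n. e i) = 0" and sq: "(\<Sum>i<n. (e i)\<^sup>2) \<le> 2"
  shows "(\<forall>i<n. e i = 0) \<or> (\<exists>p<n. \<exists>q<n. p \<noteq> q & e p = 1 & e q = -1 & (\<forall>i<n. i \<noteq> p --> i \<noteq> q --> e i = 0))"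
proof (cases "\<forall>i<n. e i = 0")
  case False
  have "\<exists>p<n. e p > 0"
  proof (rule ccontr)
    assume "\<not> (\<exists>p<n. e p > 0)"
    then have "e i \<le> 0" if "i < n" for i using that by (meson not_less)
    then have "\<And>i. i \<in> {..<n} ==> 0 \<le> - e i" by simp
    then have "(\<Sum>i<n. - e i) = 0 \<longleftrightarrow> (\<forall>i\<in>{..<n}. - e i = 0)" by (intro sum_nonneg_eq_0_iff) auto
    then show False using sum False by (auto simp: sum_negf)
  qed
  then obtain p where p: "p < n" "e p > 0" by blast
  have "\<exists>q<n. e q < 0"
  proof (rule ccontr)
    assume "\<not> (\<exists>q<n. e q < 0)"
    then have "\<And>i. i \<in> {..<n} ==> 0 \<le> e i" by (meson lessThan_iff not_less)
    then have "(\<Sum>i<n. e i) = 0 \<longleftrightarrow> (\<forall>i\<in>{..<n}. e i = 0)" by (intro sum_nonneg_eq_0_iff) auto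
    then show False using sum False by auto
  qed
  then obtain q where q: "q < n" "e q < 0" by blast
  have pq: "p \<noteq> q" using p q by auto
  have part: "(\<Sum>i\<in>T. (e i)\<^sup>2) \<le> 2" if "T \<subseteq> {..<n}" for T
    using sum_mono2[OF _ that, of "%i. (e i)\<^sup>2"] sq by simp
  have ge: "(e p)\<^sup>2 \<ge> e p" "(e q)\<^sup>2 \<ge> - e q"
    using p q self_le_power[of "e p" 2] self_le_power[of "- e q" 2] by auto
  have "(e p)\<^sup>2 + (e q)\<^sup>2 \<le> 2" using part[of "{p, q}"] p q pq by simp
  then have v: "e p = 1" "e q = -1" using ge p q by auto
  have "e i = 0" if "i < n" "i \<noteq> p" "i \<noteq> q" for i
  proof -
    have "(e p)\<^sup>2 + (e q)\<^sup>2 + (e i)\<^sup>2 \<le> 2" using part[of "{p, q, i}"] p q pq that by (simp add: add.assoc)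
    then have "(e i)\<^sup>2 \<le> 0" using v by simp
    then show ?thesis by simp
  qed
  then show ?thesis using p q pq v by blast
qed simp

context cyclic
begin

text \<open>Summation by parts around the cycle; the coordinate \<open>Suc i\<close> belongs to the
  edge from the vertex \<open>i\<close> to its successor.\<close>

lemma thval_hv:
  "thval n (hv x) X = (\<Sum>i<n. x (Suc i) * (real (dimv X (sc n i)) - real (dimv X i)))"
proof -
  \<comment> \<open>A form of \<open>hv\<close> without case distinction: for vertex 0 the index
    \<open>Suc (pr n 0)\<close> is \<open>n\<close>.\<close>
  have h: "hv x i = x (Suc (pr n i)) - x (Suc i)" if i: "i < n" for i
  proof (cases "i = 0")
    case True
    have "pr n 0 = n - 1" using n_ge2 by (simp add: pr_if)
    then have "Suc (pr n 0) = n" using n_ge2 by arith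
    then show ?thesis using True by (simp add: hv_def One_nat_def)
  next
    case False
    have "pr n i = i - 1" using i False by (simp add: pr_if)
    then have "Suc (pr n i) = i" "1 \<le> i" using False by arith+
    then show ?thesis using i by (simp add: hv_def)
  qed
  have "(\<Sum>i<n. x (Suc (pr n i)) * real (dimv X i)) = (\<Sum>i<n. x (Suc i) * real (dimv X (sc n i)))"
    by (rule sum.reindex_bij_witness[of _ "sc n" "pr n"]) (auto simp: sc_pr pr_sc sc_lt pr_lt)
  then have rs: "(\<Sum>i<n. x (Suc (pr n i)) * real (dimv X i)) = (\<Sum>i<n. x (Suc i) * real (dimv X (sc n i)))" .
  have "thval n (hv x) X = (\<Sum>i<n. (x (Suc (pr n i)) - x (Suc i)) * real (dimv X i))"
    unfolding thval_def by (rule sum.cong[OF refl]) (simp add: h)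
  also have "\<dots> = (\<Sum>i<n. x (Suc (pr n i)) * real (dimv X i)) - (\<Sum>i<n. x (Suc i) * real (dimv X i))"
    by (simp only: left_diff_distrib sum_subtractf)
  also have "\<dots> = (\<Sum>i<n. x (Suc i) * (real (dimv X (sc n i)) - real (dimv X i)))"
    unfolding rs by (simp only: right_diff_distrib sum_subtractf)
  finally show ?thesis .
qed

text \<open>The differences of neighbouring dimensions of a brick sum to zero and their squares to
  at most 2, so the value on it is 0 or a difference of two coordinates; its sign depends only on
  the weak ordering.\<close>

lemma brick_sign:
  fixes B :: "'k::field qrep"
  assumes ac: "alg_closed TYPE('k)" and B: "brick B" and xy: "same_pat x y"
  shows "0 \<le> thval n (hv x) B ==> 0 \<le> thval n (hv y) B" "thval n (hv x) B \<le> 0 ==> thval n (hv y) B \<le> 0"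
proof -
  define e where "e i = int (dimv B (sc n i)) - int (dimv B i)" for i
  have v: "thval n (hv z) B = (\<Sum>i<n. z (Suc i) * real_of_int (e i))" for z
    unfolding thval_hv by (simp add: e_def)
  have "(\<Sum>i<n. int (dimv B (sc n i))) = (\<Sum>i<n. int (dimv B i))"
    by (rule sum.reindex_bij_witness[of _ "pr n" "sc n"]) (auto simp: sc_pr pr_sc sc_lt pr_lt)
  then have "(\<Sum>i<n. e i) = 0" by (simp add: e_def sum_subtractf)
  moreover have "(\<Sum>i<n. (e i)\<^sup>2) \<le> 2" using brick_dimension_squares[OF ac B] by (simp add: e_def)
  ultimately consider "\<forall>i<n. e i = 0"
    | p q where "p < n" "q < n" "p \<noteq> q" "e p = 1" "e q = -1" "\<forall>i<n. i \<noteq> p --> i \<noteq> q --> e i = 0"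
    using small_balanced_vector[of e n] by blast
  then have "(0 \<le> thval n (hv x) B --> 0 \<le> thval n (hv y) B) & (thval n (hv x) B \<le> 0 --> thval n (hv y) B \<le> 0)"
  proof cases
    case 1
    then show ?thesis unfolding v by simp
  next
    case (2 p q)
    have w: "thval n (hv z) B = z (Suc p) - z (Suc q)" for z
    proof -
      have "thval n (hv z) B = (\<Sum>i\<in>{p, q}. z (Suc i) * real_of_int (e i))"
        unfolding v by (rule sum.mono_neutral_right) (use 2 in auto)
      then show ?thesis using 2 by simp
    qed
    have "Suc p \<in> {1..n}" "Suc q \<in> {1..n}" using 2 by auto
    then have "x (Suc p) < x (Suc q) \<longleftrightarrow> y (Suc p) < y (Suc q)" "x (Suc q) < x (Suc p) \<longleftrightarrow> y (Suc q) < y (Suc p)"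
      using xy unfolding same_pat_def by blast+
    then show ?thesis unfolding w by auto
  qed
  then show "0 \<le> thval n (hv x) B ==> 0 \<le> thval n (hv y) B" "thval n (hv x) B \<le> 0 ==> thval n (hv y) B \<le> 0"
    by blast+
qed

lemma same_pat_TF_equiv:
  assumes ac: "alg_closed TYPE('k::field)" and xy: "same_pat x y"
  shows "TF_equiv TYPE('k) n (hv x) (hv y)"
  unfolding TF_equiv_def
proof (intro conjI equalityI subsetI)
  note s = brick_sign[OF ac _ xy] and s' = brick_sign[OF ac _ same_pat_sym[OF xy]]
  fix X :: "'k qrep"
  show "X \<in> Tbar n (hv x) ==> X \<in> Tbar n (hv y)" by (rule Tbar_transfer[OF s(1)])
  show "X \<in> Tbar n (hv y) ==> X \<in> Tbar n (hv x)" by (rule Tbar_transfer[OF s'(1)])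
  show "X \<in> Fbar n (hv x) ==> X \<in> Fbar n (hv y)" by (rule Fbar_transfer[OF s(2)])
  show "X \<in> Fbar n (hv y) ==> X \<in> Fbar n (hv x)" by (rule Fbar_transfer[OF s'(2)])
qed

lemma hv_interval_sum: "1 \<le> p ==> p \<le> q ==> q \<le> n ==> (\<Sum>i\<in>{p..<q}. hv x i) = x p - x q"
proof -
  assume h: "1 \<le> p" "p \<le> q" "q \<le> n"
  have "(\<Sum>i\<in>{p..<n}. hv x i) = (\<Sum>i\<in>{p..<q}. hv x i) + (\<Sum>i\<in>{q..<n}. hv x i)"
    using sum.atLeastLessThan_concat[OF h(2,3), of "hv x"] by simp
  then show ?thesis using hv_telescope[of p x] hv_telescope[of q x] h by simp
qed

text \<open>Strings on the vertices from \<open>p\<close> to \<open>q - 1\<close> detect the sign of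
  \<open>x p - x q\<close>. The string on all \<open>n\<close> vertices, on which the value of
  \<open>hv x\<close> is 0, forces \<open>\<eta>\<close> into the hyperplane in the first
  place.\<close>

lemma TF_equiv_same_pat:
  assumes TF: "TF_equiv TYPE('k::field) n (hv x) \<eta>" and \<eta>: "\<eta> \<in> K0 n"
  shows "\<exists>y. \<eta> = hv y & same_pat x y"
proof -
  have TF': "TF_equiv TYPE('k) n \<eta> (hv x)" using TF by (simp add: TF_equiv_def)
  note i = TF_equiv_interval[OF TF] and i' = TF_equiv_interval[OF TF']
  have "(\<Sum>i\<in>{0..<n}. hv x i) = 0" using hv_Hsp[of x] by (simp add: Hsp_def lessThan_atLeast0)
  then have "(\<Sum>i\<in>{0..<n}. \<eta> i) = 0" using i[of 0 n] n_ge2 by simp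
  then have "\<eta> \<in> Hsp n" using \<eta> by (simp add: Hsp_def lessThan_atLeast0)
  then have y: "\<eta> = hv (coord \<eta>)" by (rule Hsp_hv)
  have sgn: "0 \<le> x p - x q \<longleftrightarrow> 0 \<le> coord \<eta> p - coord \<eta> q" "x p - x q \<le> 0 \<longleftrightarrow> coord \<eta> p - coord \<eta> q \<le> 0"
    if "1 \<le> p" "p < q" "q \<le> n" for p q
  proof -
    have "(\<Sum>i\<in>{p..<q}. \<eta> i) = coord \<eta> p - coord \<eta> q" using hv_interval_sum[of p q "coord \<eta>"] that y by simp
    moreover have "(\<Sum>i\<in>{p..<q}. hv x i) = x p - x q" using hv_interval_sum[of p q x] that by simp
    ultimately show "0 \<le> x p - x q \<longleftrightarrow> 0 \<le> coord \<eta> p - coord \<eta> q" "x p - x q \<le> 0 \<longleftrightarrow> coord \<eta> p - coord \<eta> q \<le> 0"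
      using i[OF that(2,3)] i'[OF that(2,3)] by auto
  qed
  have "same_pat x (coord \<eta>)" unfolding same_pat_def
  proof (intro ballI)
    fix p q assume pq: "p \<in> {1..n}" "q \<in> {1..n}"
    consider "p < q" | "p = q" | "q < p" by linarith
    then show "x p < x q \<longleftrightarrow> coord \<eta> p < coord \<eta> q"
    proof cases
      case 1
      then show ?thesis using sgn(1)[of p q] pq by auto
    next
      case 3
      then show ?thesis using sgn(2)[of q p] pq by auto
    qed simp
  qed
  then show ?thesis using y by blast
qed

lemma piece_TF_class:
  assumes ac: "alg_closed TYPE('k::field)" and J: "J \<subseteq> {1..<n}" and w: "w \<in> Wp n" and \<theta>: "\<theta> \<in> piece n J w"
  shows "{\<eta> \<in> K0 n. TF_equiv TYPE('k) n \<theta> \<eta>} = piece n J w"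
proof -
  obtain p where p: "acts w p" using Wp_acts[OF w] by blast
  have "\<theta> \<in> Hsp n" using piece_Hsp[OF J w] \<theta> by blast
  then obtain x where x: "\<theta> = hv x" using Hsp_hv by blast
  have pat: "piece n J w = {hv y | y. same_pat x y}" using piece_pattern[OF J p] \<theta> x by simp
  show ?thesis
  proof (intro equalityI subsetI)
    fix \<eta> assume "\<eta> \<in> {\<eta> \<in> K0 n. TF_equiv TYPE('k) n \<theta> \<eta>}"
    then show "\<eta> \<in> piece n J w" unfolding pat using TF_equiv_same_pat[of x \<eta>, where 'k = 'k] x by auto
  next
    fix \<eta> assume "\<eta> \<in> piece n J w"
    then obtain y where y: "\<eta> = hv y" "same_pat x y" unfolding pat by blast
    have "\<eta> \<in> K0 n" using hv_Hsp[of y] y(1) by (simp add: Hsp_def)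
    then show "\<eta> \<in> {\<eta> \<in> K0 n. TF_equiv TYPE('k) n \<theta> \<eta>}" using same_pat_TF_equiv[OF ac y(2)] x y(1) by simp
  qed
qed

end

theorem theorem8p3:
  fixes n :: nat and k :: "'k::field itself"
  assumes "alg_closed k" and "n \<ge> 2"
  shows "(Hsp n = \<Union> {piece n J w | J w. J \<subseteq> {1..<n} \<and> w \<in> Wp n})
     \<and> (\<forall>J w u. J \<subseteq> {1..<n} \<and> w \<in> Wp n \<and> u \<in> WpJ n J \<longrightarrow> piece n J (w \<circ> u) = piece n J w)
     \<and> (\<forall>J J' w w'. J \<subseteq> {1..<n} \<and> J' \<subseteq> {1..<n} \<and> w \<in> Wp n \<and> w' \<in> Wp n \<and>
            piece n J w \<inter> piece n J' w' \<noteq> {} \<longrightarrow>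
            J = J' \<and> (\<exists>u\<in>WpJ n J. w' = w \<circ> u))
     \<and> (\<forall>J w \<theta>. J \<subseteq> {1..<n} \<and> w \<in> Wp n \<and> \<theta> \<in> piece n J w \<longrightarrow>
            {\<eta> \<in> K0 n. TF_equiv k n \<theta> \<eta>} = piece n J w)
     \<and> ({piece n J w | J w. J \<subseteq> {1..<n} \<and> w \<in> Wp n}
           = {iota n ` Ccone n U | U :: 'k cx. presilt n U})
     \<and> (Hsp n = \<Union> {iota n ` Ccone n U | U :: 'k cx. presilt n U})
     \<and> (\<forall>U U' :: 'k cx. presilt n U \<and> presilt n U' \<and>
            iota n ` Ccone n U \<inter> iota n ` Ccone n U' \<noteq> {} \<longrightarrow> htpy_equiv n U U')"
proof -
  interpret cyclic n by unfold_locales (rule assms(2))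
  have ac: "alg_closed TYPE('k)" using assms(1) by (simp add: alg_closed_def)
  note inf = alg_closed_infinite[OF ac]
  have TF: "TF_equiv k n = TF_equiv TYPE('k) n" by (simp add: TF_equiv_def fun_eq_iff)
  show ?thesis
  proof (intro conjI allI impI)
    show "Hsp n = \<Union> {piece n J w | J w. J \<subseteq> {1..<n} \<and> w \<in> Wp n}" by (rule Hsp_pieces)
    show P: "{piece n J w | J w. J \<subseteq> {1..<n} \<and> w \<in> Wp n} = {iota n ` Ccone n U | U :: 'k cx. presilt n U}"
      by (rule pieces_presilting[OF inf])
    show "Hsp n = \<Union> {iota n ` Ccone n U | U :: 'k cx. presilt n U}" unfolding P[symmetric] by (rule Hsp_pieces)
  next
    fix J w u assume "J \<subseteq> {1..<n} \<and> w \<in> Wp n \<and> u \<in> WpJ n J"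
    then show "piece n J (w \<circ> u) = piece n J w" using piece_coset by blast
  next
    fix J J' w w' assume h: "J \<subseteq> {1..<n} \<and> J' \<subseteq> {1..<n} \<and> w \<in> Wp n \<and> w' \<in> Wp n \<and> piece n J w \<inter> piece n J' w' \<noteq> {}"
    then show "J = J'" "\<exists>u\<in>WpJ n J. w' = w \<circ> u" using piece_disjoint[of J J' w w'] by blast+
  next
    fix J w \<theta> assume "J \<subseteq> {1..<n} \<and> w \<in> Wp n \<and> \<theta> \<in> piece n J w"
    then show "{\<eta> \<in> K0 n. TF_equiv k n \<theta> \<eta>} = piece n J w" unfolding TF using piece_TF_class[OF ac] by blast
  next
    fix U U' :: "'k cx"
    assume "presilt n U \<and> presilt n U' \<and> iota n ` Ccone n U \<inter> iota n ` Ccone n U' \<noteq> {}"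
    then show "htpy_equiv n U U'" using presilt_disjoint[OF inf] by blast
  qed
qed

end
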